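(* Assume that $A_1=A_2$ on $\Omega$. Fix $\xi\in\mathbb{R}^n\setminus\{0\}$ and $\eta\in\mathbb S^{n-1}$ with $\eta\cdot\xi=0$. With $\lambda=\lambda(\tau)$, $\eta_1=\eta_1(\tau)$, $\eta_2=\eta_2(\tau)$, $b_2=1$ and $S_j=S_j(\lambda(\tau),\eta_1(\tau),\eta_2(\tau))$, $j=1,2$, defined in the context, we have $$\lim_{\tau\to+\infty}(S_1-S_2)=\int_\Omega(V_1-V_2)\,e^{-\mathrm{i}\xi\cdot x}\,dx.$$
   Context: Let $n\ge2$, $\Omega\subset\mathbb{R}^n$ a bounded connected $\mathcal C^{1,1}$ domain with $\mathbb{R}^n\setminus\Omega$ connected, $\Gamma=\partial\Omega$, $\nu$ the unit outward normal. For $j=1,2$ let $V_j\in L^\infty(\Omega,\mathbb{R})$ and $A_j\in\mathcal C^1(\overline\Omega,\mathbb{R}^n)$. For $x,y\in\mathbb{C}^n$, $x\cdot y=\sum_kx_ky_k$ (no conjugation). Dirichlet-to-Neumann maps: for $\lambda\in\mathbb{C}\setminus\mathbb{R}$ and $f\in H^{1/2}(\Gamma)$ let $u_{j,\lambda}\in H^1(\Omega)$ be the unique solution of $(-\mathrm{i}\nabla+A_j)^2u+V_ju-\lambda u=0$ in $\Omega$, $u=f$ on $\Gamma$, and set $\Lambda_{j,\lambda}f=(\partial_\nu+\mathrm{i}A_j\cdot\nu)u_{j,\lambda}|_\Gamma$. Parameters: for $\tau>|\xi|$, $B_\tau=\sqrt{1-\frac{|\xi|^2}{4\tau^2}}$,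 $\eta_1=B_\tau\eta-\frac{\xi}{2\tau}$, $\eta_2=B_\tau\eta+\frac{\xi}{2\tau}$, $\lambda=(\tau+\mathrm{i})^2$, $\sqrt\lambda=\tau+\mathrm{i}$. Mollified potentials: let $\tilde\Omega$ be a bounded open set with $\overline\Omega\subset\tilde\Omega$, $\tilde A_1\in\mathcal C^1_0(\tilde\Omega,\mathbb{R}^n)$ with $\tilde A_1=A_1$ on $\Omega$, and $\tilde A_2=A_2$ on $\Omega$, $\tilde A_2=\tilde A_1$ on $\tilde\Omega\setminus\Omega$ (both extended by $0$ to $\mathbb{R}^n$; here $\tilde A_1=\tilde A_2$ since $A_1=A_2$). Let $\chi\in\mathcal C^\infty_0(\mathbb{R}^n)$, $\chi\ge0$, $\operatorname{supp}\chi\subset\{|x|\le1\}$, $\int\chi=1$, $\chi_\delta(x)=\delta^{-n}\chi(x/\delta)$, with $\delta=\tau^{-1/3}$. Set $A_{j,\sharp}=\chi_\delta*\tilde A_j$ and $\psi_j(x)=-\int_{-\infty}^0\eta_j\cdot A_{j,\sharp}(x+s\eta_j)\,ds$. Ansatz: $\Phi_1(x)=e^{\mathrm{i}\sqrt\lambda\,\eta_1\cdot x}e^{\mathrm{i}\psi_1(x)}$, $\Phi_2(x)=e^{-\mathrm{i}\sqrt\lambda\,\eta_2\cdot x}b_2(x)e^{-\mathrm{i}\psi_2(x)}$ with $b_2=1$, and $S_j(\lambda,\eta_1,\eta_2)=\int_\Gamma(\Lambda_{j,\lambda}\Phi_1)\,\Phi_2\,d\sigma$. *)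

theory Defs
  imports "HOL-Analysis.Analysis"
begin

section \<open>Classical function spaces\<close>

text \<open>Component \<open>i\<close> of \<open>grad f x\<close> is the partial derivative of \<open>f\<close> in direction \<open>i\<close>;
  for vector-valued \<open>f\<close> the entries are vectors.\<close>

definition grad :: "(real^'n \<Rightarrow> 'b::real_normed_vector) \<Rightarrow> real^'n \<Rightarrow> 'b^'n" where
  "grad f x = (\<chi> i. frechet_derivative f (at x) (axis i 1))"

definition laplacian :: "(real^'n \<Rightarrow> 'b::real_normed_vector) \<Rightarrow> real^'n \<Rightarrow> 'b" where
  "laplacian f x = (\<Sum>i\<in>UNIV. grad (\<lambda>y. grad f y $ i) x $ i)"

primrec Ck :: "nat \<Rightarrow> (real^'n \<Rightarrow> 'b::real_normed_vector) \<Rightarrow> bool" where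
  "Ck 0 f \<longleftrightarrow> continuous_on UNIV f"
| "Ck (Suc k) f \<longleftrightarrow> f differentiable_on UNIV \<and> (\<forall>i. Ck k (\<lambda>x. grad f x $ i))"

definition Cinf :: "(real^'n \<Rightarrow> 'b::real_normed_vector) \<Rightarrow> bool" where
  "Cinf f \<longleftrightarrow> (\<forall>k. Ck k f)"

definition compact_support_in :: "(real^'n) set \<Rightarrow> (real^'n \<Rightarrow> 'b::real_normed_vector) \<Rightarrow> bool" where
  "compact_support_in S f \<longleftrightarrow> compact (closure {x. f x \<noteq> 0}) \<and> closure {x. f x \<noteq> 0} \<subseteq> S"

definition test_functions :: "(real^'n) set \<Rightarrow> (real^'n \<Rightarrow> real) set" where
  "test_functions \<Omega> = {\<phi>. Cinf \<phi> \<and> compact_support_in \<Omega> \<phi>}"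

definition C1_closure :: "(real^'n) set \<Rightarrow> (real^'n \<Rightarrow> real^'n) \<Rightarrow> bool" where
  "C1_closure \<Omega> A \<longleftrightarrow> continuous_on (closure \<Omega>) A \<and>
     (\<exists>D :: real^'n \<Rightarrow> (real^'n) \<Rightarrow>\<^sub>L (real^'n).
        continuous_on (closure \<Omega>) D \<and>
        (\<forall>x\<in>\<Omega>. (A has_derivative blinfun_apply (D x)) (at x)))"

definition Linf :: "(real^'n) set \<Rightarrow> (real^'n \<Rightarrow> real) \<Rightarrow> bool" where
  "Linf \<Omega> V \<longleftrightarrow> V \<in> borel_measurable (lebesgue_on \<Omega>) \<and> (\<exists>C. AE x in lebesgue_on \<Omega>. \<bar>V x\<bar> \<le> C)"

definition L2 :: "'a measure \<Rightarrow> ('a \<Rightarrow> 'b::{banach, second_countable_topology}) \<Rightarrow> bool" where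
  "L2 M f \<longleftrightarrow> f \<in> borel_measurable M \<and> integrable M (\<lambda>x. (norm (f x))\<^sup>2)"

definition L2_tendsto ::
  "'a measure \<Rightarrow> (nat \<Rightarrow> 'a \<Rightarrow> 'b::{banach, second_countable_topology}) \<Rightarrow> ('a \<Rightarrow> 'b) \<Rightarrow> bool" where
  "L2_tendsto M F f \<longleftrightarrow> (\<forall>k. L2 M (F k)) \<and> L2 M f \<and>
     (\<lambda>k. LINT x|M. (norm (F k x - f x))\<^sup>2) \<longlonglongrightarrow> 0"


section \<open>The boundary of a domain\<close>

text \<open>Locally \<open>\<Omega>\<close> is the strict subgraph, in some direction \<open>e\<close>, of a \<open>C\<close>-1-1 function.  The graph
  function \<open>h\<close> is a function on the hyperplane orthogonal to \<open>e\<close>; it is written as a function on the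
  whole space which is only evaluated at projections to that hyperplane.\<close>

definition C11_boundary :: "(real^'n) set \<Rightarrow> bool" where
  "C11_boundary \<Omega> \<longleftrightarrow> (\<forall>x0\<in>frontier \<Omega>. \<exists>r>0. \<exists>e. \<exists>h :: real^'n \<Rightarrow> real. \<exists>g L.
     norm e = 1 \<and>
     (\<forall>y. (h has_derivative (\<lambda>v. g y \<bullet> v)) (at y)) \<and> L-lipschitz_on UNIV g \<and>
     \<Omega> \<inter> ball x0 r = {y \<in> ball x0 r. y \<bullet> e < h (y - (y \<bullet> e) *\<^sub>R e)})"

text \<open>A unit vector \<open>v\<close> such that, to first order at \<open>x\<close>, \<open>\<Omega>\<close> is the half space of all \<open>y\<close> with
  \<open>v \<bullet> (y - x) < 0\<close>.\<close>

definition is_outward_normal :: "(real^'n) set \<Rightarrow> real^'n \<Rightarrow> real^'n \<Rightarrow> bool" where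
  "is_outward_normal \<Omega> x v \<longleftrightarrow> norm v = 1 \<and>
     (\<forall>\<epsilon>>0. \<forall>\<^sub>F y in at x.
        (y \<in> \<Omega> \<longrightarrow> v \<bullet> (y - x) \<le> \<epsilon> * norm (y - x)) \<and>
        (y \<notin> \<Omega> \<longrightarrow> v \<bullet> (y - x) \<ge> - \<epsilon> * norm (y - x)))"

definition outward_normal :: "(real^'n) set \<Rightarrow> real^'n \<Rightarrow> real^'n" where
  "outward_normal \<Omega> x = (THE v. is_outward_normal \<Omega> x v)"

text \<open>Hausdorff outer measure of integer dimension \<open>d > 0\<close>, normalised to agree with
  \<open>d\<close>-dimensional volume.\<close>

definition hausdorff_outer :: "nat \<Rightarrow> 'a::metric_space set \<Rightarrow> ennreal" where
  "hausdorff_outer d E =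
     (SUP \<delta>\<in>{0::real<..}. INF C\<in>{C :: nat \<Rightarrow> 'a set.
         E \<subseteq> (\<Union>i. C i) \<and> (\<forall>i. bounded (C i) \<and> diameter (C i) \<le> \<delta>)}.
       (\<Sum>i. ennreal (unit_ball_vol (real d) * (diameter (C i) / 2) ^ d)))"

text \<open>The surface measure \<open>\<sigma>\<close> on the boundary of \<open>\<Omega>\<close>, on the Borel sets.\<close>

definition surface_measure :: "(real^'n) set \<Rightarrow> (real^'n) measure" where
  "surface_measure \<Omega> =
     measure_of (frontier \<Omega>) (sets (restrict_space borel (frontier \<Omega>)))
       (hausdorff_outer (CARD('n) - 1))"


section \<open>Sobolev spaces and traces\<close>

text \<open>The product on complex vectors is bilinear, without conjugation.\<close>

definition cdot :: "complex^'n \<Rightarrow> complex^'n \<Rightarrow> complex" where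
  "cdot z w = (\<Sum>i\<in>UNIV. z $ i * w $ i)"

definition cvec :: "real^'n \<Rightarrow> complex^'n" where
  "cvec x = (\<chi> i. complex_of_real (x $ i))"

definition is_weak_gradient ::
  "(real^'n) set \<Rightarrow> (real^'n \<Rightarrow> complex) \<Rightarrow> (real^'n \<Rightarrow> complex^'n) \<Rightarrow> bool" where
  "is_weak_gradient \<Omega> u G \<longleftrightarrow> L2 (lebesgue_on \<Omega>) u \<and> L2 (lebesgue_on \<Omega>) G \<and>
     (\<forall>\<phi>\<in>test_functions \<Omega>. \<forall>i.
        (LINT x|lebesgue_on \<Omega>. u x * complex_of_real (grad \<phi> x $ i)) =
        - (LINT x|lebesgue_on \<Omega>. G x $ i * complex_of_real (\<phi> x)))"

definition H1 :: "(real^'n) set \<Rightarrow> (real^'n \<Rightarrow> complex) set" where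
  "H1 \<Omega> = {u. \<exists>G. is_weak_gradient \<Omega> u G}"

text \<open>Weak gradients (and weak Laplacians below) are determined almost everywhere in \<open>\<Omega>\<close> and occur
  only under integrals over \<open>\<Omega>\<close>.\<close>

definition weak_gradient ::
  "(real^'n) set \<Rightarrow> (real^'n \<Rightarrow> complex) \<Rightarrow> real^'n \<Rightarrow> complex^'n" where
  "weak_gradient \<Omega> u = (SOME G. is_weak_gradient \<Omega> u G)"

definition is_weak_laplacian ::
  "(real^'n) set \<Rightarrow> (real^'n \<Rightarrow> complex) \<Rightarrow> (real^'n \<Rightarrow> complex) \<Rightarrow> bool" where
  "is_weak_laplacian \<Omega> u w \<longleftrightarrow> L2 (lebesgue_on \<Omega>) w \<and>
     (\<forall>\<phi>\<in>test_functions \<Omega>.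
        (LINT x|lebesgue_on \<Omega>. u x * complex_of_real (laplacian \<phi> x)) =
        (LINT x|lebesgue_on \<Omega>. w x * complex_of_real (\<phi> x)))"

definition weak_laplacian ::
  "(real^'n) set \<Rightarrow> (real^'n \<Rightarrow> complex) \<Rightarrow> real^'n \<Rightarrow> complex" where
  "weak_laplacian \<Omega> u = (SOME w. is_weak_laplacian \<Omega> u w)"

text \<open>The trace operator is the continuous extension, from \<open>H1 \<Omega>\<close> to the space of square integrable
  functions on the boundary, of the restriction of functions that are continuously differentiable
  up to the boundary.  Only the values of \<open>f\<close> on \<open>frontier \<Omega>\<close> matter.\<close>

definition has_trace ::
  "(real^'n) set \<Rightarrow> (real^'n \<Rightarrow> complex) \<Rightarrow> (real^'n \<Rightarrow> complex) \<Rightarrow> bool" where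
  "has_trace \<Omega> u f \<longleftrightarrow> u \<in> H1 \<Omega> \<and>
     (\<exists>U :: nat \<Rightarrow> real^'n \<Rightarrow> complex. (\<forall>k. Ck 1 (U k)) \<and>
        L2_tendsto (lebesgue_on \<Omega>) U u \<and>
        L2_tendsto (lebesgue_on \<Omega>) (\<lambda>k. grad (U k)) (weak_gradient \<Omega> u) \<and>
        L2_tendsto (surface_measure \<Omega>) U f)"

text \<open>The Sobolev space of order one half on the boundary is the range of the trace operator.\<close>

definition H_half :: "(real^'n) set \<Rightarrow> (real^'n \<Rightarrow> complex) set" where
  "H_half \<Omega> = {f. \<exists>u. has_trace \<Omega> u f}"

text \<open>For \<open>u\<close> in \<open>H1 \<Omega>\<close> with square integrable Laplacian, the normal derivative
  \<open>\<partial>\<^sub>\<nu> u\<close> is an element of the dual space of \<open>H_half \<Omega>\<close>, where the duality extends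
  the pairing of functions \<open>h, g\<close> by the integral of \<open>h g\<close> over the boundary with respect to
  \<open>\<sigma>\<close> (no conjugation).  As usual at this regularity, \<open>\<langle>\<partial>\<^sub>\<nu> u, g\<rangle>\<close> is the number
  given by Green's formula with an arbitrary function \<open>v\<close> in \<open>H1 \<Omega>\<close> whose trace is \<open>g\<close>.\<close>

definition normal_derivative ::
  "(real^'n) set \<Rightarrow> (real^'n \<Rightarrow> complex) \<Rightarrow> (real^'n \<Rightarrow> complex) \<Rightarrow> complex" where
  "normal_derivative \<Omega> u g = (THE z. \<forall>v. has_trace \<Omega> v g \<longrightarrow>
     z = (LINT x|lebesgue_on \<Omega>.
            cdot (weak_gradient \<Omega> u x) (weak_gradient \<Omega> v x) + weak_laplacian \<Omega> u x * v x))"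


section \<open>The magnetic Schroedinger equation and its Dirichlet-to-Neumann map\<close>

text \<open>\<open>(-i\<nabla> + A)\<^sup>2 u + V u - \<mu> u = 0\<close> in the sense of distributions: the outer
  factor \<open>-i\<nabla> + A\<close> is moved to the test function, where it becomes \<open>i\<nabla> + A\<close>.\<close>

definition magnetic_schroedinger_eq ::
  "(real^'n) set \<Rightarrow> (real^'n \<Rightarrow> real^'n) \<Rightarrow> (real^'n \<Rightarrow> real) \<Rightarrow> complex \<Rightarrow>
     (real^'n \<Rightarrow> complex) \<Rightarrow> bool" where
  "magnetic_schroedinger_eq \<Omega> A V \<mu> u \<longleftrightarrow> (\<forall>\<phi>\<in>test_functions \<Omega>.
     (LINT x|lebesgue_on \<Omega>.
        cdot ((- \<i>) *s weak_gradient \<Omega> u x + u x *s cvec (A x))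
             (\<i> *s cvec (grad \<phi> x) + complex_of_real (\<phi> x) *s cvec (A x))
        + (complex_of_real (V x) - \<mu>) * u x * complex_of_real (\<phi> x)) = 0)"

definition is_bvp_solution ::
  "(real^'n) set \<Rightarrow> (real^'n \<Rightarrow> real^'n) \<Rightarrow> (real^'n \<Rightarrow> real) \<Rightarrow> complex \<Rightarrow>
     (real^'n \<Rightarrow> complex) \<Rightarrow> (real^'n \<Rightarrow> complex) \<Rightarrow> bool" where
  "is_bvp_solution \<Omega> A V \<mu> f u \<longleftrightarrow>
     u \<in> H1 \<Omega> \<and> magnetic_schroedinger_eq \<Omega> A V \<mu> u \<and> has_trace \<Omega> u f"

text \<open>For non-real \<open>\<mu>\<close> and \<open>f\<close> in \<open>H_half \<Omega>\<close> the solution is unique up to null sets.\<close>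

definition bvp_solution ::
  "(real^'n) set \<Rightarrow> (real^'n \<Rightarrow> real^'n) \<Rightarrow> (real^'n \<Rightarrow> real) \<Rightarrow> complex \<Rightarrow>
     (real^'n \<Rightarrow> complex) \<Rightarrow> real^'n \<Rightarrow> complex" where
  "bvp_solution \<Omega> A V \<mu> f = (SOME u. is_bvp_solution \<Omega> A V \<mu> f u)"

text \<open>\<open>(\<partial>\<^sub>\<nu> + i A \<bullet> \<nu>) u\<close> on the boundary, for the solution \<open>u\<close> with trace
  \<open>f\<close>, as an element of the dual space of \<open>H_half \<Omega>\<close>: the value at \<open>g\<close> is the boundary
  integral of its product with \<open>g\<close>, which for the first term is the duality above.\<close>

definition DN_map ::
  "(real^'n) set \<Rightarrow> (real^'n \<Rightarrow> real^'n) \<Rightarrow> (real^'n \<Rightarrow> real) \<Rightarrow> complex \<Rightarrow>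
     (real^'n \<Rightarrow> complex) \<Rightarrow> (real^'n \<Rightarrow> complex) \<Rightarrow> complex" where
  "DN_map \<Omega> A V \<mu> f = (\<lambda>g. normal_derivative \<Omega> (bvp_solution \<Omega> A V \<mu> f) g +
     (LINT x|surface_measure \<Omega>.
        \<i> * complex_of_real (A x \<bullet> outward_normal \<Omega> x) * f x * g x))"


section \<open>Mollified potentials and the ansatz\<close>

definition B_fac :: "real^'n \<Rightarrow> real \<Rightarrow> real" where
  "B_fac \<xi> \<tau> = sqrt (1 - (norm \<xi>)\<^sup>2 / (4 * \<tau>\<^sup>2))"

definition eta1 :: "real^'n \<Rightarrow> real^'n \<Rightarrow> real \<Rightarrow> real^'n" where
  "eta1 \<xi> \<eta> \<tau> = B_fac \<xi> \<tau> *\<^sub>R \<eta> - (1 / (2 * \<tau>)) *\<^sub>R \<xi>"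

definition eta2 :: "real^'n \<Rightarrow> real^'n \<Rightarrow> real \<Rightarrow> real^'n" where
  "eta2 \<xi> \<eta> \<tau> = B_fac \<xi> \<tau> *\<^sub>R \<eta> + (1 / (2 * \<tau>)) *\<^sub>R \<xi>"

definition sqrt_lam :: "real \<Rightarrow> complex" where
  "sqrt_lam \<tau> = complex_of_real \<tau> + \<i>"

definition lam :: "real \<Rightarrow> complex" where
  "lam \<tau> = (sqrt_lam \<tau>)\<^sup>2"

definition mollifier :: "(real^'n \<Rightarrow> real) \<Rightarrow> real \<Rightarrow> real^'n \<Rightarrow> real" where
  "mollifier \<rho> \<delta> x = \<rho> (x /\<^sub>R \<delta>) / \<delta> ^ CARD('n)"

definition mollified :: "(real^'n \<Rightarrow> real) \<Rightarrow> (real^'n \<Rightarrow> real^'n) \<Rightarrow> real \<Rightarrow> real^'n \<Rightarrow> real^'n" where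
  "mollified \<rho> At \<tau> x = (LINT y|lborel. mollifier \<rho> (\<tau> powr (- 1 / 3)) (x - y) *\<^sub>R At y)"

definition phase :: "(real^'n \<Rightarrow> real) \<Rightarrow> (real^'n \<Rightarrow> real^'n) \<Rightarrow> real \<Rightarrow> real^'n \<Rightarrow> real^'n \<Rightarrow> real" where
  "phase \<rho> At \<tau> \<theta> x = - (LINT s:{..0}|lborel. \<theta> \<bullet> mollified \<rho> At \<tau> (x + s *\<^sub>R \<theta>))"

definition Phi1 ::
  "(real^'n \<Rightarrow> real) \<Rightarrow> (real^'n \<Rightarrow> real^'n) \<Rightarrow> real^'n \<Rightarrow> real^'n \<Rightarrow> real \<Rightarrow> real^'n \<Rightarrow> complex" where
  "Phi1 \<rho> At \<xi> \<eta> \<tau> x =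
     exp (\<i> * sqrt_lam \<tau> * complex_of_real (eta1 \<xi> \<eta> \<tau> \<bullet> x)) *
     exp (\<i> * complex_of_real (phase \<rho> At \<tau> (eta1 \<xi> \<eta> \<tau>) x))"

definition Phi2 ::
  "(real^'n \<Rightarrow> real) \<Rightarrow> (real^'n \<Rightarrow> real^'n) \<Rightarrow> (real^'n \<Rightarrow> complex) \<Rightarrow> real^'n \<Rightarrow> real^'n \<Rightarrow> real \<Rightarrow>
     real^'n \<Rightarrow> complex" where
  "Phi2 \<rho> At b \<xi> \<eta> \<tau> x =
     exp (- \<i> * sqrt_lam \<tau> * complex_of_real (eta2 \<xi> \<eta> \<tau> \<bullet> x)) * b x *
     exp (- \<i> * complex_of_real (phase \<rho> At \<tau> (eta2 \<xi> \<eta> \<tau>) x))"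

text \<open>The boundary integral of \<open>(\<Lambda> \<Phi>\<^sub>1) \<Phi>\<^sub>2\<close>, with \<open>b\<^sub>2 = 1\<close>; here \<open>A, V\<close> are the
  coefficients of the equation, and \<open>At1, At2\<close> are the extended potentials in the phases of
  \<open>\<Phi>\<^sub>1\<close> and \<open>\<Phi>\<^sub>2\<close>.\<close>

definition S_ansatz ::
  "(real^'n) set \<Rightarrow> (real^'n \<Rightarrow> real^'n) \<Rightarrow> (real^'n \<Rightarrow> real) \<Rightarrow> (real^'n \<Rightarrow> real) \<Rightarrow>
     (real^'n \<Rightarrow> real^'n) \<Rightarrow> (real^'n \<Rightarrow> real^'n) \<Rightarrow> real^'n \<Rightarrow> real^'n \<Rightarrow> real \<Rightarrow> complex" where
  "S_ansatz \<Omega> A V \<rho> At1 At2 \<xi> \<eta> \<tau> =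
     DN_map \<Omega> A V (lam \<tau>) (Phi1 \<rho> At1 \<xi> \<eta> \<tau>) (Phi2 \<rho> At2 (\<lambda>_. 1) \<xi> \<eta> \<tau>)"

end

theory Submission imports Defs begin

text \<open>Let \<open>u1, u2\<close> be the two solutions with boundary value \<open>\<Phi>1\<close>. Since the magnetic potentials agree, Green's
  formula with the test function \<open>\<Phi>2\<close> expresses \<open>S1 - S2\<close> through \<open>\<integral> (V1 - V2) \<Phi>1 \<Phi>2\<close> and terms containing
  \<open>w = u1 - u2\<close> or \<open>u1 - \<Phi>1\<close>, which have vanishing trace. Testing the equations of these two functions with
  their conjugates and taking imaginary parts bounds them in \<open>L2\<close> by the right hand sides divided by
  \<open>Im \<lambda> = 2 \<tau>\<close>. Because of the transport equation of the phase and the mollification scale \<open>\<delta> = \<tau> powr (- 1/3)\<close>,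
  \<open>\<Phi>1\<close> and \<open>\<Phi>2\<close> solve the free magnetic equations up to \<open>O(\<tau> powr (2/3))\<close>. Hence \<open>u1 - \<Phi>1\<close> tends to 0,
  \<open>w = O(1/\<tau>)\<close>, and all terms but the first vanish in the limit, where \<open>\<Phi>1 \<Phi>2\<close> tends to \<open>exp (- \<i> \<xi> \<bullet> x)\<close>.\<close>

section \<open>Hausdorff measure on the boundary\<close>

text \<open>The obstacle is the trace. A vanishing trace only means that some C1 functions,
  converging in L2 together with their gradients, have boundary values tending to 0 in L2 of the
  Hausdorff measure. Yet the normal derivative (its independence of the extension) and the energy
  estimate need Green's formula for such functions. It follows from a Hardy-type inequality near the
  boundary, and that in turn from a comparison of volumes below the boundary graph with Hausdorff
  measure, made directly on coverings. Solutions are picked by choice in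
  \<open>bvp_solution\<close>, so existence has to be shown as well; it comes from Lax-Milgram. As
  to the parameters: the imaginary part of \<open>sqrt_lam\<close> is 1, so the exponentials stay
  bounded on \<Omega>, whereas that of \<lambda> grows like \<tau>. The potential is only C1: second
  derivatives of the phase cost 1/\<delta>, and the transport equation has an error of size
  \<delta>, multiplied by the modulus of \<open>sqrt_lam\<close>. With the given \<delta> these are
  the powers 1/3 and 2/3 of \<tau>, both small against \<tau>.\<close>

definition hausdorff_cover :: "real \<Rightarrow> 'a::metric_space set \<Rightarrow> (nat \<Rightarrow> 'a set) set" where
  "hausdorff_cover d E =
     {C. E \<subseteq> (\<Union>i. C i) \<and> (\<forall>i. bounded (C i) \<and> diameter (C i) \<le> d)}"

text \<open>The volume of the \<open>d\<close>-dimensional ball whose diameter is that of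
  \<open>C\<close>.\<close>

definition hausdorff_weight :: "nat \<Rightarrow> 'a::metric_space set \<Rightarrow> ennreal" where
  "hausdorff_weight d C = ennreal (unit_ball_vol (real d) * (diameter C / 2) ^ d)"

text \<open>The outer measure at mesh size \<open>h\<close>. It grows as \<open>h\<close> decreases,
  so the supremum in \<open>hausdorff_outer\<close> is a limit as \<open>h\<close> tends to
  0.\<close>

definition hausdorff_pre :: "nat \<Rightarrow> real \<Rightarrow> 'a::metric_space set \<Rightarrow> ennreal" where
  "hausdorff_pre d h E = (INF C\<in>hausdorff_cover h E. \<Sum>i. hausdorff_weight d (C i))"

lemma hausdorff_outer_eq_SUP: "hausdorff_outer d E = (SUP h\<in>{0<..}. hausdorff_pre d h E)"
  unfolding hausdorff_outer_def hausdorff_pre_def hausdorff_cover_def hausdorff_weight_def by simp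

lemma hausdorff_pre_le_outer: "0 < h \<Longrightarrow> hausdorff_pre d h E \<le> hausdorff_outer d E"
  unfolding hausdorff_outer_eq_SUP by (rule SUP_upper) auto

lemma hausdorff_weight_empty: "d > 0 \<Longrightarrow> hausdorff_weight d {} = 0" by (simp add: hausdorff_weight_def)

lemma hausdorff_pre_mono: "E \<subseteq> F \<Longrightarrow> hausdorff_pre d h E \<le> hausdorff_pre d h F"
  unfolding hausdorff_pre_def by (rule INF_superset_mono) (auto simp: hausdorff_cover_def)

lemma hausdorff_pre_antimono: "h \<le> e \<Longrightarrow> hausdorff_pre d e E \<le> hausdorff_pre d h E" unfolding hausdorff_pre_def
  by (rule INF_superset_mono) (auto simp: hausdorff_cover_def intro: order_trans)

lemma hausdorff_outer_mono: "E \<subseteq> F \<Longrightarrow> hausdorff_outer d E \<le> hausdorff_outer d F"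
  unfolding hausdorff_outer_eq_SUP by (rule SUP_mono) (auto intro: hausdorff_pre_mono)

lemma hausdorff_pre_empty: assumes "d > 0" "h > 0" shows "hausdorff_pre d h ({} :: 'a::metric_space set) = 0"
proof -
  have "(\<lambda>_. {}) \<in> hausdorff_cover h {}" using assms by (auto simp: hausdorff_cover_def)
  from INF_lower[OF this, of "\<lambda>C. \<Sum>i. hausdorff_weight d (C i)"]
  have "hausdorff_pre d h ({} :: 'a set) \<le> (\<Sum>i::nat. hausdorff_weight d ({} :: 'a set))" unfolding hausdorff_pre_def .
  then show ?thesis using assms by (simp add: hausdorff_weight_empty)
qed

lemma hausdorff_outer_empty: "d > 0 \<Longrightarrow> hausdorff_outer d {} = 0"
  unfolding hausdorff_outer_eq_SUP by (auto simp: hausdorff_pre_empty)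

lemma hausdorff_pre_close: assumes "hausdorff_pre d h E < \<infinity>" "0 < (e::ennreal)"
  shows "\<exists>C\<in>hausdorff_cover h E. (\<Sum>i. hausdorff_weight d (C i)) \<le> hausdorff_pre d h E + e"
proof -
  have "hausdorff_pre d h E < hausdorff_pre d h E + e"
    using assms ennreal_add_left_cancel_less[of "hausdorff_pre d h E" 0 e] by auto
  then obtain C where "C \<in> hausdorff_cover h E"
      "(\<Sum>i. hausdorff_weight d (C i)) < hausdorff_pre d h E + e" unfolding hausdorff_pre_def INF_less_iff by auto
  then show ?thesis by (auto intro!: bexI less_imp_le)
qed

text \<open>Each \<open>A n\<close> has a covering that is optimal up to
  \<open>e * (1/2)^Suc n\<close>; together these cover the union, and the errors add up to
  \<open>e\<close>. An infinite term makes the bound trivial.\<close>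

lemma hausdorff_pre_subadditive:
  fixes A :: "nat \<Rightarrow> 'a::metric_space set" shows "hausdorff_pre d h (\<Union>n. A n) \<le> (\<Sum>n. hausdorff_pre d h (A n))"
proof (cases "\<forall>n. hausdorff_pre d h (A n) < \<infinity>")
  case False
  then obtain n where "hausdorff_pre d h (A n) = top" by (auto simp: less_top[symmetric])
  moreover have "hausdorff_pre d h (A n) \<le> (\<Sum>n. hausdorff_pre d h (A n))"
    using sum_le_suminf[of "\<lambda>n. hausdorff_pre d h (A n)" "{n}"] by simp
  ultimately show ?thesis by (simp add: top_unique)
next
  case True
  show ?thesis
  proof (rule ennreal_le_epsilon)
    fix e :: real assume e: "0 < e"
    have "\<exists>C\<in>hausdorff_cover h (A n).
        (\<Sum>i. hausdorff_weight d (C i)) \<le> hausdorff_pre d h (A n) + ennreal (e * (1/2)^Suc n)" for n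
      using True e by (intro hausdorff_pre_close) auto
    then obtain C where C: "\<And>n. C n \<in> hausdorff_cover h (A n)"
      "\<And>n. (\<Sum>i. hausdorff_weight d (C n i)) \<le> hausdorff_pre d h (A n) + ennreal (e * (1/2)^Suc n)" by metis
    \<comment> \<open>The pairing of naturals turns the double family \<open>C n i\<close> into a
      single sequence.\<close>
    define D where "D = (\<lambda>m. case prod_decode m of (n, i) \<Rightarrow> C n i)"
    have "D \<in> hausdorff_cover h (\<Union>n. A n)"
    proof -
      have "x \<in> (\<Union>m. D m)" if x: "x \<in> A n" for x n
      proof -
        obtain i where "x \<in> C n i" using C(1)[of n] x unfolding hausdorff_cover_def by blast
        then have "x \<in> D (prod_encode (n, i))" by (simp add: D_def)
        then show ?thesis by blast
      qed
      moreover have "bounded (D m) \<and> diameter (D m) \<le> h" for m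
        using C(1) by (cases "prod_decode m") (auto simp: D_def hausdorff_cover_def)
      ultimately show ?thesis by (auto simp: hausdorff_cover_def)
    qed
    then have "hausdorff_pre d h (\<Union>n. A n) \<le> (\<Sum>m. hausdorff_weight d (D m))"
      unfolding hausdorff_pre_def by (rule INF_lower)
    also have "\<dots> = (\<Sum>m. (\<lambda>(n, i). hausdorff_weight d (C n i)) (prod_decode m))"
      by (rule suminf_cong) (simp add: D_def split: prod.split)
    also have "\<dots> = (\<Sum>n. \<Sum>i. hausdorff_weight d (C n i))" by (rule suminf_ennreal_2dimen[unfolded comp_def]) simp
    also have "\<dots> \<le> (\<Sum>n. hausdorff_pre d h (A n) + ennreal (e * (1/2)^Suc n))" by (intro suminf_le C) auto
    also have "\<dots> = (\<Sum>n. hausdorff_pre d h (A n)) + (\<Sum>n. ennreal (e * (1/2)^Suc n))"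
      by (rule suminf_add[symmetric]) auto
    also have "(\<Sum>n. ennreal (e * (1/2)^Suc n)) = ennreal e"
    proof -
      have "(\<lambda>n. e * (1/2)^Suc n) sums (e * 1)" by (intro sums_mult power_half_series)
      then show ?thesis using e by (subst suminf_ennreal_eq[of _ e]) auto
    qed
    finally show "hausdorff_pre d h (\<Union>n. A n) \<le> (\<Sum>n. hausdorff_pre d h (A n)) + ennreal e" .
  qed
qed

lemma hausdorff_outer_subadditive:
  fixes A :: "nat \<Rightarrow> 'a::metric_space set" shows "hausdorff_outer d (\<Union>n. A n) \<le> (\<Sum>n. hausdorff_outer d (A n))"
proof -
  have "hausdorff_pre d h (\<Union>n. A n) \<le> (\<Sum>n. hausdorff_outer d (A n))" if "0 < h" for h
    using hausdorff_pre_subadditive[of d h A]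
    by (rule order_trans) (auto intro!: suminf_le hausdorff_pre_le_outer that)
  then show ?thesis unfolding hausdorff_outer_eq_SUP[of d "\<Union>n. A n"] by (intro SUP_least) auto
qed

lemma hausdorff_outer_Un_le:
  fixes A B :: "'a::metric_space set" assumes "d > 0"
  shows "hausdorff_outer d (A \<union> B) \<le> hausdorff_outer d A + hausdorff_outer d B"
proof -
  define D where "D = (\<lambda>n::nat. if n = 0 then A else if n = 1 then B else {})"
  have "(\<Union>n. D n) = A \<union> B"
  proof
    have "D 0 \<subseteq> (\<Union>n. D n)" "D 1 \<subseteq> (\<Union>n. D n)" by blast+
    then show "A \<union> B \<subseteq> (\<Union>n. D n)" by (simp add: D_def)
  qed (auto simp: D_def split: if_splits)
  moreover have "(\<Sum>n. hausdorff_outer d (D n)) = (\<Sum>n\<in>{0,1}. hausdorff_outer d (D n))"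
    by (rule suminf_finite) (auto simp: D_def hausdorff_outer_empty assms)
  ultimately show ?thesis using hausdorff_outer_subadditive[of d D] by (simp add: D_def)
qed

text \<open>No set of diameter at most \<open>h\<close> meets both \<open>A\<close> and
  \<open>B\<close>. A covering of the union thus splits into one of \<open>A\<close> and one of
  \<open>B\<close>, where discarded sets become empty and weigh nothing since
  \<open>d > 0\<close>.\<close>

lemma hausdorff_pre_separated:
  fixes A B :: "'a::metric_space set" assumes d: "d > 0" and sep: "\<And>a b. a \<in> A \<Longrightarrow> b \<in> B \<Longrightarrow> h < dist a b"
  shows "hausdorff_pre d h A + hausdorff_pre d h B \<le> hausdorff_pre d h (A \<union> B)"
  unfolding hausdorff_pre_def[of d h "A \<union> B"]
proof (rule INF_greatest)
  fix C assume C: "C \<in> hausdorff_cover h (A \<union> B)"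
  then have diam: "bounded (C i)" "diameter (C i) \<le> h" for i by (auto simp: hausdorff_cover_def)
  define CA where "CA = (\<lambda>i. if C i \<inter> A = {} then {} else C i)"
  define CB where "CB = (\<lambda>i. if C i \<inter> B = {} then {} else C i)"
  have diam': "diameter (C i) \<ge> 0" for i using diam by (intro diameter_ge_0)
  have h: "h \<ge> 0" using diam[of 0] diam'[of 0] by linarith
  have "CA \<in> hausdorff_cover h A" "CB \<in> hausdorff_cover h B"
    using C h by (fastforce simp: CA_def CB_def hausdorff_cover_def)+
  then have "hausdorff_pre d h A \<le> (\<Sum>i. hausdorff_weight d (CA i))"
    "hausdorff_pre d h B \<le> (\<Sum>i. hausdorff_weight d (CB i))" unfolding hausdorff_pre_def by (auto intro: INF_lower)
  then have "hausdorff_pre d h A + hausdorff_pre d h B \<le>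
      (\<Sum>i. hausdorff_weight d (CA i)) + (\<Sum>i. hausdorff_weight d (CB i))" by (rule add_mono)
  also have "\<dots> = (\<Sum>i. hausdorff_weight d (CA i) + hausdorff_weight d (CB i))" by (rule suminf_add) auto
  also have "\<dots> \<le> (\<Sum>i. hausdorff_weight d (C i))"
  proof (rule suminf_le)
    fix i
    have "C i \<inter> A = {} \<or> C i \<inter> B = {}"
    proof (rule ccontr)
      assume "\<not> ?thesis"
      then obtain a b where "a \<in> C i" "a \<in> A" "b \<in> C i" "b \<in> B" by auto
      then show False using diameter_bounded_bound[OF diam(1), of a i b] sep[of a b] diam(2)[of i] by simp
    qed
    then show "hausdorff_weight d (CA i) + hausdorff_weight d (CB i) \<le> hausdorff_weight d (C i)"
      by (auto simp: CA_def CB_def hausdorff_weight_empty d)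
  qed auto
  finally show "hausdorff_pre d h A + hausdorff_pre d h B \<le> (\<Sum>i. hausdorff_weight d (C i))" .
qed

text \<open>Additivity holds at every mesh below \<open>r\<close>, and a finer mesh only increases
  the pre-measures. The two suprema are taken one after the other, which is why \<open>le\<close>
  has independent meshes \<open>d1\<close> and \<open>d2\<close>.\<close>

lemma hausdorff_outer_separated:
  fixes A B :: "'a::metric_space set" assumes d: "d > 0" and r: "r > 0" and sep: "\<And>a b. a \<in> A \<Longrightarrow> b \<in> B \<Longrightarrow> r \<le> dist a b"
  shows "hausdorff_outer d A + hausdorff_outer d B \<le> hausdorff_outer d (A \<union> B)"
proof -
  have le: "hausdorff_pre d d1 A + hausdorff_pre d d2 B \<le> hausdorff_outer d (A \<union> B)" if "0 < d1" "0 < d2" for d1 d2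
  proof -
    define m where "m = min (min d1 d2) (r / 2)"
    have m: "0 < m" "m \<le> d1" "m \<le> d2" "m < r" using that r by (auto simp: m_def)
    have "hausdorff_pre d d1 A + hausdorff_pre d d2 B \<le> hausdorff_pre d m A + hausdorff_pre d m B"
      using m by (intro add_mono hausdorff_pre_antimono)
    also have "\<dots> \<le> hausdorff_pre d m (A \<union> B)" using m sep by (intro hausdorff_pre_separated d) force
    also have "\<dots> \<le> hausdorff_outer d (A \<union> B)" using m by (intro hausdorff_pre_le_outer)
    finally show ?thesis .
  qed
  have "hausdorff_pre d d1 A + hausdorff_outer d B \<le> hausdorff_outer d (A \<union> B)" if "0 < d1" for d1
    unfolding hausdorff_outer_eq_SUP[of d B] by (subst ennreal_SUP_add_right) (auto intro!: SUP_least le that)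
  then show ?thesis unfolding hausdorff_outer_eq_SUP[of d A]
    by (subst ennreal_SUP_add_left[symmetric]) (auto intro!: SUP_least)
qed

text \<open>Caratheodory's criterion: the shells \<open>R k\<close> of even and of odd index are pairwise
  separated, hence the tail \<open>\<Sum>k\<ge>n. R k\<close> of the decomposition of \<open>E - F\<close> is negligible.\<close>

lemma hausdorff_outer_caratheodory:
  fixes E F :: "'a::metric_space set" assumes d: "d > 0" and F: "closed F"
  shows "hausdorff_outer d (E \<inter> F) + hausdorff_outer d (E - F) \<le> hausdorff_outer d E"
proof (cases "F = {} \<or> hausdorff_outer d E = top")
  case True
  then show ?thesis by (auto simp: hausdorff_outer_empty d)
next
  case False
  then have ne: "F \<noteq> {}" and fin: "hausdorff_outer d E < top" by (auto simp: less_top)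
  let ?H = "hausdorff_outer d :: 'a set \<Rightarrow> ennreal"
  define S where "S n = {x\<in>E. inverse (real (Suc n)) \<le> infdist x F}" for n
  define R where "R k = S (Suc k) - S k" for k
  have S_mono: "m \<le> n \<Longrightarrow> S m \<subseteq> S n" for m n by (auto simp: S_def intro: order_trans[rotated] le_imp_inverse_le)
  have "S n \<subseteq> E" for n by (auto simp: S_def)
  have infd: "infdist x F \<le> infdist y F + dist x y" for x y by (rule infdist_triangle)
  have 1: "?H (E \<inter> F) + ?H (S n) \<le> ?H E" for n
  proof -
    have "?H (E \<inter> F) + ?H (S n) \<le> ?H ((E \<inter> F) \<union> S n)"
    proof (rule hausdorff_outer_separated[OF d, of "inverse (real (Suc n))"])
      fix a b assume "a \<in> E \<inter> F" "b \<in> S n"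
      then show "inverse (real (Suc n)) \<le> dist a b" using infd[of b a] by (auto simp: S_def dist_commute)
    qed auto
    also have "\<dots> \<le> ?H E" by (rule hausdorff_outer_mono) (auto simp: S_def)
    finally show ?thesis .
  qed
  \<comment> \<open>Shells two indices apart are separated: points of \<open>S (Suc k)\<close> have
    distance at least 1/(k+2) from \<open>F\<close>, points of \<open>R (Suc (Suc k))\<close> less
    than 1/(k+3).\<close>
  have sep: "?H (S (Suc k)) + ?H (R (Suc (Suc k))) \<le> ?H (S (Suc k) \<union> R (Suc (Suc k)))" for k
  proof (rule hausdorff_outer_separated[OF d, of "inverse (real (Suc (Suc k))) - inverse (real (Suc (Suc (Suc k))))"])
    show "0 < inverse (real (Suc (Suc k))) - inverse (real (Suc (Suc (Suc k))))" by (simp add: less_imp_inverse_less)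
    fix a b assume "a \<in> S (Suc k)" "b \<in> R (Suc (Suc k))"
    then have "inverse (real (Suc (Suc k))) \<le> infdist a F" "infdist b F < inverse (real (Suc (Suc (Suc k))))"
      by (auto simp: S_def R_def)
    then show "inverse (real (Suc (Suc k))) - inverse (real (Suc (Suc (Suc k)))) \<le> dist a b"
      using infd[of a b] by linarith
  qed
  \<comment> \<open>Shells of equal parity are added one at a time; the earlier ones lie in
    \<open>S (2 * N + j + 1)\<close>, which is separated from the next.\<close>
  have chain: "(\<Sum>k\<le>N. ?H (R (2 * k + j))) \<le> ?H (S (2 * N + j + 1))" for N j
  proof (induction N)
    case 0
    show ?case by (auto intro!: hausdorff_outer_mono simp: R_def)
  next
    case (Suc N)
    have "(\<Sum>k\<le>Suc N. ?H (R (2 * k + j))) \<le> ?H (S (Suc (2 * N + j))) + ?H (R (Suc (Suc (2 * N + j))))"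
      using Suc by (simp add: add_mono)
    also have "\<dots> \<le> ?H (S (Suc (2 * N + j)) \<union> R (Suc (Suc (2 * N + j))))" by (rule sep)
    also have "\<dots> \<le> ?H (S (2 * Suc N + j + 1))" using S_mono[of "Suc (2 * N + j)" "2 * Suc N + j + 1"]
      by (intro hausdorff_outer_mono) (auto simp: R_def)
    finally show ?case .
  qed
  have R_sum: "(\<Sum>k. ?H (R k)) \<le> ?H E + ?H E"
  proof (rule suminf_le_const)
    fix N
    have half: "(\<Sum>k\<le>N. ?H (R (2 * k + j))) \<le> ?H E" for j
      using chain[of j N] hausdorff_outer_mono[OF \<open>S (2 * N + j + 1) \<subseteq> E\<close>, of d] by (rule order_trans)
    have "(\<Sum>k<N. ?H (R k)) \<le> (\<Sum>k<2 * Suc N. ?H (R k))" by (rule sum_mono2) auto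
    also have "\<dots> = (\<Sum>k\<le>N. ?H (R (2 * k + 0))) + (\<Sum>k\<le>N. ?H (R (2 * k + 1)))"
      by (induction N) (simp_all add: algebra_simps numeral_2_eq_2)
    also have "\<dots> \<le> ?H E + ?H E" by (intro add_mono half)
    finally show "(\<Sum>k<N. ?H (R k)) \<le> ?H E + ?H E" .
  qed auto
  then have R_fin: "(\<Sum>k. ?H (R k)) < top" using fin by (auto simp: less_top[symmetric] top_unique)
  define r where "r k = enn2real (?H (R k))" for k
  have r: "ennreal (r k) = ?H (R k)" "0 \<le> r k" for k
    using R_fin sum_le_suminf[of "\<lambda>k. ?H (R k)" "{k}"] by (auto simp: r_def less_top top_unique intro!: ennreal_enn2real)
  have summ: "summable r" using R_fin r by (intro summable_suminf_not_top) (auto simp: less_top)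
  \<comment> \<open>Closedness of \<open>F\<close> enters here: a point outside \<open>F\<close> has
    positive distance and therefore lies in some \<open>S m\<close>; if the least such
    \<open>m\<close> exceeds \<open>n\<close>, the point lies in the shell
    \<open>R (m - 1)\<close>.\<close>
  have EF: "E - F \<subseteq> S n \<union> (\<Union>k. R (k + n))" for n
  proof
    fix x assume x: "x \<in> E - F"
    then have "infdist x F > 0" using F ne in_closed_iff_infdist_zero[of F x] infdist_nonneg[of x F] by auto
    then obtain m where "inverse (real (Suc m)) < infdist x F" using reals_Archimedean by blast
    then have ex: "\<exists>m. x \<in> S m" using x by (auto simp: S_def intro: less_imp_le)
    define m where "m = (LEAST m. x \<in> S m)"
    have m: "x \<in> S m" "\<And>k. k < m \<Longrightarrow> x \<notin> S k" unfolding m_def by (rule LeastI_ex[OF ex]) (rule not_less_Least)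
    show "x \<in> S n \<union> (\<Union>k. R (k + n))"
    proof (cases "m \<le> n")
      case True then show ?thesis using S_mono m by blast
    next
      case False
      then have "x \<in> R ((m - 1 - n) + n)" using m(1) m(2)[of "m - 1"] by (simp add: R_def)
      then show ?thesis by blast
    qed
  qed
  show ?thesis
  proof (rule ennreal_le_epsilon)
    fix e :: real assume e: "0 < e"
    obtain n where n: "norm (\<Sum>k. r (k + n)) < e" using suminf_exist_split[OF e summ] by blast
    have "?H (E - F) \<le> ?H (S n) + ?H (\<Union>k. R (k + n))"
      using hausdorff_outer_mono[OF EF, of d n] hausdorff_outer_Un_le[OF d] by (rule order_trans)
    also have "?H (\<Union>k. R (k + n)) \<le> (\<Sum>k. ?H (R (k + n)))" by (rule hausdorff_outer_subadditive)
    also have "\<dots> = ennreal (\<Sum>k. r (k + n))"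
      using r summ by (subst suminf_ennreal2[symmetric]) (auto simp: summable_iff_shift)
    also have "\<dots> \<le> ennreal e" using n by (intro ennreal_leI) auto
    finally have "?H (E \<inter> F) + ?H (E - F) \<le> ?H (E \<inter> F) + (?H (S n) + ennreal e)" by (simp add: add_mono)
    also have "\<dots> = (?H (E \<inter> F) + ?H (S n)) + ennreal e" by (simp add: add.assoc)
    also have "\<dots> \<le> ?H E + ennreal e" by (intro add_mono 1 order_refl)
    finally show "?H (E \<inter> F) + ?H (E - F) \<le> ?H E + ennreal e" .
  qed
qed

text \<open>A measure made by \<open>measure_of\<close> takes the prescribed values only if they are
  countably additive. Caratheodory's theorem provides this on the sets that split every set
  additively; these include the closed sets and hence all Borel sets.\<close>

lemma emeasure_surface_measure:
  fixes \<Omega> :: "(real^'n) set" assumes dim: "CARD('n) \<ge> 2" and B: "B \<in> sets (restrict_space borel (frontier \<Omega>))"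
  shows "emeasure (surface_measure \<Omega>) B = hausdorff_outer (CARD('n) - 1) B"
proof -
  let ?d = "CARD('n) - 1"
  have d: "?d > 0" using dim by simp
  interpret sigma_algebra "UNIV :: (real^'n) set" UNIV using sigma_algebra_Pow[of "UNIV :: (real^'n) set"] by simp
  have "outer_measure_space UNIV (hausdorff_outer ?d :: (real^'n) set \<Rightarrow> ennreal)"
    unfolding outer_measure_space_def positive_def increasing_def countably_subadditive_def
    by (auto intro: hausdorff_outer_mono hausdorff_outer_subadditive simp: hausdorff_outer_empty[OF d, simplified])
  from caratheodory_lemma[OF this]
  have ms: "measure_space UNIV (lambda_system UNIV UNIV (hausdorff_outer ?d)) (hausdorff_outer ?d :: (real^'n) set \<Rightarrow> ennreal)" .
  have cl: "F \<in> lambda_system UNIV UNIV (hausdorff_outer ?d)" if "closed F" for F :: "(real^'n) set"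
    unfolding lambda_system_eq
  proof (safe, simp)
    fix E :: "(real^'n) set"
    show "hausdorff_outer ?d (E \<inter> F) + hausdorff_outer ?d (E - F) = hausdorff_outer ?d E"
      using hausdorff_outer_caratheodory[OF d that, of E] hausdorff_outer_Un_le[OF d, of "E \<inter> F" "E - F"]
      by (auto simp: Int_Diff_Un)
  qed
  have sa: "sigma_algebra UNIV (lambda_system UNIV UNIV (hausdorff_outer ?d :: (real^'n) set \<Rightarrow> ennreal))"
    using ms by (simp add: measure_space_def)
  have sub: "sets borel \<subseteq> lambda_system UNIV UNIV (hausdorff_outer ?d :: (real^'n) set \<Rightarrow> ennreal)"
    unfolding borel_eq_closed using sigma_algebra.sigma_sets_subset[OF sa, of "Collect closed"] cl by auto
  have "sets (restrict_space borel (frontier \<Omega>)) \<subseteq> sets (borel :: (real^'n) measure)"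
    by (auto simp: sets_restrict_space)
  then have ca: "countably_additive (sets (restrict_space borel (frontier \<Omega>))) (hausdorff_outer ?d :: (real^'n) set \<Rightarrow> ennreal)"
    using ms sub sigma_algebra.countable_UN[OF sa, of _ UNIV]
    unfolding measure_space_def countably_additive_def by (meson subset_trans)
  have sp: "sigma_algebra (frontier \<Omega>) (sets (restrict_space borel (frontier \<Omega>)))"
    by (metis inf_top_right sets.sigma_algebra_axioms space_borel space_restrict_space)
  show ?thesis unfolding surface_measure_def
    by (rule emeasure_measure_of_sigma[OF sp _ ca B]) (simp add: positive_def hausdorff_outer_empty[OF d, simplified])
qed

lemma sets_surface_measure [simp, measurable_cong]:
  "sets (surface_measure \<Omega>) = sets (restrict_space borel (frontier \<Omega>))"
proof -
  have "sigma_algebra (frontier \<Omega>) (sets (restrict_space borel (frontier \<Omega>)))"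
    by (metis inf_top_right sets.sigma_algebra_axioms space_borel space_restrict_space)
  then show ?thesis unfolding surface_measure_def by (simp add: sigma_algebra.sets_measure_of_eq)
qed

lemma space_surface_measure [simp]: "space (surface_measure \<Omega>) = frontier \<Omega>"
  unfolding surface_measure_def by (rule space_measure_of_conv)

text \<open>\<open>H y\<close> is the height of the boundary graph over the projection of \<open>y\<close> along \<open>e\<close>.\<close>

locale boundary_graph =
  fixes \<Omega> :: "(real^'n) set" and x0 :: "real^'n" and r :: real and e :: "real^'n"
    and H :: "real^'n \<Rightarrow> real" and M :: real
  assumes dim: "CARD('n) \<ge> 2" and open_domain: "open \<Omega>"
    and r_pos: "0 < r" and norm_e: "norm e = 1" and M_nonneg: "0 \<le> M"
    and in_domain_iff: "\<And>y. y \<in> ball x0 r \<Longrightarrow> y \<in> \<Omega> \<longleftrightarrow> y \<bullet> e < H y"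
    and H_shift [simp]: "\<And>y t. H (y + t *\<^sub>R e) = H y"
    and H_lipschitz: "\<And>y z. y \<in> ball x0 r \<Longrightarrow> z \<in> ball x0 r \<Longrightarrow> \<bar>H y - H z\<bar> \<le> M * dist y z"
    and H_continuous: "continuous_on UNIV H"
    and base_in_frontier: "x0 \<in> frontier \<Omega>"

text \<open>The height over the projection is \<open>h\<close> composed with the projection
  \<open>Q\<close> along \<open>e\<close>. As \<open>h\<close> has a Lipschitz gradient, this
  gradient is bounded on balls, and the mean value inequality makes \<open>H\<close> Lipschitz
  there.\<close>

lemma C11_boundary_graph:
  fixes \<Omega> :: "(real^'n) set"
  assumes dim: "CARD('n) \<ge> 2" and op: "open \<Omega>" and bd: "C11_boundary \<Omega>" and x0: "x0 \<in> frontier \<Omega>"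
  obtains r e H M where "boundary_graph \<Omega> x0 r e H M"
proof -
  obtain r e h g L where r: "r > 0" and e: "norm e = 1"
    and h: "\<And>y. (h has_derivative (\<lambda>v. g y \<bullet> v)) (at y)" and g: "L-lipschitz_on UNIV g"
    and \<Omega>: "\<Omega> \<inter> ball x0 r = {y \<in> ball x0 r. y \<bullet> e < h (y - (y \<bullet> e) *\<^sub>R e)}"
    using bd x0 unfolding C11_boundary_def by (meson)
  define Q where "Q y = y - (y \<bullet> e) *\<^sub>R e" for y
  define H where "H y = h (Q y)" for y
  \<comment> \<open>A gradient bound on \<open>ball (Q x0) (2 * r)\<close>, which contains the
    projection of \<open>ball x0 r\<close>, times the Lipschitz constant 2 of \<open>Q\<close> from
    \<open>Q_diff\<close>.\<close>
  define M where "M = (norm (g (Q x0)) + L * (2 * r)) * 2"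
  have L: "L \<ge> 0" using g by (rule lipschitz_on_nonneg)
  have Q_diff: "dist (Q y) (Q z) \<le> 2 * dist y z" for y z
  proof -
    have "dist (Q y) (Q z) = norm ((y - z) - ((y - z) \<bullet> e) *\<^sub>R e)"
      by (simp add: Q_def dist_norm algebra_simps inner_diff_left)
    also have "\<dots> \<le> norm (y - z) + norm (((y - z) \<bullet> e) *\<^sub>R e)" by (rule norm_triangle_ineq4)
    also have "norm (((y - z) \<bullet> e) *\<^sub>R e) \<le> norm (y - z)" using Cauchy_Schwarz_ineq2[of "y - z" e] e by simp
    finally show ?thesis by (simp add: dist_norm)
  qed
  have h_lip: "norm (h a - h b) \<le> (norm (g (Q x0)) + L * (2 * r)) * norm (a - b)"
    if "a \<in> ball (Q x0) (2 * r)" "b \<in> ball (Q x0) (2 * r)" for a b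
  proof (rule differentiable_bound[OF convex_ball[of "Q x0" "2 * r"] _ _ that])
    fix y assume y: "y \<in> ball (Q x0) (2 * r)"
    show "(h has_derivative (\<lambda>v. g y \<bullet> v)) (at y within ball (Q x0) (2 * r))"
      using h by (rule has_derivative_at_withinI)
    have "norm (g y) \<le> norm (g (Q x0)) + dist (g y) (g (Q x0))" by (metis dist_norm norm_triangle_sub)
    also have "dist (g y) (g (Q x0)) \<le> L * dist y (Q x0)" using lipschitz_onD[OF g] by auto
    also have "\<dots> \<le> L * (2 * r)" using y L by (intro mult_left_mono) (auto simp: dist_commute)
    finally have "norm (g y) \<le> norm (g (Q x0)) + L * (2 * r)" by simp
    moreover have "onorm (\<lambda>v. g y \<bullet> v) \<le> norm (g y)" by (rule onorm_le) (simp add: Cauchy_Schwarz_ineq2)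
    ultimately show "onorm (\<lambda>v. g y \<bullet> v) \<le> norm (g (Q x0)) + L * (2 * r)" by linarith
  qed
  have "boundary_graph \<Omega> x0 r e H M"
  proof
    show "y \<in> \<Omega> \<longleftrightarrow> y \<bullet> e < H y" if "y \<in> ball x0 r" for y using \<Omega> that unfolding H_def Q_def by blast
    show "H (y + t *\<^sub>R e) = H y" for y t
    proof -
      have "e \<bullet> e = 1" using e by (simp add: norm_eq_1)
      then have "Q (y + t *\<^sub>R e) = Q y" by (simp add: Q_def inner_add_left scaleR_add_left)
      then show ?thesis by (simp add: H_def)
    qed
    show "continuous_on UNIV H"
    proof -
      have "continuous_on UNIV h" using has_derivative_continuous[OF h] by (simp add: continuous_at_imp_continuous_on)
      moreover have "continuous_on UNIV Q" unfolding Q_def by (intro continuous_intros)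
      ultimately show ?thesis unfolding H_def by (rule continuous_on_compose2) auto
    qed
    show "\<bar>H y - H z\<bar> \<le> M * dist y z" if "y \<in> ball x0 r" "z \<in> ball x0 r" for y z
    proof -
      have in_b: "Q w \<in> ball (Q x0) (2 * r)" if "w \<in> ball x0 r" for w using Q_diff[of x0 w] that by auto
      have "\<bar>H y - H z\<bar> \<le> (norm (g (Q x0)) + L * (2 * r)) * dist (Q y) (Q z)"
        using h_lip[OF in_b in_b] that by (simp add: H_def dist_norm)
      also have "\<dots> \<le> (norm (g (Q x0)) + L * (2 * r)) * (2 * dist y z)" using L r by (intro mult_left_mono Q_diff) simp
      finally show ?thesis by (simp add: M_def algebra_simps)
    qed
  qed (use assms r e L in \<open>auto simp: M_def\<close>)
  then show thesis by (rule that)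
qed

context boundary_graph
begin

lemma inner_e_e [simp]: "e \<bullet> e = 1" using norm_e by (simp add: norm_eq_1)

text \<open>The region strictly above the graph is open and misses \<Omega>, which keeps it out of
  the closure; conversely, lowering a point of the graph by a small multiple of \<open>e\<close>
  leads into \<Omega>.\<close>

lemma frontier_iff: assumes y: "y \<in> ball x0 r" shows "y \<in> frontier \<Omega> \<longleftrightarrow> y \<bullet> e = H y"
proof
  have front: "frontier \<Omega> = closure \<Omega> - \<Omega>" using open_domain by (simp add: frontier_def interior_open)
  {
    assume y': "y \<in> frontier \<Omega>"
    then have "y \<notin> \<Omega>" "y \<in> closure \<Omega>" by (auto simp: front)
    then have "H y \<le> y \<bullet> e" using in_domain_iff[OF y] by linarith
    moreover have "y \<bullet> e \<le> H y"
    proof (rule ccontr)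
      assume "\<not> ?thesis"
      then have "y \<in> {z. H z < z \<bullet> e} \<inter> ball x0 r" using y by auto
      moreover have "open ({z. H z < z \<bullet> e} \<inter> ball x0 r)"
        by (intro open_Int open_Collect_less continuous_intros H_continuous) auto
      ultimately have "\<Omega> \<inter> ({z. H z < z \<bullet> e} \<inter> ball x0 r) \<noteq> {}"
        using \<open>y \<in> closure \<Omega>\<close> by (metis Int_iff closure_iff_nhds_not_empty empty_iff order_refl)
      then show False using in_domain_iff by force
    qed
    ultimately show "y \<bullet> e = H y" by simp
  }
  assume y': "y \<bullet> e = H y"
  then have "y \<notin> \<Omega>" using in_domain_iff[OF y] by simp
  moreover have "y \<in> closure \<Omega>" unfolding closure_approachable
  proof (intro allI impI)
    fix d :: real assume d: "0 < d"
    define t where "t = min d (r - dist x0 y) / 2"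
    have t: "0 < t" "t < d" "t < r - dist x0 y" using d y by (auto simp: t_def min_def)
    have "dist (y + (- t) *\<^sub>R e) y = t" using t norm_e by (simp add: dist_norm)
    moreover have "y + (- t) *\<^sub>R e \<in> ball x0 r"
      using t dist_triangle[of x0 "y + (- t) *\<^sub>R e" y] calculation by (simp add: dist_commute)
    then have "y + (- t) *\<^sub>R e \<in> \<Omega>"
      using in_domain_iff[of "y + (- t) *\<^sub>R e"] H_shift[of y "-t"] y' t by (simp add: inner_diff_left)
    ultimately show "\<exists>z\<in>\<Omega>. dist z y < d" using t by (intro bexI[of _ "y + (- t) *\<^sub>R e"]) auto
  qed
  ultimately show "y \<in> frontier \<Omega>" by (simp add: front)
qed

text \<open>The translates of a separated subset of the graph by multiples of \<open>(1 + M) d e\<close> are again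
  separated; about \<open>r / d\<close> of them fit into a fixed ball, and the volume of the balls of radius
  \<open>d/2\<close> around all these points is bounded.\<close>

lemma separated_card_bound: assumes d: "0 < d" "(1 + M) * d \<le> r" and Z: "finite Z" "Z \<subseteq> frontier \<Omega> \<inter> ball x0 (r/4)"
    and sep: "\<And>a b. a \<in> Z \<Longrightarrow> b \<in> Z \<Longrightarrow> a \<noteq> b \<Longrightarrow> d \<le> dist a b"
  shows "real (card Z) * d ^ (CARD('n) - 1) \<le> 2 * (1 + M) * (4 * r) ^ CARD('n) / r"
proof -
  define c where "c = (1 + M) * d"
  \<comment> \<open>The number of translates by multiples of \<open>c\<close> that fit into length
    \<open>r\<close>; it is comparable to \<open>r / c\<close> because \<open>c\<close> is at most
    \<open>r\<close>.\<close>
  define m where "m = nat \<lfloor>r / c\<rfloor>"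
  have c: "0 < c" "c \<le> r" "d \<le> c" using d M_nonneg by (auto simp: c_def mult_le_cancel_right1)
  then have "1 \<le> \<lfloor>r / c\<rfloor>" by simp
  then have "real m = of_int \<lfloor>r / c\<rfloor>" "(1 :: real) \<le> of_int \<lfloor>r / c\<rfloor>" by (simp_all add: m_def)
  then have "real m \<le> r / c" "r / c \<le> 2 * real m" using floor_correct[of "r / c"] by linarith+
  then have m: "real m \<le> r / c" "r / (2 * c) \<le> real m" by (simp_all add: field_simps)
  define F where "F p = fst p + (real (snd p) * c) *\<^sub>R e" for p :: "(real^'n) \<times> nat"
  let ?I = "Z \<times> {..<m}"
  have far: "d \<le> dist (F p) (F q)" if pq: "p \<in> ?I" "q \<in> ?I" "p \<noteq> q" for p q
  proof (cases "snd p = snd q")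
    case True
    then show ?thesis using pq sep[of "fst p" "fst q"] by (auto simp: F_def prod_eq_iff mem_Times_iff)
  next
    case False
    let ?z = "fst p" and ?y = "fst q" and ?v = "F p - F q"
    \<comment> \<open>The point \<open>x\<close> lies over the projection of \<open>?y\<close> at
      the height of \<open>?z\<close>. So \<open>?z - x\<close> is the horizontal part of
      \<open>?v\<close>, and the Lipschitz bound for \<open>H\<close> involves this part
      only.\<close>
    define x where "x = ?y + ((?z - ?y) \<bullet> e) *\<^sub>R e"
    have zy: "?z \<in> ball x0 (r/4)" "?y \<in> ball x0 (r/4)" "?z \<bullet> e = H ?z" "?y \<bullet> e = H ?y"
      using pq Z r_pos frontier_iff[of ?z] frontier_iff[of ?y] by (auto simp: mem_Times_iff subset_iff)
    have "\<bar>(?z - ?y) \<bullet> e\<bar> \<le> dist ?z ?y" using Cauchy_Schwarz_ineq2[of "?z - ?y" e] norm_e by (simp add: dist_norm)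
    moreover have "dist x0 x \<le> dist x0 ?y + \<bar>(?z - ?y) \<bullet> e\<bar>"
      using dist_triangle[of x0 x ?y] norm_e by (simp add: x_def dist_norm)
    ultimately have "x \<in> ball x0 r" using zy(1,2) dist_triangle2[of ?z ?y x0] by (simp add: dist_commute)
    then have "\<bar>H ?z - H x\<bar> \<le> M * dist ?z x" using zy(1) r_pos by (intro H_lipschitz) auto
    moreover have "dist ?z x \<le> norm ?v"
    proof -
      have "norm (u - (u \<bullet> e) *\<^sub>R e) \<le> norm u" for u
        by (rule power2_le_imp_le) (simp_all add: power2_norm_eq_inner inner_diff_left inner_diff_right inner_commute[of e u])
      moreover have "?z - x = ?v - (?v \<bullet> e) *\<^sub>R e"
        by (simp add: x_def F_def inner_diff_left inner_add_left algebra_simps)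
      ultimately show ?thesis by (simp only: dist_norm)
    qed
    moreover have "H x = H ?y" by (simp add: x_def)
    ultimately have "\<bar>H ?z - H ?y\<bar> \<le> M * norm ?v" using mult_left_mono[OF _ M_nonneg, of "dist ?z x" "norm ?v"] by simp
    moreover have "\<bar>?v \<bullet> e\<bar> \<le> norm ?v" using Cauchy_Schwarz_ineq2[of ?v e] norm_e by simp
    moreover have "?v \<bullet> e = H ?z - H ?y + (real (snd p) - real (snd q)) * c"
      using zy(3,4) by (simp add: F_def algebra_simps inner_simps)
    ultimately have "\<bar>(real (snd p) - real (snd q)) * c\<bar> \<le> (1 + M) * norm ?v" by (simp add: algebra_simps)
    moreover have "1 * c \<le> \<bar>real (snd p) - real (snd q)\<bar> * c" using False c(1) by (intro mult_right_mono) linarith+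
    moreover have "\<bar>(real (snd p) - real (snd q)) * c\<bar> = \<bar>real (snd p) - real (snd q)\<bar> * c" using c(1) by (simp add: abs_mult)
    ultimately have "c \<le> (1 + M) * norm ?v" by linarith
    then have "(1 + M) * d \<le> (1 + M) * norm ?v" by (simp add: c_def)
    then show ?thesis using M_nonneg by (simp add: dist_norm mult_le_cancel_left_pos)
  qed
  have disj: "disjnt (ball (F p) (d/2)) (ball (F q) (d/2))" if "p \<in> ?I" "q \<in> ?I" "p \<noteq> q" for p q
  proof -
    have False if "dist (F p) y < d / 2" "dist (F q) y < d / 2" for y
      using far[OF \<open>p \<in> ?I\<close> \<open>q \<in> ?I\<close> \<open>p \<noteq> q\<close>] dist_triangle_half_r[of y "F p" d "F q"] that by (simp add: dist_commute)
    then show ?thesis by (auto simp: disjnt_def)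
  qed
  let ?w = "unit_ball_vol (real CARD('n))"
  have "real (card ?I) * (?w * (d/2) ^ CARD('n)) = (\<Sum>p\<in>?I. measure lebesgue (ball (F p) (d/2)))"
    using d by (simp add: content_ball)
  also have "\<dots> = measure lebesgue (\<Union>p\<in>?I. ball (F p) (d/2))"
    using Z(1) disj by (intro measure_UNION'[symmetric]) (auto simp: pairwise_def)
  also have "\<dots> \<le> measure lebesgue (ball x0 (2 * r))"
  proof (rule measure_mono_fmeasurable)
    show "(\<Union>p\<in>?I. ball (F p) (d/2)) \<subseteq> ball x0 (2 * r)"
    proof safe
      fix z i y assume z: "z \<in> Z" and i: "i < m" and y: "y \<in> ball (F (z, i)) (d/2)"
      have "real i * c \<le> real m * c" using i c(1) by (intro mult_right_mono) auto
      also have "\<dots> \<le> r" using m(1) c(1) by (simp add: field_simps)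
      finally have "dist z (F (z, i)) \<le> r" using c(1) norm_e by (simp add: F_def dist_norm)
      moreover have "dist x0 z < r/4" using z Z(2) by auto
      ultimately show "y \<in> ball x0 (2 * r)"
        using y c dist_triangle[of x0 y z] dist_triangle[of z y "F (z, i)"] by simp
    qed
    show "(\<Union>p\<in>?I. ball (F p) (d/2)) \<in> sets lebesgue" using Z(1) by (intro sets.finite_UN) auto
  qed auto
  also have "\<dots> = ?w * (2 * r) ^ CARD('n)" using content_ball[of "2 * r" x0] r_pos by simp
  finally have "?w * (real (card ?I) * (d/2) ^ CARD('n)) \<le> ?w * (2 * r) ^ CARD('n)" by (simp add: ac_simps)
  then have "real m * (real (card Z) * (d/2) ^ CARD('n)) \<le> (2 * r) ^ CARD('n)"
    by (simp add: mult_le_cancel_left_pos card_cartesian_product ac_simps)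
  then have le: "r / (2 * c) * (real (card Z) * (d/2) ^ CARD('n)) \<le> (2 * r) ^ CARD('n)"
    using mult_right_mono[OF m(2), of "real (card Z) * (d/2) ^ CARD('n)"] d(1) by simp
  have dn: "d ^ CARD('n) = d ^ (CARD('n) - 1) * d"
    using dim by (metis One_nat_def Suc_pred less_le_trans pos2 power_Suc2)
  have rn: "(4 * r) ^ CARD('n) = (2 * r) ^ CARD('n) * 2 ^ CARD('n)"
    unfolding power_mult_distrib[symmetric] by (rule arg_cong[where f = "\<lambda>x. x ^ _"]) simp
  \<comment> \<open>Solves \<open>le\<close> for the cardinality: one factor \<open>d\<close> of the
    volume cancels against \<open>c = (1 + M) * d\<close>, leaving the exponent
    \<open>CARD('n) - 1\<close>.\<close>
  have "y * N \<le> 2 * k * (X * P) / r" if "r / (2 * (k * d)) * (y * (N * d / P)) \<le> X" "0 < k" "0 < P" for y N X P k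
  proof -
    have "y * N = (r / (2 * (k * d)) * (y * (N * d / P))) * (2 * k * P / r)" using that(2,3) d(1) r_pos by simp
    also have "\<dots> \<le> X * (2 * k * P / r)" using that r_pos by (intro mult_right_mono) auto
    finally show ?thesis by (simp add: ac_simps)
  qed
  from this[OF le[unfolded c_def power_divide dn]] show ?thesis unfolding rn using M_nonneg by simp
qed

text \<open>A maximal \<open>h\<close>-separated subset of the patch is also an
  \<open>h\<close>-net, so balls of radius \<open>h\<close> around its points form an admissible
  covering. The cardinality bound makes its weight bounded independently of the mesh
  \<open>s\<close>.\<close>

lemma hausdorff_outer_patch_finite: "hausdorff_outer (CARD('n) - 1) (frontier \<Omega> \<inter> ball x0 (r/4)) < top"
proof -
  let ?d = "CARD('n) - 1" and ?E = "frontier \<Omega> \<inter> ball x0 (r/4)"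
  define C where "C = 2 * (1 + M) * (4 * r) ^ CARD('n) / r"
  have bound: "hausdorff_pre ?d s ?E \<le> ennreal (unit_ball_vol (real ?d) * C)" if s: "0 < s" for s
  proof -
    define h where "h = min (r / (1 + M)) (s / 2)"
    have h: "0 < h" "h \<le> r / (1 + M)" "2 * h \<le> s" using r_pos M_nonneg s by (auto simp: h_def)
    then have h': "(1 + M) * h \<le> r" using M_nonneg by (simp add: field_simps)
    define P where "P Z \<longleftrightarrow> finite Z \<and> Z \<subseteq> ?E \<and> (\<forall>a\<in>Z. \<forall>b\<in>Z. a \<noteq> b \<longrightarrow> h \<le> dist a b)" for Z
    have cardle: "real (card Z) * h ^ ?d \<le> C" if "P Z" for Z
      unfolding C_def by (rule separated_card_bound[OF h(1) h']) (use that in \<open>auto simp: P_def\<close>)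
    \<comment> \<open>Separated sets have bounded cardinality, so one of greatest cardinality
      exists.\<close>
    have "card Z < nat \<lceil>C / h ^ ?d\<rceil> + 1" if "P Z" for Z
    proof -
      have "real (card Z) \<le> C / h ^ ?d" using cardle[OF that] h by (simp add: field_simps)
      then show ?thesis by linarith
    qed
    moreover have "P {}" by (simp add: P_def)
    ultimately obtain Z where Z: "P Z" "\<And>Y. P Y \<Longrightarrow> card Y \<le> card Z"
      using ex_has_greatest_nat[of P "{}" card "nat \<lceil>C / h ^ ?d\<rceil> + 1"] by (metis less_imp_le)
    have cover: "\<exists>z\<in>Z. dist z y < h" if y: "y \<in> ?E" for y
    proof (rule ccontr)
      assume neg: "\<not> ?thesis"
      then have "y \<notin> Z" using h by auto
      moreover have "P (insert y Z)" using Z(1) neg y unfolding P_def by (auto simp: dist_commute not_less)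
      ultimately show False using Z(2)[of "insert y Z"] Z(1) by (simp add: P_def)
    qed
    obtain f where f: "bij_betw f {..<card Z} Z" using Z(1) ex_bij_betw_nat_finite[of Z]
      by (auto simp: P_def atLeast0LessThan)
    define D where "D i = (if i < card Z then ball (f i) h else {})" for i
    have "D \<in> hausdorff_cover s ?E"
    proof -
      have "y \<in> (\<Union>i. D i)" if y: "y \<in> ?E" for y
      proof -
        obtain z where z: "z \<in> Z" "dist z y < h" using cover[OF y] by blast
        then obtain i where "i < card Z" "f i = z" using f by (metis bij_betw_imp_surj_on imageE lessThan_iff)
        then have "y \<in> D i" using z by (simp add: D_def)
        then show ?thesis by blast
      qed
      moreover have "bounded (D i) \<and> diameter (D i) \<le> s" for i using h s by (auto simp: D_def)
      ultimately show ?thesis unfolding hausdorff_cover_def by blast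
    qed
    then have "hausdorff_pre ?d s ?E \<le> (\<Sum>i. hausdorff_weight ?d (D i))"
      unfolding hausdorff_pre_def by (rule INF_lower)
    also have "\<dots> = (\<Sum>i<card Z. hausdorff_weight ?d (D i))"
      using dim by (intro suminf_finite) (auto simp: D_def hausdorff_weight_empty)
    also have "\<dots> = (\<Sum>i<card Z. ennreal (unit_ball_vol (real ?d) * h ^ ?d))"
      using h by (intro sum.cong) (auto simp: D_def hausdorff_weight_def)
    also have "\<dots> = ennreal (real (card Z) * (unit_ball_vol (real ?d) * h ^ ?d))"
      using h by (simp add: ennreal_mult'' ennreal_of_nat_eq_real_of_nat)
    also have "\<dots> \<le> ennreal (unit_ball_vol (real ?d) * C)"
      using cardle[OF Z(1)] by (intro ennreal_leI) (simp add: mult.left_commute mult_left_mono)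
    finally show ?thesis .
  qed
  have "hausdorff_outer ?d ?E \<le> ennreal (unit_ball_vol (real ?d) * C)"
    unfolding hausdorff_outer_eq_SUP by (rule SUP_least) (use bound in auto)
  then show ?thesis by (rule le_less_trans) simp
qed

end

text \<open>The boundary is compact, so finitely many patches of finite measure cover it.\<close>

lemma surface_measure_finite:
  fixes \<Omega> :: "(real^'n) set"
  assumes dim: "CARD('n) \<ge> 2" and op: "open \<Omega>" and bnd: "bounded \<Omega>" and c11: "C11_boundary \<Omega>"
  shows "finite_measure (surface_measure \<Omega>)"
proof
  let ?d = "CARD('n) - 1"
  have "\<exists>r. r > 0 \<and> hausdorff_outer ?d (frontier \<Omega> \<inter> ball x r) < top" if x: "x \<in> frontier \<Omega>" for x
  proof -
    obtain r e H M where "boundary_graph \<Omega> x r e H M" using C11_boundary_graph[OF dim op c11 x] by metis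
    then show ?thesis using boundary_graph.hausdorff_outer_patch_finite boundary_graph.r_pos
      by (intro exI[of _ "r/4"]) auto
  qed
  then obtain r where r: "\<And>x. x \<in> frontier \<Omega> \<Longrightarrow> r x > 0"
    "\<And>x. x \<in> frontier \<Omega> \<Longrightarrow> hausdorff_outer ?d (frontier \<Omega> \<inter> ball x (r x)) < top" by metis
  have comp: "compact (frontier \<Omega>)" using bnd by (rule compact_frontier_bounded)
  have "frontier \<Omega> \<subseteq> (\<Union>x\<in>frontier \<Omega>. ball x (r x))" using r(1) by force
  then obtain X where X: "X \<subseteq> frontier \<Omega>" "finite X" "frontier \<Omega> \<subseteq> (\<Union>x\<in>X. ball x (r x))"
    by (rule compactE_image[OF comp, rotated]) auto
  have "hausdorff_outer ?d (\<Union>x\<in>Y. frontier \<Omega> \<inter> ball x (r x)) < top" if "finite Y" "Y \<subseteq> frontier \<Omega>" for Y using that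
  proof (induction rule: finite_induct)
    case empty then show ?case using dim by (simp add: hausdorff_outer_empty)
  next
    case (insert x Y)
    have "hausdorff_outer ?d (\<Union>x\<in>insert x Y. frontier \<Omega> \<inter> ball x (r x)) \<le>
        hausdorff_outer ?d (frontier \<Omega> \<inter> ball x (r x)) + hausdorff_outer ?d (\<Union>x\<in>Y. frontier \<Omega> \<inter> ball x (r x))"
      using dim by (simp add: hausdorff_outer_Un_le)
    also have "\<dots> < top" using insert r(2)[of x] by (simp add: ennreal_add_less_top)
    finally show ?case .
  qed
  from this[OF X(2,1)] have "hausdorff_outer ?d (\<Union>x\<in>X. frontier \<Omega> \<inter> ball x (r x)) < top" .
  moreover have "frontier \<Omega> \<subseteq> (\<Union>x\<in>X. frontier \<Omega> \<inter> ball x (r x))" using X by blast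
  ultimately have "hausdorff_outer ?d (frontier \<Omega>) < top" using hausdorff_outer_mono by (metis le_less_trans)
  moreover have "frontier \<Omega> \<in> sets (restrict_space borel (frontier \<Omega>))"
    by (metis inf_top_right sets.top space_borel space_restrict_space)
  ultimately show "emeasure (surface_measure \<Omega>) (space (surface_measure \<Omega>)) \<noteq> \<infinity>"
    using emeasure_surface_measure[OF dim] by simp
qed

section \<open>The boundary layer inequality\<close>

definition collar :: "(real^'n) set \<Rightarrow> real \<Rightarrow> (real^'n) set" where
  "collar \<Omega> e = {x\<in>\<Omega>. infdist x (frontier \<Omega>) \<le> e}"

lemma collar_borel: "open \<Omega> \<Longrightarrow> collar \<Omega> e \<in> sets borel"
proof -
  assume "open \<Omega>"
  moreover have "collar \<Omega> e = \<Omega> \<inter> (\<lambda>x. infdist x (frontier \<Omega>)) -` {..e}" by (auto simp: collar_def)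
  moreover have "(\<lambda>x. infdist x (frontier \<Omega>)) \<in> borel_measurable borel"
    by (intro borel_measurable_continuous_onI continuous_intros)
  ultimately show ?thesis using measurable_sets_borel by (metis atMost_borel borel_open sets.Int)
qed

text \<open>A Hardy-type inequality: near the boundary, the mass of \<open>U\<close> is controlled
  by its boundary values and, with a factor \<open>e^2\<close>, by its gradient. The single constant
  \<open>C\<close> limits the range of \<open>e\<close>, gives both factors and dilates the collar,
  so that a larger constant makes a weaker statement. Integrals are taken in \<open>ennreal\<close>,
  where both sides always make sense.\<close>

definition layer_bound :: "(real^'n) set \<Rightarrow> (real^'n) set \<Rightarrow> real \<Rightarrow> bool" where
  "layer_bound \<Omega> S C \<longleftrightarrow> (\<forall>e U. 0 < e \<longrightarrow> C * e \<le> 1 \<longrightarrow> Ck 1 (U :: real^'n \<Rightarrow> complex) \<longrightarrow>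
    (\<integral>\<^sup>+x. indicator (collar \<Omega> e \<inter> S) x * ennreal ((norm (U x))^2) \<partial>lborel) \<le>
      ennreal (C * e) * (\<integral>\<^sup>+x. ennreal ((norm (U x))^2) \<partial>surface_measure \<Omega>) +
      ennreal (C * e^2) * (\<integral>\<^sup>+x. indicator (collar \<Omega> (C * e)) x * ennreal ((norm (grad U x))^2) \<partial>lborel))"

context boundary_graph
begin

text \<open>Projection along \<open>e\<close> onto the graph.\<close>

definition lift :: "real^'n \<Rightarrow> real^'n" where
  "lift y = y + (H y - y \<bullet> e) *\<^sub>R e"

lemma lift_continuous: "continuous_on UNIV lift"
  unfolding lift_def[abs_def] using H_continuous by (intro continuous_intros) auto

lemma lift_borel [measurable]: "lift \<in> borel_measurable borel"
  using lift_continuous by (rule borel_measurable_continuous_onI)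

definition under_graph :: "real \<Rightarrow> (real^'n) set" where
  "under_graph T = {y \<in> ball x0 (r/4). 0 < H y - y \<bullet> e \<and> H y - y \<bullet> e \<le> T}"

lemma under_graph_borel [measurable]: "under_graph T \<in> sets borel"
proof -
  have "(\<lambda>y. H y - y \<bullet> e) \<in> borel_measurable borel"
    by (intro borel_measurable_continuous_onI continuous_intros H_continuous)
  then have "(\<lambda>y. H y - y \<bullet> e) -` {0<..T} \<in> sets borel" using measurable_sets_borel by (metis greaterThanAtMost_borel)
  moreover have "under_graph T = ball x0 (r/4) \<inter> (\<lambda>y. H y - y \<bullet> e) -` {0<..T}" by (auto simp: under_graph_def)
  ultimately have "under_graph T \<in> sets borel" by (simp add: sets.Int)
  then show ?thesis .
qed

text \<open>These are the segments along which \<open>U\<close> is compared with its boundary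
  values. They stay in the ball where the graph describes \<Omega>, since both the distance of
  \<open>y\<close> from \<open>x0\<close> and its depth are at most \<open>r/4\<close>.\<close>

lemma segment_under_graph: assumes y: "y \<in> under_graph T" and T: "T \<le> r/4" and s: "0 \<le> s" "s \<le> H y - y \<bullet> e"
  shows "y + s *\<^sub>R e \<in> ball x0 (r/2)" "s < H y - y \<bullet> e \<Longrightarrow> y + s *\<^sub>R e \<in> \<Omega>"
    "lift y \<in> frontier \<Omega>" "infdist (y + s *\<^sub>R e) (frontier \<Omega>) \<le> T"
proof -
  have b: "y + u *\<^sub>R e \<in> ball x0 (r/2)" if "0 \<le> u" "u \<le> H y - y \<bullet> e" for u
  proof -
    have "dist x0 (y + u *\<^sub>R e) \<le> dist x0 y + dist y (y + u *\<^sub>R e)" by (rule dist_triangle)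
    also have "dist y (y + u *\<^sub>R e) = u" using that norm_e by (simp add: dist_norm)
    finally show ?thesis using y T that by (auto simp: under_graph_def)
  qed
  show "y + s *\<^sub>R e \<in> ball x0 (r/2)" using b s by blast
  show "y + s *\<^sub>R e \<in> \<Omega>" if "s < H y - y \<bullet> e"
    using b[OF s] r_pos that by (subst in_domain_iff) (auto simp: inner_add_left)
  have l: "lift y = y + (H y - y \<bullet> e) *\<^sub>R e" by (simp add: lift_def)
  show f: "lift y \<in> frontier \<Omega>" using b[of "H y - y \<bullet> e"] y r_pos unfolding l
    by (subst frontier_iff) (auto simp: inner_add_left under_graph_def)
  have "dist (y + s *\<^sub>R e) (lift y) = H y - y \<bullet> e - s" unfolding l dist_norm using s norm_e
    by (simp add: algebra_simps flip: scaleR_diff_left scaleR_add_left) 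
  then show "infdist (y + s *\<^sub>R e) (frontier \<Omega>) \<le> T" using infdist_le2[OF f] y s by (auto simp: under_graph_def)
qed

text \<open>The preimage lies in a tube of length \<open>T\<close>, which is covered by about \<open>T / d\<close> balls of radius \<open>2 d\<close>.\<close>

lemma lift_preimage_cover: assumes T: "0 < T" "T \<le> r/4" and d: "0 < d" "d \<le> T" and C: "bounded C" "diameter C \<le> d"
  obtains D where "D \<in> sets borel" "under_graph T \<inter> lift -` C \<subseteq> D"
    "emeasure lborel D \<le> ennreal (2 * 2 ^ CARD('n) * unit_ball_vol (real CARD('n)) * T * d ^ (CARD('n) - 1))"
proof (cases "C = {}")
  case True
  then show ?thesis by (intro that[of "{}"]) auto
next
  case False
  then obtain c where c: "c \<in> C" by auto
  define m where "m = nat \<lfloor>T / d\<rfloor>"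
  have Td: "T / d \<ge> 1" using T d by simp
  have m: "real m \<le> T / d" unfolding m_def using Td by linarith
  let ?w = "unit_ball_vol (real CARD('n))"
  define D where "D = (\<Union>j\<in>{..m}. cball (c - (real j * d) *\<^sub>R e) (2 * d))"
  show thesis
  proof (rule that[of D])
    show "D \<in> sets borel" unfolding D_def by (intro sets.finite_UN) auto
    show "under_graph T \<inter> lift -` C \<subseteq> D"
    proof
      fix y assume y: "y \<in> under_graph T \<inter> lift -` C"
      define t where "t = H y - y \<bullet> e"
      have t: "0 < t" "t \<le> T" "lift y = y + t *\<^sub>R e" using y by (auto simp: t_def under_graph_def lift_def)
      \<comment> \<open>The depth of \<open>y\<close>, rounded down to a multiple of
        \<open>d\<close>, selects the ball that contains \<open>y\<close>.\<close>
      define j where "j = nat \<lfloor>t / d\<rfloor>"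
      have td: "t / d \<ge> 0" using t d by simp
      have j: "real j \<le> t / d" "t / d < real j + 1" unfolding j_def using td by linarith+
      have jd: "real j * d \<le> t" "t < real j * d + d" using j d by (auto simp: field_simps)
      have "t / d \<le> T / d" using t d by (simp add: divide_right_mono)
      then have jm: "j \<le> m" unfolding j_def m_def by (intro nat_mono floor_mono)
      have "dist c (lift y) \<le> d" using diameter_bounded_bound[OF C(1) c, of "lift y"] y C(2) by auto
      have "dist (c - (real j * d) *\<^sub>R e) y = norm ((c - lift y) + (t - real j * d) *\<^sub>R e)"
        unfolding dist_norm t by (simp add: algebra_simps)
      also have "\<dots> \<le> norm (c - lift y) + norm ((t - real j * d) *\<^sub>R e)" by (rule norm_triangle_ineq)
      also have "\<dots> \<le> d + d" using \<open>dist c (lift y) \<le> d\<close> jd norm_e by (intro add_mono) (auto simp: dist_norm)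
      finally show "y \<in> D" using jm by (auto simp: D_def)
    qed
    have "emeasure lborel D \<le> (\<Sum>j\<in>{..m}. emeasure lborel (cball (c - (real j * d) *\<^sub>R e) (2 * d)))"
      unfolding D_def by (rule emeasure_subadditive_finite) auto
    also have "\<dots> = (\<Sum>j\<in>{..m}. ennreal (?w * (2 * d) ^ CARD('n)))" using d by (simp add: emeasure_cball)
    also have "\<dots> = ennreal (real (Suc m) * (?w * (2 * d) ^ CARD('n)))"
      using d by (simp add: ennreal_mult'' ennreal_of_nat_eq_real_of_nat flip: of_nat_Suc)
    also have "\<dots> \<le> ennreal (2 * 2 ^ CARD('n) * ?w * T * d ^ (CARD('n) - 1))"
    proof (rule ennreal_leI)
      have "d ^ CARD('n) = d * d ^ (CARD('n) - 1)"
        using dim by (metis One_nat_def Suc_pred less_le_trans pos2 power_Suc)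
      then have eq: "real (Suc m) * (?w * (2 * d) ^ CARD('n)) = (real (Suc m) * d) * (2 ^ CARD('n) * ?w * d ^ (CARD('n) - 1))"
        by (simp add: power_mult_distrib ac_simps)
      \<comment> \<open>With \<open>d \<le> T\<close> the number \<open>Suc m\<close> of balls is at
        most \<open>2 * T / d\<close>, which turns \<open>d ^ CARD('n)\<close> into
        \<open>T * d ^ (CARD('n) - 1)\<close>.\<close>
      have "real m * d \<le> T" using m d by (simp add: field_simps)
      then have "real (Suc m) * d \<le> 2 * T" using d by (simp add: algebra_simps)
      then have "(real (Suc m) * d) * (2 ^ CARD('n) * ?w * d ^ (CARD('n) - 1)) \<le> (2 * T) * (2 ^ CARD('n) * ?w * d ^ (CARD('n) - 1))"
        using d by (intro mult_right_mono) auto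
      then show "real (Suc m) * (?w * (2 * d) ^ CARD('n)) \<le> 2 * 2 ^ CARD('n) * ?w * T * d ^ (CARD('n) - 1)"
        unfolding eq by (simp add: ac_simps)
    qed
    finally show "emeasure lborel D \<le> ennreal (2 * 2 ^ CARD('n) * ?w * T * d ^ (CARD('n) - 1))" .
  qed
qed

text \<open>Quotient of the tube volume in \<open>lift_preimage_cover\<close> by \<open>T\<close>
  times the Hausdorff weight of a set of diameter \<open>d\<close>. The power of 4 collects
  \<open>2 * 2 ^ CARD('n)\<close> and the factor from the radius \<open>d / 2\<close>.\<close>

definition tube_const :: real where
  "tube_const = 4 ^ CARD('n) * unit_ball_vol (real CARD('n)) / unit_ball_vol (real (CARD('n) - 1))"

lemma tube_const_pos: "tube_const > 0" by (simp add: tube_const_def)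

text \<open>For positive diameter the tube bound is exactly proportional to the weight. A set of
  diameter 0 has weight 0, whereas a tube has positive thickness; the slack \<open>s\<close> pays
  for it.\<close>

lemma lift_preimage_weight: assumes T: "0 < T" "T \<le> r/4" and C: "bounded C" "diameter C \<le> T" and s: "0 < s"
  obtains D where "D \<in> sets borel" "under_graph T \<inter> lift -` C \<subseteq> D"
    "emeasure lborel D \<le> ennreal (tube_const * T) * hausdorff_weight (CARD('n) - 1) C + ennreal s"
proof -
  let ?w = "unit_ball_vol (real CARD('n))" and ?k = "CARD('n) - 1"
  have k: "?k > 0" using dim by simp
  define K where "K = 2 * 2 ^ CARD('n) * ?w * T"
  have K: "K > 0" using T by (simp add: K_def)
  have diam: "0 \<le> diameter C" using C by (intro diameter_ge_0)
  consider "diameter C > 0" | "diameter C = 0" using diam by linarith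
  then show thesis
  proof cases
    case 1
    obtain D where D: "D \<in> sets borel" "under_graph T \<inter> lift -` C \<subseteq> D"
      "emeasure lborel D \<le> ennreal (K * diameter C ^ ?k)"
      using lift_preimage_cover[OF T 1 C(2) C(1) order_refl] unfolding K_def by blast
    have "(4::real) ^ CARD('n) = 2 * 2 ^ CARD('n) * 2 ^ ?k"
    proof -
      have "(4::real) ^ CARD('n) = 2 ^ CARD('n) * 2 ^ CARD('n)" by (simp add: power_mult_distrib[symmetric])
      also have "\<dots> = 2 * 2 ^ CARD('n) * 2 ^ ?k"
      proof -
        have "CARD('n) = Suc ?k" using k by simp
        then have "(2::real) ^ CARD('n) = 2 * 2 ^ ?k" by (metis power_Suc)
        moreover have "a * a = 2 * a * b" if "a = 2 * b" for a b :: real using that by simp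
        ultimately show ?thesis by blast
      qed
      finally show ?thesis .
    qed
    moreover have v: "unit_ball_vol (real ?k) \<noteq> 0" using unit_ball_vol_pos[of "real ?k"] by (metis less_irrefl of_nat_0_le_iff)
    ultimately have "K * diameter C ^ ?k = tube_const * T * (unit_ball_vol (real ?k) * (diameter C / 2) ^ ?k)"
      by (simp add: K_def tube_const_def power_divide del: of_nat_diff One_nat_def)
    also have "ennreal \<dots> = ennreal (tube_const * T) * hausdorff_weight ?k C"
      unfolding hausdorff_weight_def using T tube_const_pos diam by (intro ennreal_mult) auto
    finally show ?thesis using D by (intro that[of D]) (auto intro: order_trans)
  next
    case 2
    \<comment> \<open>Since \<open>d \<le> 1\<close> the power of \<open>d\<close> is at most
      \<open>d\<close>, so the tube volume is at most \<open>K * d \<le> s\<close>.\<close>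
    define d where "d = min (min 1 T) (s / K)"
    have d: "0 < d" "d \<le> 1" "d \<le> T" "d \<le> s / K" using T K s by (auto simp: d_def)
    obtain D where D: "D \<in> sets borel" "under_graph T \<inter> lift -` C \<subseteq> D"
      "emeasure lborel D \<le> ennreal (K * d ^ ?k)"
      using lift_preimage_cover[OF T d(1,3) C(1)] 2 d unfolding K_def by force
    have "d ^ ?k \<le> d" using d k by (metis less_imp_le power_decreasing power_one_right Suc_leI One_nat_def)
    then have "K * d ^ ?k \<le> K * (s / K)" using d K by (intro mult_left_mono) auto
    then have "K * d ^ ?k \<le> s" using K by simp
    then have "ennreal (K * d ^ ?k) \<le> ennreal (tube_const * T) * hausdorff_weight ?k C + ennreal s"
      by (metis add.commute add_increasing2 ennreal_leI zero_le)
    then show ?thesis using D by (intro that[of D]) (auto intro: order_trans)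
  qed
qed

text \<open>Every covering of \<open>B\<close> with mesh \<open>T\<close> gives tubes that cover the
  preimage, and the infimum over coverings yields the pre-measure. Comparing coverings replaces a
  computation of the surface area in charts.\<close>

lemma emeasure_lift_preimage: assumes T: "0 < T" "T \<le> r/4" and B: "B \<in> sets borel"
  shows "emeasure lborel (under_graph T \<inter> lift -` B) \<le> ennreal (tube_const * T) * hausdorff_outer (CARD('n) - 1) B"
proof -
  let ?k = "CARD('n) - 1"
  have "emeasure lborel (under_graph T \<inter> lift -` B) \<le> ennreal (tube_const * T) * hausdorff_pre ?k T B"
  proof (cases "hausdorff_pre ?k T B = top")
    case True then show ?thesis using T tube_const_pos by (simp add: ennreal_mult_top)
  next
    case False
    have cov: "emeasure lborel (under_graph T \<inter> lift -` B) \<le> ennreal (tube_const * T) * (\<Sum>i. hausdorff_weight ?k (C i))"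
      if C: "C \<in> hausdorff_cover T B" for C
    proof (rule ennreal_le_epsilon)
      fix s :: real assume s: "0 < s"
      have "\<exists>D. D \<in> sets borel \<and> under_graph T \<inter> lift -` C i \<subseteq> D \<and>
        emeasure lborel D \<le> ennreal (tube_const * T) * hausdorff_weight ?k (C i) + ennreal (s * (1/2)^Suc i)" for i
      proof -
        have "bounded (C i)" "diameter (C i) \<le> T" "0 < s * (1/2)^Suc i" using C s by (auto simp: hausdorff_cover_def)
        from lift_preimage_weight[OF T this] show ?thesis by metis
      qed
      then obtain D where D: "\<And>i. D i \<in> sets borel" "\<And>i. under_graph T \<inter> lift -` C i \<subseteq> D i"
        "\<And>i. emeasure lborel (D i) \<le> ennreal (tube_const * T) * hausdorff_weight ?k (C i) + ennreal (s * (1/2)^Suc i)"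
        by metis
      have "B \<subseteq> (\<Union>i. C i)" using C by (auto simp: hausdorff_cover_def)
      then have "under_graph T \<inter> lift -` B \<subseteq> (\<Union>i. D i)" using D(2) by blast
      then have "emeasure lborel (under_graph T \<inter> lift -` B) \<le> emeasure lborel (\<Union>i. D i)"
        using D(1) by (intro emeasure_mono) auto
      also have "\<dots> \<le> (\<Sum>i. emeasure lborel (D i))" using D(1) by (intro emeasure_subadditive_countably) auto
      also have "\<dots> \<le> (\<Sum>i. ennreal (tube_const * T) * hausdorff_weight ?k (C i) + ennreal (s * (1/2)^Suc i))"
        by (intro suminf_le D) auto
      also have "\<dots> = (\<Sum>i. ennreal (tube_const * T) * hausdorff_weight ?k (C i)) + (\<Sum>i. ennreal (s * (1/2)^Suc i))"
        by (rule suminf_add[symmetric]) auto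
      also have "(\<Sum>i. ennreal (s * (1/2)^Suc i)) = ennreal s"
      proof -
        have "(\<lambda>n. s * (1/2)^Suc n) sums (s * 1)" by (intro sums_mult power_half_series)
        then show ?thesis using s by (subst suminf_ennreal_eq[of _ s]) auto
      qed
      finally show "emeasure lborel (under_graph T \<inter> lift -` B) \<le>
          ennreal (tube_const * T) * (\<Sum>i. hausdorff_weight ?k (C i)) + ennreal s" by simp
    qed
    show ?thesis
    proof (rule ennreal_le_epsilon)
      fix s :: real assume s: "0 < s"
      have c: "tube_const * T > 0" using T tube_const_pos by simp
      obtain C where C: "C \<in> hausdorff_cover T B"
        "(\<Sum>i. hausdorff_weight ?k (C i)) \<le> hausdorff_pre ?k T B + ennreal (s / (tube_const * T))"
        using hausdorff_pre_close[of ?k T B "ennreal (s / (tube_const * T))"] False s c by (auto simp: less_top)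
      have "emeasure lborel (under_graph T \<inter> lift -` B) \<le>
          ennreal (tube_const * T) * (hausdorff_pre ?k T B + ennreal (s / (tube_const * T)))"
        using cov[OF C(1)] mult_left_mono[OF C(2), of "ennreal (tube_const * T)"] by (auto intro: order_trans)
      also have "\<dots> = ennreal (tube_const * T) * hausdorff_pre ?k T B + ennreal s"
        using c s T tube_const_pos by (simp add: distrib_left flip: ennreal_mult)
      finally show "emeasure lborel (under_graph T \<inter> lift -` B) \<le>
          ennreal (tube_const * T) * hausdorff_pre ?k T B + ennreal s" .
    qed
  qed
  also have "\<dots> \<le> ennreal (tube_const * T) * hausdorff_outer ?k B"
    using T by (intro mult_left_mono hausdorff_pre_le_outer) auto
  finally show ?thesis .
qed

text \<open>The image under \<open>lift\<close> of Lebesgue measure on \<open>under_graph T\<close>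
  is dominated, set by set, by a multiple of the surface measure; an inequality between measures
  passes to integrals.\<close>

lemma nn_integral_lift_le: assumes T: "0 < T" "T \<le> r/4" and f: "f \<in> borel_measurable borel"
  shows "(\<integral>\<^sup>+y. indicator (under_graph T) y * f (lift y) \<partial>lborel) \<le>
     ennreal (tube_const * T) * (\<integral>\<^sup>+x. f x \<partial>surface_measure \<Omega>)"
proof -
  let ?E = "under_graph T" and ?F = "restrict_space borel (frontier \<Omega>)"
  define N where "N = distr (restrict_space lborel ?E) ?F lift"
  have mem: "lift y \<in> frontier \<Omega>" if "y \<in> ?E" for y
    using segment_under_graph(3)[OF that T(2), of 0] that by (auto simp: under_graph_def)
  have lm: "lift \<in> restrict_space lborel ?E \<rightarrow>\<^sub>M ?F"
    using mem by (intro measurable_restrict_space2 measurable_restrict_space1) (auto simp: space_restrict_space)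
  have fm: "f \<in> borel_measurable ?F" using f by (rule measurable_restrict_space1)
  have "(\<integral>\<^sup>+y. indicator ?E y * f (lift y) \<partial>lborel) = (\<integral>\<^sup>+y. f (lift y) \<partial>restrict_space lborel ?E)"
    by (subst nn_integral_restrict_space) (auto intro!: nn_integral_cong simp: indicator_def)
  also have "\<dots> = (\<integral>\<^sup>+x. f x \<partial>N)" unfolding N_def using fm by (intro nn_integral_distr[OF lm, symmetric]) simp
  also have "\<dots> \<le> (\<integral>\<^sup>+x. f x \<partial>scale_measure (ennreal (tube_const * T)) (surface_measure \<Omega>))"
  proof (rule nn_integral_mono_measure)
    show s: "sets N = sets (scale_measure (ennreal (tube_const * T)) (surface_measure \<Omega>))" by (simp add: N_def)
    show "N \<le> scale_measure (ennreal (tube_const * T)) (surface_measure \<Omega>)" unfolding le_measure[OF s]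
    proof
      fix B
      show "emeasure N B \<le> emeasure (scale_measure (ennreal (tube_const * T)) (surface_measure \<Omega>)) B"
      proof (cases "B \<in> sets ?F")
        case False
        then show ?thesis by (simp add: N_def emeasure_notin_sets)
      next
        case True
        then have Bb: "B \<in> sets borel" by (auto simp: sets_restrict_space)
        have "emeasure N B = emeasure (restrict_space lborel ?E) (lift -` B \<inter> space (restrict_space lborel ?E))"
          unfolding N_def by (rule emeasure_distr[OF lm True])
        also have "\<dots> = emeasure lborel (?E \<inter> lift -` B)"
          by (subst emeasure_restrict_space) (auto simp: space_restrict_space Int_commute)
        also have "\<dots> \<le> ennreal (tube_const * T) * hausdorff_outer (CARD('n) - 1) B"
          by (rule emeasure_lift_preimage[OF T Bb])
        finally show ?thesis by (simp add: emeasure_surface_measure[OF dim True])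
      qed
    qed
  qed
  also have "\<dots> = ennreal (tube_const * T) * (\<integral>\<^sup>+x. f x \<partial>surface_measure \<Omega>)"
    using fm by (intro nn_integral_scale_measure) (simp cong: measurable_cong_sets)
  finally show ?thesis .
qed

end

text \<open>\<open>Ck\<close> contains differentiability, so the derivative is linear and determined
  by the partial derivatives. In this form derivatives are composed below.\<close>

lemma Ck1_has_derivative:
  fixes U :: "real^'n \<Rightarrow> 'b::real_normed_vector" assumes "Ck 1 U"
  shows "(U has_derivative (\<lambda>v. \<Sum>i\<in>UNIV. (v $ i) *\<^sub>R grad U x $ i)) (at x)"
proof -
  have "U differentiable (at x)" using assms by (simp add: differentiable_on_def)
  then have D: "(U has_derivative frechet_derivative U (at x)) (at x)" by (simp add: frechet_derivative_works)
  have "frechet_derivative U (at x) = (\<lambda>v. \<Sum>i\<in>UNIV. (v $ i) *\<^sub>R grad U x $ i)"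
  proof
    fix v
    interpret linear "frechet_derivative U (at x)" using D by (rule has_derivative_linear)
    have "frechet_derivative U (at x) v = frechet_derivative U (at x) (\<Sum>i\<in>UNIV. (v $ i) *\<^sub>R axis i 1)"
      using basis_expansion[of v] by (simp add: scalar_mult_eq_scaleR)
    then show "frechet_derivative U (at x) v = (\<Sum>i\<in>UNIV. (v $ i) *\<^sub>R grad U x $ i)" by (simp add: sum scale grad_def)
  qed
  then show ?thesis using D by simp
qed

lemma Ck1_continuous: "Ck 1 U \<Longrightarrow> continuous_on UNIV U" by (simp add: differentiable_imp_continuous_on)

lemma Ck1_continuous_grad: "Ck 1 U \<Longrightarrow> continuous_on UNIV (grad U)"
  using continuous_on_vec_lambda[of UNIV "\<lambda>i x. grad U x $ i"] by simp

lemma norm_sum_scaleR_le: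
  fixes g :: "'b::real_normed_vector^'n" shows "norm (\<Sum>i\<in>UNIV. (v $ i) *\<^sub>R g $ i) \<le> norm (v :: real^'n) * norm g"
proof -
  have "norm (\<Sum>i\<in>UNIV. (v $ i) *\<^sub>R g $ i) \<le> (\<Sum>i\<in>UNIV. \<bar>v $ i\<bar> * \<bar>norm (g $ i)\<bar>)"
    by (rule order_trans[OF norm_sum]) (simp add: sum_mono)
  also have "\<dots> \<le> L2_set (\<lambda>i. v $ i) UNIV * L2_set (\<lambda>i. norm (g $ i)) UNIV" by (rule L2_set_mult_ineq)
  also have "\<dots> = norm v * norm g" by (simp add: norm_vec_def L2_set_def)
  finally show ?thesis .
qed

text \<open>The fundamental theorem along the segment, then Cauchy-Schwarz and
  \<open>(p + q)^2 \<le> 2 * p^2 + 2 * q^2\<close>. The interval is half-open because the endpoint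
  of the segment will be on the boundary, outside the collar.\<close>

lemma Ck1_difference_bound:
  fixes U :: "real^'n \<Rightarrow> complex" assumes U: "Ck 1 U" and e: "norm e = 1" and t: "0 \<le> t" "t \<le> T"
  shows "ennreal ((norm (U y))^2) \<le> 2 * ennreal ((norm (U (y + t *\<^sub>R e)))^2) +
     2 * ennreal T * (\<integral>\<^sup>+s. indicator {0..<t} s * ennreal ((norm (grad U (y + s *\<^sub>R e)))^2) \<partial>lborel)"
proof -
  let ?g = "\<lambda>s. norm (grad U (y + s *\<^sub>R e))"
  have line: "continuous_on S (\<lambda>s. y + s *\<^sub>R e)" for S by (intro continuous_intros)
  have cg: "continuous_on S ?g" for S
    by (intro continuous_on_norm continuous_on_compose2[OF Ck1_continuous_grad[OF U] line]) auto
  have [measurable]: "?g \<in> borel_measurable borel" using cg by (rule borel_measurable_continuous_onI)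
  have "((\<lambda>s. U (y + s *\<^sub>R e)) has_vector_derivative (\<Sum>i\<in>UNIV. (e $ i) *\<^sub>R grad U (y + s *\<^sub>R e) $ i)) (at s)" for s
    unfolding has_vector_derivative_def
    by (rule has_derivative_eq_rhs, rule has_derivative_compose[OF _ Ck1_has_derivative[OF U]])
       (auto intro!: derivative_eq_intros simp: scaleR_sum_right)
  then have int: "((\<lambda>s. \<Sum>i\<in>UNIV. (e $ i) *\<^sub>R grad U (y + s *\<^sub>R e) $ i) has_integral (U (y + t *\<^sub>R e) - U (y + 0 *\<^sub>R e))) {0..t}"
    using t(1) by (intro fundamental_theorem_of_calculus) (auto intro: has_vector_derivative_at_within)
  moreover have gint: "(?g has_integral integral {0..t} ?g) {0..t}"
    by (intro integrable_integral integrable_continuous_interval cg)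
  ultimately have "norm (integral {0..t} (\<lambda>s. \<Sum>i\<in>UNIV. (e $ i) *\<^sub>R grad U (y + s *\<^sub>R e) $ i)) \<le> integral {0..t} ?g"
    using norm_sum_scaleR_le[of e] e by (intro integral_norm_bound_integral) (auto simp: has_integral_iff)
  then have J: "norm (U (y + t *\<^sub>R e) - U y) \<le> integral {0..t} ?g" using int by (simp add: has_integral_iff)
  have "0 \<le> integral {0..t} ?g" by (intro integral_nonneg gint[THEN has_integral_integrable]) auto
  \<comment> \<open>The indicator is written twice so that Cauchy-Schwarz against it produces the
    length \<open>t\<close>.\<close>
  have Jeq: "ennreal (integral {0..t} ?g) = (\<integral>\<^sup>+s. indicator {0..<t} s * (indicator {0..<t} s * ennreal (?g s)) \<partial>lborel)"
  proof -
    have "ennreal (integral {0..t} ?g) = (\<integral>\<^sup>+s. ennreal (?g s) * indicator {0..t} s \<partial>lborel)"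
      using gint by (intro nn_integral_has_integral_lebesgue'[symmetric]) auto
    also have "\<dots> = (\<integral>\<^sup>+s. indicator {0..<t} s * (indicator {0..<t} s * ennreal (?g s)) \<partial>lborel)"
      using AE_lborel_singleton[of t] by (intro nn_integral_cong_AE) (auto simp: indicator_def elim!: eventually_mono)
    finally show ?thesis .
  qed
  have "(ennreal (integral {0..t} ?g))^2 \<le> (\<integral>\<^sup>+s. (indicator {0..<t} s)^2 \<partial>lborel) * (\<integral>\<^sup>+s. (indicator {0..<t} s * ennreal (?g s))^2 \<partial>lborel)"
    unfolding Jeq by (intro Cauchy_Schwarz_nn_integral) measurable
  also have "(\<integral>\<^sup>+s. (indicator {0..<t} s)^2 \<partial>lborel) = (\<integral>\<^sup>+s. indicator {0..<t} s \<partial>(lborel :: real measure))"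
    by (intro nn_integral_cong) (auto simp: indicator_def)
  also have "\<dots> = ennreal t" using t by simp
  also have "(\<integral>\<^sup>+s. (indicator {0..<t} s * ennreal (?g s))^2 \<partial>lborel) = (\<integral>\<^sup>+s. indicator {0..<t} s * ennreal ((?g s)^2) \<partial>lborel)"
    by (intro nn_integral_cong) (auto simp: indicator_def ennreal_power)
  also have "ennreal t * \<dots> \<le> ennreal T * \<dots>" using t by (intro mult_right_mono ennreal_leI) auto
  finally have CS: "ennreal ((integral {0..t} ?g)^2) \<le> ennreal T * (\<integral>\<^sup>+s. indicator {0..<t} s * ennreal ((?g s)^2) \<partial>lborel)"
    using \<open>0 \<le> integral {0..t} ?g\<close> by (simp add: ennreal_power)
  have "norm (U y) \<le> norm (U (y + t *\<^sub>R e)) + integral {0..t} ?g"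
    using J norm_triangle_sub[of "U y" "U (y + t *\<^sub>R e)"] by (simp add: norm_minus_commute)
  then have "(norm (U y))^2 \<le> (norm (U (y + t *\<^sub>R e)) + integral {0..t} ?g)^2" by (simp add: power_mono)
  also have "\<dots> \<le> 2 * (norm (U (y + t *\<^sub>R e)))^2 + 2 * (integral {0..t} ?g)^2"
    using sum_squares_bound[of "norm (U (y + t *\<^sub>R e))" "integral {0..t} ?g"] by (simp add: power2_sum)
  finally have "ennreal ((norm (U y))^2) \<le> ennreal (2 * (norm (U (y + t *\<^sub>R e)))^2 + 2 * (integral {0..t} ?g)^2)"
    by (rule ennreal_leI)
  also have "\<dots> = 2 * ennreal ((norm (U (y + t *\<^sub>R e)))^2) + 2 * ennreal ((integral {0..t} ?g)^2)"
    by (subst ennreal_plus) (simp_all add: ennreal_mult)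
  also have "\<dots> \<le> 2 * ennreal ((norm (U (y + t *\<^sub>R e)))^2) + 2 * (ennreal T * (\<integral>\<^sup>+s. indicator {0..<t} s * ennreal ((?g s)^2) \<partial>lborel))"
    by (intro add_left_mono mult_left_mono CS) auto
  finally show ?thesis by (simp add: mult.assoc)
qed

context boundary_graph
begin

text \<open>The bound along vertical segments is integrated over all \<open>y\<close>, and the
  boundary term is estimated by \<open>nn_integral_lift_le\<close>. In the gradient term the order
  of integration is exchanged: by translation invariance each \<open>s\<close> gives the integral
  over the collar, and \<open>s\<close> itself contributes another factor \<open>T\<close>.\<close>

lemma nn_integral_under_graph_le:
  fixes U :: "real^'n \<Rightarrow> complex" assumes T: "0 < T" "T \<le> r/4" and U: "Ck 1 U"
  shows "(\<integral>\<^sup>+y. indicator (under_graph T) y * ennreal ((norm (U y))^2) \<partial>lborel) \<le>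
     2 * ennreal (tube_const * T) * (\<integral>\<^sup>+x. ennreal ((norm (U x))^2) \<partial>surface_measure \<Omega>) +
     2 * ennreal (T^2) * (\<integral>\<^sup>+x. indicator (collar \<Omega> T) x * ennreal ((norm (grad U x))^2) \<partial>lborel)"
proof -
  let ?E = "under_graph T" and ?L = "collar \<Omega> T"
  let ?u = "\<lambda>x. ennreal ((norm (U x))^2)" and ?v = "\<lambda>x. ennreal ((norm (grad U x))^2)"
  have [measurable]: "U \<in> borel_measurable borel" "grad U \<in> borel_measurable borel"
    using Ck1_continuous[OF U] Ck1_continuous_grad[OF U] by (auto intro: borel_measurable_continuous_onI)
  have [measurable]: "?L \<in> sets borel" by (rule collar_borel[OF open_domain])
  have pt: "indicator ?E y * ?u y \<le> 2 * (indicator ?E y * ?u (lift y)) +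
      2 * ennreal T * (\<integral>\<^sup>+s. indicator {0..T} s * (indicator ?L (y + s *\<^sub>R e) * ?v (y + s *\<^sub>R e)) \<partial>lborel)" for y
  proof (cases "y \<in> ?E")
    case True
    define t where "t = H y - y \<bullet> e"
    have t: "0 \<le> t" "t \<le> T" "lift y = y + t *\<^sub>R e" using True by (auto simp: t_def under_graph_def lift_def)
    have "?u y \<le> 2 * ?u (lift y) + 2 * ennreal T * (\<integral>\<^sup>+s. indicator {0..<t} s * ?v (y + s *\<^sub>R e) \<partial>lborel)"
      using Ck1_difference_bound[OF U norm_e t(1,2), of y] t(3) by simp
    also have "(\<integral>\<^sup>+s. indicator {0..<t} s * ?v (y + s *\<^sub>R e) \<partial>lborel) \<le>
        (\<integral>\<^sup>+s. indicator {0..T} s * (indicator ?L (y + s *\<^sub>R e) * ?v (y + s *\<^sub>R e)) \<partial>lborel)"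
    proof (rule nn_integral_mono)
      fix s
      show "indicator {0..<t} s * ?v (y + s *\<^sub>R e) \<le> indicator {0..T} s * (indicator ?L (y + s *\<^sub>R e) * ?v (y + s *\<^sub>R e))"
      proof (cases "s \<in> {0..<t}")
        case s: True
        then have "y + s *\<^sub>R e \<in> ?L"
          using segment_under_graph(2,4)[OF True T(2), of s] by (auto simp: t_def collar_def)
        then show ?thesis using s t by simp
      qed simp
    qed
    finally show ?thesis using True by (simp add: mult_left_mono add_left_mono)
  qed simp
  have "(\<integral>\<^sup>+y. indicator ?E y * ?u y \<partial>lborel) \<le> (\<integral>\<^sup>+y. 2 * (indicator ?E y * ?u (lift y)) +
      2 * ennreal T * (\<integral>\<^sup>+s. indicator {0..T} s * (indicator ?L (y + s *\<^sub>R e) * ?v (y + s *\<^sub>R e)) \<partial>lborel) \<partial>lborel)"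
    by (intro nn_integral_mono pt)
  also have "\<dots> = 2 * (\<integral>\<^sup>+y. indicator ?E y * ?u (lift y) \<partial>lborel) +
      2 * ennreal T * (\<integral>\<^sup>+y. (\<integral>\<^sup>+s. indicator {0..T} s * (indicator ?L (y + s *\<^sub>R e) * ?v (y + s *\<^sub>R e)) \<partial>lborel) \<partial>lborel)"
    by (subst nn_integral_add, measurable, subst (1 2) nn_integral_cmult, measurable)
  also have "(\<integral>\<^sup>+y. (\<integral>\<^sup>+s. indicator {0..T} s * (indicator ?L (y + s *\<^sub>R e) * ?v (y + s *\<^sub>R e)) \<partial>lborel) \<partial>lborel)
     = (\<integral>\<^sup>+s. (\<integral>\<^sup>+y. indicator {0..T} s * (indicator ?L (y + s *\<^sub>R e) * ?v (y + s *\<^sub>R e)) \<partial>lborel) \<partial>lborel)"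
    by (rule lborel_pair.Fubini') measurable
  also have "\<dots> = (\<integral>\<^sup>+s. indicator {0..T} s * (\<integral>\<^sup>+y. indicator ?L y * ?v y \<partial>lborel) \<partial>lborel)"
  proof (rule nn_integral_cong)
    fix s :: real
    have "(\<integral>\<^sup>+y. indicator {0..T} s * (indicator ?L (y + s *\<^sub>R e) * ?v (y + s *\<^sub>R e)) \<partial>lborel)
       = indicator {0..T} s * (\<integral>\<^sup>+y. indicator ?L (s *\<^sub>R e + y) * ?v (s *\<^sub>R e + y) \<partial>lborel)"
      by (subst nn_integral_cmult) (auto simp: add.commute)
    also have "(\<integral>\<^sup>+y. indicator ?L (s *\<^sub>R e + y) * ?v (s *\<^sub>R e + y) \<partial>lborel) =
       (\<integral>\<^sup>+y. indicator ?L y * ?v y \<partial>distr lborel borel ((+) (s *\<^sub>R e)))"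
      by (rule nn_integral_distr[symmetric]) measurable
    finally show "(\<integral>\<^sup>+y. indicator {0..T} s * (indicator ?L (y + s *\<^sub>R e) * ?v (y + s *\<^sub>R e)) \<partial>lborel)
       = indicator {0..T} s * (\<integral>\<^sup>+y. indicator ?L y * ?v y \<partial>lborel)" by (simp add: lborel_distr_plus)
  qed
  also have "\<dots> = ennreal T * (\<integral>\<^sup>+y. indicator ?L y * ?v y \<partial>lborel)" using T by (subst nn_integral_multc) auto
  also have "2 * (\<integral>\<^sup>+y. indicator ?E y * ?u (lift y) \<partial>lborel) + 2 * ennreal T * (ennreal T * (\<integral>\<^sup>+y. indicator ?L y * ?v y \<partial>lborel))
     \<le> 2 * (ennreal (tube_const * T) * (\<integral>\<^sup>+x. ?u x \<partial>surface_measure \<Omega>)) + 2 * ennreal T * (ennreal T * (\<integral>\<^sup>+y. indicator ?L y * ?v y \<partial>lborel))"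
    by (intro add_right_mono mult_left_mono nn_integral_lift_le T) auto
  also have "\<dots> = 2 * ennreal (tube_const * T) * (\<integral>\<^sup>+x. ?u x \<partial>surface_measure \<Omega>) + 2 * ennreal (T^2) * (\<integral>\<^sup>+y. indicator ?L y * ?v y \<partial>lborel)"
    using T by (simp add: mult.assoc power2_eq_square ennreal_mult)
  finally show ?thesis .
qed

text \<open>A nearest boundary point \<open>p\<close> lies on the graph; on the way from
  \<open>p\<close> to \<open>y\<close> the height changes by at most \<open>dist y p\<close> and the
  graph function by at most \<open>M * dist y p\<close>.\<close>

lemma collar_subset_under_graph: assumes y: "y \<in> collar \<Omega> s" "y \<in> ball x0 (r/4)" and s: "s \<le> r/4"
  shows "y \<in> under_graph ((1 + M) * s)"
proof -
  have "frontier \<Omega> \<noteq> {}" using base_in_frontier by auto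
  then obtain p where p: "p \<in> frontier \<Omega>" "infdist y (frontier \<Omega>) = dist y p"
    using infdist_attains_inf[of "frontier \<Omega>" y] by auto
  have yp: "dist y p \<le> s" "y \<in> \<Omega>" using p y by (auto simp: collar_def)
  have yr: "y \<in> ball x0 r" using y r_pos by auto
  have pr: "p \<in> ball x0 r" using dist_triangle[of x0 p y] yp y s r_pos by auto
  have "\<bar>H y - H p\<bar> \<le> M * dist y p" by (rule H_lipschitz[OF yr pr])
  moreover have "\<bar>y \<bullet> e - p \<bullet> e\<bar> \<le> dist y p"
    using Cauchy_Schwarz_ineq2[of "y - p" e] norm_e by (simp add: inner_diff_left dist_norm)
  moreover have "p \<bullet> e = H p" using frontier_iff[OF pr] p by simp
  ultimately have "H y - y \<bullet> e \<le> (1 + M) * dist y p" by (simp add: algebra_simps)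
  also have "\<dots> \<le> (1 + M) * s" using yp M_nonneg by (intro mult_left_mono) auto
  finally show ?thesis using y yp in_domain_iff[OF yr] by (simp add: under_graph_def)
qed

lemma local_boundary_layer: "\<exists>C\<ge>0. layer_bound \<Omega> (ball x0 (r/4)) C"
proof -
  \<comment> \<open>The first summand forces \<open>(1 + M) * s \<le> r/4\<close>, the second allows
    the wider collar, the last two are the factors of the two integrals.\<close>
  define C where "C = (1 + M) * (4 / r) + (1 + M) + 2 * tube_const * (1 + M) + 2 * (1 + M)^2"
  have C: "1 + M \<le> C" "(1 + M) * (4 / r) \<le> C" "2 * tube_const * (1 + M) \<le> C" "2 * (1 + M)^2 \<le> C"
    using M_nonneg tube_const_pos r_pos by (simp_all add: C_def)
  have "layer_bound \<Omega> (ball x0 (r/4)) C" unfolding layer_bound_def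
  proof (intro allI impI)
    fix s :: real and U :: "real^'n \<Rightarrow> complex" assume s: "0 < s" "C * s \<le> 1" and U: "Ck 1 U"
    let ?u = "\<lambda>x. ennreal ((norm (U x))^2)" and ?v = "\<lambda>x. ennreal ((norm (grad U x))^2)" and ?T = "(1 + M) * s"
    have "(1 + M) * (4 / r) * s \<le> 1" using mult_right_mono[OF C(2), of s] s by linarith
    then have T: "0 < ?T" "?T \<le> r/4" using s(1) M_nonneg r_pos by (simp, simp add: field_simps)
    moreover have "s \<le> ?T" using s(1) M_nonneg by simp
    ultimately have sr: "s \<le> r/4" by linarith
    have TC: "?T \<le> C * s" using s C by (intro mult_right_mono) auto
    have "(\<integral>\<^sup>+x. indicator (collar \<Omega> s \<inter> ball x0 (r/4)) x * ?u x \<partial>lborel) \<le> (\<integral>\<^sup>+x. indicator (under_graph ?T) x * ?u x \<partial>lborel)"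
      using collar_subset_under_graph[OF _ _ sr] by (intro nn_integral_mono mult_right_mono) (auto simp: indicator_def)
    also have "\<dots> \<le> 2 * ennreal (tube_const * ?T) * (\<integral>\<^sup>+x. ?u x \<partial>surface_measure \<Omega>) +
       2 * ennreal (?T^2) * (\<integral>\<^sup>+x. indicator (collar \<Omega> ?T) x * ?v x \<partial>lborel)"
      by (rule nn_integral_under_graph_le[OF T U])
    also have "\<dots> \<le> ennreal (C * s) * (\<integral>\<^sup>+x. ?u x \<partial>surface_measure \<Omega>) +
       ennreal (C * s^2) * (\<integral>\<^sup>+x. indicator (collar \<Omega> (C * s)) x * ?v x \<partial>lborel)"
    proof (intro add_mono mult_mono order_refl nn_integral_mono)
      have "2 * ennreal (tube_const * ?T) = ennreal (2 * tube_const * (1 + M) * s)"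
        using tube_const_pos M_nonneg s by (simp add: ennreal_mult mult.assoc)
      also have "\<dots> \<le> ennreal (C * s)" using s C by (intro ennreal_leI mult_right_mono) auto
      finally show "2 * ennreal (tube_const * ?T) \<le> ennreal (C * s)" .
      have "2 * ennreal (?T^2) = ennreal (2 * (1 + M)^2 * s^2)" by (simp add: ennreal_mult mult.assoc power_mult_distrib)
      also have "\<dots> \<le> ennreal (C * s^2)" using C by (intro ennreal_leI mult_right_mono) auto
      finally show "2 * ennreal (?T^2) \<le> ennreal (C * s^2)" .
    qed (use TC in \<open>auto simp: indicator_def collar_def\<close>)
    finally show "(\<integral>\<^sup>+x. indicator (collar \<Omega> s \<inter> ball x0 (r/4)) x * ?u x \<partial>lborel) \<le> \<dots>" .
  qed
  then show ?thesis using C(1) M_nonneg by (intro exI[of _ C]) auto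
qed

end

text \<open>The set \<open>S'\<close> has to lie in \<open>S\<close> only within thin collars: this
  is how a bound near the boundary becomes one on \<open>UNIV\<close>.\<close>

lemma layer_bound_mono:
  fixes \<Omega> :: "(real^'n) set" assumes "layer_bound \<Omega> S C" "0 \<le> C" "C \<le> C'"
    and sub: "\<And>e. 0 < e \<Longrightarrow> C' * e \<le> 1 \<Longrightarrow> collar \<Omega> e \<inter> S' \<subseteq> S"
  shows "layer_bound \<Omega> S' C'" unfolding layer_bound_def
proof (intro allI impI)
  fix e :: real and U :: "real^'n \<Rightarrow> complex" assume e: "0 < e" "C' * e \<le> 1" and U: "Ck 1 U"
  let ?u = "\<lambda>x. ennreal ((norm (U x))^2)" and ?v = "\<lambda>x. ennreal ((norm (grad U x))^2)"
  have le: "C * e \<le> C' * e" using assms(3) e by (intro mult_right_mono) auto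
  have "(\<integral>\<^sup>+x. indicator (collar \<Omega> e \<inter> S') x * ?u x \<partial>lborel) \<le> (\<integral>\<^sup>+x. indicator (collar \<Omega> e \<inter> S) x * ?u x \<partial>lborel)"
    using sub[OF e] by (intro nn_integral_mono mult_right_mono) (auto simp: indicator_def)
  also have "\<dots> \<le> ennreal (C * e) * (\<integral>\<^sup>+x. ?u x \<partial>surface_measure \<Omega>)
      + ennreal (C * e^2) * (\<integral>\<^sup>+x. indicator (collar \<Omega> (C * e)) x * ?v x \<partial>lborel)"
    using assms(1) e le U unfolding layer_bound_def by (meson order_trans)
  also have "\<dots> \<le> ennreal (C' * e) * (\<integral>\<^sup>+x. ?u x \<partial>surface_measure \<Omega>)
      + ennreal (C' * e^2) * (\<integral>\<^sup>+x. indicator (collar \<Omega> (C' * e)) x * ?v x \<partial>lborel)"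
    by (intro add_mono mult_mono nn_integral_mono ennreal_leI le mult_right_mono assms) (use le in \<open>auto simp: indicator_def collar_def\<close>)
  finally show "(\<integral>\<^sup>+x. indicator (collar \<Omega> e \<inter> S') x * ?u x \<partial>lborel) \<le> \<dots>" .
qed

lemma layer_bound_Un:
  fixes \<Omega> :: "(real^'n) set"
  assumes S: "layer_bound \<Omega> S C" "0 \<le> C" "open S" and T: "layer_bound \<Omega> T C'" "0 \<le> C'" "open T" and op: "open \<Omega>"
  shows "layer_bound \<Omega> (S \<union> T) (C + C')" unfolding layer_bound_def
proof (intro allI impI)
  fix e :: real and U :: "real^'n \<Rightarrow> complex" assume e: "0 < e" "(C + C') * e \<le> 1" and U: "Ck 1 U"
  let ?u = "\<lambda>x. ennreal ((norm (U x))^2)" and ?v = "\<lambda>x. ennreal ((norm (grad U x))^2)"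
  let ?I = "\<lambda>S. \<integral>\<^sup>+x. indicator (collar \<Omega> e \<inter> S) x * ?u x \<partial>lborel"
  let ?s = "\<integral>\<^sup>+x. ?u x \<partial>surface_measure \<Omega>" and ?g = "\<integral>\<^sup>+x. indicator (collar \<Omega> ((C + C') * e)) x * ?v x \<partial>lborel"
  have [measurable]: "U \<in> borel_measurable borel" using Ck1_continuous[OF U] by (rule borel_measurable_continuous_onI)
  have m: "(\<lambda>x. indicator (collar \<Omega> e \<inter> X) x * ?u x) \<in> borel_measurable lborel" if "open X" for X
  proof -
    have [measurable]: "collar \<Omega> e \<inter> X \<in> sets borel" using collar_borel[OF op] that by auto
    show ?thesis by measurable
  qed
  have bound: "?I X \<le> ennreal (c * e) * ?s + ennreal (c * e^2) * ?g" if "layer_bound \<Omega> X c" "0 \<le> c" "c \<le> C + C'" for X c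
  proof -
    have le: "c * e \<le> (C + C') * e" using that e by (intro mult_right_mono) auto
    then have "?I X \<le> ennreal (c * e) * ?s + ennreal (c * e^2) * (\<integral>\<^sup>+x. indicator (collar \<Omega> (c * e)) x * ?v x \<partial>lborel)"
      using that(1) e U unfolding layer_bound_def by (meson order_trans)
    also have "\<dots> \<le> ennreal (c * e) * ?s + ennreal (c * e^2) * ?g"
      using le by (intro add_left_mono mult_left_mono nn_integral_mono mult_right_mono) (auto simp: indicator_def collar_def)
    finally show ?thesis .
  qed
  have "?I (S \<union> T) \<le> (\<integral>\<^sup>+x. indicator (collar \<Omega> e \<inter> S) x * ?u x + indicator (collar \<Omega> e \<inter> T) x * ?u x \<partial>lborel)"
    by (rule nn_integral_mono) (auto simp: indicator_def)
  also have "\<dots> = ?I S + ?I T" by (rule nn_integral_add[OF m[OF S(3)] m[OF T(3)]])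
  also have "\<dots> \<le> (ennreal (C * e) * ?s + ennreal (C * e^2) * ?g) + (ennreal (C' * e) * ?s + ennreal (C' * e^2) * ?g)"
    using S(1,2) T(1,2) by (intro add_mono bound) auto
  also have "\<dots> = ennreal ((C + C') * e) * ?s + ennreal ((C + C') * e^2) * ?g"
  proof -
    have "ennreal ((C + C') * b) * z = ennreal (C * b) * z + ennreal (C' * b) * z" if "0 \<le> b" for b z
      using that S(2) T(2) by (simp add: distrib_right)
    from this[OF less_imp_le[OF e(1)]] this[OF zero_le_power2] show ?thesis by (simp only: add_ac)
  qed
  finally show "?I (S \<union> T) \<le> \<dots>" .
qed

text \<open>By compactness finitely many local bounds cover the boundary, and the union
  \<open>W\<close> of their balls contains a neighbourhood of it.\<close>

lemma boundary_layer:
  fixes \<Omega> :: "(real^'n) set"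
  assumes dim: "CARD('n) \<ge> 2" and op: "open \<Omega>" and bnd: "bounded \<Omega>" and c11: "C11_boundary \<Omega>"
    and ne: "frontier \<Omega> \<noteq> {}"
  obtains C where "C \<ge> 1" "layer_bound \<Omega> UNIV C"
proof -
  have "\<exists>\<rho> C. 0 < \<rho> \<and> 0 \<le> C \<and> layer_bound \<Omega> (ball x \<rho>) C" if x: "x \<in> frontier \<Omega>" for x
  proof -
    obtain r e H M where bg: "boundary_graph \<Omega> x r e H M" using C11_boundary_graph[OF dim op c11 x] by metis
    from boundary_graph.local_boundary_layer[OF this] boundary_graph.r_pos[OF this] show ?thesis
      by (meson divide_pos_pos zero_less_numeral)
  qed
  then obtain \<rho> C where loc: "\<And>x. x \<in> frontier \<Omega> \<Longrightarrow> 0 < \<rho> x \<and> 0 \<le> C x \<and> layer_bound \<Omega> (ball x (\<rho> x)) (C x)" by metis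
  have comp: "compact (frontier \<Omega>)" using bnd by (rule compact_frontier_bounded)
  have "frontier \<Omega> \<subseteq> (\<Union>x\<in>frontier \<Omega>. ball x (\<rho> x))" using loc by force
  then obtain X where X: "X \<subseteq> frontier \<Omega>" "finite X" "frontier \<Omega> \<subseteq> (\<Union>x\<in>X. ball x (\<rho> x))"
    by (rule compactE_image[OF comp, rotated]) auto
  define W where "W = (\<Union>x\<in>X. ball x (\<rho> x))"
  have "\<exists>c\<ge>0. layer_bound \<Omega> (\<Union>x\<in>Y. ball x (\<rho> x)) c" if "finite Y" "Y \<subseteq> frontier \<Omega>" for Y using that
  proof (induction Y)
    case empty
    show ?case by (rule exI[of _ 0]) (simp add: layer_bound_def)
  next
    case (insert y Y)
    then obtain c where c: "c \<ge> 0" "layer_bound \<Omega> (\<Union>x\<in>Y. ball x (\<rho> x)) c" by auto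
    then have "layer_bound \<Omega> (ball y (\<rho> y) \<union> (\<Union>x\<in>Y. ball x (\<rho> x))) (C y + c)"
      using loc[of y] insert.prems by (intro layer_bound_Un op) auto
    then show ?case using c(1) loc[of y] insert.prems by (intro exI[of _ "C y + c"]) auto
  qed
  from this[OF X(2,1)] obtain c where c: "c \<ge> 0" "layer_bound \<Omega> W c" by (auto simp: W_def)
  obtain d where d: "d > 0" "(\<Union>x\<in>frontier \<Omega>. cball x d) \<subseteq> W"
    by (rule compact_subset_open_imp_cball_epsilon_subset[OF comp _ X(3)[folded W_def]]) (auto simp: W_def)
  show thesis
  \<comment> \<open>The summand \<open>1 / d\<close> forces \<open>s \<le> d\<close>, so that the
    collar lies in \<open>W\<close>; the summand 1 makes the constant at least 1.\<close>
  proof (rule that[of "c + 1 + 1 / d"])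
    show "layer_bound \<Omega> UNIV (c + 1 + 1 / d)"
    proof (rule layer_bound_mono[OF c(2,1)])
      fix s :: real assume s: "0 < s" "(c + 1 + 1 / d) * s \<le> 1"
      have "1 / d * s \<le> (c + 1 + 1 / d) * s" using s c(1) by (intro mult_right_mono) auto
      then have "s \<le> d" using s d(1) by (simp add: field_simps)
      show "collar \<Omega> s \<inter> UNIV \<subseteq> W"
      proof
        fix y assume "y \<in> collar \<Omega> s \<inter> UNIV"
        moreover obtain p where "p \<in> frontier \<Omega>" "infdist y (frontier \<Omega>) = dist y p"
          using infdist_attains_inf[of "frontier \<Omega>" y] ne by auto
        ultimately have "y \<in> (\<Union>x\<in>frontier \<Omega>. cball x d)"
          using \<open>s \<le> d\<close> by (intro UN_I[of p]) (auto simp: collar_def dist_commute)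
        then show "y \<in> W" using d(2) by blast
      qed
    qed (use d(1) in simp)
  qed (use c(1) d(1) in simp)
qed

section \<open>Mollification and test functions\<close>

subsection \<open>Differentiation of weighted averages of translates\<close>

lemma grad_eqI: assumes "(f has_derivative D) (at x)"
  shows "grad f x $ i = D (axis i 1)" using frechet_derivative_at[OF assms] by (simp add: grad_def)

lemma Ck_SucI: assumes "\<And>x. (f has_derivative D x) (at x)" "\<And>i. Ck k (\<lambda>x. D x (axis i 1))"
  shows "Ck (Suc k) f"
proof -
  have "(\<lambda>x. grad f x $ i) = (\<lambda>x. D x (axis i 1))" for i using grad_eqI[OF assms(1)] by blast
  moreover have "f differentiable_on UNIV" using assms(1) by (auto simp: differentiable_on_def differentiable_def)
  ultimately show ?thesis using assms(2) by simp
qed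

lemma Ck_Suc_imp_Ck: "Ck (Suc k) f \<Longrightarrow> Ck k f"
proof (induction k arbitrary: f)
  case 0 then show ?case using Ck1_continuous by simp
next
  case (Suc k) then show ?case by simp
qed

lemma Ck_Suc_imp_Ck1: "Ck (Suc k) f \<Longrightarrow> Ck 1 f" by (induction k arbitrary: f) (use Ck_Suc_imp_Ck in fastforce)+

lemma Ck_imp_continuous: "Ck k f \<Longrightarrow> continuous_on UNIV f"
  using Ck_Suc_imp_Ck1 Ck1_continuous by (metis Ck.simps(1) not0_implies_Suc)

lemma Ck_add: "Ck k f \<Longrightarrow> Ck k g \<Longrightarrow> Ck k (\<lambda>x. f x + g x)"
  and Ck_bounded_linear: "bounded_linear l \<Longrightarrow> Ck k f \<Longrightarrow> Ck k (\<lambda>x. l (f x))"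
proof -
  show "Ck k f \<Longrightarrow> Ck k g \<Longrightarrow> Ck k (\<lambda>x. f x + g x)"
  proof (induction k arbitrary: f g)
    case (Suc k)
    have "Ck 1 f" "Ck 1 g" using Suc.prems Ck_Suc_imp_Ck1 by blast+
    note D = has_derivative_add[OF this[THEN Ck1_has_derivative]]
    show ?case using Suc by (intro Ck_SucI[OF D]) (simp add: axis_def if_distrib if_distribR cong: if_cong)
  qed (simp add: continuous_on_add)
  show "bounded_linear l \<Longrightarrow> Ck k f \<Longrightarrow> Ck k (\<lambda>x. l (f x))"
  proof (induction k arbitrary: f)
    case 0
    then show ?case by (simp add: bounded_linear.continuous_on)
  next
    case (Suc k)
    have "Ck 1 f" using Suc.prems Ck_Suc_imp_Ck1 by blast
    note D = bounded_linear.has_derivative[OF Suc.prems(1) Ck1_has_derivative[OF this]]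
    show ?case using Suc by (intro Ck_SucI[OF D]) (simp add: axis_def if_distrib if_distribR cong: if_cong)
  qed
qed

lemma Ck_cmult_scaled:
  "Ck k f \<Longrightarrow> Ck k (\<lambda>x. c *\<^sub>R f (d *\<^sub>R x))"
proof (induction k arbitrary: f c)
  case 0
  then have f: "continuous_on UNIV f" by simp
  have "continuous_on UNIV (\<lambda>x :: real^'a. d *\<^sub>R x)" by (intro continuous_intros)
  from continuous_on_compose2[OF f this] show ?case by (simp add: continuous_on_scaleR)
next
  case (Suc k)
  have f: "Ck 1 f" using Suc.prems Ck_Suc_imp_Ck1 by blast
  have D: "((\<lambda>x. c *\<^sub>R f (d *\<^sub>R x)) has_derivative (\<lambda>h. c *\<^sub>R (\<Sum>i\<in>UNIV. ((d *\<^sub>R h) $ i) *\<^sub>R grad f (d *\<^sub>R x) $ i))) (at x)" for x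
    by (rule has_derivative_scaleR_right[OF has_derivative_compose[OF
          bounded_linear_imp_has_derivative[OF bounded_linear_scaleR_right] Ck1_has_derivative[OF f]]])
  have "c *\<^sub>R (\<Sum>j\<in>UNIV. ((d *\<^sub>R axis i 1) $ j) *\<^sub>R grad f (d *\<^sub>R x) $ j) = (c * d) *\<^sub>R grad f (d *\<^sub>R x) $ i" for i x
    by (simp add: axis_def if_distrib if_distribR cong: if_cong)
  moreover have "Ck k (\<lambda>x. (c * d) *\<^sub>R grad f (d *\<^sub>R x) $ i)" for i
    using Suc.IH[of "\<lambda>x. grad f x $ i" "c * d"] Suc.prems by simp
  ultimately show ?case by (intro Ck_SucI[OF D]) simp
qed

lemma grad_scaled: assumes f: "Ck 1 f"
  shows "grad (\<lambda>x. c *\<^sub>R f (d *\<^sub>R x)) x $ i = (c * d) *\<^sub>R grad f (d *\<^sub>R x) $ i"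
proof -
  have D: "((\<lambda>x. c *\<^sub>R f (d *\<^sub>R x)) has_derivative (\<lambda>h. c *\<^sub>R (\<Sum>i\<in>UNIV. ((d *\<^sub>R h) $ i) *\<^sub>R grad f (d *\<^sub>R x) $ i))) (at x)" for x
    by (rule has_derivative_scaleR_right[OF has_derivative_compose[OF
          bounded_linear_imp_has_derivative[OF bounded_linear_scaleR_right] Ck1_has_derivative[OF f]]])
  show ?thesis unfolding grad_eqI[OF D] by (simp add: axis_def if_distrib if_distribR cong: if_cong)
qed

text \<open>Together with continuity this yields boundedness, uniform continuity and integrability
  on the whole space, as used for differentiation under the integral.\<close>

definition bounded_support :: "('a::real_normed_vector \<Rightarrow> 'b::zero) \<Rightarrow> bool" where
  "bounded_support f \<longleftrightarrow> (\<exists>R. \<forall>x. R < norm x \<longrightarrow> f x = 0)"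

lemma bounded_support_iff: "bounded_support f \<longleftrightarrow> bounded {x. f x \<noteq> 0}"
  unfolding bounded_support_def bounded_iff by (auto simp: not_less[symmetric])

lemma grad_eq_0: assumes "open S" "x \<in> S" "\<And>y. y \<in> S \<Longrightarrow> f y = 0"
  shows "grad f x = 0"
proof -
  have "((\<lambda>_. 0) has_derivative (\<lambda>_. 0)) (at x)" by simp
  then have "(f has_derivative (\<lambda>_. 0)) (at x)"
    by (rule has_derivative_transform_within_open[OF _ assms(1,2)]) (simp add: assms(3))
  then show ?thesis by (simp add: vec_eq_iff grad_eqI)
qed

lemma bounded_support_grad:
  fixes f :: "real^'n \<Rightarrow> 'b::real_normed_vector" assumes "bounded_support f" shows "bounded_support (grad f)"
proof -
  obtain R where R: "\<And>x. R < norm x \<Longrightarrow> f x = 0" using assms by (auto simp: bounded_support_def)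
  have "open {x :: real^'n. R < norm x}" by (intro open_Collect_less continuous_intros)
  then have "grad f x = 0" if "R < norm x" for x using grad_eq_0[of _ x f] R that by blast
  then show ?thesis by (auto simp: bounded_support_def)
qed

lemma bounded_support_grad_component:
  "bounded_support f \<Longrightarrow> bounded_support (\<lambda>x. grad f x $ i)"
  using bounded_support_grad[of f] by (auto simp: bounded_support_def) (metis zero_index)

lemma uniformly_continuous_bounded_support:
  fixes f :: "'a::euclidean_space \<Rightarrow> 'b::real_normed_vector"
  assumes c: "continuous_on UNIV f" and s: "bounded_support f" shows "uniformly_continuous_on UNIV f"
  unfolding uniformly_continuous_on_def
proof (intro allI impI)
  fix e :: real assume e: "0 < e"
  obtain R where R: "\<And>x. R < norm x \<Longrightarrow> f x = 0" using s by (auto simp: bounded_support_def)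
  \<comment> \<open>The margin 1: two points at distance less than 1 lie both in this ball or both
    in the region where \<open>f\<close> vanishes.\<close>
  have "uniformly_continuous_on (cball 0 (R + 1)) f"
    by (rule compact_uniformly_continuous) (use c continuous_on_subset in auto)
  then obtain d where d: "d > 0"
    "\<And>x x'. x \<in> cball 0 (R+1) \<Longrightarrow> x' \<in> cball 0 (R+1) \<Longrightarrow> dist x' x < d \<Longrightarrow> dist (f x') (f x) < e"
    using e unfolding uniformly_continuous_on_def by metis
  have "dist (f x') (f x) < e" if "dist x' x < min d 1" for x x'
  proof (cases "norm x \<le> R + 1 \<and> norm x' \<le> R + 1")
    case True then show ?thesis using d that by simp
  next
    case False
    have "\<bar>norm x' - norm x\<bar> < 1" using that norm_triangle_ineq3[of x' x] by (simp add: dist_norm)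
    then have "R < norm x" "R < norm x'" using False by auto
    then show ?thesis using R e by simp
  qed
  then show "\<exists>d>0. \<forall>x\<in>UNIV. \<forall>x'\<in>UNIV. dist x' x < d \<longrightarrow> dist (f x') (f x) < e"
    using d(1) by (intro exI[of _ "min d 1"]) auto
qed

lemma bounded_bounded_support:
  fixes f :: "'a::euclidean_space \<Rightarrow> 'b::real_normed_vector"
  assumes c: "continuous_on UNIV f" and s: "bounded_support f" obtains B where "B \<ge> 0" "\<And>x. norm (f x) \<le> B"
proof -
  obtain R where R: "\<And>x. R < norm x \<Longrightarrow> f x = 0" using s by (auto simp: bounded_support_def)
  have "compact (f ` cball 0 R)" by (rule compact_continuous_image) (use c continuous_on_subset in auto)
  then obtain B where B: "\<And>x. norm x \<le> R \<Longrightarrow> norm (f x) \<le> B"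
    by (meson bounded_iff compact_imp_bounded image_eqI mem_cball_0)
  have "norm (f x) \<le> max B 0" for x using B[of x] R[of x] by (cases "norm x \<le> R") auto
  then show thesis by (intro that[of "max B 0"]) auto
qed

text \<open>The gradient is uniformly continuous, and the mean value inequality is applied to
  \<open>f\<close> minus its linear part at \<open>x\<close>. Uniformity in \<open>x\<close> is what
  permits differentiation under the integral below.\<close>

lemma uniform_derivative:
  fixes f :: "real^'n \<Rightarrow> 'b::real_normed_vector" assumes f: "Ck 1 f" and s: "bounded_support f" and e: "0 < e"
  obtains d where "d > 0"
    "\<And>x h. norm h < d \<Longrightarrow> norm (f (x + h) - f x - (\<Sum>i\<in>UNIV. (h $ i) *\<^sub>R grad f x $ i)) \<le> e * norm h"
proof -
  obtain d where d: "d > 0" "\<And>x x'. dist x' x < d \<Longrightarrow> dist (grad f x') (grad f x) < e"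
    using uniformly_continuous_bounded_support[OF Ck1_continuous_grad[OF f] bounded_support_grad[OF s]] e
    unfolding uniformly_continuous_on_def by (metis UNIV_I)
  show thesis
  proof (rule that[OF d(1)])
    fix x h :: "real^'n" assume h: "norm h < d"
    let ?l = "\<lambda>z. \<Sum>i\<in>UNIV. (z $ i) *\<^sub>R grad f x $ i"
    let ?k = "\<lambda>z. f z - ?l z"
    have lin: "?l (u + v) = ?l u + ?l v" for u v by (simp add: scaleR_add_left sum.distrib)
    have bl: "bounded_linear ?l" by (intro bounded_linear_sum bounded_linear_scaleR_const bounded_linear_vec_nth)
    have "norm (?k (x + h) - ?k x) \<le> e * norm ((x + h) - x)"
    proof (rule differentiable_bound[of "ball x d" ?k "\<lambda>z v. \<Sum>i\<in>UNIV. (v $ i) *\<^sub>R (grad f z - grad f x) $ i"])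
      fix z assume z: "z \<in> ball x d"
      have "(?k has_derivative (\<lambda>v. (\<Sum>i\<in>UNIV. (v $ i) *\<^sub>R grad f z $ i) - ?l v)) (at z)"
        by (rule has_derivative_diff[OF Ck1_has_derivative[OF f] bounded_linear_imp_has_derivative[OF bl]])
      then show "(?k has_derivative (\<lambda>v. \<Sum>i\<in>UNIV. (v $ i) *\<^sub>R (grad f z - grad f x) $ i)) (at z within ball x d)"
        by (rule has_derivative_at_withinI[THEN has_derivative_eq_rhs]) (simp add: scaleR_diff_right sum_subtractf)
      show "onorm (\<lambda>v. \<Sum>i\<in>UNIV. (v $ i) *\<^sub>R (grad f z - grad f x) $ i) \<le> e"
      proof (rule onorm_le)
        fix v
        have "norm (\<Sum>i\<in>UNIV. (v $ i) *\<^sub>R (grad f z - grad f x) $ i) \<le> norm v * norm (grad f z - grad f x)"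
          by (rule norm_sum_scaleR_le)
        also have "\<dots> \<le> norm v * e"
          using d(2)[of z x] z by (intro mult_left_mono) (auto simp: dist_norm dist_commute norm_minus_commute)
        finally show "norm (\<Sum>i\<in>UNIV. (v $ i) *\<^sub>R (grad f z - grad f x) $ i) \<le> e * norm v" by (simp add: mult.commute)
      qed
    qed (use h d in \<open>auto simp: dist_norm\<close>)
    moreover have "a - (u + v) - (b - u) = a - b - v" for a b u v :: 'b by simp
    then have "?k (x + h) - ?k x = f (x + h) - f x - ?l h" unfolding lin by blast
    moreover have "norm ((x + h) - x) = norm h" by simp
    ultimately show "norm (f (x + h) - f x - ?l h) \<le> e * norm h" by metis
  qed
qed

lemma norm_integral_le:
  fixes f :: "'a \<Rightarrow> 'b::{banach, second_countable_topology}"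
  assumes "integrable M f" "integrable M g" "\<And>x. norm (f x) \<le> g x" shows "norm (\<integral>x. f x \<partial>M) \<le> (\<integral>x. g x \<partial>M)"
proof -
  have "norm (\<integral>x. f x \<partial>M) \<le> (\<integral>x. norm (f x) \<partial>M)" by (rule integral_norm_bound)
  also have "\<dots> \<le> (\<integral>x. g x \<partial>M)" by (rule integral_mono) (use assms in auto)
  finally show ?thesis .
qed

context
  fixes prod :: "'b::{banach, second_countable_topology} \<Rightarrow> 'c::{banach, second_countable_topology} \<Rightarrow> 'd::{banach, second_countable_topology}"
    and g :: "'a \<Rightarrow> 'b" and k :: "'a \<Rightarrow> real^'n" and M :: "'a measure"
  assumes p: "bounded_bilinear prod" and g: "integrable M g" and k: "k \<in> borel_measurable M"
begin

lemma integrable_weighted_translate: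
  fixes f :: "real^'n \<Rightarrow> 'c" assumes c: "continuous_on UNIV f" and s: "bounded_support f"
  shows "integrable M (\<lambda>y. prod (g y) (f (x + k y)))"
proof -
  interpret bounded_bilinear prod by (rule p)
  obtain K where K: "K > 0" "\<And>a b. norm (prod a b) \<le> norm a * norm b * K" using pos_bounded by blast
  obtain B where B: "B \<ge> 0" "\<And>x. norm (f x) \<le> B" using bounded_bounded_support[OF c s] by metis
  have [measurable]: "f \<in> borel_measurable borel" "g \<in> borel_measurable M" "k \<in> borel_measurable M"
    using c g k by (auto intro: borel_measurable_continuous_onI)
  show ?thesis
  proof (rule Bochner_Integration.integrable_bound[of M "\<lambda>y. (B * K) * norm (g y)"])
    show "(\<lambda>y. prod (g y) (f (x + k y))) \<in> borel_measurable M"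
      by (rule borel_measurable_continuous_Pair) (auto intro!: continuous_on continuous_intros)
    have "norm (prod (g y) (f (x + k y))) \<le> norm (B * K * norm (g y))" for y
    proof -
      have "norm (prod (g y) (f (x + k y))) \<le> norm (g y) * norm (f (x + k y)) * K" by (rule K(2))
      also have "\<dots> \<le> norm (g y) * B * K" using K B by (intro mult_right_mono mult_left_mono) auto
      finally show ?thesis using K B by (simp add: ac_simps)
    qed
    then show "AE y in M. norm (prod (g y) (f (x + k y))) \<le> norm (B * K * norm (g y))" by simp
  qed (use g in auto)
qed

lemma weighted_average_bound:
  obtains C where "C > 0" "\<And>u e. integrable M (\<lambda>y. prod (g y) (u y)) \<Longrightarrow> (\<And>y. norm (u y) \<le> e) \<Longrightarrow>
    norm (\<integral>y. prod (g y) (u y) \<partial>M) \<le> C * e"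
proof -
  interpret bounded_bilinear prod by (rule p)
  obtain K where K: "K > 0" "\<And>a b. norm (prod a b) \<le> norm a * norm b * K" using pos_bounded by blast
  show thesis
  \<comment> \<open>The summand 1 keeps the constant positive, as it becomes a divisor
    later.\<close>
  proof (rule that[of "(\<integral>y. norm (g y) \<partial>M) * K + 1"])
    fix u e assume int: "integrable M (\<lambda>y. prod (g y) (u y))" and u: "\<And>y. norm (u y) \<le> e"
    have "norm (\<integral>y. prod (g y) (u y) \<partial>M) \<le> (\<integral>y. norm (g y) * (e * K) \<partial>M)"
    proof (rule norm_integral_le[OF int])
      show "norm (prod (g y) (u y)) \<le> norm (g y) * (e * K)" for y
        using order_trans[OF K(2)[of "g y" "u y"] mult_right_mono[OF mult_left_mono[OF u[of y] norm_ge_zero[of "g y"]], of K]] K(1)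
        by (simp add: ac_simps)
    qed (use g in auto)
    moreover have "0 \<le> e" using order_trans[OF norm_ge_zero u] .
    ultimately show "norm (\<integral>y. prod (g y) (u y) \<partial>M) \<le> ((\<integral>y. norm (g y) \<partial>M) * K + 1) * e" by (simp add: algebra_simps)
  qed (use K in \<open>simp add: add_nonneg_pos\<close>)
qed

lemma continuous_weighted_translate:
  fixes f :: "real^'n \<Rightarrow> 'c" assumes c: "continuous_on UNIV f" and s: "bounded_support f"
  shows "continuous_on UNIV (\<lambda>x. \<integral>y. prod (g y) (f (x + k y)) \<partial>M)"
proof -
  interpret bounded_bilinear prod by (rule p)
  obtain C where C: "C > 0" "\<And>u e. integrable M (\<lambda>y. prod (g y) (u y)) \<Longrightarrow> (\<And>y. norm (u y) \<le> e) \<Longrightarrow>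
    norm (\<integral>y. prod (g y) (u y) \<partial>M) \<le> C * e" using weighted_average_bound by metis
  note int = integrable_weighted_translate[OF assms]
  show ?thesis unfolding continuous_on_iff dist_norm
  proof (intro ballI allI impI)
    fix x :: "real^'n" and e :: real assume e: "0 < e"
    then obtain d where d: "d > 0" "\<And>x x'. dist x' x < d \<Longrightarrow> dist (f x') (f x) < e / (2 * C)"
      using uniformly_continuous_bounded_support[OF c s] C(1)
      unfolding uniformly_continuous_on_def by (metis UNIV_I divide_pos_pos mult_pos_pos zero_less_numeral)
    have "norm ((\<integral>y. prod (g y) (f (x' + k y)) \<partial>M) - (\<integral>y. prod (g y) (f (x + k y)) \<partial>M)) < e" if "norm (x' - x) < d" for x'
    proof -
      have "norm (\<integral>y. prod (g y) (f (x' + k y) - f (x + k y)) \<partial>M) \<le> C * (e / (2 * C))"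
      proof (rule C(2))
        show "integrable M (\<lambda>y. prod (g y) (f (x' + k y) - f (x + k y)))"
          unfolding diff_right by (intro Bochner_Integration.integrable_diff int)
        show "norm (f (x' + k y) - f (x + k y)) \<le> e / (2 * C)" for y
          using d(2)[of "x' + k y" "x + k y"] that by (simp add: dist_norm)
      qed
      then show ?thesis using C(1) e by (simp add: diff_right int)
    qed
    then show "\<exists>d>0. \<forall>x'\<in>UNIV. norm (x' - x) < d \<longrightarrow>
        norm ((\<integral>y. prod (g y) (f (x' + k y)) \<partial>M) - (\<integral>y. prod (g y) (f (x + k y)) \<partial>M)) < e" using d(1) by blast
  qed
qed

text \<open>The remainder of \<open>f\<close> is small uniformly in \<open>y\<close>, so
  integrability of the weight \<open>g\<close> suffices to pull the derivative inside. The data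
  \<open>prod\<close>, \<open>g\<close> and \<open>k\<close> are general in order to cover
  convolutions, where \<open>k\<close> is \<open>uminus\<close>, and integrals along rays, where
  \<open>k\<close> is a multiple of the direction.\<close>

lemma has_derivative_weighted_translate:
  fixes f :: "real^'n \<Rightarrow> 'c" assumes f: "Ck 1 f" and s: "bounded_support f"
  shows "((\<lambda>x. \<integral>y. prod (g y) (f (x + k y)) \<partial>M) has_derivative
     (\<lambda>h. \<Sum>i\<in>UNIV. (h $ i) *\<^sub>R (\<integral>y. prod (g y) (grad f (x + k y) $ i) \<partial>M))) (at x)"
    (is "(?F has_derivative ?D) (at x)")
proof -
  interpret bounded_bilinear prod by (rule p)
  obtain C where C: "C > 0" "\<And>u e. integrable M (\<lambda>y. prod (g y) (u y)) \<Longrightarrow> (\<And>y. norm (u y) \<le> e) \<Longrightarrow>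
    norm (\<integral>y. prod (g y) (u y) \<partial>M) \<le> C * e" using weighted_average_bound by metis
  have int0: "integrable M (\<lambda>y. prod (g y) (f (x + k y)))" for x
    by (rule integrable_weighted_translate[OF Ck1_continuous[OF f] s])
  have int1: "integrable M (\<lambda>y. prod (g y) (grad f (x + k y) $ i))" for x i
    using f bounded_support_grad_component[OF s] by (intro integrable_weighted_translate) auto
  show ?thesis unfolding has_derivative_at_alt
  proof (intro conjI allI impI)
    show "bounded_linear ?D" by (intro bounded_linear_sum bounded_linear_scaleR_const bounded_linear_vec_nth)
    fix e :: real assume "0 < e"
    then obtain d where d: "d > 0"
      "\<And>x h. norm h < d \<Longrightarrow> norm (f (x + h) - f x - (\<Sum>i\<in>UNIV. (h $ i) *\<^sub>R grad f x $ i)) \<le> e / C * norm h"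
      using uniform_derivative[OF f s divide_pos_pos[OF _ C(1)]] by metis
    have "norm (?F z - ?F x - ?D (z - x)) \<le> e * norm (z - x)" if z: "norm (z - x) < d" for z
    proof -
      let ?R = "\<lambda>y. f (z + k y) - f (x + k y) - (\<Sum>i\<in>UNIV. ((z - x) $ i) *\<^sub>R grad f (x + k y) $ i)"
      have R: "prod (g y) (?R y) = prod (g y) (f (z + k y)) - prod (g y) (f (x + k y)) -
          (\<Sum>i\<in>UNIV. ((z - x) $ i) *\<^sub>R prod (g y) (grad f (x + k y) $ i))" for y
        by (simp add: diff_right sum_right scaleR_right)
      have "norm (\<integral>y. prod (g y) (?R y) \<partial>M) \<le> C * (e / C * norm (z - x))"
      proof (rule C(2))
        show "integrable M (\<lambda>y. prod (g y) (?R y))" unfolding R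
          by (intro Bochner_Integration.integrable_diff int0 Bochner_Integration.integrable_sum integrable_scaleR_right int1)
        show "norm (?R y) \<le> e / C * norm (z - x)" for y using d(2)[OF z, of "x + k y"] by (simp add: add.commute add.left_commute)
      qed
      then show ?thesis unfolding R using C(1) by (simp add: int0 int1 Bochner_Integration.integrable_sum)
    qed
    then show "\<exists>d>0. \<forall>z. norm (z - x) < d \<longrightarrow> norm (?F z - ?F x - ?D (z - x)) \<le> e * norm (z - x)" using d(1) by blast
  qed
qed

lemma grad_weighted_translate:
  fixes f :: "real^'n \<Rightarrow> 'c" assumes f: "Ck 1 f" and s: "bounded_support f"
  shows "grad (\<lambda>x. \<integral>y. prod (g y) (f (x + k y)) \<partial>M) x $ i = (\<integral>y. prod (g y) (grad f (x + k y) $ i) \<partial>M)"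
  unfolding grad_eqI[OF has_derivative_weighted_translate[OF assms]]
  by (simp add: axis_def if_distrib if_distribR cong: if_cong)

lemma Ck_weighted_translate:
  fixes f :: "real^'n \<Rightarrow> 'c" shows "Ck m f \<Longrightarrow> bounded_support f \<Longrightarrow> Ck m (\<lambda>x. \<integral>y. prod (g y) (f (x + k y)) \<partial>M)"
proof (induction m arbitrary: f)
  case 0
  then show ?case by (simp add: continuous_weighted_translate)
next
  case (Suc m)
  have f: "Ck 1 f" using Suc.prems Ck_Suc_imp_Ck1 by blast
  have "Ck m (\<lambda>x. \<integral>y. prod (g y) (grad f (x + k y) $ i) \<partial>M)" for i
    using Suc by (intro Suc.IH bounded_support_grad_component) auto
  then show ?case by (intro Ck_SucI[OF has_derivative_weighted_translate[OF f Suc.prems(2)]])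
       (simp add: axis_def if_distrib if_distribR cong: if_cong)
qed

end

lemma lborel_integral_affine:
  fixes f :: "'a::euclidean_space \<Rightarrow> 'b::{banach, second_countable_topology}"
  assumes c: "c \<noteq> 0" and f: "f \<in> borel_measurable borel"
  shows "(\<integral>x. f x \<partial>lborel) = \<bar>c\<bar> ^ DIM('a) *\<^sub>R (\<integral>x. f (t + c *\<^sub>R x) \<partial>lborel)"
proof -
  have "(\<integral>x. f x \<partial>lborel) = (\<integral>x. f x \<partial>density (distr lborel borel (\<lambda>x. t + c *\<^sub>R x)) (\<lambda>_. \<bar>c\<bar>^DIM('a)))"
    using lborel_affine[OF c, of t] by simp
  also have "\<dots> = (\<integral>x. \<bar>c\<bar>^DIM('a) *\<^sub>R f x \<partial>distr lborel borel (\<lambda>x. t + c *\<^sub>R x))"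
    using f by (intro integral_density) auto
  also have "\<dots> = (\<integral>x. \<bar>c\<bar>^DIM('a) *\<^sub>R f (t + c *\<^sub>R x) \<partial>lborel)" using f by (intro integral_distr) auto
  finally show ?thesis by simp
qed

subsection \<open>Mollifiers\<close>

text \<open>The convolution in \<open>mollified\<close> with width and type of values left open: it
  also smooths indicators and test functions.\<close>

definition conv :: "(real^'n \<Rightarrow> real) \<Rightarrow> real \<Rightarrow> (real^'n \<Rightarrow> 'b::{banach, second_countable_topology}) \<Rightarrow> real^'n \<Rightarrow> 'b" where
  "conv \<rho> d f x = (\<integral>y. mollifier \<rho> d (x - y) *\<^sub>R f y \<partial>lborel)"

lemma mollified_eq_conv: "mollified \<rho> At t = conv \<rho> (t powr (- 1 / 3)) At"
  by (simp add: fun_eq_iff mollified_def conv_def)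

lemma integrable_bounded_support:
  fixes f :: "real^'n \<Rightarrow> 'b::{banach, second_countable_topology}" assumes "continuous_on UNIV f" "bounded_support f"
  shows "integrable lborel f"
proof -
  obtain R where R: "\<And>x. R < norm x \<Longrightarrow> f x = 0" using assms(2) by (auto simp: bounded_support_def)
  have "integrable lborel (\<lambda>x. indicator (cball 0 R) x *\<^sub>R f x)" using assms(1) continuous_on_subset
    by (intro borel_integrable_compact) auto
  moreover have "(\<lambda>x. indicator (cball 0 R) x *\<^sub>R f x) = f" using R by (auto simp: fun_eq_iff indicator_def)
  ultimately show ?thesis by simp
qed

locale mollifying =
  fixes \<rho> :: "real^'n \<Rightarrow> real" assumes smooth: "Cinf \<rho>" and nonneg: "\<And>x. \<rho> x \<ge> 0"
    and support: "closure {x. \<rho> x \<noteq> 0} \<subseteq> cball 0 1" and unit: "(\<integral>x. \<rho> x \<partial>lborel) = 1"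
begin

lemma kernel_eq: "mollifier \<rho> d = (\<lambda>x. (1 / d ^ CARD('n)) *\<^sub>R \<rho> ((1 / d) *\<^sub>R x))"
  by (simp add: mollifier_def fun_eq_iff divide_inverse mult.commute)

lemma \<rho>_Ck: "Ck m \<rho>" using smooth by (simp add: Cinf_def)

lemma \<rho>_zero: "1 < norm x \<Longrightarrow> \<rho> x = 0" using support closure_subset[of "{x. \<rho> x \<noteq> 0}"] by (force simp: subset_iff)

lemma \<rho>_bounded_support: "bounded_support \<rho>" using \<rho>_zero by (auto simp: bounded_support_def)

lemma kernel_Ck: "Ck m (mollifier \<rho> d)" unfolding kernel_eq by (rule Ck_cmult_scaled[OF \<rho>_Ck])

lemma kernel_borel [measurable]: "mollifier \<rho> d \<in> borel_measurable borel"
  using Ck_imp_continuous[OF kernel_Ck[of 0]] by (rule borel_measurable_continuous_onI)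

lemma kernel_nonneg: "0 < d \<Longrightarrow> 0 \<le> mollifier \<rho> d x" by (simp add: mollifier_def nonneg)

lemma kernel_zero: "0 < d \<Longrightarrow> d < norm x \<Longrightarrow> mollifier \<rho> d x = 0"
  using \<rho>_zero[of "x /\<^sub>R d"] by (simp add: mollifier_def field_simps)

lemma kernel_bounded_support: "0 < d \<Longrightarrow> bounded_support (mollifier \<rho> d)"
  using kernel_zero by (auto simp: bounded_support_def)

lemma kernel_integrable: "0 < d \<Longrightarrow> integrable lborel (mollifier \<rho> d)"
  using Ck_imp_continuous[OF kernel_Ck[of 0]] kernel_bounded_support by (rule integrable_bounded_support)

lemma kernel_unit: assumes "0 < d" shows "(\<integral>x. mollifier \<rho> d x \<partial>lborel) = 1"
proof -
  have "\<rho> \<in> borel_measurable borel" using Ck_imp_continuous[OF \<rho>_Ck[of 0]] by (rule borel_measurable_continuous_onI)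
  from lborel_integral_affine[OF _ this, of "1/d" 0] assms unit
  have "(1/d) ^ CARD('n) * (\<integral>x. \<rho> ((1/d) *\<^sub>R x) \<partial>lborel) = 1" by (simp del: power_divide add: abs_of_pos)
  then show ?thesis unfolding kernel_eq integral_scaleR_right by (simp only: power_one_over real_scaleR_def)
qed

text \<open>By scaling, the gradient of the kernel has size \<open>d\<close> to the power
  \<open>- CARD('n) - 1\<close> and lives on a ball of volume proportional to
  \<open>d ^ CARD('n)\<close>, whence the factor \<open>1 / d\<close>.\<close>

lemma grad_kernel_integral_bound:
  obtains K where "K \<ge> 0" "\<And>d. 0 < d \<Longrightarrow> integrable lborel (\<lambda>y. norm (grad (mollifier \<rho> d) y))"
    "\<And>d. 0 < d \<Longrightarrow> (\<integral>y. norm (grad (mollifier \<rho> d) y) \<partial>lborel) \<le> K / d"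
proof -
  obtain B where B: "B \<ge> 0" "\<And>x. norm (grad \<rho> x) \<le> B"
    using bounded_bounded_support[OF Ck1_continuous_grad[OF \<rho>_Ck] bounded_support_grad[OF \<rho>_bounded_support]] by metis
  define K where "K = B * unit_ball_vol (real CARD('n))"
  show thesis
  proof (rule that[of K])
    show "K \<ge> 0" using B by (simp add: K_def)
    fix d :: real assume d: "0 < d"
    have gk: "grad (mollifier \<rho> d) x = (1 / d ^ CARD('n) * (1/d)) *\<^sub>R grad \<rho> ((1/d) *\<^sub>R x)" for x
      unfolding kernel_eq vec_eq_iff grad_scaled[OF \<rho>_Ck] by simp
    show int: "integrable lborel (\<lambda>y. norm (grad (mollifier \<rho> d) y))"
      using bounded_support_grad[OF kernel_bounded_support[OF d]] 
      by (intro integrable_bounded_support continuous_on_norm Ck1_continuous_grad kernel_Ck)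
         (auto simp: bounded_support_def)
    have "(\<integral>y. norm (grad (mollifier \<rho> d) y) \<partial>lborel) \<le> (\<integral>y. (1 / d ^ CARD('n) * (1/d) * B) * indicator (cball (0 :: real^'n) d) y \<partial>lborel)"
    proof (rule integral_mono[OF int])
      fix y :: "real^'n"
      show "norm (grad (mollifier \<rho> d) y) \<le> (1 / d ^ CARD('n) * (1/d) * B) * indicator (cball 0 d) y"
      proof (cases "norm y \<le> d")
        case True
        then show ?thesis unfolding gk using d B(2)[of "(1/d) *\<^sub>R y"] by (simp add: divide_right_mono)
      next
        case False
        have "open {x :: real^'n. d < norm x}" by (intro open_Collect_less continuous_intros)
        then have "grad (mollifier \<rho> d) y = 0" using False kernel_zero[OF d] by (intro grad_eq_0) auto
        then show ?thesis using B d by simp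
      qed
    next
      show "integrable lborel (\<lambda>y. (1 / d ^ CARD('n) * (1/d) * B) * indicator (cball (0 :: real^'n) d) y)"
        by (intro integrable_mult_right integrable_real_indicator) (use d in \<open>auto simp: emeasure_cball\<close>)
    qed
    also have "\<dots> = (1 / d ^ CARD('n) * (1/d) * B) * (unit_ball_vol (real CARD('n)) * d ^ CARD('n))"
      using d content_cball[of d "0 :: real^'n"] by simp
    also have "\<dots> = K / d" using d by (simp add: K_def)
    finally show "(\<integral>y. norm (grad (mollifier \<rho> d) y) \<partial>lborel) \<le> K / d" .
  qed
qed

lemma conv_eq: assumes [measurable]: "f \<in> borel_measurable borel"
  shows "conv \<rho> d f x = (\<integral>y. mollifier \<rho> d y *\<^sub>R f (x - y) \<partial>lborel)"
  unfolding conv_def using lborel_integral_affine[of "-1" "\<lambda>y. mollifier \<rho> d (x - y) *\<^sub>R f y" x] by simp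

lemma Ck_conv: assumes "0 < d" "integrable lborel f"
  shows "Ck m (conv \<rho> d f)"
  using Ck_weighted_translate[OF bounded_bilinear.flip[OF bounded_bilinear_scaleR] assms(2), of uminus m "mollifier \<rho> d"]
    kernel_Ck kernel_bounded_support[OF assms(1)] by (simp add: conv_def[abs_def])

text \<open>Here the derivative falls on the kernel, at a cost of \<open>1 / d\<close> but for any
  integrable \<open>f\<close>; in \<open>grad_conv\<close> it falls on \<open>f\<close>. Second
  derivatives of the mollified potential will use one of each.\<close>

lemma grad_conv_kernel: assumes "0 < d" "integrable lborel f"
  shows "grad (conv \<rho> d f) x $ i = (\<integral>y. (grad (mollifier \<rho> d) (x - y) $ i) *\<^sub>R f y \<partial>lborel)"
  using grad_weighted_translate[OF bounded_bilinear.flip[OF bounded_bilinear_scaleR] assms(2), of uminus "mollifier \<rho> d" x i]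
    kernel_Ck kernel_bounded_support[OF assms(1)] by (simp add: conv_def[abs_def])

lemma grad_conv: assumes "0 < d" "Ck 1 f" "bounded_support f"
  shows "grad (conv \<rho> d f) x $ i = conv \<rho> d (\<lambda>y. grad f y $ i) x"
proof -
  have neg: "bounded_support (\<lambda>y. f y)" using assms by simp
  have m1: "f \<in> borel_measurable borel" "(\<lambda>y. grad f y $ i) \<in> borel_measurable borel"
    using Ck1_continuous[OF assms(2)] assms(2) by (auto intro: borel_measurable_continuous_onI)
  have "conv \<rho> d f = (\<lambda>x. \<integral>y. mollifier \<rho> d y *\<^sub>R f (x + - y) \<partial>lborel)" using conv_eq[OF m1(1)] by auto
  then show ?thesis
    using grad_weighted_translate[OF bounded_bilinear_scaleR kernel_integrable[OF assms(1)] _ assms(2,3), of uminus x i]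
    by (simp add: conv_eq[OF m1(2)])
qed

lemma conv_integrable:
  fixes f :: "real^'n \<Rightarrow> 'b::{banach, second_countable_topology}"
  assumes [measurable]: "f \<in> borel_measurable borel" and B: "\<And>x. norm (f x) \<le> B" and "0 < d"
  shows "integrable lborel (\<lambda>y. mollifier \<rho> d y *\<^sub>R f (x - y))"
proof (rule Bochner_Integration.integrable_bound[of lborel "\<lambda>y. B * mollifier \<rho> d y"])
  have "norm (mollifier \<rho> d y *\<^sub>R f (x - y)) \<le> norm (B * mollifier \<rho> d y)" for y
  proof -
    have "0 \<le> B" using B[of 0] norm_ge_zero[of "f 0"] by linarith
    then show ?thesis
      using mult_right_mono[OF B[of "x - y"] kernel_nonneg[OF assms(3), of y]] kernel_nonneg[OF assms(3), of y]
      by (simp add: abs_mult mult.commute)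
  qed
  then show "AE y in lborel. norm (mollifier \<rho> d y *\<^sub>R f (x - y)) \<le> norm (B * mollifier \<rho> d y)" by simp
qed (use kernel_integrable[OF assms(3)] in auto)

text \<open>The kernel is a probability density, so \<open>conv \<rho> d f x - c\<close> is an
  average of the values \<open>f (x - y) - c\<close>. The case \<open>e = 0\<close> gives local
  constancy, the case \<open>c = 0\<close> a bound.\<close>

lemma conv_close: assumes m: "f \<in> borel_measurable borel" and B: "\<And>x. norm (f x) \<le> B" and d: "0 < d"
    and e: "\<And>y. norm y \<le> d \<Longrightarrow> norm (f (x - y) - c) \<le> e"
  shows "norm (conv \<rho> d f x - c) \<le> e"
proof -
  note i = conv_integrable[OF m B d]
  have i2: "integrable lborel (\<lambda>y. mollifier \<rho> d y *\<^sub>R c)" using kernel_integrable[OF d] by simp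
  have "c = (\<integral>y. mollifier \<rho> d y *\<^sub>R c \<partial>lborel)"
    by (subst integral_scaleR_left) (use kernel_integrable[OF d] kernel_unit[OF d] in auto)
  then have "conv \<rho> d f x - c = (\<integral>y. mollifier \<rho> d y *\<^sub>R (f (x - y) - c) \<partial>lborel)"
    by (simp add: conv_eq[OF m] scaleR_diff_right Bochner_Integration.integral_diff[OF i i2])
  also have "norm \<dots> \<le> (\<integral>y. mollifier \<rho> d y * e \<partial>lborel)"
  proof (rule norm_integral_le)
    show "integrable lborel (\<lambda>y. mollifier \<rho> d y *\<^sub>R (f (x - y) - c))"
      unfolding scaleR_diff_right by (rule Bochner_Integration.integrable_diff[OF i i2])
    show "norm (mollifier \<rho> d y *\<^sub>R (f (x - y) - c)) \<le> mollifier \<rho> d y * e" for y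
      using e[of y] kernel_zero[OF d, of y] kernel_nonneg[OF d, of y]
      by (cases "norm y \<le> d") (auto intro: mult_left_mono)
  qed (use kernel_integrable[OF d] in auto)
  also have "\<dots> = e" using kernel_unit[OF d] by simp
  finally show ?thesis .
qed

lemma conv_const: assumes "f \<in> borel_measurable borel" "\<And>x. norm (f x) \<le> B" "0 < d"
    and "\<And>y. dist x y \<le> d \<Longrightarrow> f y = c"
  shows "conv \<rho> d f x = c" using conv_close[OF assms(1-3), of x c 0] assms(4)[of "x - _"] by (simp add: dist_norm)

lemma norm_conv_le: assumes "f \<in> borel_measurable borel" "\<And>x. norm (f x) \<le> B" "0 < d"
  shows "norm (conv \<rho> d f x) \<le> B" using conv_close[OF assms, of x 0 B] assms(2) by simp

text \<open>The integral norm of the kernel gradient times the supremum of \<open>f\<close>; the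
  source of the growth of the second derivatives of the phase.\<close>

lemma norm_grad_conv_le: assumes d: "0 < d" and f: "integrable lborel f" and B: "\<And>x. norm (f x) \<le> B"
    and int: "integrable lborel (\<lambda>y. norm (grad (mollifier \<rho> d) y))"
    and K: "(\<integral>y. norm (grad (mollifier \<rho> d) y) \<partial>lborel) \<le> K / d"
  shows "norm (grad (conv \<rho> d f) x $ i) \<le> K * B / d"
proof -
  have B0: "0 \<le> B" using B[of 0] norm_ge_zero[of "f 0"] by linarith
  have m: "(\<lambda>y. norm (grad (mollifier \<rho> d) y)) \<in> borel_measurable borel"
    using int by (simp add: borel_measurable_integrable)
  have eq: "(\<integral>y. norm (grad (mollifier \<rho> d) y) \<partial>lborel) = (\<integral>y. norm (grad (mollifier \<rho> d) (x - y)) \<partial>lborel)"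
    using lborel_integral_affine[OF _ m, of "-1" x] by simp
  have int': "integrable lborel (\<lambda>y. norm (grad (mollifier \<rho> d) (x + - y)))"
  proof (rule integrable_bounded_support)
    have "continuous_on UNIV (\<lambda>y. x + - y)" by (intro continuous_intros)
    from continuous_on_compose2[OF Ck1_continuous_grad[OF kernel_Ck] this]
    show "continuous_on UNIV (\<lambda>y. norm (grad (mollifier \<rho> d) (x + - y)))" by (auto intro: continuous_on_norm)
    obtain R where R: "\<And>z. R < norm z \<Longrightarrow> grad (mollifier \<rho> d) z = 0"
      using bounded_support_grad[OF kernel_bounded_support[OF d]] by (auto simp: bounded_support_def)
    have "R < norm (x - y)" if "R + norm x < norm y" for y
      using that norm_triangle_ineq2[of y x] by (simp add: norm_minus_commute)
    then show "bounded_support (\<lambda>y. norm (grad (mollifier \<rho> d) (x + - y)))"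
      using R unfolding bounded_support_def by (intro exI[of _ "R + norm x"]) auto
  qed
  have "norm (grad (conv \<rho> d f) x $ i) \<le> (\<integral>y. norm (grad (mollifier \<rho> d) (x - y)) * B \<partial>lborel)"
    unfolding grad_conv_kernel[OF d f]
  proof (rule norm_integral_le)
    show "integrable lborel (\<lambda>y. (grad (mollifier \<rho> d) (x - y) $ i) *\<^sub>R f y)"
      using integrable_weighted_translate[OF bounded_bilinear.flip[OF bounded_bilinear_scaleR] f, of uminus "\<lambda>y. grad (mollifier \<rho> d) y $ i" x]
        kernel_Ck[of 1] bounded_support_grad_component[OF kernel_bounded_support[OF d]] by simp
    show "norm ((grad (mollifier \<rho> d) (x - y) $ i) *\<^sub>R f y) \<le> norm (grad (mollifier \<rho> d) (x - y)) * B" for y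
      using component_le_norm_cart[of "grad (mollifier \<rho> d) (x - y)" i] B[of y] B0 by (simp add: mult_mono)
  qed (use int' in simp)
  also have "\<dots> = (\<integral>y. norm (grad (mollifier \<rho> d) y) \<partial>lborel) * B" using eq by simp
  also have "\<dots> \<le> K / d * B" using K B0 by (rule mult_right_mono)
  finally show ?thesis by simp
qed

end

section \<open>Square integrable functions\<close>

definition l2norm :: "'a measure \<Rightarrow> ('a \<Rightarrow> 'b::{banach, second_countable_topology}) \<Rightarrow> real" where
  "l2norm M f = sqrt (\<integral>x. (norm (f x))^2 \<partial>M)"

lemma l2norm_nonneg [simp]: "0 \<le> l2norm M f" by (simp add: l2norm_def)

lemma l2norm_sq: "(l2norm M f)^2 = (\<integral>x. (norm (f x))^2 \<partial>M)" by (simp add: l2norm_def)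

lemma L2_measurable: "L2 M f \<Longrightarrow> f \<in> borel_measurable M" by (simp add: L2_def)

lemma L2_square_integrable: "L2 M f \<Longrightarrow> integrable M (\<lambda>x. (norm (f x))^2)" by (simp add: L2_def)

lemma L2_bound: assumes f: "f \<in> borel_measurable M" and g: "L2 M g" and le: "AE x in M. norm (f x) \<le> c * norm (g x)"
  shows "L2 M f" unfolding L2_def
proof
  show "integrable M (\<lambda>x. (norm (f x))^2)"
  proof (rule Bochner_Integration.integrable_bound[of M "\<lambda>x. c^2 * (norm (g x))^2"])
    show "AE x in M. norm ((norm (f x))^2) \<le> norm (c^2 * (norm (g x))^2)"
      using le by eventually_elim (auto simp: power_mult_distrib[symmetric] power2_le_iff_abs_le intro!: power_mono)
  qed (use f L2_square_integrable[OF g] in auto)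
qed (rule f)

lemma L2_add: assumes "L2 M f" "L2 M g" shows "L2 M (\<lambda>x. f x + g x)" unfolding L2_def
proof
  note [measurable] = L2_measurable[OF assms(1)] L2_measurable[OF assms(2)]
  show "(\<lambda>x. f x + g x) \<in> borel_measurable M" by measurable
  show "integrable M (\<lambda>x. (norm (f x + g x))^2)"
  proof (rule Bochner_Integration.integrable_bound[of M "\<lambda>x. 2 * (norm (f x))^2 + 2 * (norm (g x))^2"])
    have "(norm (f x + g x))^2 \<le> 2 * (norm (f x))^2 + 2 * (norm (g x))^2" for x
    proof -
      have "(norm (f x + g x))^2 \<le> (norm (f x) + norm (g x))^2" by (intro power_mono norm_triangle_ineq) auto
      also have "\<dots> \<le> 2 * (norm (f x))^2 + 2 * (norm (g x))^2"
        using sum_squares_bound[of "norm (f x)" "norm (g x)"] by (simp add: power2_sum)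
      finally show ?thesis .
    qed
    then show "AE x in M. norm ((norm (f x + g x))^2) \<le> norm (2 * (norm (f x))^2 + 2 * (norm (g x))^2)" by simp
  qed (use L2_square_integrable[OF assms(1)] L2_square_integrable[OF assms(2)] in auto)
qed

lemma L2_scaleR: "L2 M f \<Longrightarrow> L2 M (\<lambda>x. c *\<^sub>R f x)"
  by (rule L2_bound[where g = f and c = "\<bar>c\<bar>"]) (auto dest: L2_measurable)

lemma L2_uminus: "L2 M f \<Longrightarrow> L2 M (\<lambda>x. - f x)" using L2_scaleR[of M f "-1"] by simp

lemma L2_diff: "L2 M f \<Longrightarrow> L2 M g \<Longrightarrow> L2 M (\<lambda>x. f x - g x)" using L2_add[of M f "\<lambda>x. - g x"] L2_uminus[of M g] by simp

lemma L2_mult_bounded: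
  fixes f c :: "'a \<Rightarrow> 'b::{real_normed_algebra, banach, second_countable_topology}"
  assumes f: "L2 M f" and c: "c \<in> borel_measurable M" and B: "AE x in M. norm (c x) \<le> B" shows "L2 M (\<lambda>x. c x * f x)"
proof (rule L2_bound[OF _ f, of _ B])
  show "(\<lambda>x. c x * f x) \<in> borel_measurable M" using c L2_measurable[OF f] by measurable
  show "AE x in M. norm (c x * f x) \<le> B * norm (f x)"
    using B by eventually_elim (metis mult_right_mono norm_ge_zero norm_mult_ineq order_trans)
qed

lemma L2_scaleR_bounded: assumes f: "L2 M f" and c: "c \<in> borel_measurable M" and B: "AE x in M. \<bar>c x\<bar> \<le> B"
  shows "L2 M (\<lambda>x. c x *\<^sub>R f x)"
proof (rule L2_bound[OF _ f, of _ B])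
  show "(\<lambda>x. c x *\<^sub>R f x) \<in> borel_measurable M" using c L2_measurable[OF f] by measurable
  show "AE x in M. norm (c x *\<^sub>R f x) \<le> B * norm (f x)" using B by eventually_elim (simp add: mult_right_mono)
qed

lemma (in finite_measure) L2_bounded: assumes f: "f \<in> borel_measurable M" and B: "AE x in M. norm (f x) \<le> B"
  shows "L2 M f" unfolding L2_def
proof
  show "integrable M (\<lambda>x. (norm (f x))^2)"
  proof (rule integrable_const_bound[of _ "B^2"])
    show "AE x in M. norm ((norm (f x))^2) \<le> B^2" using B by eventually_elim (auto intro: power_mono)
  qed (use f in measurable)
qed (rule f)

lemma (in finite_measure) L2_integrable: assumes f: "L2 M f" shows "integrable M f"
proof (rule Bochner_Integration.integrable_bound[of M "\<lambda>x. 1 + (norm (f x))^2"])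
  have "a \<le> 1 + a^2" for a :: real using sum_squares_bound[of a 1] by (simp add: algebra_simps) (smt (verit) zero_le_power2)
  then show "AE x in M. norm (f x) \<le> norm (1 + (norm (f x))^2)" by (auto simp: add_nonneg_nonneg)
qed (use L2_measurable[OF f] L2_square_integrable[OF f] in auto)

lemma l2norm_eq_0D: assumes "L2 M f" "l2norm M f = 0" shows "AE x in M. f x = 0"
proof -
  have "(\<integral>x. (norm (f x))^2 \<partial>M) = 0" using assms(2) by (metis l2norm_sq power_zero_numeral)
  then have "AE x in M. (norm (f x))^2 = 0"
    using integral_nonneg_eq_0_iff_AE[OF L2_square_integrable[OF assms(1)]] by simp
  then show ?thesis by simp
qed

lemma integrable_L2_product:
  fixes h :: "'a \<Rightarrow> 'd::{banach, second_countable_topology}"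
  assumes f: "L2 M f" and g: "L2 M g" and h: "h \<in> borel_measurable M"
    and le: "AE x in M. norm (h x) \<le> norm (f x) * norm (g x)"
  shows "integrable M h"
proof (rule Bochner_Integration.integrable_bound[of M "\<lambda>x. (norm (f x))^2 + (norm (g x))^2"])
  have "a * b \<le> a^2 + b^2" if "0 \<le> a" "0 \<le> b" for a b :: real
    using sum_squares_bound[of a b] mult_nonneg_nonneg[OF that] by linarith
  then show "AE x in M. norm (h x) \<le> norm ((norm (f x))^2 + (norm (g x))^2)"
    using le by (auto elim!: eventually_mono intro: order_trans)
qed (use L2_square_integrable[OF f] L2_square_integrable[OF g] h in auto)

text \<open>Expands the integral of the square of \<open>?b * norm (f x) - ?a * norm (g x)\<close>.
  The integrand \<open>h\<close> is only dominated by the product of the norms, so the lemma serves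
  complex products, \<open>cdot\<close> and the magnetic form alike.\<close>

lemma cauchy_schwarz_integral:
  fixes h :: "'a \<Rightarrow> 'd::{banach, second_countable_topology}"
  assumes f: "L2 M f" and g: "L2 M g" and h: "h \<in> borel_measurable M"
    and le: "AE x in M. norm (h x) \<le> norm (f x) * norm (g x)"
  shows "norm (\<integral>x. h x \<partial>M) \<le> l2norm M f * l2norm M g"
proof -
  note [measurable] = L2_measurable[OF f] L2_measurable[OF g]
  let ?p = "\<lambda>x. norm (f x) * norm (g x)"
  let ?a = "l2norm M f" and ?b = "l2norm M g"
  have p: "integrable M ?p" by (rule integrable_L2_product[OF f g]) auto
  have "norm (\<integral>x. h x \<partial>M) \<le> (\<integral>x. norm (h x) \<partial>M)" by (rule integral_norm_bound)
  also have "\<dots> \<le> (\<integral>x. ?p x \<partial>M)" by (rule integral_mono_AE) (use le p integrable_L2_product[OF f g h le] in auto)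
  also have "\<dots> \<le> ?a * ?b"
  proof (cases "?a = 0 \<or> ?b = 0")
    case True
    then have "AE x in M. ?p x = 0" using l2norm_eq_0D[OF f] l2norm_eq_0D[OF g] by (auto elim: eventually_mono)
    then have "(\<integral>x. ?p x \<partial>M) = 0" by (rule integral_eq_zero_AE)
    then show ?thesis by simp
  next
    case False
    then have ab: "?a > 0" "?b > 0" by (simp_all add: order_less_le)
    have "0 \<le> (\<integral>x. (?b * norm (f x) - ?a * norm (g x))^2 \<partial>M)" by (rule Bochner_Integration.integral_nonneg) simp
    also have "(\<lambda>x. (?b * norm (f x) - ?a * norm (g x))^2) =
        (\<lambda>x. ?b^2 * (norm (f x))^2 + ?a^2 * (norm (g x))^2 - 2 * ?a * ?b * ?p x)"
      by (simp add: power2_diff power_mult_distrib fun_eq_iff)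
    also have "(\<integral>x. ?b^2 * (norm (f x))^2 + ?a^2 * (norm (g x))^2 - 2 * ?a * ?b * ?p x \<partial>M) =
        ?b^2 * ?a^2 + ?a^2 * ?b^2 - 2 * ?a * ?b * (\<integral>x. ?p x \<partial>M)"
      using L2_square_integrable[OF f] L2_square_integrable[OF g] p by (simp add: l2norm_sq)
    finally have "(2 * ?a * ?b) * (\<integral>x. ?p x \<partial>M) \<le> (2 * ?a * ?b) * (?a * ?b)"
      by (simp add: power2_eq_square algebra_simps)
    then show ?thesis using ab by (simp only: mult_le_cancel_left_pos mult_pos_pos zero_less_numeral)
  qed
  finally show ?thesis .
qed

lemma l2norm_triangle: assumes f: "L2 M f" and g: "L2 M g"
  shows "l2norm M (\<lambda>x. f x + g x) \<le> l2norm M f + l2norm M g"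
proof -
  note [measurable] = L2_measurable[OF f] L2_measurable[OF g]
  note i = L2_square_integrable[OF f] L2_square_integrable[OF g] L2_square_integrable[OF L2_add[OF f g]]
  let ?p = "\<lambda>x. norm (f x) * norm (g x)"
  have p: "integrable M ?p" by (rule integrable_L2_product[OF f g]) auto
  have "(l2norm M (\<lambda>x. f x + g x))^2 \<le> (\<integral>x. (norm (f x))^2 + (norm (g x))^2 + 2 * ?p x \<partial>M)" unfolding l2norm_sq
  proof (rule integral_mono)
    fix x
    have "(norm (f x + g x))^2 \<le> (norm (f x) + norm (g x))^2" by (intro power_mono norm_triangle_ineq) auto
    then show "(norm (f x + g x))^2 \<le> (norm (f x))^2 + (norm (g x))^2 + 2 * ?p x" by (simp add: power2_sum)
  qed (use i p in auto)
  also have "\<dots> = (l2norm M f)^2 + (l2norm M g)^2 + 2 * (\<integral>x. ?p x \<partial>M)" using i p by (simp add: l2norm_sq)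
  also have "(\<integral>x. ?p x \<partial>M) \<le> l2norm M f * l2norm M g" using cauchy_schwarz_integral[OF f g, of ?p] by auto
  finally have "(l2norm M (\<lambda>x. f x + g x))^2 \<le> (l2norm M f + l2norm M g)^2" by (simp add: power2_sum)
  then show ?thesis by (rule power2_le_imp_le) simp
qed

lemma l2norm_minus_commute: "l2norm M (\<lambda>x. f x - g x) = l2norm M (\<lambda>x. g x - f x)"
  by (simp add: l2norm_def norm_minus_commute)

lemma l2norm_cong_AE: assumes "f \<in> borel_measurable M" "g \<in> borel_measurable M" "AE x in M. f x = g x"
  shows "l2norm M f = l2norm M g"
  unfolding l2norm_def using assms by (intro arg_cong[of _ _ sqrt] integral_cong_AE) auto

lemma l2norm_le:
  assumes f: "f \<in> borel_measurable M" and g: "L2 M g" and le: "AE x in M. norm (f x) \<le> c * norm (g x)" and c: "0 \<le> c"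
  shows "l2norm M f \<le> c * l2norm M g"
proof -
  have "(l2norm M f)^2 \<le> (\<integral>x. c^2 * (norm (g x))^2 \<partial>M)" unfolding l2norm_sq
  proof (rule integral_mono_AE)
    show "AE x in M. (norm (f x))^2 \<le> c^2 * (norm (g x))^2"
      using le by eventually_elim (auto simp: power_mult_distrib[symmetric] intro!: power_mono)
  qed (use L2_square_integrable[OF g] L2_square_integrable[OF L2_bound[OF f g le]] in auto)
  also have "\<dots> = (c * l2norm M g)^2" by (simp add: power_mult_distrib l2norm_sq)
  finally show ?thesis using c by (auto intro: power2_le_imp_le)
qed

lemma (in finite_measure) l2norm_bounded_le:
  assumes f: "f \<in> borel_measurable M" and B: "AE x in M. norm (f x) \<le> B" and B0: "0 \<le> B"
  shows "l2norm M f \<le> B * sqrt (measure M (space M))"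
proof -
  have "l2norm M f \<le> B * l2norm M (\<lambda>_. 1 :: real)" by (rule l2norm_le[OF f L2_bounded[of _ 1] _ B0]) (use B in auto)
  then show ?thesis by (simp add: l2norm_def)
qed

lemma L2_tendsto_l2norm:
  "L2_tendsto M F f \<longleftrightarrow> (\<forall>k. L2 M (F k)) \<and> L2 M f \<and> (\<lambda>k. l2norm M (\<lambda>x. F k x - f x)) \<longlonglongrightarrow> 0"
proof -
  have "(\<lambda>k. l2norm M (\<lambda>x. F k x - f x)) \<longlonglongrightarrow> 0 \<longleftrightarrow> (\<lambda>k. (l2norm M (\<lambda>x. F k x - f x))^2) \<longlonglongrightarrow> 0"
    using tendsto_power[of "\<lambda>k. l2norm M (\<lambda>x. F k x - f x)" 0 sequentially 2]
      tendsto_real_sqrt[of "\<lambda>k. (l2norm M (\<lambda>x. F k x - f x))^2" 0 sequentially] by auto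
  then show ?thesis unfolding L2_tendsto_def l2norm_sq by simp
qed

lemma l2norm_tendsto_0: assumes "\<And>k. l2norm M (F k) \<le> b k" "b \<longlonglongrightarrow> 0"
  shows "(\<lambda>k. l2norm M (F k)) \<longlonglongrightarrow> 0" using assms(1) by (intro Lim_null_comparison[OF _ assms(2)]) simp

lemma L2_tendsto_diff: assumes "L2_tendsto M F f" "L2_tendsto M G g"
  shows "L2_tendsto M (\<lambda>k x. F k x - G k x) (\<lambda>x. f x - g x)" unfolding L2_tendsto_l2norm
proof (intro conjI allI)
  have L: "\<And>k. L2 M (F k)" "L2 M f" "\<And>k. L2 M (G k)" "L2 M g" using assms by (auto simp: L2_tendsto_l2norm)
  show "L2 M (\<lambda>x. F k x - G k x)" for k by (intro L2_diff L)
  show "L2 M (\<lambda>x. f x - g x)" by (intro L2_diff L)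
  have le: "l2norm M (\<lambda>x. F k x - G k x - (f x - g x)) \<le> l2norm M (\<lambda>x. F k x - f x) + l2norm M (\<lambda>x. G k x - g x)" for k
    using l2norm_triangle[OF L2_diff[OF L(1,2)] L2_uminus[OF L2_diff[OF L(3,4)]], of k k]
    by (simp add: l2norm_minus_commute[of M "\<lambda>x. G k x"] algebra_simps)
  have "(\<lambda>k. l2norm M (\<lambda>x. F k x - f x) + l2norm M (\<lambda>x. G k x - g x)) \<longlonglongrightarrow> 0"
    using assms tendsto_add[of "\<lambda>k. l2norm M (\<lambda>x. F k x - f x)" 0 sequentially "\<lambda>k. l2norm M (\<lambda>x. G k x - g x)" 0]
    by (simp add: L2_tendsto_l2norm)
  then show "(\<lambda>k. l2norm M (\<lambda>x. F k x - G k x - (f x - g x))) \<longlonglongrightarrow> 0" by (rule l2norm_tendsto_0[OF le])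
qed

lemma L2_tendsto_norm: assumes "L2_tendsto M F f"
  shows "(\<lambda>k. l2norm M (F k)) \<longlonglongrightarrow> l2norm M f"
proof -
  have L: "\<And>k. L2 M (F k)" "L2 M f" "(\<lambda>k. l2norm M (\<lambda>x. F k x - f x)) \<longlonglongrightarrow> 0"
    using assms by (auto simp: L2_tendsto_l2norm)
  have "\<bar>l2norm M (F k) - l2norm M f\<bar> \<le> l2norm M (\<lambda>x. F k x - f x)" for k
  proof -
    have "l2norm M (F k) \<le> l2norm M (\<lambda>x. F k x - f x) + l2norm M f"
      using l2norm_triangle[OF L2_diff[OF L(1,2)] L(2), of k] by simp
    moreover have "l2norm M f \<le> l2norm M (\<lambda>x. F k x - f x) + l2norm M (F k)"
      using l2norm_triangle[OF L2_uminus[OF L2_diff[OF L(1,2)]] L(1), of k k] by (simp add: l2norm_minus_commute[of M "\<lambda>x. F k x"])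
    ultimately show ?thesis by linarith
  qed
  then have "(\<lambda>k. l2norm M (F k) - l2norm M f) \<longlonglongrightarrow> 0" by (intro Lim_null_comparison[OF _ L(3)]) auto
  then show ?thesis by (simp add: LIM_zero_iff)
qed

lemma bounded_bilinear_measurable:
  fixes prod :: "'b::{banach, second_countable_topology} \<Rightarrow> 'c::{banach, second_countable_topology} \<Rightarrow> 'd::{banach, second_countable_topology}"
  assumes p: "bounded_bilinear prod" and F: "F \<in> borel_measurable M" and G: "G \<in> borel_measurable M"
  shows "(\<lambda>x. prod (F x) (G x)) \<in> borel_measurable M"
proof -
  have "continuous_on UNIV (\<lambda>p. prod (fst p) (snd p))"
    by (rule bounded_bilinear.continuous_on[OF p]) (intro continuous_intros)+
  from borel_measurable_continuous_Pair[OF F G this] show ?thesis by simp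
qed

text \<open>Cauchy-Schwarz; this is the means of passing to the limit in weak identities.\<close>

lemma L2_tendsto_pairing:
  fixes prod :: "'b::{banach, second_countable_topology} \<Rightarrow> 'c::{banach, second_countable_topology} \<Rightarrow> 'd::{banach, second_countable_topology}"
  assumes p: "bounded_bilinear prod" and le: "\<And>a b. norm (prod a b) \<le> norm a * norm b"
    and g: "L2 M g" and T: "L2_tendsto M F f"
  shows "(\<lambda>k. \<integral>x. prod (g x) (F k x) \<partial>M) \<longlonglongrightarrow> (\<integral>x. prod (g x) (f x) \<partial>M)"
proof -
  interpret bounded_bilinear prod by (rule p)
  have L: "\<And>k. L2 M (F k)" "L2 M f" "(\<lambda>k. l2norm M (\<lambda>x. F k x - f x)) \<longlonglongrightarrow> 0" using T by (auto simp: L2_tendsto_l2norm)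
  have m: "(\<lambda>x. prod (g x) (u x)) \<in> borel_measurable M" if "L2 M u" for u
    by (rule bounded_bilinear_measurable[OF p L2_measurable[OF g] L2_measurable[OF that]])
  have i: "integrable M (\<lambda>x. prod (g x) (u x))" if "L2 M u" for u
    by (rule integrable_L2_product[OF g that m[OF that]]) (simp add: le)
  have nb: "norm ((\<integral>x. prod (g x) (F k x) \<partial>M) - (\<integral>x. prod (g x) (f x) \<partial>M)) \<le> l2norm M g * l2norm M (\<lambda>x. F k x - f x)" for k
  proof -
    have "(\<integral>x. prod (g x) (F k x) \<partial>M) - (\<integral>x. prod (g x) (f x) \<partial>M) = (\<integral>x. prod (g x) (F k x - f x) \<partial>M)"
      unfolding diff_right by (rule Bochner_Integration.integral_diff[OF i[OF L(1)] i[OF L(2)], symmetric])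
    also have "norm \<dots> \<le> l2norm M g * l2norm M (\<lambda>x. F k x - f x)"
      by (rule cauchy_schwarz_integral[OF g L2_diff[OF L(1,2)] m[OF L2_diff[OF L(1,2)]]]) (simp add: le)
    finally show ?thesis .
  qed
  have "(\<lambda>k. l2norm M g * l2norm M (\<lambda>x. F k x - f x)) \<longlonglongrightarrow> 0" using tendsto_mult_left[OF L(3), of "l2norm M g"] by simp
  then have "(\<lambda>k. (\<integral>x. prod (g x) (F k x) \<partial>M) - (\<integral>x. prod (g x) (f x) \<partial>M)) \<longlonglongrightarrow> 0"
    by (rule Lim_null_comparison[OF always_eventually[OF allI[OF nb]]])
  then show ?thesis by (rule LIM_zero_cancel)
qed

lemma bounded_bilinear_cdot: "bounded_bilinear (cdot :: complex^'n \<Rightarrow> complex^'n \<Rightarrow> complex)"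
  and norm_cdot_le: "norm (cdot z w) \<le> norm z * norm (w :: complex^'n)"
proof -
  have le: "norm (cdot z w) \<le> norm z * norm w" for z w :: "complex^'n"
  proof -
    have "norm (cdot z w) \<le> (\<Sum>i\<in>UNIV. \<bar>norm (z $ i)\<bar> * \<bar>norm (w $ i)\<bar>)"
      unfolding cdot_def by (rule order_trans[OF norm_sum]) (simp add: norm_mult)
    also have "\<dots> \<le> norm z * norm w" unfolding norm_vec_def by (rule L2_set_mult_ineq)
    finally show ?thesis .
  qed
  then show "norm (cdot z w) \<le> norm z * norm w" .
  show "bounded_bilinear (cdot :: complex^'n \<Rightarrow> complex^'n \<Rightarrow> complex)"
  proof
    fix a a' b b' :: "complex^'n" and r :: real
    show "cdot (a + a') b = cdot a b + cdot a' b" by (simp add: cdot_def distrib_right sum.distrib)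
    show "cdot a (b + b') = cdot a b + cdot a b'" by (simp add: cdot_def distrib_left sum.distrib)
    show "cdot (r *\<^sub>R a) b = r *\<^sub>R cdot a b" by (simp add: cdot_def scaleR_sum_right)
    show "cdot a (r *\<^sub>R b) = r *\<^sub>R cdot a b" by (simp add: cdot_def scaleR_sum_right)
    show "\<exists>K. \<forall>a b :: complex^'n. norm (cdot a b) \<le> norm a * norm b * K" using le by (intro exI[of _ 1]) simp
  qed
qed

lemmas cdot_measurable = bounded_bilinear_measurable[OF bounded_bilinear_cdot]

section \<open>Weak derivatives and traces on a domain\<close>

lemma grad_bounded_linear: assumes "bounded_linear l" "Ck 1 f"
  shows "grad (\<lambda>x. l (f x)) x $ i = l (grad f x $ i)"
proof -
  interpret l: bounded_linear l by (rule assms(1))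
  have "grad (\<lambda>x. l (f x)) x $ i = l (\<Sum>j\<in>UNIV. (axis i 1 $ j) *\<^sub>R grad f x $ j)"
    by (rule grad_eqI[OF bounded_linear.has_derivative[OF assms(1) Ck1_has_derivative[OF assms(2)]]])
  then show ?thesis by (simp add: axis_def if_distrib if_distribR cong: if_cong)
qed

lemma Ck1_mult:
  fixes f g :: "real^'n \<Rightarrow> 'b::real_normed_algebra" assumes "Ck 1 f" "Ck 1 g"
  shows "Ck 1 (\<lambda>x. f x * g x)" and grad_mult: "grad (\<lambda>x. f x * g x) x $ i = f x * grad g x $ i + grad f x $ i * g x"
proof -
  note D = has_derivative_mult[OF Ck1_has_derivative[OF assms(1)] Ck1_has_derivative[OF assms(2)]]
  have eq: "f x * (\<Sum>j\<in>UNIV. (axis i 1 $ j) *\<^sub>R grad g x $ j) + (\<Sum>j\<in>UNIV. (axis i 1 $ j) *\<^sub>R grad f x $ j) * g x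
     = f x * grad g x $ i + grad f x $ i * g x" for x i by (simp add: axis_def if_distrib if_distribR cong: if_cong)
  show "grad (\<lambda>x. f x * g x) x $ i = f x * grad g x $ i + grad f x $ i * g x" unfolding grad_eqI[OF D] eq ..
  have "Ck (Suc 0) (\<lambda>x. f x * g x)"
  proof (rule Ck_SucI[OF D])
    have "continuous_on UNIV f" "continuous_on UNIV g" using assms Ck1_continuous by blast+
    moreover have "continuous_on UNIV (\<lambda>x. grad f x $ i)" "continuous_on UNIV (\<lambda>x. grad g x $ i)" for i
      using assms by simp_all
    ultimately show "Ck 0 (\<lambda>x. f x * (\<Sum>j\<in>UNIV. (axis i 1 $ j) *\<^sub>R grad g x $ j) + (\<Sum>j\<in>UNIV. (axis i 1 $ j) *\<^sub>R grad f x $ j) * g x)" for i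
      unfolding eq by (simp add: continuous_on_add continuous_on_mult)
  qed
  then show "Ck 1 (\<lambda>x. f x * g x)" by simp
qed

lemma l2norm_scaleR_le: "L2 M f \<Longrightarrow> 0 \<le> c \<Longrightarrow> l2norm M (\<lambda>x. c *\<^sub>R f x) \<le> c * l2norm M f"
  by (rule l2norm_le) (auto dest: L2_scaleR L2_measurable)

lemma cdot_axis: "cdot (axis i c) w = c * w $ i" by (simp add: cdot_def axis_def if_distrib if_distribR cong: if_cong)

lemma L2_vec_component: assumes "L2 M G" shows "L2 M (\<lambda>x. (G x :: complex^'m) $ i)"
proof (rule L2_bound[where g = G and c = 1])
  have "continuous_on UNIV (\<lambda>z :: complex^'m. z $ i)" by (intro continuous_intros)
  then have "(\<lambda>z :: complex^'m. z $ i) \<in> borel_measurable borel" by (rule borel_measurable_continuous_onI)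
  from measurable_compose[OF L2_measurable[OF assms] this] show "(\<lambda>x. G x $ i) \<in> borel_measurable M" .
  show "AE x in M. norm (G x $ i) \<le> 1 * norm (G x)" using Finite_Cartesian_Product.norm_nth_le[of "G _" i] by (intro AE_I2) simp
qed (rule assms)

lemma L2_axis: "L2 M u \<Longrightarrow> L2 M (\<lambda>x. axis i (u x) :: complex^'m)"
proof (rule L2_bound[where g = u and c = 1])
  assume u: "L2 M u"
  have "continuous_on UNIV (\<lambda>z :: complex. axis i z :: complex^'m)" unfolding axis_def
  proof (intro continuous_on_vec_lambda)
    show "continuous_on UNIV (\<lambda>z :: complex. if j = i then z else 0)" for j by (cases "j = i") auto
  qed
  then show "(\<lambda>x. axis i (u x) :: complex^'m) \<in> borel_measurable M"
    using measurable_compose[OF L2_measurable[OF u] borel_measurable_continuous_onI] by blast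
qed (auto simp: norm_vec_def L2_set_def axis_def if_distrib if_distribR cong: if_cong)

lemma compact_support_in_bounded_support: "compact_support_in S f \<Longrightarrow> bounded_support f"
  unfolding compact_support_in_def bounded_support_iff by (meson bounded_subset closure_subset compact_imp_bounded)

lemma norm_cvec [simp]: "norm (cvec x) = norm x" by (simp add: norm_vec_def cvec_def L2_set_def)

lemma cvec_diff: "cvec (x - y) = cvec x - cvec y" by (simp add: cvec_def vec_eq_iff)

lemma continuous_cvec: "continuous_on S f \<Longrightarrow> continuous_on S (\<lambda>x. cvec (f x))"
  unfolding cvec_def by (intro continuous_on_vec_lambda continuous_intros)

lemma grad_times_of_real: assumes "Ck 1 U" "Ck 1 z"
  shows "Ck 1 (\<lambda>x. U x * of_real (z x))"
    "grad (\<lambda>x. U x * of_real (z x)) x = of_real (z x) *s grad U x + U x *s cvec (grad z x)"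
proof -
  have c: "Ck 1 (\<lambda>x. of_real (z x))" by (rule Ck_bounded_linear[OF bounded_linear_of_real assms(2)])
  show "Ck 1 (\<lambda>x. U x * of_real (z x))" by (rule Ck1_mult[OF assms(1) c])
  show "grad (\<lambda>x. U x * of_real (z x)) x = of_real (z x) *s grad U x + U x *s cvec (grad z x)"
    by (simp add: vec_eq_iff cvec_def grad_mult[OF assms(1) c] grad_bounded_linear[OF bounded_linear_of_real assms(2)])
qed

text \<open>The mollifier of the statement also serves as kernel for cutoffs and test functions on
  the domain, hence the common locale.\<close>

locale smooth_domain = mollifying \<rho> for \<rho> :: "real^'n \<Rightarrow> real" +
  fixes \<Omega> :: "(real^'n) set" assumes dim: "CARD('n) \<ge> 2" and open_domain: "open \<Omega>" and nonempty_domain: "\<Omega> \<noteq> {}"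
    and bounded_domain: "bounded \<Omega>" and C11: "C11_boundary \<Omega>"
begin

abbreviation "\<D> \<equiv> lebesgue_on \<Omega>"

lemma domain_lebesgue [simp]: "\<Omega> \<in> sets lebesgue" "\<Omega> \<in> sets borel" using open_domain by auto

lemma finite_measure_domain: "finite_measure \<D>"
proof
  have "\<Omega> \<in> lmeasurable" using bounded_domain by (simp add: bounded_set_imp_lmeasurable)
  then show "emeasure \<D> (space \<D>) \<noteq> \<infinity>"
    by (simp add: emeasure_restrict_space space_restrict_space fmeasurable_def less_top[symmetric])
qed

sublocale dom: finite_measure "\<D>" by (rule finite_measure_domain)

lemma borel_measurable_domain: assumes "f \<in> borel_measurable borel" shows "f \<in> borel_measurable \<D>"
  using assms by (intro measurable_restrict_space1 measurable_completion) simp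

lemma continuous_measurable: assumes "continuous_on UNIV f" shows "f \<in> borel_measurable \<D>"
  using assms by (intro borel_measurable_domain borel_measurable_continuous_onI)

lemma AE_domainI: "(\<And>x. x \<in> \<Omega> \<Longrightarrow> P x) \<Longrightarrow> AE x in \<D>. P x" by (rule AE_I2) simp

lemma continuous_bounded:
  fixes f :: "real^'n \<Rightarrow> 'b::real_normed_vector" assumes "continuous_on UNIV f"
  obtains B where "B \<ge> 0" "\<And>x. x \<in> closure \<Omega> \<Longrightarrow> norm (f x) \<le> B"
proof -
  have "compact (f ` closure \<Omega>)"
    using bounded_domain assms by (intro compact_continuous_image) (auto intro: continuous_on_subset)
  then obtain B where B: "\<And>x. x \<in> closure \<Omega> \<Longrightarrow> norm (f x) \<le> B" by (meson bounded_iff compact_imp_bounded image_eqI)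
  have "norm (f x) \<le> max B 0" if "x \<in> closure \<Omega>" for x using B[OF that] by simp
  then show thesis by (intro that[of "max B 0"]) auto
qed

lemma continuous_L2: assumes "continuous_on UNIV f" shows "L2 \<D> f"
proof -
  obtain B where B: "\<And>x. x \<in> closure \<Omega> \<Longrightarrow> norm (f x) \<le> B" using continuous_bounded[OF assms] by metis
  show ?thesis by (rule dom.L2_bounded[OF continuous_measurable[OF assms] AE_domainI]) (use B closure_subset in blast)
qed

lemma L2_continuous_scaleR: assumes "L2 \<D> f" "continuous_on UNIV c"
  shows "L2 \<D> (\<lambda>x. c x *\<^sub>R f x)"
proof -
  obtain B where B: "\<And>x. x \<in> closure \<Omega> \<Longrightarrow> norm (c x) \<le> B" using continuous_bounded[OF assms(2)] by metis
  show ?thesis by (rule L2_scaleR_bounded[OF assms(1) continuous_measurable[OF assms(2)] AE_domainI])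
       (use B closure_subset in force)
qed

lemma L2_bounded_bilinear_continuous:
  fixes prod :: "'b::{banach, second_countable_topology} \<Rightarrow> 'c::{banach, second_countable_topology} \<Rightarrow> 'd::{banach, second_countable_topology}"
  assumes p: "bounded_bilinear prod" and f: "L2 \<D> f" and c: "continuous_on UNIV c" shows "L2 \<D> (\<lambda>x. prod (f x) (c x))"
proof -
  interpret bounded_bilinear prod by (rule p)
  obtain K where K: "K > 0" "\<And>a b. norm (prod a b) \<le> norm a * norm b * K" using pos_bounded by blast
  obtain B where B: "B \<ge> 0" "\<And>x. x \<in> closure \<Omega> \<Longrightarrow> norm (c x) \<le> B" using continuous_bounded[OF c] by metis
  show ?thesis
  proof (rule L2_bound[OF bounded_bilinear_measurable[OF p L2_measurable[OF f] continuous_measurable[OF c]] f AE_domainI])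
    fix x assume "x \<in> \<Omega>"
    then have "norm (f x) * norm (c x) * K \<le> norm (f x) * B * K"
      using B closure_subset K by (intro mult_right_mono mult_left_mono) auto
    then show "norm (prod (f x) (c x)) \<le> (B * K) * norm (f x)" using K(2)[of "f x" "c x"] by (simp add: ac_simps)
  qed
qed

text \<open>The distributional divergence. Weak gradients and weak Laplacians are both instances,
  see \<open>is_weak_gradient_iff\<close> and \<open>is_weak_laplacian_iff\<close>, so uniqueness
  and Green's formula are proved once for this notion.\<close>

definition weak_div :: "(real^'n \<Rightarrow> complex^'n) \<Rightarrow> (real^'n \<Rightarrow> complex) \<Rightarrow> bool" where
  "weak_div F q \<longleftrightarrow> L2 \<D> F \<and> L2 \<D> q \<and>
     (\<forall>f\<in>test_functions \<Omega>. (\<integral>x. cdot (F x) (cvec (grad f x)) \<partial>\<D>) =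
        - (\<integral>x. q x * complex_of_real (f x) \<partial>\<D>))"

lemma is_weak_gradient_iff:
  "is_weak_gradient \<Omega> u G \<longleftrightarrow> L2 \<D> u \<and> L2 \<D> G \<and>
     (\<forall>i. weak_div (\<lambda>x. axis i (u x)) (\<lambda>x. G x $ i))" unfolding is_weak_gradient_def weak_div_def
  by (auto simp: cdot_axis cvec_def L2_axis L2_vec_component)

lemma compact_support_inI: assumes "compact K" "K \<subseteq> \<Omega>" "\<And>x. x \<notin> K \<Longrightarrow> f x = 0"
  shows "compact_support_in \<Omega> f"
proof -
  have "closure {x. f x \<noteq> 0} \<subseteq> K" using assms by (intro closure_minimal compact_imp_closed) auto
  moreover from this have "compact (closure {x. f x \<noteq> 0})"
    using compact_Int_closed[OF assms(1) closed_closure[of "{x. f x \<noteq> 0}"]] by (simp add: Int_absorb1)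
  ultimately show ?thesis using assms(2) unfolding compact_support_in_def by blast
qed

text \<open>Mollification at a width below the distance of the support from the boundary keeps the
  support compact in \<Omega>, and uniform continuity of \<open>f\<close> and its gradient gives
  uniform closeness. Products of C1 functions thereby become admissible in weak identities.\<close>

lemma test_function_approximation:
  fixes f :: "real^'n \<Rightarrow> real" assumes f: "Ck 1 f" "compact_support_in \<Omega> f" and e: "0 < e"
  obtains g where "g \<in> test_functions \<Omega>" "\<And>x. \<bar>g x - f x\<bar> \<le> e" "\<And>x. norm (grad g x - grad f x) \<le> e"
proof -
  define K where "K = closure {x. f x \<noteq> 0}"
  have K: "compact K" "K \<subseteq> \<Omega>" using f(2) by (auto simp: K_def compact_support_in_def)
  have f0: "x \<notin> K \<Longrightarrow> f x = 0" for x using closure_subset[of "{x. f x \<noteq> 0}"] by (auto simp: K_def)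
  note bs = compact_support_in_bounded_support[OF f(2)]
  obtain d0 where d0: "d0 > 0" "(\<Union>x\<in>K. cball x d0) \<subseteq> \<Omega>"
    using compact_subset_open_imp_cball_epsilon_subset[OF K(1) open_domain K(2)] by blast
  \<comment> \<open>The norm of the gradient is estimated by the sum over its
    \<open>CARD('n)\<close> components.\<close>
  define e' where "e' = e / real CARD('n)"
  have e': "e' > 0" using e by (simp add: e'_def)
  obtain d1 where d1: "d1 > 0" "\<And>x x'. dist x' x < d1 \<Longrightarrow> dist (f x') (f x) < e"
    using uniformly_continuous_bounded_support[OF Ck1_continuous[OF f(1)] bs] e
    unfolding uniformly_continuous_on_def by (metis UNIV_I)
  obtain d2 where d2: "d2 > 0" "\<And>x x'. dist x' x < d2 \<Longrightarrow> dist (grad f x') (grad f x) < e'"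
    using uniformly_continuous_bounded_support[OF Ck1_continuous_grad[OF f(1)] bounded_support_grad[OF bs]] e'
    unfolding uniformly_continuous_on_def by (metis UNIV_I)
  define d where "d = min d0 (min d1 d2) / 2"
  have d: "0 < d" "d \<le> d0" "d < d1" "d < d2" using d0(1) d1(1) d2(1) by (auto simp: d_def)
  obtain B where B: "\<And>x. norm (f x) \<le> B" using bounded_bounded_support[OF Ck1_continuous[OF f(1)] bs] by metis
  have m: "f \<in> borel_measurable borel" using Ck1_continuous[OF f(1)] by (rule borel_measurable_continuous_onI)
  show thesis
  proof (rule that[of "conv \<rho> d f"])
    have "conv \<rho> d f x = 0" if "x \<notin> (\<Union>x\<in>K. cball x d)" for x
    proof (rule conv_const[OF m B d(1)])
      fix y assume "dist x y \<le> d"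
      then have "y \<notin> K" using that by (auto simp: dist_commute)
      then show "f y = 0" by (rule f0)
    qed
    moreover have "(\<Union>x\<in>K. cball x d) = {x + y |x y. x \<in> K \<and> y \<in> cball 0 d}"
    proof safe
      fix x y assume "x \<in> K" "y \<in> cball x d"
      then show "\<exists>x' y'. y = x' + y' \<and> x' \<in> K \<and> y' \<in> cball 0 d"
        by (intro exI[of _ x] exI[of _ "y - x"]) (auto simp: dist_norm norm_minus_commute)
    next
      fix x y assume "x \<in> K" "y \<in> cball (0 :: real^'n) d"
      then show "x + y \<in> (\<Union>x\<in>K. cball x d)" by (intro UN_I[of x]) (auto simp: dist_norm)
    qed
    then have "compact (\<Union>x\<in>K. cball x d)" using compact_sums[OF K(1) compact_cball[of 0 d]] by simp
    moreover have "(\<Union>x\<in>K. cball x d) \<subseteq> \<Omega>" using d0(2) d(2) by (meson SUP_mono subset_cball subset_trans)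
    ultimately have "compact_support_in \<Omega> (conv \<rho> d f)" by (intro compact_support_inI)
    moreover have "Cinf (conv \<rho> d f)"
      unfolding Cinf_def using Ck_conv[OF d(1) integrable_bounded_support[OF Ck1_continuous[OF f(1)] bs]] by blast
    ultimately show "conv \<rho> d f \<in> test_functions \<Omega>" by (simp add: test_functions_def)
    show "\<bar>conv \<rho> d f x - f x\<bar> \<le> e" for x
    proof -
      have "norm (f (x - y) - f x) \<le> e" if "norm y \<le> d" for y
        using d1(2)[of "x - y" x] that d by (simp add: dist_norm)
      from conv_close[OF m B d(1) this] show ?thesis by simp
    qed
    show "norm (grad (conv \<rho> d f) x - grad f x) \<le> e" for x
    proof -
      have "\<bar>(grad (conv \<rho> d f) x - grad f x) $ i\<bar> \<le> e'" for i
      proof -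
        have c: "continuous_on UNIV (\<lambda>y. grad f y $ i)" using f(1) by simp
        obtain B' where B': "\<And>x. norm (grad f x $ i) \<le> B'"
          using bounded_bounded_support[OF c bounded_support_grad_component[OF bs]] by metis
        have "norm (conv \<rho> d (\<lambda>y. grad f y $ i) x - grad f x $ i) \<le> e'"
        proof (rule conv_close[OF borel_measurable_continuous_onI[OF c] B' d(1)])
          fix y :: "real^'n" assume "norm y \<le> d"
          then have "dist (grad f (x - y)) (grad f x) < e'" using d by (intro d2) (simp add: dist_norm)
          then show "norm (grad f (x - y) $ i - grad f x $ i) \<le> e'"
            using component_le_norm_cart[of "grad f (x - y) - grad f x" i] by (simp add: dist_norm)
        qed
        then show ?thesis by (simp add: grad_conv[OF d(1) f(1) bs])
      qed
      then have "norm (grad (conv \<rho> d f) x - grad f x) \<le> (\<Sum>i\<in>(UNIV :: 'n set). e')"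
        by (intro order_trans[OF norm_le_l1_cart] sum_mono)
      also have "\<dots> = e" by (simp add: e'_def)
      finally show ?thesis .
    qed
  qed
qed

lemma integrable_pair:
  fixes prod :: "'b::{banach, second_countable_topology} \<Rightarrow> 'c::{banach, second_countable_topology} \<Rightarrow> 'd::{banach, second_countable_topology}"
  assumes p: "bounded_bilinear prod" and f: "L2 \<D> f" and g: "L2 \<D> g"
    and le: "\<And>a b. norm (prod a b) \<le> norm a * norm b"
  shows "integrable \<D> (\<lambda>x. prod (f x) (g x))"
  by (rule integrable_L2_product[OF f g bounded_bilinear_measurable[OF p L2_measurable[OF f] L2_measurable[OF g]]])
     (simp add: le)

lemmas integrable_cdot = integrable_pair[OF bounded_bilinear_cdot _ _ norm_cdot_le]

lemma integrable_times:
  fixes f g :: "real^'n \<Rightarrow> complex" shows "L2 \<D> f \<Longrightarrow> L2 \<D> g \<Longrightarrow> integrable \<D> (\<lambda>x. f x * g x)"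
  by (rule integrable_pair[OF bounded_bilinear_mult]) (auto simp: norm_mult)

lemma L2_tendsto_uniform:
  assumes c: "\<And>k. continuous_on UNIV (F k)" "continuous_on UNIV f" and le: "\<And>k x. norm (F k x - f x) \<le> 1 / real (Suc k)"
  shows "L2_tendsto \<D> F f"
proof -
  have "l2norm \<D> (\<lambda>x. F k x - f x) \<le> 1 / real (Suc k) * sqrt (measure \<D> (space \<D>))" for k
    by (rule dom.l2norm_bounded_le[OF continuous_measurable AE_I2[OF le]]) (intro continuous_on_diff c, simp)
  moreover have "(\<lambda>k. 1 / real (Suc k) * sqrt (measure \<D> (space \<D>))) \<longlonglongrightarrow> 0"
    using tendsto_mult_left_zero[OF LIMSEQ_Suc[OF lim_1_over_n]] .
  ultimately have "(\<lambda>k. l2norm \<D> (\<lambda>x. F k x - f x)) \<longlonglongrightarrow> 0" by (rule l2norm_tendsto_0)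
  then show ?thesis using continuous_L2[OF c(1)] continuous_L2[OF c(2)] by (simp add: L2_tendsto_l2norm)
qed

lemma weak_div_C1: assumes F: "weak_div F q" and f: "Ck 1 f" "compact_support_in \<Omega> f"
  shows "(\<integral>x. cdot (F x) (cvec (grad f x)) \<partial>\<D>) = - (\<integral>x. q x * complex_of_real (f x) \<partial>\<D>)"
proof -
  have L: "L2 \<D> F" "L2 \<D> q" using F by (auto simp: weak_div_def)
  have "\<exists>g. g \<in> test_functions \<Omega> \<and> (\<forall>x. \<bar>g x - f x\<bar> \<le> 1 / real (Suc k)) \<and> (\<forall>x. norm (grad g x - grad f x) \<le> 1 / real (Suc k))" for k
    using test_function_approximation[OF f, of "1 / real (Suc k)"] by (metis of_nat_0_less_iff zero_less_Suc zero_less_divide_1_iff)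
  then obtain g where g: "\<And>k. g k \<in> test_functions \<Omega>" "\<And>k x. \<bar>g k x - f x\<bar> \<le> 1 / real (Suc k)"
    "\<And>k x. norm (grad (g k) x - grad f x) \<le> 1 / real (Suc k)" by metis
  have C: "Ck 1 (g k)" for k using g(1) by (auto simp: test_functions_def Cinf_def)
  have G: "L2_tendsto \<D> (\<lambda>k x. cvec (grad (g k) x)) (\<lambda>x. cvec (grad f x))"
    using g(3) by (intro L2_tendsto_uniform continuous_cvec Ck1_continuous_grad C f) (simp flip: cvec_diff)
  have T: "L2_tendsto \<D> (\<lambda>k x. complex_of_real (g k x)) (\<lambda>x. complex_of_real (f x))"
    using g(2) by (intro L2_tendsto_uniform continuous_on_of_real Ck1_continuous C f) (simp flip: of_real_diff)
  have "(\<lambda>k. - (\<integral>x. q x * complex_of_real (g k x) \<partial>\<D>)) \<longlonglongrightarrow> - (\<integral>x. q x * complex_of_real (f x) \<partial>\<D>)"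
    by (intro tendsto_minus L2_tendsto_pairing[OF bounded_bilinear_mult _ L(2) T]) (simp add: norm_mult)
  moreover have "- (\<integral>x. q x * complex_of_real (g k x) \<partial>\<D>) = (\<integral>x. cdot (F x) (cvec (grad (g k) x)) \<partial>\<D>)" for k
    using F g(1) by (simp add: weak_div_def)
  ultimately show ?thesis
    using L2_tendsto_pairing[OF bounded_bilinear_cdot norm_cdot_le L(1) G] by (intro LIMSEQ_unique) auto
qed

lemma weak_div_complex:
  fixes f :: "real^'n \<Rightarrow> complex" assumes F: "weak_div F q" and f: "Ck 1 f" "compact_support_in \<Omega> f"
  shows "(\<integral>x. cdot (F x) (grad f x) \<partial>\<D>) = - (\<integral>x. q x * f x \<partial>\<D>)"
proof -
  have L: "L2 \<D> F" "L2 \<D> q" using F by (auto simp: weak_div_def)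
  let ?R = "\<lambda>x. Re (f x)" and ?J = "\<lambda>x. Im (f x)"
  have C: "Ck 1 ?R" "Ck 1 ?J"
    using Ck_bounded_linear[OF bounded_linear_Re f(1)] Ck_bounded_linear[OF bounded_linear_Im f(1)] by auto
  have z: "f x = 0" if "x \<notin> closure {x. f x \<noteq> 0}" for x using that closure_subset[of "{x. f x \<noteq> 0}"] by blast
  have supp: "compact_support_in \<Omega> ?R" "compact_support_in \<Omega> ?J"
  proof -
    have K: "compact (closure {x. f x \<noteq> 0})" "closure {x. f x \<noteq> 0} \<subseteq> \<Omega>"
      using f(2) unfolding compact_support_in_def by blast+
    show "compact_support_in \<Omega> ?R" by (rule compact_support_inI[OF K]) (drule z, simp only: complex.sel zero_complex.simps)
    show "compact_support_in \<Omega> ?J" by (rule compact_support_inI[OF K]) (drule z, simp only: complex.sel zero_complex.simps)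
  qed
  have g: "grad f x = cvec (grad ?R x) + \<i> *s cvec (grad ?J x)" for x
    by (simp add: vec_eq_iff cvec_def grad_bounded_linear[OF bounded_linear_Re f(1)]
        grad_bounded_linear[OF bounded_linear_Im f(1)] complex_eq_iff)
  have g': "cdot (F x) (grad f x) = cdot (F x) (cvec (grad ?R x)) + \<i> * cdot (F x) (cvec (grad ?J x))" for x
    unfolding g cdot_def vector_add_component vector_smult_component distrib_left sum.distrib sum_distrib_left
    by (simp only: mult.left_commute)
  have f': "q x * f x = q x * of_real (?R x) + \<i> * (q x * of_real (?J x))" for x
    using arg_cong[OF complex_eq[of "f x"], of "(*) (q x)"] by (simp only: distrib_left mult.left_commute)
  have int: "integrable \<D> (\<lambda>x. cdot (F x) (cvec (grad p x)))"
     "integrable \<D> (\<lambda>x. q x * of_real (p x))" if "Ck 1 p" for p :: "real^'n \<Rightarrow> real"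
    by (intro integrable_cdot integrable_times L continuous_L2 continuous_cvec continuous_on_of_real Ck1_continuous_grad Ck1_continuous that)+
  show ?thesis
    unfolding g' f' using int[OF C(1)] int[OF C(2)] weak_div_C1[OF F C(1) supp(1)] weak_div_C1[OF F C(2) supp(2)]
    by (simp add: algebra_simps)
qed

text \<open>The limit \<open>G\<close> of the gradients is a separate argument, so that differences
  and conjugates can be formed without the choice made in \<open>weak_gradient\<close>.\<close>

definition zero_trace :: "(real^'n \<Rightarrow> complex) \<Rightarrow> (real^'n \<Rightarrow> complex^'n) \<Rightarrow> bool" where
  "zero_trace w G \<longleftrightarrow> (\<exists>U :: nat \<Rightarrow> real^'n \<Rightarrow> complex. (\<forall>k. Ck 1 (U k)) \<and>
     L2_tendsto \<D> U w \<and> L2_tendsto \<D> (\<lambda>k. grad (U k)) G \<and>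
     (\<forall>k. L2 (surface_measure \<Omega>) (U k)) \<and> (\<lambda>k. l2norm (surface_measure \<Omega>) (U k)) \<longlonglongrightarrow> 0)"

abbreviation layer :: "real \<Rightarrow> (real^'n) set" where
  "layer \<equiv> collar \<Omega>"

lemma frontier_nonempty: "frontier \<Omega> \<noteq> {}"
  using nonempty_domain bounded_domain frontier_not_empty not_bounded_UNIV by metis

lemma infdist_frontier_pos: "x \<in> \<Omega> \<Longrightarrow> 0 < infdist x (frontier \<Omega>)" using open_domain frontier_nonempty
  by (intro infdist_pos_not_in_closed) (auto simp: frontier_def interior_open)

text \<open>A ball is connected, so if it had points inside and outside \<Omega> it would meet the
  boundary.\<close>

lemma ball_infdist_subset: assumes "x \<in> \<Omega>" "r \<le> infdist x (frontier \<Omega>)" shows "ball x r \<subseteq> \<Omega>"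
proof (rule ccontr)
  assume "\<not> ball x r \<subseteq> \<Omega>"
  moreover then have "x \<in> ball x r" by (metis ball_empty centre_in_ball empty_subsetI not_le)
  ultimately have "ball x r \<inter> frontier \<Omega> \<noteq> {}" using assms(1) by (intro connected_Int_frontier connected_ball) blast+
  then obtain p where "p \<in> frontier \<Omega>" "dist x p < r" by auto
  then show False using infdist_le[of p "frontier \<Omega>" x] assms(2) by linarith
qed

lemma layer_borel [simp]: "layer e \<in> sets borel" by (rule collar_borel[OF open_domain])

definition inner_set :: "real \<Rightarrow> (real^'n) set" where
  "inner_set e = {x\<in>\<Omega>. e \<le> infdist x (frontier \<Omega>)}"

text \<open>Boundary points have distance 0, so \<Omega> may be replaced by its closure in
  \<open>inner_set e\<close>, which is then an intersection of closed sets.\<close>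

lemma inner_set_compact: "0 < e \<Longrightarrow> compact (inner_set e)"
proof -
  assume e: "0 < e"
  have "inner_set e = closure \<Omega> \<inter> {x. e \<le> infdist x (frontier \<Omega>)}"
  proof -
    have "infdist x (frontier \<Omega>) = 0" if "x \<in> closure \<Omega>" "x \<notin> \<Omega>" for x
      using that open_domain by (intro infdist_zero) (simp add: frontier_def interior_open)
    then show ?thesis using e closure_subset[of \<Omega>] by (force simp: inner_set_def)
  qed
  moreover have "closed {x :: real^'n. e \<le> infdist x (frontier \<Omega>)}" by (intro closed_Collect_le continuous_intros)
  ultimately show ?thesis using bounded_domain by (simp add: compact_Int_closed)
qed

text \<open>Mollifying at width \<open>e\<close> the indicator of the points at depth
  \<open>2 * e\<close> gives a function that vanishes at depth below \<open>e\<close> and equals 1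
  from depth \<open>3 * e\<close> on; from \<open>4 * e\<close> on it is 1 in a whole ball, so its
  gradient vanishes.\<close>

definition cutoff :: "real \<Rightarrow> real^'n \<Rightarrow> real" where
  "cutoff e = conv \<rho> e (indicator (inner_set (2 * e)))"

lemma cutoff_props: assumes e: "0 < e"
  shows cutoff_Ck: "Ck m (cutoff e)" and cutoff_support: "x \<notin> inner_set e \<Longrightarrow> cutoff e x = 0"
    and cutoff_bound: "\<bar>cutoff e x\<bar> \<le> 1"
    and cutoff_one: "x \<in> \<Omega> \<Longrightarrow> x \<notin> layer (4 * e) \<Longrightarrow> cutoff e x = 1"
    and cutoff_grad_zero: "x \<in> \<Omega> \<Longrightarrow> x \<notin> layer (4 * e) \<Longrightarrow> grad (cutoff e) x = 0"
proof -
  have cpt: "compact (inner_set (2 * e))" using e by (intro inner_set_compact) simp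
  let ?f = "indicator (inner_set (2 * e)) :: real^'n \<Rightarrow> real"
  have m: "?f \<in> borel_measurable borel" using cpt by (intro borel_measurable_indicator borel_compact)
  have B: "norm (?f x) \<le> 1" for x by (simp add: indicator_def)
  have int: "integrable lborel ?f"
    using emeasure_bounded_finite[OF compact_imp_bounded[OF cpt]] borel_compact[OF cpt] by (simp add: less_top)
  show "Ck m (cutoff e)" unfolding cutoff_def by (rule Ck_conv[OF e int])
  show "\<bar>cutoff e x\<bar> \<le> 1" unfolding cutoff_def using norm_conv_le[OF m B e, of x] by simp
  have tri: "infdist x (frontier \<Omega>) \<le> infdist y (frontier \<Omega>) + dist x y" for x y by (rule infdist_triangle)
  show "cutoff e x = 0" if x: "x \<notin> inner_set e" unfolding cutoff_def
  proof (rule conv_const[OF m B e])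
    fix y assume y: "dist x y \<le> e"
    have "y \<notin> inner_set (2 * e)"
    proof
      assume y2: "y \<in> inner_set (2 * e)"
      then have "x \<in> \<Omega>" using ball_infdist_subset[of y "2 * e"] y e by (auto simp: inner_set_def dist_commute)
      moreover have "e \<le> infdist x (frontier \<Omega>)" using tri[of y x] y y2 by (auto simp: inner_set_def dist_commute)
      ultimately show False using x by (simp add: inner_set_def)
    qed
    then show "?f y = 0" by simp
  qed
  have one: "cutoff e z = 1" if z: "z \<in> \<Omega>" "3 * e \<le> infdist z (frontier \<Omega>)" for z unfolding cutoff_def
  proof (rule conv_const[OF m B e])
    fix y assume y: "dist z y \<le> e"
    have "y \<in> \<Omega>" using ball_infdist_subset[OF z] y e by auto
    moreover have "2 * e \<le> infdist y (frontier \<Omega>)" using tri[of z y] y z by linarith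
    ultimately show "?f y = 1" by (simp add: inner_set_def)
  qed
  show "cutoff e x = 1" if "x \<in> \<Omega>" "x \<notin> layer (4 * e)" using that e by (intro one) (auto simp: collar_def)
  show "grad (cutoff e) x = 0" if x: "x \<in> \<Omega>" "x \<notin> layer (4 * e)"
  proof -
    have x': "4 * e \<le> infdist x (frontier \<Omega>)" using x by (simp add: collar_def)
    have c1: "cutoff e y = 1" if "y \<in> ball x e" for y
    proof (rule one)
      show "y \<in> \<Omega>" using ball_infdist_subset[OF x(1) x'] that e by auto
      show "3 * e \<le> infdist y (frontier \<Omega>)" using tri[of x y] that x' by auto
    qed
    have "((\<lambda>_. 1 :: real) has_derivative (\<lambda>_. 0)) (at x)" by simp
    then have "(cutoff e has_derivative (\<lambda>_. 0)) (at x)"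
      by (rule has_derivative_transform_within_open[of _ _ _ _ "ball x e"]) (use c1 e in auto)
    then show ?thesis by (simp add: vec_eq_iff grad_eqI)
  qed
qed

lemma cutoff_grad_bound: obtains K where "K \<ge> 0" "\<And>e x. 0 < e \<Longrightarrow> norm (grad (cutoff e) x) \<le> K / e"
proof -
  obtain K where K: "K \<ge> 0" "\<And>d. 0 < d \<Longrightarrow> integrable lborel (\<lambda>y. norm (grad (mollifier \<rho> d) y))"
    "\<And>d. 0 < d \<Longrightarrow> (\<integral>y. norm (grad (mollifier \<rho> d) y) \<partial>lborel) \<le> K / d" using grad_kernel_integral_bound by metis
  show thesis
  proof (rule that[of "real CARD('n) * K"])
    show "real CARD('n) * K \<ge> 0" using K by simp
    fix e :: real and x assume e: "0 < e"
    let ?f = "indicator (inner_set (2 * e)) :: real^'n \<Rightarrow> real"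
    have cpt: "compact (inner_set (2 * e))" using e by (intro inner_set_compact) simp
    have int: "integrable lborel ?f"
      using emeasure_bounded_finite[OF compact_imp_bounded[OF cpt]] borel_compact[OF cpt] by (simp add: less_top)
    have B: "norm (?f x) \<le> 1" for x by (simp add: indicator_def)
    have "\<bar>grad (cutoff e) x $ i\<bar> \<le> K / e" for i
      unfolding cutoff_def using norm_grad_conv_le[OF e int B K(2)[OF e] K(3)[OF e], of x i] by simp
    then have "norm (grad (cutoff e) x) \<le> (\<Sum>i\<in>(UNIV :: 'n set). K / e)"
      by (intro order_trans[OF norm_le_l1_cart] sum_mono)
    then show "norm (grad (cutoff e) x) \<le> real CARD('n) * K / e" by simp
  qed
qed

lemma nn_integral_domain: assumes [measurable]: "f \<in> borel_measurable borel" "S \<in> sets borel" and "S \<subseteq> \<Omega>"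
  shows "(\<integral>\<^sup>+x. indicator S x * ennreal (f x) \<partial>lborel) = (\<integral>\<^sup>+x. indicator S x * ennreal (f x) \<partial>\<D>)"
proof -
  have "(\<integral>\<^sup>+x. indicator S x * ennreal (f x) \<partial>\<D>) = (\<integral>\<^sup>+x. indicator S x * ennreal (f x) * indicator \<Omega> x \<partial>lebesgue)"
    by (rule nn_integral_restrict_space) simp
  also have "\<dots> = (\<integral>\<^sup>+x. indicator S x * ennreal (f x) * indicator \<Omega> x \<partial>lborel)" by (rule nn_integral_completion)
  also have "\<dots> = (\<integral>\<^sup>+x. indicator S x * ennreal (f x) \<partial>lborel)"
    using assms(3) by (intro nn_integral_cong) (auto simp: indicator_def)
  finally show ?thesis ..
qed

definition restr :: "(real^'n) set \<Rightarrow> (real^'n \<Rightarrow> 'b::{banach, second_countable_topology}) \<Rightarrow> real^'n \<Rightarrow> 'b" where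
  "restr S f x = indicator S x *\<^sub>R f x"

lemma restr_measurable: "f \<in> borel_measurable \<D> \<Longrightarrow> restr (layer e) f \<in> borel_measurable \<D>" unfolding restr_def[abs_def]
  by (rule borel_measurable_scaleR[OF borel_measurable_domain[OF borel_measurable_indicator[OF layer_borel]]])

lemma norm_restr_le: "norm (restr S f x) \<le> norm (f x)" by (simp add: restr_def indicator_def)

lemma L2_restr: "L2 \<D> f \<Longrightarrow> L2 \<D> (restr (layer e) f)"
  by (rule L2_bound[where g = f and c = 1]) (auto intro: restr_measurable L2_measurable norm_restr_le)

lemma L2_tendsto_restr: assumes T: "L2_tendsto \<D> U u"
  shows "L2_tendsto \<D> (\<lambda>k. restr (layer e) (U k)) (restr (layer e) u)" unfolding L2_tendsto_l2norm
proof (intro conjI allI)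
  have L: "\<And>k. L2 \<D> (U k)" "L2 \<D> u" "(\<lambda>k. l2norm \<D> (\<lambda>x. U k x - u x)) \<longlonglongrightarrow> 0" using T by (auto simp: L2_tendsto_l2norm)
  show "L2 \<D> (restr (layer e) (U k))" for k by (rule L2_restr[OF L(1)])
  show "L2 \<D> (restr (layer e) u)" by (rule L2_restr[OF L(2)])
  have "l2norm \<D> (\<lambda>x. restr (layer e) (U k) x - restr (layer e) u x) \<le> 1 * l2norm \<D> (\<lambda>x. U k x - u x)" for k
  proof (rule l2norm_le[OF _ L2_diff[OF L(1,2)]])
    show "(\<lambda>x. restr (layer e) (U k) x - restr (layer e) u x) \<in> borel_measurable \<D>"
      by (intro borel_measurable_diff restr_measurable L2_measurable L)
  qed (auto simp: restr_def indicator_def)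
  then show "(\<lambda>k. l2norm \<D> (\<lambda>x. restr (layer e) (U k) x - restr (layer e) u x)) \<longlonglongrightarrow> 0"
    using L(3) by (intro l2norm_tendsto_0) auto
qed

lemma restr_l2norm_sq: assumes f: "continuous_on UNIV f"
  shows "(\<integral>\<^sup>+x. indicator (layer e) x * ennreal ((norm (f x))^2) \<partial>lborel) = ennreal ((l2norm \<D> (restr (layer e) f))^2)"
proof -
  have m: "(\<lambda>x. (norm (f x))^2) \<in> borel_measurable borel"
    using f by (intro borel_measurable_continuous_onI continuous_intros)
  have "(\<integral>\<^sup>+x. indicator (layer e) x * ennreal ((norm (f x))^2) \<partial>lborel) =
      (\<integral>\<^sup>+x. indicator (layer e) x * ennreal ((norm (f x))^2) \<partial>\<D>)"
    by (rule nn_integral_domain[OF m]) (auto simp: collar_def[of _ e] intro: layer_borel[unfolded collar_def])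
  also have "\<dots> = (\<integral>\<^sup>+x. ennreal ((norm (restr (layer e) f x))^2) \<partial>\<D>)"
    by (intro nn_integral_cong) (auto simp: restr_def indicator_def)
  also have "\<dots> = ennreal ((l2norm \<D> (restr (layer e) f))^2)" unfolding l2norm_sq
    by (rule nn_integral_eq_integral) (use L2_square_integrable[OF L2_restr[OF continuous_L2[OF f]]] in auto)
  finally show ?thesis .
qed

text \<open>\<open>layer_bound\<close> is applied to the approximating functions, whose boundary
  integrals tend to 0, and then the limit is taken on both sides.\<close>

lemma zero_trace_layer: obtains C where "C \<ge> 1"
    "\<And>e w G. \<lbrakk>0 < e; C * e \<le> 1; zero_trace w G\<rbrakk> \<Longrightarrow>
      l2norm \<D> (restr (layer e) w) \<le> C * e * l2norm \<D> (restr (layer (C * e)) G)"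
proof -
  obtain C where C: "C \<ge> 1" "layer_bound \<Omega> UNIV C"
    by (rule boundary_layer[OF dim open_domain bounded_domain C11 frontier_nonempty]) (rule that)
  show thesis
  proof (rule that[OF C(1)])
    fix e w G assume e: "0 < e" "C * e \<le> 1" and "zero_trace w G"
    then obtain U :: "nat \<Rightarrow> real^'n \<Rightarrow> complex" where U: "\<And>k. Ck 1 (U k)" "L2_tendsto \<D> U w"
      "L2_tendsto \<D> (\<lambda>k. grad (U k)) G" "\<And>k. L2 (surface_measure \<Omega>) (U k)"
      "(\<lambda>k. l2norm (surface_measure \<Omega>) (U k)) \<longlonglongrightarrow> 0" unfolding zero_trace_def by blast
    let ?n = "\<lambda>e f. l2norm \<D> (restr (layer e) f)"
    have bound: "(?n e (U k))^2 \<le> C * e * (l2norm (surface_measure \<Omega>) (U k))^2 + C * e^2 * (?n (C * e) (grad (U k)))^2" for k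
    proof -
      have "ennreal ((?n e (U k))^2) \<le> ennreal (C * e) * (\<integral>\<^sup>+x. ennreal ((norm (U k x))^2) \<partial>surface_measure \<Omega>)
          + ennreal (C * e^2) * ennreal ((?n (C * e) (grad (U k)))^2)" using C(2) e U(1)[of k]
        by (simp add: layer_bound_def flip: restr_l2norm_sq[OF Ck1_continuous[OF U(1)]] restr_l2norm_sq[OF Ck1_continuous_grad[OF U(1)]])
      also have "(\<integral>\<^sup>+x. ennreal ((norm (U k x))^2) \<partial>surface_measure \<Omega>) = ennreal ((l2norm (surface_measure \<Omega>) (U k))^2)"
        unfolding l2norm_sq by (rule nn_integral_eq_integral) (use L2_square_integrable[OF U(4)] in auto)
      finally show ?thesis using C(1) e by (simp add: ennreal_mult'[symmetric] ennreal_plus[symmetric] del: ennreal_plus)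
    qed
    have "(\<lambda>k. (?n e (U k))^2) \<longlonglongrightarrow> (?n e w)^2" by (intro tendsto_power L2_tendsto_norm L2_tendsto_restr U)
    moreover have "(\<lambda>k. C * e * (l2norm (surface_measure \<Omega>) (U k))^2 + C * e^2 * (?n (C * e) (grad (U k)))^2)
        \<longlonglongrightarrow> C * e * 0^2 + C * e^2 * (?n (C * e) G)^2"
      by (intro tendsto_add tendsto_mult_left tendsto_power U(5) L2_tendsto_norm L2_tendsto_restr U(3))
    ultimately have "(?n e w)^2 \<le> C * e * 0^2 + C * e^2 * (?n (C * e) G)^2" by (rule LIMSEQ_le) (use bound in blast)
    \<comment> \<open>Since \<open>C \<ge> 1\<close>, the factor \<open>C\<close> may be replaced by
      its square, so that the right hand side becomes a square.\<close>
    also have "\<dots> \<le> C^2 * (e^2 * (?n (C * e) G)^2)"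
      using mult_right_mono[OF self_le_power[OF C(1), of 2], of "e^2 * (?n (C * e) G)^2"] by (simp add: mult.assoc)
    also have "\<dots> = (C * e * ?n (C * e) G)^2" by (simp only: power_mult_distrib mult.assoc)
    finally show "?n e w \<le> C * e * ?n (C * e) G" by (rule power2_le_imp_le) (use C e in simp)
  qed
qed

lemma layer_pairing:
  fixes h :: "real^'n \<Rightarrow> complex" assumes f: "L2 \<D> f" and g: "L2 \<D> g" and h: "h \<in> borel_measurable \<D>"
    and zero: "\<And>x. x \<in> \<Omega> \<Longrightarrow> x \<notin> layer e \<Longrightarrow> h x = 0" and le: "\<And>x. norm (h x) \<le> c * norm (f x) * norm (g x)" and c: "0 \<le> c"
  shows "norm (\<integral>x. h x \<partial>\<D>) \<le> c * l2norm \<D> f * l2norm \<D> (restr (layer e) g)"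
proof -
  have "norm (\<integral>x. h x \<partial>\<D>) \<le> l2norm \<D> (\<lambda>x. c *\<^sub>R f x) * l2norm \<D> (restr (layer e) g)"
  proof (rule cauchy_schwarz_integral[OF L2_scaleR[OF f] L2_restr[OF g] h AE_domainI])
    fix x assume x: "x \<in> \<Omega>"
    show "norm (h x) \<le> norm (c *\<^sub>R f x) * norm (restr (layer e) g x)"
      using zero[OF x] le[of x] c by (cases "x \<in> layer e") (auto simp: restr_def)
  qed
  also have "\<dots> \<le> c * l2norm \<D> f * l2norm \<D> (restr (layer e) g)" by (intro mult_right_mono l2norm_scaleR_le f c) simp
  finally show ?thesis .
qed

text \<open>Every point of \<Omega> has positive distance from the boundary and so eventually leaves
  the collars; then dominated convergence.\<close>

lemma restr_layer_tendsto_0: assumes G: "L2 \<D> G" and a: "a \<longlonglongrightarrow> 0"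
  shows "(\<lambda>n. l2norm \<D> (restr (layer (a n)) G)) \<longlonglongrightarrow> 0"
proof -
  have "(\<lambda>n. \<integral>x. (norm (restr (layer (a n)) G x))^2 \<partial>\<D>) \<longlonglongrightarrow> (\<integral>x. 0 \<partial>\<D>)"
  proof (rule integral_dominated_convergence[where w = "\<lambda>x. (norm (G x))^2"])
    show "AE x in \<D>. (\<lambda>n. (norm (restr (layer (a n)) G x))^2) \<longlonglongrightarrow> 0"
    proof (rule AE_domainI)
      fix x assume x: "x \<in> \<Omega>"
      have "\<forall>\<^sub>F n in sequentially. a n < infdist x (frontier \<Omega>)"
        using order_tendstoD(2)[OF a infdist_frontier_pos[OF x]] .
      then have "\<forall>\<^sub>F n in sequentially. (norm (restr (layer (a n)) G x))^2 = 0"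
        by eventually_elim (simp add: restr_def collar_def)
      then show "(\<lambda>n. (norm (restr (layer (a n)) G x))^2) \<longlonglongrightarrow> 0" by (rule tendsto_eventually)
    qed
    show "AE x in \<D>. norm ((norm (restr (layer (a n)) G x))^2) \<le> (norm (G x))^2" for n
      by (rule AE_domainI) (simp add: norm_restr_le power_mono)
  qed (use L2_square_integrable[OF G] L2_square_integrable[OF L2_restr[OF G]] in auto)
  from tendsto_real_sqrt[OF this] show ?thesis by (simp add: l2norm_def)
qed

text \<open>Multiply the approximating functions by a cutoff at distance \<open>e\<close> from the boundary; by the Hardy-type
  estimate \<open>zero_trace_layer\<close> the derivative of the cutoff does not contribute in the limit.\<close>

theorem green_zero_trace: assumes F: "weak_div F q" and zt: "zero_trace w G"
  shows "(\<integral>x. cdot (F x) (G x) \<partial>\<D>) = - (\<integral>x. q x * w x \<partial>\<D>)"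
proof -
  have L: "L2 \<D> F" "L2 \<D> q" using F by (auto simp: weak_div_def)
  obtain U :: "nat \<Rightarrow> real^'n \<Rightarrow> complex" where U: "\<And>k. Ck 1 (U k)" "L2_tendsto \<D> U w" "L2_tendsto \<D> (\<lambda>k. grad (U k)) G"
    using zt unfolding zero_trace_def by blast
  have Lw: "L2 \<D> w" "L2 \<D> G" using U by (auto simp: L2_tendsto_def)
  obtain C where C: "C \<ge> 1" "\<And>e w G. \<lbrakk>0 < e; C * e \<le> 1; zero_trace w G\<rbrakk> \<Longrightarrow>
      l2norm \<D> (restr (layer e) w) \<le> C * e * l2norm \<D> (restr (layer (C * e)) G)"
    by (rule zero_trace_layer) (rule that)
  obtain K where K: "K \<ge> 0" "\<And>e x. 0 < e \<Longrightarrow> norm (grad (cutoff e) x) \<le> K / e" using cutoff_grad_bound by metis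
  let ?D = "(\<integral>x. cdot (F x) (G x) \<partial>\<D>) + (\<integral>x. q x * w x \<partial>\<D>)"
  let ?b = "\<lambda>e. 2 * l2norm \<D> F * l2norm \<D> (restr (layer (4 * e)) G) + 2 * l2norm \<D> q * l2norm \<D> (restr (layer (4 * e)) w)
     + 4 * K * C * l2norm \<D> F * l2norm \<D> (restr (layer (C * (4 * e))) G)"
  have bound: "norm ?D \<le> ?b e" if e: "0 < e" "C * (4 * e) \<le> 1" for e
  proof -
    let ?z = "cutoff e"
    have z: "Ck 1 ?z" by (rule cutoff_Ck[OF e(1)])
    note cz = Ck1_continuous[OF z] and cg = continuous_cvec[OF Ck1_continuous_grad[OF z]]
    have LF: "L2 \<D> (\<lambda>x. ?z x *\<^sub>R F x)" by (rule L2_continuous_scaleR[OF L(1) cz])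
    have Lq: "L2 \<D> (\<lambda>x. ?z x *\<^sub>R q x)" by (rule L2_continuous_scaleR[OF L(2) cz])
    have Lg: "L2 \<D> (\<lambda>x. cdot (F x) (cvec (grad ?z x)))"
      by (rule L2_bounded_bilinear_continuous[OF bounded_bilinear_cdot L(1) cg])
    \<comment> \<open>The product of \<open>U k\<close> with the cutoff is C1 with compact support
      in \<Omega>, hence admissible in the weak identity.\<close>
    have step: "(\<integral>x. cdot (?z x *\<^sub>R F x) (grad (U k) x) \<partial>\<D>) + (\<integral>x. cdot (F x) (cvec (grad ?z x)) * U k x \<partial>\<D>)
        = - (\<integral>x. (?z x *\<^sub>R q x) * U k x \<partial>\<D>)" for k
    proof -
      have "compact_support_in \<Omega> (\<lambda>x. U k x * of_real (?z x))"
      proof (rule compact_support_inI[OF inner_set_compact[OF e(1)]])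
        show "inner_set e \<subseteq> \<Omega>" by (auto simp: inner_set_def)
      qed (simp add: cutoff_support[OF e(1)])
      note weak_div_complex[OF F grad_times_of_real(1)[OF U(1) z] this]
      moreover have "cdot (F x) (grad (\<lambda>x. U k x * of_real (?z x)) x) =
          cdot (?z x *\<^sub>R F x) (grad (U k) x) + cdot (F x) (cvec (grad ?z x)) * U k x" for x
        unfolding grad_times_of_real(2)[OF U(1) z] cdot_def vector_add_component vector_smult_component
          distrib_left sum.distrib sum_distrib_right vector_scaleR_component
        by (simp add: ac_simps scaleR_conv_of_real)
      moreover have "q x * (U k x * of_real (?z x)) = (?z x *\<^sub>R q x) * U k x" for x
        by (simp add: scaleR_conv_of_real ac_simps)
      moreover have "integrable \<D> (\<lambda>x. cdot (?z x *\<^sub>R F x) (grad (U k) x))"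
        by (rule integrable_cdot[OF LF continuous_L2[OF Ck1_continuous_grad[OF U(1)]]])
      moreover have "integrable \<D> (\<lambda>x. cdot (F x) (cvec (grad ?z x)) * U k x)"
        by (rule integrable_times[OF Lg continuous_L2[OF Ck1_continuous[OF U(1)]]])
      ultimately show ?thesis by simp
    qed
    have lim1: "(\<lambda>k. (\<integral>x. cdot (?z x *\<^sub>R F x) (grad (U k) x) \<partial>\<D>) + (\<integral>x. cdot (F x) (cvec (grad ?z x)) * U k x \<partial>\<D>))
        \<longlonglongrightarrow> (\<integral>x. cdot (?z x *\<^sub>R F x) (G x) \<partial>\<D>) + (\<integral>x. cdot (F x) (cvec (grad ?z x)) * w x \<partial>\<D>)"
      by (intro tendsto_add L2_tendsto_pairing[OF bounded_bilinear_cdot norm_cdot_le LF U(3)]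
           L2_tendsto_pairing[OF bounded_bilinear_mult _ Lg U(2)]) (simp add: norm_mult)
    have lim2: "(\<lambda>k. - (\<integral>x. (?z x *\<^sub>R q x) * U k x \<partial>\<D>)) \<longlonglongrightarrow> - (\<integral>x. (?z x *\<^sub>R q x) * w x \<partial>\<D>)"
      by (intro tendsto_minus L2_tendsto_pairing[OF bounded_bilinear_mult _ Lq U(2)]) (simp add: norm_mult)
    have id: "(\<integral>x. cdot (?z x *\<^sub>R F x) (G x) \<partial>\<D>) + (\<integral>x. cdot (F x) (cvec (grad ?z x)) * w x \<partial>\<D>)
        = - (\<integral>x. (?z x *\<^sub>R q x) * w x \<partial>\<D>)" using LIMSEQ_unique[OF lim1[unfolded step] lim2] by simp
    let ?I1 = "\<integral>x. (1 - ?z x) *\<^sub>R cdot (F x) (G x) \<partial>\<D>" and ?I2 = "\<integral>x. (1 - ?z x) *\<^sub>R (q x * w x) \<partial>\<D>"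
      and ?I3 = "\<integral>x. cdot (F x) (cvec (grad ?z x)) * w x \<partial>\<D>"
    have i1: "integrable \<D> (\<lambda>x. cdot (F x) (G x))" "integrable \<D> (\<lambda>x. cdot (?z x *\<^sub>R F x) (G x))"
      by (rule integrable_cdot[OF L(1) Lw(2)], rule integrable_cdot[OF LF Lw(2)])
    have i2: "integrable \<D> (\<lambda>x. q x * w x)" "integrable \<D> (\<lambda>x. (?z x *\<^sub>R q x) * w x)"
      by (rule integrable_times[OF L(2) Lw(1)], rule integrable_times[OF Lq Lw(1)])
    have e1: "?I1 = (\<integral>x. cdot (F x) (G x) \<partial>\<D>) - (\<integral>x. cdot (?z x *\<^sub>R F x) (G x) \<partial>\<D>)"
      unfolding Bochner_Integration.integral_diff[OF i1, symmetric]
      by (simp add: scaleR_diff_left bounded_bilinear.scaleR_left[OF bounded_bilinear_cdot])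
    have e2: "?I2 = (\<integral>x. q x * w x \<partial>\<D>) - (\<integral>x. (?z x *\<^sub>R q x) * w x \<partial>\<D>)"
      unfolding Bochner_Integration.integral_diff[OF i2, symmetric] by (simp add: scaleR_diff_left)
    \<comment> \<open>The defect of Green's formula consists of integrals that live in the collar of
      width \<open>4 * e\<close>: two with \<open>1 - ?z\<close>, one with the gradient of the
      cutoff.\<close>
    have D: "?D = ?I1 + ?I2 - ?I3"
    proof -
      have "x + y = (x - p) + (y - r) - c" if "p + c = - r" for x y p r c :: complex
      proof -
        have "c = - r - p" using that by (metis add_diff_cancel_left')
        then show ?thesis by simp
      qed
      from this[OF id] show ?thesis unfolding e1 e2 .
    qed
    have z2: "\<bar>1 - ?z x\<bar> \<le> 2" for x using cutoff_bound[OF e(1), of x] by (simp add: abs_le_iff)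
    have m: "(\<lambda>x. 1 - ?z x) \<in> borel_measurable \<D>" by (intro continuous_measurable continuous_on_diff cz) auto
    have "norm ?I1 \<le> 2 * l2norm \<D> F * l2norm \<D> (restr (layer (4 * e)) G)"
    proof (rule layer_pairing[OF L(1) Lw(2)])
      show "norm ((1 - ?z x) *\<^sub>R cdot (F x) (G x)) \<le> 2 * norm (F x) * norm (G x)" for x
        unfolding norm_scaleR mult.assoc by (intro mult_mono z2 norm_cdot_le) auto
    qed (use m borel_measurable_integrable[OF i1(1)] in \<open>auto simp: cutoff_one[OF e(1)]\<close>)
    moreover have "norm ?I2 \<le> 2 * l2norm \<D> q * l2norm \<D> (restr (layer (4 * e)) w)"
    proof (rule layer_pairing[OF L(2) Lw(1)])
      show "norm ((1 - ?z x) *\<^sub>R (q x * w x)) \<le> 2 * norm (q x) * norm (w x)" for x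
        unfolding norm_scaleR norm_mult mult.assoc by (intro mult_mono z2) auto
    qed (use m borel_measurable_integrable[OF i2(1)] in \<open>auto simp: cutoff_one[OF e(1)]\<close>)
    moreover have "norm ?I3 \<le> (K / e) * l2norm \<D> F * l2norm \<D> (restr (layer (4 * e)) w)"
    proof (rule layer_pairing[OF L(1) Lw(1) borel_measurable_integrable[OF integrable_times[OF Lg Lw(1)]]])
      show "cdot (F x) (cvec (grad ?z x)) * w x = 0" if "x \<in> \<Omega>" "x \<notin> layer (4 * e)" for x
        using cutoff_grad_zero[OF e(1) that] by (simp add: cvec_def cdot_def)
      show "norm (cdot (F x) (cvec (grad ?z x)) * w x) \<le> (K / e) * norm (F x) * norm (w x)" for x
      proof -
        have "norm (cdot (F x) (cvec (grad ?z x))) \<le> norm (F x) * norm (grad ?z x)"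
          using norm_cdot_le by (metis norm_cvec)
        also have "\<dots> \<le> norm (F x) * (K / e)" by (intro mult_left_mono K(2) e) auto
        finally show ?thesis unfolding norm_mult by (intro mult_right_mono) (simp_all add: mult.commute)
      qed
    qed (use K e in simp)
    \<comment> \<open>The factor \<open>1 / e\<close> from the cutoff is compensated by the factor
      \<open>e\<close> of the layer estimate; what remains is the norm of \<open>G\<close> in a
      shrinking collar.\<close>
    moreover have "(K / e) * l2norm \<D> F * l2norm \<D> (restr (layer (4 * e)) w) \<le>
        (K / e) * l2norm \<D> F * (C * (4 * e) * l2norm \<D> (restr (layer (C * (4 * e))) G))"
      using K e by (intro mult_left_mono C(2) zt) auto
    moreover have "(K / e) * l2norm \<D> F * (C * (4 * e) * l2norm \<D> (restr (layer (C * (4 * e))) G)) =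
        4 * K * C * l2norm \<D> F * l2norm \<D> (restr (layer (C * (4 * e))) G)" using e by simp
    moreover have "norm ?D \<le> norm ?I1 + norm ?I2 + norm ?I3"
      unfolding D by (rule order_trans[OF norm_triangle_ineq4]) (simp add: norm_triangle_ineq)
    ultimately show ?thesis by linarith
  qed
  \<comment> \<open>Widths tending to 0 within the range \<open>C * (4 * e) \<le> 1\<close> of the
    layer estimate.\<close>
  define a where "a n = 1 / (4 * C) / real (Suc n)" for n
  have a: "a n > 0" "C * (4 * a n) \<le> 1" for n using C(1) by (simp_all add: a_def)
  have a0: "a \<longlonglongrightarrow> 0"
    unfolding a_def[abs_def] by (intro real_tendsto_divide_at_top[OF tendsto_const] filterlim_compose[OF filterlim_real_sequentially] filterlim_Suc)
  have "(\<lambda>n. c * a n) \<longlonglongrightarrow> 0" for c using tendsto_mult_left[OF a0, of c] by simp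
  from this[of 4] this[of "C * 4"]
  have "(\<lambda>n. ?b (a n)) \<longlonglongrightarrow> 2 * l2norm \<D> F * 0 + 2 * l2norm \<D> q * 0 + 4 * K * C * l2norm \<D> F * 0"
    by (intro tendsto_add tendsto_mult_left restr_layer_tendsto_0 Lw) (simp_all add: mult.assoc)
  then have "norm ?D \<le> 2 * l2norm \<D> F * 0 + 2 * l2norm \<D> q * 0 + 4 * K * C * l2norm \<D> F * 0"
    by (rule LIMSEQ_le_const) (use bound[OF a] in blast)
  then show ?thesis by (simp add: eq_neg_iff_add_eq_0)
qed

end

lemma compact_infdist_le:
  fixes K :: "(real^'n) set" assumes "compact K" "K \<noteq> {}" shows "compact {x. infdist x K \<le> d}"
proof -
  have "closed {x. infdist x K \<le> d}" by (intro closed_Collect_le continuous_intros)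
  moreover have "bounded {x. infdist x K \<le> d}"
  proof -
    obtain B where B: "\<And>y. y \<in> K \<Longrightarrow> norm y \<le> B" using compact_imp_bounded[OF assms(1)] by (auto simp: bounded_iff)
    have "norm x \<le> B + d" if "infdist x K \<le> d" for x
    proof -
      obtain y where y: "y \<in> K" "infdist x K = dist x y" using infdist_attains_inf[OF compact_imp_closed[OF assms(1)] assms(2)] by metis
      then show ?thesis using that B[OF y(1)] norm_triangle_sub[of x y] by (simp add: dist_norm)
    qed
    then show ?thesis by (auto simp: bounded_iff)
  qed
  ultimately show ?thesis by (simp add: compact_eq_bounded_closed)
qed

lemma L2_cmult: "L2 M q \<Longrightarrow> L2 M (\<lambda>x. (c::complex) * q x)" by (rule L2_mult_bounded[where B = "norm c"]) auto

lemma norm_smult_vec: "norm (c *s (z :: complex^'m)) = norm c * norm z"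
  unfolding norm_vec_def vector_smult_component norm_mult by (simp add: L2_set_right_distrib)

lemma bounded_bilinear_smult: "bounded_bilinear (\<lambda>(c::complex) (z :: complex^'m). c *s z)"
proof
  show "\<exists>K. \<forall>a b. norm (a *s b :: complex^'m) \<le> norm a * norm b * K" by (rule exI[of _ 1]) (simp add: norm_smult_vec)
qed (simp_all add: vec_eq_iff algebra_simps)

lemma L2_smult: assumes "L2 M F" shows "L2 M (\<lambda>x. (c::complex) *s (F x :: complex^'m))"
  by (rule L2_bound[where g = F and c = "norm c"])
     (use assms in \<open>auto simp: norm_smult_vec intro!: bounded_bilinear_measurable[OF bounded_bilinear_smult] dest: L2_measurable\<close>)

lemma AE_vecI: "(\<And>i. AE x in M. (f x :: 'b^'m) $ i = g x $ i) \<Longrightarrow> AE x in M. f x = g x"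
  unfolding vec_eq_iff by (subst AE_all_countable) auto

text \<open>By translation invariance the integral of \<open>f (x + y)\<close> over \<open>y\<close>
  is constant for small \<open>x\<close>; its derivative at 0 is the integral of the partial
  derivative.\<close>

lemma integral_partial_derivative:
  fixes f :: "real^'n \<Rightarrow> complex" assumes f: "Ck 1 f" and s: "bounded_support f" shows "(\<integral>x. grad f x $ i \<partial>lborel) = 0"
proof -
  obtain R where R: "\<And>x. R < norm x \<Longrightarrow> f x = 0" using s by (auto simp: bounded_support_def)
  obtain R' where R': "\<And>x. R' < norm x \<Longrightarrow> grad f x = 0"
    using bounded_support_grad[OF s] by (auto simp: bounded_support_def)
  \<comment> \<open>A ball so large that shifts by less than 1 keep the support inside; its
    indicator is the integrable weight for \<open>grad_weighted_translate\<close>.\<close>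
  define S where "S = max R R' + 1"
  let ?g = "indicator (cball (0 :: real^'n) S) :: real^'n \<Rightarrow> real"
  have g: "integrable lborel ?g" by (intro integrable_real_indicator emeasure_bounded_finite) auto
  have k: "(\<lambda>y. y) \<in> borel_measurable (lborel :: (real^'n) measure)" by simp
  let ?F = "\<lambda>x. \<integral>y. ?g y *\<^sub>R f (x + y) \<partial>lborel"
  have m: "f \<in> borel_measurable borel" using Ck1_continuous[OF f] by (rule borel_measurable_continuous_onI)
  have const: "?F x = (\<integral>y. f y \<partial>lborel)" if x: "x \<in> ball 0 1" for x
  proof -
    have "?g y *\<^sub>R f (x + y) = f (x + y)" for y
    proof (cases "norm y \<le> S")
      case False
      have "norm y - norm x \<le> norm (x + y)" using norm_triangle_ineq2[of y "- x"] by (simp add: add.commute)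
      then have "R < norm (x + y)" using False x by (simp add: S_def)
      then show ?thesis using R by simp
    qed simp
    then show ?thesis using lborel_integral_affine[of 1 f x] m by simp
  qed
  have "grad ?F 0 $ i = 0"
  proof -
    have "((\<lambda>_. \<integral>y. f y \<partial>lborel) has_derivative (\<lambda>_. 0)) (at (0 :: real^'n))" by simp
    then have "(?F has_derivative (\<lambda>_. 0)) (at 0)"
      by (rule has_derivative_transform_within_open[of _ _ _ _ "ball 0 1"]) (use const in auto)
    from grad_eqI[OF this] show ?thesis .
  qed
  moreover have "grad ?F 0 $ i = (\<integral>y. ?g y *\<^sub>R (grad f (0 + y) $ i) \<partial>lborel)"
    by (rule grad_weighted_translate[OF bounded_bilinear_scaleR g k f s])
  moreover have "?g y *\<^sub>R (grad f (0 + y) $ i) = grad f y $ i" for y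
    using R'[of y] by (auto simp: indicator_def S_def)
  ultimately show ?thesis by simp
qed

definition divergence :: "(real^'n \<Rightarrow> real^'n) \<Rightarrow> real^'n \<Rightarrow> real" where
  "divergence a x = (\<Sum>i\<in>UNIV. grad a x $ i $ i)"

lemma divergence_continuous: "Ck 1 a \<Longrightarrow> continuous_on UNIV (divergence a)"
proof -
  assume a: "Ck 1 a"
  have "continuous_on UNIV (\<lambda>x. grad a x $ i $ i)" for i
    using Ck_bounded_linear[OF bounded_linear_vec_nth a, of i] grad_bounded_linear[OF bounded_linear_vec_nth a, of i] by simp
  then show ?thesis unfolding divergence_def[abs_def] by (intro continuous_on_sum)
qed

section \<open>Vanishing against test functions, and uniqueness of weak derivatives\<close>

context smooth_domain
begin

text \<open>Mollified indicators of shrinking neighbourhoods of \<open>K\<close> are test functions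
  that converge pointwise to the indicator of \<open>K\<close> and stay bounded by 1.\<close>

lemma integral_compact_eq_0:
  fixes q :: "real^'n \<Rightarrow> complex" assumes q: "L2 \<D> q"
    and z: "\<And>g. g \<in> test_functions \<Omega> \<Longrightarrow> (\<integral>x. q x * of_real (g x) \<partial>\<D>) = 0"
    and K: "compact K" "K \<subseteq> \<Omega>"
  shows "(\<integral>x. q x * indicator K x \<partial>\<D>) = 0"
proof (cases "K = {}")
  case False
  obtain d0 where d0: "d0 > 0" "(\<Union>x\<in>K. cball x d0) \<subseteq> \<Omega>"
    using compact_subset_open_imp_cball_epsilon_subset[OF K(1) open_domain K(2)] by blast
  \<comment> \<open>Half of \<open>d0\<close> keeps the mollified neighbourhoods, of radius
    \<open>2 * h k\<close>, inside \<Omega>.\<close>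
  define h where "h k = d0 / 2 / real (Suc k)" for k
  have h: "0 < h k" "2 * h k \<le> d0" for k using d0(1) by (auto simp: h_def field_simps)
  have h0: "(\<lambda>k. 2 * h k) \<longlonglongrightarrow> 0"
  proof -
    have "h \<longlonglongrightarrow> 0"
      unfolding h_def[abs_def] by (intro real_tendsto_divide_at_top[OF tendsto_const] filterlim_compose[OF filterlim_real_sequentially] filterlim_Suc)
    from tendsto_mult_left[OF this, of 2] show ?thesis by simp
  qed
  let ?N = "\<lambda>d. {x. infdist x K \<le> d}"
  have cN: "compact (?N d)" for d by (rule compact_infdist_le[OF K(1) False])
  let ?f = "\<lambda>k. indicator (?N (h k)) :: real^'n \<Rightarrow> real"
  define g where "g k = conv \<rho> (h k) (?f k)" for k
  have m: "?f k \<in> borel_measurable borel" for k using cN by (intro borel_measurable_indicator borel_compact)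
  have B: "norm (?f k x) \<le> 1" for k x by (simp add: indicator_def)
  have tri: "infdist x K \<le> infdist y K + dist x y" for x y by (rule infdist_triangle)
  have one: "g k x = 1" if x: "x \<in> K" for k x unfolding g_def
  proof (rule conv_const[OF m B h(1)])
    fix y assume "dist x y \<le> h k"
    then have "infdist y K \<le> h k" using infdist_le2[OF x] by (simp add: dist_commute)
    then show "?f k y = 1" by simp
  qed
  have zero: "g k x = 0" if x: "2 * h k < infdist x K" for k x unfolding g_def
  proof (rule conv_const[OF m B h(1)])
    fix y assume "dist x y \<le> h k"
    then have "h k < infdist y K" using tri[of x y] x by linarith
    then show "?f k y = 0" by simp
  qed
  have bd: "norm (g k x) \<le> 1" for k x unfolding g_def by (rule norm_conv_le[OF m B h(1)])
  have smooth: "Cinf (g k)" for k unfolding Cinf_def g_def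
  proof (intro allI Ck_conv[OF h(1)])
    show "integrable lborel (?f k)"
      using emeasure_bounded_finite[OF compact_imp_bounded[OF cN]] borel_compact[OF cN] by (simp add: less_top)
  qed
  have "compact_support_in \<Omega> (g k)" for k
  proof (rule compact_support_inI[OF cN[of "2 * h k"]])
    show "?N (2 * h k) \<subseteq> \<Omega>"
    proof safe
      fix x assume x: "infdist x K \<le> 2 * h k"
      obtain y where "y \<in> K" "infdist x K = dist x y" using infdist_attains_inf[OF compact_imp_closed[OF K(1)] False] by metis
      then have "x \<in> (\<Union>x\<in>K. cball x d0)" using x h(2)[of k] by (auto simp: dist_commute intro!: bexI[of _ y])
      then show "x \<in> \<Omega>" using d0(2) by blast
    qed
  qed (use zero in auto)
  then have tf: "g k \<in> test_functions \<Omega>" for k using smooth by (simp add: test_functions_def)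
  have "(\<lambda>k. \<integral>x. q x * of_real (g k x) \<partial>\<D>) \<longlonglongrightarrow> (\<integral>x. q x * indicator K x \<partial>\<D>)"
  proof (rule integral_dominated_convergence[where w = "\<lambda>x. norm (q x)"])
    show "integrable \<D> (\<lambda>x. norm (q x))" using dom.L2_integrable[OF q] by simp
    show "(\<lambda>x. q x * indicator K x) \<in> borel_measurable \<D>"
      by (intro borel_measurable_times L2_measurable[OF q] borel_measurable_domain borel_measurable_indicator borel_compact K)
    show "(\<lambda>x. q x * of_real (g k x)) \<in> borel_measurable \<D>" for k
      using Ck_imp_continuous[of 1 "g k"] smooth[of k] unfolding Cinf_def
      by (intro borel_measurable_times L2_measurable[OF q] continuous_measurable continuous_on_of_real) blast
    show "AE x in \<D>. (\<lambda>k. q x * of_real (g k x)) \<longlonglongrightarrow> q x * indicator K x"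
    proof (rule AE_domainI)
      fix x
      show "(\<lambda>k. q x * of_real (g k x)) \<longlonglongrightarrow> q x * indicator K x"
      proof (cases "x \<in> K")
        case True then show ?thesis using one by simp
      next
        case x: False
        have "0 < infdist x K" using infdist_pos_not_in_closed[OF compact_imp_closed[OF K(1)] False x] .
        then have "\<forall>\<^sub>F k in sequentially. 2 * h k < infdist x K" using order_tendstoD(2)[OF h0] by blast
        then have "\<forall>\<^sub>F k in sequentially. q x * of_real (g k x) = q x * indicator K x"
          by eventually_elim (use zero x in simp)
        then show ?thesis by (rule tendsto_eventually)
      qed
    qed
    show "AE x in \<D>. norm (q x * of_real (g k x)) \<le> norm (q x)" for k
      using bd by (intro AE_domainI) (simp add: norm_mult mult_left_le)
  qed
  then show ?thesis using z[OF tf] by (simp add: LIMSEQ_const_iff)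
qed simp

text \<open>By inner regularity the set where \<open>g > 0\<close> contains a compact set that
  exhausts it up to measure \<open>e\<close>; there \<open>g\<close> is positive with integral 0, so
  this compact set is null.\<close>

lemma AE_nonpos_of_integral_compact:
  fixes g :: "real^'n \<Rightarrow> real" assumes g: "integrable \<D> g"
    and z: "\<And>K. compact K \<Longrightarrow> K \<subseteq> \<Omega> \<Longrightarrow> (\<integral>x. g x * indicator K x \<partial>\<D>) = 0"
  shows "AE x in \<D>. g x \<le> 0"
proof -
  define S where "S = {x\<in>\<Omega>. 0 < g x}"
  have [measurable]: "g \<in> borel_measurable \<D>" using g by simp
  have "S = {x \<in> space \<D>. 0 < g x}" by (auto simp: S_def)
  also have "\<dots> \<in> sets \<D>" by measurable
  finally have S: "S \<in> sets \<D>" .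
  then have Sl: "S \<in> sets lebesgue" by (simp add: sets_restrict_space_iff)
  have "emeasure lebesgue S \<le> 0"
  proof (rule ennreal_le_epsilon)
    fix e :: real assume e: "0 < e"
    obtain T where T: "closed T" "T \<subseteq> S" "S - T \<in> lmeasurable" "emeasure lebesgue (S - T) < ennreal e"
      using sets_lebesgue_inner_closed[OF Sl e] by metis
    have T\<Omega>: "T \<subseteq> \<Omega>" using T(2) by (auto simp: S_def)
    then have cT: "compact T" using T(1) bounded_domain bounded_subset compact_eq_bounded_closed by blast
    have TS: "T \<in> sets \<D>" using T T\<Omega> by (simp add: sets_restrict_space_iff)
    have "integrable \<D> (\<lambda>x. g x * indicator T x)" using integrable_mult_indicator[OF TS g] by (simp add: mult.commute)
    moreover have "AE x in \<D>. 0 \<le> g x * indicator T x" using T(2) by (intro AE_I2) (auto simp: S_def indicator_def)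
    ultimately have "AE x in \<D>. g x * indicator T x = 0" using integral_nonneg_eq_0_iff_AE z[OF cT T\<Omega>] by blast
    then have "AE x in \<D>. x \<notin> T" by eventually_elim (use T(2) in \<open>auto simp: S_def indicator_def\<close>)
    then have "emeasure \<D> T = 0" using TS by (subst (asm) AE_iff_null) (auto simp: null_sets_def Int_absorb1 T\<Omega> Collect_conj_eq intro: arg_cong[where f = "emeasure _"])
    then have T0: "emeasure lebesgue T = 0" using T\<Omega> TS by (simp add: emeasure_restrict_space)
    have "emeasure lebesgue S = emeasure lebesgue (T \<union> (S - T))" using T(2) by (simp add: Un_absorb1)
    also have "\<dots> \<le> emeasure lebesgue T + emeasure lebesgue (S - T)" using T by (intro emeasure_subadditive) auto
    also have "\<dots> \<le> 0 + ennreal e" using T0 T(4) by simp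
    finally show "emeasure lebesgue S \<le> 0 + ennreal e" .
  qed
  then have "emeasure \<D> S = 0" using S by (simp add: emeasure_restrict_space S_def)
  then have "S \<in> null_sets \<D>" using S by (simp add: null_sets_def)
  then show ?thesis by (rule AE_I') (auto simp: S_def)
qed

theorem fundamental_lemma:
  fixes q :: "real^'n \<Rightarrow> complex" assumes q: "L2 \<D> q"
    and z: "\<And>f. f \<in> test_functions \<Omega> \<Longrightarrow> (\<integral>x. q x * of_real (f x) \<partial>\<D>) = 0"
  shows "AE x in \<D>. q x = 0"
proof -
  note iq = dom.L2_integrable[OF q]
  have K: "(\<integral>x. q x * indicator K x \<partial>\<D>) = 0" if "compact K" "K \<subseteq> \<Omega>" for K
    using integral_compact_eq_0[OF q z that] by blast
  have i: "integrable \<D> (\<lambda>x. q x * indicator K x)" if "compact K" "K \<subseteq> \<Omega>" for K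
  proof -
    have "K \<in> sets \<D>" using that lmeasurable_compact[OF that(1)] by (simp add: sets_restrict_space_iff)
    from integrable_mult_indicator[OF this iq] show ?thesis
      by (rule Bochner_Integration.integrable_cong[THEN iffD1, rotated 2]) (auto simp: indicator_def)
  qed
  have re: "(\<integral>x. Re (q x) * indicator K x \<partial>\<D>) = 0" "(\<integral>x. Im (q x) * indicator K x \<partial>\<D>) = 0"
    if "compact K" "K \<subseteq> \<Omega>" for K
  proof -
    have "Re (\<integral>x. q x * indicator K x \<partial>\<D>) = (\<integral>x. Re (q x * indicator K x) \<partial>\<D>)"
      "Im (\<integral>x. q x * indicator K x \<partial>\<D>) = (\<integral>x. Im (q x * indicator K x) \<partial>\<D>)"
      by (rule integral_bounded_linear[OF bounded_linear_Re i[OF that], symmetric],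
          rule integral_bounded_linear[OF bounded_linear_Im i[OF that], symmetric])
    moreover have "Re (q x * indicator K x) = Re (q x) * indicator K x" "Im (q x * indicator K x) = Im (q x) * indicator K x" for x
      by (auto simp: indicator_def)
    ultimately show "(\<integral>x. Re (q x) * indicator K x \<partial>\<D>) = 0" "(\<integral>x. Im (q x) * indicator K x \<partial>\<D>) = 0"
      using K[OF that] by simp_all
  qed
  have ir: "integrable \<D> (\<lambda>x. Re (q x))" "integrable \<D> (\<lambda>x. Im (q x))" using iq by auto
  have "AE x in \<D>. Re (q x) \<le> 0" "AE x in \<D>. - Re (q x) \<le> 0"
    "AE x in \<D>. Im (q x) \<le> 0" "AE x in \<D>. - Im (q x) \<le> 0" using ir re by (intro AE_nonpos_of_integral_compact; simp)+
  then show ?thesis by eventually_elim (simp add: complex_eq_iff)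
qed

lemma test_functionD: assumes "f \<in> test_functions \<Omega>"
  shows "Ck k f" "compact_support_in \<Omega> f" using assms by (auto simp: test_functions_def Cinf_def)

lemma test_function_grad: assumes "f \<in> test_functions \<Omega>" shows "(\<lambda>x. grad f x $ i) \<in> test_functions \<Omega>"
proof -
  have "Ck k (\<lambda>x. grad f x $ i)" for k using test_functionD(1)[OF assms, of "Suc k"] by simp
  moreover have "compact_support_in \<Omega> (\<lambda>x. grad f x $ i)"
  proof (rule compact_support_inI[of "closure {x. f x \<noteq> 0}"])
    fix x assume x: "x \<notin> closure {x. f x \<noteq> 0}"
    have "grad f x = 0"
    proof (rule grad_eq_0[of "- closure {x. f x \<noteq> 0}"])
      show "f y = 0" if "y \<in> - closure {x. f x \<noteq> 0}" for y using that closure_subset[of "{x. f x \<noteq> 0}"] by blast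
    qed (use x in auto)
    then show "grad f x $ i = 0" by simp
  qed (use test_functionD(2)[OF assms] in \<open>auto simp only: compact_support_in_def\<close>)
  ultimately show ?thesis by (simp add: test_functions_def Cinf_def)
qed

lemma test_function_L2: assumes "f \<in> test_functions \<Omega>"
  shows "L2 \<D> (\<lambda>x. of_real (f x))" "L2 \<D> (\<lambda>x. cvec (grad f x))"
proof -
  note C = test_functionD(1)[OF assms, of 1]
  show "L2 \<D> (\<lambda>x. of_real (f x))" by (rule continuous_L2[OF continuous_on_of_real[OF Ck1_continuous[OF C]]])
  show "L2 \<D> (\<lambda>x. cvec (grad f x))" by (rule continuous_L2[OF continuous_cvec[OF Ck1_continuous_grad[OF C]]])
qed

lemma weak_divD: assumes "weak_div F q" "f \<in> test_functions \<Omega>"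
  shows "(\<integral>x. cdot (F x) (cvec (grad f x)) \<partial>\<D>) = - (\<integral>x. q x * of_real (f x) \<partial>\<D>)"
  using assms unfolding weak_div_def by blast

lemma weak_div_unique: assumes "weak_div F q" "weak_div F q'"
  shows "AE x in \<D>. q x = q' x"
proof -
  have L: "L2 \<D> q" "L2 \<D> q'" using assms by (auto simp: weak_div_def)
  have "AE x in \<D>. q x - q' x = 0"
  proof (rule fundamental_lemma[OF L2_diff[OF L]])
    fix f assume f: "f \<in> test_functions \<Omega>"
    have "(\<integral>x. q x * of_real (f x) \<partial>\<D>) = (\<integral>x. q' x * of_real (f x) \<partial>\<D>)"
      using trans[OF weak_divD[OF assms(1) f, symmetric] weak_divD[OF assms(2) f]] by (simp only: neg_equal_iff_equal)
    then show "(\<integral>x. (q x - q' x) * of_real (f x) \<partial>\<D>) = 0"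
      using integrable_times[OF L(1) test_function_L2(1)[OF f]] integrable_times[OF L(2) test_function_L2(1)[OF f]]
      by (simp add: left_diff_distrib)
  qed
  then show ?thesis by simp
qed

lemma weak_div_cong_AE: assumes "weak_div F q" "L2 \<D> F'" "L2 \<D> q'"
    and "AE x in \<D>. F x = F' x" "AE x in \<D>. q x = q' x"
  shows "weak_div F' q'" unfolding weak_div_def
proof (intro conjI ballI assms)
  fix f assume f: "f \<in> test_functions \<Omega>"
  have L: "L2 \<D> F" "L2 \<D> q" using assms by (auto simp: weak_div_def)
  note T = test_function_L2[OF f]
  have "(\<integral>x. cdot (F' x) (cvec (grad f x)) \<partial>\<D>) = (\<integral>x. cdot (F x) (cvec (grad f x)) \<partial>\<D>)"
    using assms(4) L2_measurable[OF T(2)] L2_measurable[OF L(1)] L2_measurable[OF assms(2)]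
    by (intro integral_cong_AE cdot_measurable) (auto elim!: eventually_mono)
  moreover have "(\<integral>x. q' x * of_real (f x) \<partial>\<D>) = (\<integral>x. q x * of_real (f x) \<partial>\<D>)"
    using assms(5) L2_measurable[OF T(1)] L2_measurable[OF L(2)] L2_measurable[OF assms(3)]
    by (intro integral_cong_AE borel_measurable_times) (auto elim!: eventually_mono)
  ultimately show "(\<integral>x. cdot (F' x) (cvec (grad f x)) \<partial>\<D>) = - (\<integral>x. q' x * of_real (f x) \<partial>\<D>)"
    using weak_divD[OF assms(1) f] by simp
qed

lemma weak_div_lincomb: assumes "weak_div F q" "weak_div F' q'"
  shows "weak_div (\<lambda>x. F x + c *s F' x) (\<lambda>x. q x + c * q' x)" unfolding weak_div_def
proof (intro conjI ballI)
  have L: "L2 \<D> F" "L2 \<D> q" "L2 \<D> F'" "L2 \<D> q'" using assms by (auto simp: weak_div_def)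
  show "L2 \<D> (\<lambda>x. F x + c *s F' x)" by (intro L2_add L2_smult L)
  show "L2 \<D> (\<lambda>x. q x + c * q' x)" by (intro L2_add L2_cmult L)
  fix f assume f: "f \<in> test_functions \<Omega>"
  note T = test_function_L2[OF f]
  have "cdot (F x + c *s F' x) w = cdot (F x) w + c * cdot (F' x) w" for x w
    by (simp add: cdot_def distrib_right sum.distrib sum_distrib_left mult.assoc)
  moreover have "(q x + c * q' x) * t = q x * t + c * (q' x * t)" for x t by (simp add: algebra_simps)
  ultimately show "(\<integral>x. cdot (F x + c *s F' x) (cvec (grad f x)) \<partial>\<D>) = - (\<integral>x. (q x + c * q' x) * of_real (f x) \<partial>\<D>)"
    using integrable_cdot[OF L(1) T(2)] integrable_cdot[OF L(3) T(2)] integrable_times[OF L(2) T(1)] integrable_times[OF L(4) T(1)]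
      weak_divD[OF assms(1) f] weak_divD[OF assms(2) f] by (simp add: algebra_simps)
qed

lemma weak_gradient_spec: "u \<in> H1 \<Omega> \<Longrightarrow> is_weak_gradient \<Omega> u (weak_gradient \<Omega> u)"
  unfolding H1_def weak_gradient_def by (auto intro: someI[of "is_weak_gradient \<Omega> u"])

lemma weak_gradient_unique: assumes "is_weak_gradient \<Omega> u G" "is_weak_gradient \<Omega> u G'"
  shows "AE x in \<D>. G x = G' x"
proof (rule AE_vecI)
  fix i
  have "weak_div (\<lambda>x. axis i (u x)) (\<lambda>x. G x $ i)" "weak_div (\<lambda>x. axis i (u x)) (\<lambda>x. G' x $ i)"
    using assms by (simp_all add: is_weak_gradient_iff)
  then show "AE x in \<D>. G x $ i = G' x $ i" by (rule weak_div_unique)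
qed

lemma weak_gradient_eq_AE: assumes "is_weak_gradient \<Omega> u G"
  shows "AE x in \<D>. weak_gradient \<Omega> u x = G x"
  using weak_gradient_unique[OF weak_gradient_spec assms] assms by (auto simp: H1_def)

text \<open>Partial derivatives of test functions are test functions, so one of the two derivatives
  in the Laplacian can be moved onto \<open>u\<close>.\<close>

lemma is_weak_laplacian_iff: assumes G: "is_weak_gradient \<Omega> u G" and q: "L2 \<D> q"
  shows "is_weak_laplacian \<Omega> u q \<longleftrightarrow> weak_div G q"
proof -
  have L: "L2 \<D> u" "L2 \<D> G" using G by (auto simp: is_weak_gradient_def)
  have "(\<integral>x. u x * of_real (laplacian f x) \<partial>\<D>) = - (\<integral>x. cdot (G x) (cvec (grad f x)) \<partial>\<D>)"
    if f: "f \<in> test_functions \<Omega>" for f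
  proof -
    note t = test_function_grad[OF f]
    have "u x * of_real (laplacian f x) = (\<Sum>i\<in>UNIV. u x * of_real (grad (\<lambda>y. grad f y $ i) x $ i))" for x
      by (simp add: laplacian_def sum_distrib_left)
    moreover have "integrable \<D> (\<lambda>x. u x * of_real (grad (\<lambda>y. grad f y $ i) x $ i))" for i
      by (rule integrable_times[OF L(1) test_function_L2(1)[OF test_function_grad[OF t]]])
    ultimately have "(\<integral>x. u x * of_real (laplacian f x) \<partial>\<D>) =
        (\<Sum>i\<in>UNIV. \<integral>x. u x * of_real (grad (\<lambda>y. grad f y $ i) x $ i) \<partial>\<D>)" by simp
    also have "\<dots> = (\<Sum>i\<in>UNIV. - (\<integral>x. G x $ i * of_real (grad f x $ i) \<partial>\<D>))"
      using G t unfolding is_weak_gradient_def by (intro sum.cong) auto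
    also have "\<dots> = - (\<integral>x. (\<Sum>i\<in>UNIV. G x $ i * of_real (grad f x $ i)) \<partial>\<D>)"
      using integrable_times[OF L2_vec_component[OF L(2)] test_function_L2(1)[OF t]]
      by (subst Bochner_Integration.integral_sum) (auto simp: sum_negf)
    finally show ?thesis by (simp add: cdot_def cvec_def)
  qed
  then show ?thesis unfolding is_weak_laplacian_def weak_div_def using L q
    by (metis (no_types, lifting) minus_equation_iff)
qed

lemma weak_laplacian_spec: "is_weak_laplacian \<Omega> u q \<Longrightarrow> is_weak_laplacian \<Omega> u (weak_laplacian \<Omega> u)"
  unfolding weak_laplacian_def by (rule someI[of "is_weak_laplacian \<Omega> u"])

lemma integral_domain_eq_lborel:
  fixes f :: "real^'n \<Rightarrow> 'b::{banach, second_countable_topology}"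
  assumes m: "f \<in> borel_measurable borel" and z: "\<And>x. x \<notin> \<Omega> \<Longrightarrow> f x = 0" shows "(\<integral>x. f x \<partial>\<D>) = (\<integral>x. f x \<partial>lborel)"
proof -
  have "(\<integral>x. f x \<partial>\<D>) = (\<integral>x. indicator \<Omega> x *\<^sub>R f x \<partial>lebesgue)" by (rule integral_restrict_space) simp
  also have "(\<lambda>x. indicator \<Omega> x *\<^sub>R f x) = f" using z by (auto simp: fun_eq_iff indicator_def)
  also have "(\<integral>x. f x \<partial>lebesgue) = (\<integral>x. f x \<partial>lborel)" using m by (intro integral_completion) simp
  finally show ?thesis .
qed

lemma integral_by_parts:
  fixes f :: "real^'n \<Rightarrow> complex" assumes f: "Ck 1 f" and g: "Ck 1 g" "compact_support_in \<Omega> g"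
  shows "(\<integral>x. f x * complex_of_real (grad g x $ i) \<partial>\<D>) = - (\<integral>x. grad f x $ i * complex_of_real (g x) \<partial>\<D>)"
proof -
  let ?p = "\<lambda>x. complex_of_real (g x)"
  have p: "Ck 1 ?p" by (rule Ck_bounded_linear[OF bounded_linear_of_real g(1)])
  have gp: "grad ?p x $ i = complex_of_real (grad g x $ i)" for x
    by (rule grad_bounded_linear[OF bounded_linear_of_real g(1)])
  have K: "closure {x. g x \<noteq> 0} \<subseteq> \<Omega>" using g(2) by (simp add: compact_support_in_def)
  have z: "g x = 0" if "x \<notin> \<Omega>" for x using that K closure_subset[of "{x. g x \<noteq> 0}"] by blast
  have gz: "grad g x = 0" if "x \<notin> \<Omega>" for x
  proof (rule grad_eq_0[of "- closure {x. g x \<noteq> 0}"])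
    show "g y = 0" if "y \<in> - closure {x. g x \<noteq> 0}" for y using that closure_subset[of "{x. g x \<noteq> 0}"] by blast
  qed (use that K in auto)
  have bs: "bounded_support (\<lambda>x. f x * ?p x)"
    using compact_support_in_bounded_support[OF g(2)] by (auto simp: bounded_support_def)
  have cf: "continuous_on UNIV f" "continuous_on UNIV (\<lambda>x. grad f x $ i)" "continuous_on UNIV ?p" "continuous_on UNIV (\<lambda>x. complex_of_real (grad g x $ i))"
    using f Ck1_continuous[OF f] Ck1_continuous[OF p] g(1) by (auto intro: continuous_on_of_real)
  let ?a = "\<lambda>x. f x * complex_of_real (grad g x $ i)" and ?b = "\<lambda>x. grad f x $ i * ?p x"
  have ca: "continuous_on UNIV ?a" "continuous_on UNIV ?b" by (intro continuous_on_mult cf)+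
  have int: "integrable lborel ?a" "integrable lborel ?b"
    using compact_support_in_bounded_support[OF g(2)] bounded_support_grad_component[OF compact_support_in_bounded_support[OF g(2)], of i]
    by (intro integrable_bounded_support ca; auto simp: bounded_support_def)+
  have "0 = (\<integral>x. ?a x + ?b x \<partial>lborel)"
    using integral_partial_derivative[OF Ck1_mult(1)[OF f p] bs, of i] unfolding grad_mult[OF f p] gp by simp
  also have "\<dots> = (\<integral>x. ?a x \<partial>lborel) + (\<integral>x. ?b x \<partial>lborel)" using int by simp
  also have "(\<integral>x. ?a x \<partial>lborel) = (\<integral>x. ?a x \<partial>\<D>)"
    using gz by (intro integral_domain_eq_lborel[symmetric] borel_measurable_continuous_onI ca) simp
  also have "(\<integral>x. ?b x \<partial>lborel) = (\<integral>x. ?b x \<partial>\<D>)"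
    using z by (intro integral_domain_eq_lborel[symmetric] borel_measurable_continuous_onI ca) simp
  finally show ?thesis by (simp add: eq_neg_iff_add_eq_0)
qed

lemma weak_gradient_classical: assumes f: "Ck 1 f" shows "is_weak_gradient \<Omega> f (grad f)"
  unfolding is_weak_gradient_def
proof (intro conjI ballI allI)
  show "L2 \<D> f" "L2 \<D> (grad f)"
    using continuous_L2[OF Ck1_continuous[OF f]] continuous_L2[OF Ck1_continuous_grad[OF f]] .
qed (rule integral_by_parts[OF f test_functionD])

lemma weak_div_classical:
  fixes F :: "real^'n \<Rightarrow> complex^'n" assumes F: "Ck 1 F" shows "weak_div F (\<lambda>x. \<Sum>i\<in>UNIV. grad F x $ i $ i)"
  unfolding weak_div_def
proof (intro conjI ballI)
  have c: "Ck 1 (\<lambda>x. F x $ i)" and g: "grad (\<lambda>x. F x $ i) x $ j = grad F x $ j $ i" for i j x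
    using Ck_bounded_linear[OF bounded_linear_vec_nth F] grad_bounded_linear[OF bounded_linear_vec_nth F] by auto
  have cg: "continuous_on UNIV (\<lambda>x. grad F x $ i $ i)" for i using c[of i] g[of i] by simp
  show LF: "L2 \<D> F" by (rule continuous_L2[OF Ck1_continuous[OF F]])
  show "L2 \<D> (\<lambda>x. \<Sum>i\<in>UNIV. grad F x $ i $ i)" by (intro continuous_L2 continuous_on_sum cg)
  fix f assume f: "f \<in> test_functions \<Omega>"
  have i1: "integrable \<D> (\<lambda>x. F x $ i * of_real (grad f x $ i))" for i
    by (rule integrable_times[OF L2_vec_component[OF LF] test_function_L2(1)[OF test_function_grad[OF f]]])
  have i2: "integrable \<D> (\<lambda>x. grad F x $ i $ i * of_real (f x))" for i
    by (rule integrable_times[OF continuous_L2[OF cg] test_function_L2(1)[OF f]])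
  have "(\<integral>x. cdot (F x) (cvec (grad f x)) \<partial>\<D>) = (\<Sum>i\<in>UNIV. \<integral>x. F x $ i * of_real (grad f x $ i) \<partial>\<D>)"
    using i1 by (simp add: cdot_def cvec_def)
  also have "\<dots> = (\<Sum>i\<in>UNIV. - (\<integral>x. grad F x $ i $ i * of_real (f x) \<partial>\<D>))"
    using integral_by_parts[OF c test_functionD[OF f]] by (simp add: g)
  also have "\<dots> = - (\<integral>x. (\<Sum>i\<in>UNIV. grad F x $ i $ i) * of_real (f x) \<partial>\<D>)"
    using i2 by (simp add: sum_distrib_right sum_negf)
  finally show "(\<integral>x. cdot (F x) (cvec (grad f x)) \<partial>\<D>) = - (\<integral>x. (\<Sum>i\<in>UNIV. grad F x $ i $ i) * of_real (f x) \<partial>\<D>)" .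
qed

lemma L2_real_continuous_mult: "L2 \<D> u \<Longrightarrow> continuous_on UNIV c \<Longrightarrow> L2 \<D> (\<lambda>x. of_real (c x) * u x)"
  using L2_continuous_scaleR[of u c] by (simp add: scaleR_conv_of_real)

text \<open>The product rule for the divergence. The weak gradient is tested with components of
  \<open>a\<close> times a test function; these products are only C1, which
  \<open>weak_div_C1\<close> admits.\<close>

lemma weak_div_product: assumes G: "is_weak_gradient \<Omega> u G" and a: "Ck 1 a"
  shows "weak_div (\<lambda>x. u x *s cvec (a x)) (\<lambda>x. of_real (divergence a x) * u x + cdot (G x) (cvec (a x)))"
  unfolding weak_div_def
proof (intro conjI ballI)
  have L: "L2 \<D> u" "L2 \<D> G" using G by (auto simp: is_weak_gradient_def)
  have ca: "continuous_on UNIV (\<lambda>x. cvec (a x))" by (rule continuous_cvec[OF Ck1_continuous[OF a]])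
  have La: "L2 \<D> (\<lambda>x. u x *s cvec (a x))" by (rule L2_bounded_bilinear_continuous[OF bounded_bilinear_smult L(1) ca])
  have Ld: "L2 \<D> (\<lambda>x. of_real (divergence a x) * u x)"
    by (rule L2_real_continuous_mult[OF L(1) divergence_continuous[OF a]])
  have LG: "L2 \<D> (\<lambda>x. cdot (G x) (cvec (a x)))"
    by (rule L2_bounded_bilinear_continuous[OF bounded_bilinear_cdot L(2) ca])
  show "L2 \<D> (\<lambda>x. u x *s cvec (a x))" by (rule La)
  show "L2 \<D> (\<lambda>x. of_real (divergence a x) * u x + cdot (G x) (cvec (a x)))" by (rule L2_add[OF Ld LG])
  fix f assume f: "f \<in> test_functions \<Omega>"
  note T = test_function_L2[OF f] and f1 = test_functionD(1)[OF f, of 1]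
  have ci: "Ck 1 (\<lambda>x. a x $ i)" for i by (rule Ck_bounded_linear[OF bounded_linear_vec_nth a])
  have gi: "grad (\<lambda>x. a x $ i) x $ j = grad a x $ j $ i" for i j x by (rule grad_bounded_linear[OF bounded_linear_vec_nth a])
  let ?f = "\<lambda>i x. a x $ i * f x"
  have C: "Ck 1 (?f i)" for i by (rule Ck1_mult[OF ci f1])
  have gC: "grad (?f i) x $ i = a x $ i * grad f x $ i + grad a x $ i $ i * f x" for i x
    by (simp add: grad_mult[OF ci f1] gi)
  have S: "compact_support_in \<Omega> (?f i)" for i using test_functionD(2)[OF f] closure_subset[of "{x. f x \<noteq> 0}"]
    by (intro compact_support_inI[of "closure {x. f x \<noteq> 0}"]) (auto simp only: compact_support_in_def mult_eq_0_iff)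
  have step: "(\<integral>x. u x * of_real (grad (?f i) x $ i) \<partial>\<D>) = - (\<integral>x. G x $ i * of_real (?f i x) \<partial>\<D>)" for i
  proof -
    have "weak_div (\<lambda>x. axis i (u x)) (\<lambda>x. G x $ i)" using G by (simp add: is_weak_gradient_iff)
    from weak_div_C1[OF this C S] show ?thesis by (simp add: cdot_axis cvec_def)
  qed
  have i1: "integrable \<D> (\<lambda>x. u x * of_real (grad (?f i) x $ i))" for i
  proof (rule integrable_times[OF L(1) continuous_L2[OF continuous_on_of_real]])
    show "continuous_on UNIV (\<lambda>x. grad (?f i) x $ i)" using C[of i] by simp
  qed
  have i2: "integrable \<D> (\<lambda>x. G x $ i * of_real (?f i x))" for i
    by (rule integrable_times[OF L2_vec_component[OF L(2)] continuous_L2[OF continuous_on_of_real[OF Ck1_continuous[OF C]]]])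
  have i3: "integrable \<D> (\<lambda>x. cdot (u x *s cvec (a x)) (cvec (grad f x)))" by (rule integrable_cdot[OF La T(2)])
  have i4: "integrable \<D> (\<lambda>x. of_real (divergence a x) * u x * of_real (f x))" by (rule integrable_times[OF Ld T(1)])
  have i5: "integrable \<D> (\<lambda>x. cdot (G x) (cvec (a x)) * of_real (f x))" by (rule integrable_times[OF LG T(1)])
  have p1: "(\<Sum>i\<in>UNIV. u x * of_real (grad (?f i) x $ i)) = cdot (u x *s cvec (a x)) (cvec (grad f x)) + of_real (divergence a x) * u x * of_real (f x)" for x
    unfolding gC by (simp add: cdot_def cvec_def divergence_def sum_distrib_left sum_distrib_right distrib_left sum.distrib ac_simps)
  have p2: "(\<Sum>i\<in>UNIV. G x $ i * of_real (?f i x)) = cdot (G x) (cvec (a x)) * of_real (f x)" for x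
    by (simp add: cdot_def cvec_def sum_distrib_left sum_distrib_right ac_simps)
  have "(\<integral>x. (\<Sum>i\<in>UNIV. u x * of_real (grad (?f i) x $ i)) \<partial>\<D>) = - (\<integral>x. (\<Sum>i\<in>UNIV. G x $ i * of_real (?f i x)) \<partial>\<D>)"
    using step by (simp only: Bochner_Integration.integral_sum[OF i1] Bochner_Integration.integral_sum[OF i2] sum_negf)
  then show "(\<integral>x. cdot (u x *s cvec (a x)) (cvec (grad f x)) \<partial>\<D>) =
      - (\<integral>x. (of_real (divergence a x) * u x + cdot (G x) (cvec (a x))) * of_real (f x) \<partial>\<D>)"
    unfolding p1 p2 distrib_right Bochner_Integration.integral_add[OF i3 i4] Bochner_Integration.integral_add[OF i4 i5]
    by (simp only: eq_neg_iff_add_eq_0 add.assoc)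
qed

end

lemma L2_tendsto_vec_component:
  assumes "L2_tendsto M F f" shows "L2_tendsto M (\<lambda>k x. (F k x :: complex^'m) $ i) (\<lambda>x. f x $ i)"
  unfolding L2_tendsto_l2norm
proof (intro conjI allI)
  have L: "\<And>k. L2 M (F k)" "L2 M f" "(\<lambda>k. l2norm M (\<lambda>x. F k x - f x)) \<longlonglongrightarrow> 0"
    using assms by (auto simp: L2_tendsto_l2norm)
  show "L2 M (\<lambda>x. F k x $ i)" "L2 M (\<lambda>x. f x $ i)" for k by (rule L2_vec_component[OF L(1)], rule L2_vec_component[OF L(2)])
  have "l2norm M (\<lambda>x. F k x $ i - f x $ i) \<le> 1 * l2norm M (\<lambda>x. F k x - f x)" for k
  proof (rule l2norm_le[OF _ L2_diff[OF L(1,2)]])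
    show "(\<lambda>x. F k x $ i - f x $ i) \<in> borel_measurable M"
      by (intro borel_measurable_diff L2_measurable L2_vec_component L)
    show "AE x in M. norm (F k x $ i - f x $ i) \<le> 1 * norm (F k x - f x)"
      using Finite_Cartesian_Product.norm_nth_le[of "F k _ - f _" i] by (intro AE_I2) simp
  qed simp
  then show "(\<lambda>k. l2norm M (\<lambda>x. F k x $ i - f x $ i)) \<longlonglongrightarrow> 0" using L(3) by (intro l2norm_tendsto_0) auto
qed

definition cnjv :: "complex^'n \<Rightarrow> complex^'n" where
  "cnjv z = (\<chi> i. cnj (z $ i))"

lemma norm_cnjv [simp]: "norm (cnjv z) = norm z" by (simp add: norm_vec_def cnjv_def)

lemma bounded_linear_cnjv: "bounded_linear cnjv"
  by (rule bounded_linear_intro[where K = 1]) (auto simp: cnjv_def vec_eq_iff norm_vec_def)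

lemma L2_bounded_linear:
  assumes l: "bounded_linear l" and f: "L2 M f" shows "L2 M (\<lambda>x. l (f x) :: 'd::{banach, second_countable_topology})"
proof -
  obtain K where K: "\<And>x. norm (l x) \<le> norm x * K" using bounded_linear.bounded[OF l] by blast
  show ?thesis
  proof (rule L2_bound[where g = f and c = K])
    show "(\<lambda>x. l (f x)) \<in> borel_measurable M"
      using measurable_compose[OF L2_measurable[OF f] borel_measurable_continuous_onI] linear_continuous_on[OF l] by blast
    show "AE x in M. norm (l (f x)) \<le> K * norm (f x)" using K by (simp add: mult.commute)
  qed (rule f)
qed

lemma L2_tendsto_isometry: assumes l: "bounded_linear l" and iso: "\<And>x. norm (l x) = norm x" and T: "L2_tendsto M F f"
  shows "L2_tendsto M (\<lambda>k x. l (F k x) :: 'd::{banach, second_countable_topology}) (\<lambda>x. l (f x))"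
proof -
  have "norm (l (F k x) - l (f x)) = norm (F k x - f x)" for k x
    using iso[of "F k x - f x"] by (simp add: linear_diff bounded_linear.linear[OF l])
  moreover have "L2 M (\<lambda>x. l (F k x))" "L2 M (\<lambda>x. l (f x))" for k
    using T by (auto simp: L2_tendsto_def intro!: L2_bounded_linear[OF l])
  ultimately show ?thesis using T by (simp add: L2_tendsto_def)
qed

lemma grad_diff: assumes "Ck 1 f" "Ck 1 g"
  shows "Ck 1 (\<lambda>x. f x - g x)" "grad (\<lambda>x. f x - g x) x = grad f x - grad g x"
proof -
  show "Ck 1 (\<lambda>x. f x - g x)"
    using Ck_add[OF assms(1) Ck_bounded_linear[OF bounded_linear_minus[OF bounded_linear_ident] assms(2)]] by simp
  note D = has_derivative_diff[OF Ck1_has_derivative[OF assms(1)] Ck1_has_derivative[OF assms(2)]]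
  show "grad (\<lambda>x. f x - g x) x = grad f x - grad g x"
    unfolding vec_eq_iff grad_eqI[OF D] by (simp add: axis_def if_distrib if_distribR cong: if_cong)
qed

lemma cdot_cvec_self: "cdot (cvec y) (cvec y) = of_real ((norm y)^2)"
  by (simp add: cdot_def cvec_def power2_norm_eq_inner inner_vec_def)

lemma cdot_linear:
  "cdot (x + y) z = cdot x z + cdot y z" "cdot (x - y) z = cdot x z - cdot y z" "cdot (c *s x) z = c * cdot x z"
  "cdot z (x + y) = cdot z x + cdot z y" "cdot z (x - y) = cdot z x - cdot z y" "cdot z (c *s x) = c * cdot z x"
  and cdot_commute: "cdot z x = cdot x z"
  by (simp_all add: cdot_def sum.distrib sum_subtractf sum_distrib_left ring_distribs mult_ac)

context smooth_domain
begin

lemma zero_trace_L2: "zero_trace w G \<Longrightarrow> L2 \<D> w" "zero_trace w G \<Longrightarrow> L2 \<D> G" by (auto simp: zero_trace_def L2_tendsto_def)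

lemma is_weak_gradient_limit: assumes g: "\<And>k. is_weak_gradient \<Omega> (U k) (V k)"
    and T: "L2_tendsto \<D> U u" "L2_tendsto \<D> V G"
  shows "is_weak_gradient \<Omega> u G" unfolding is_weak_gradient_def
proof (intro conjI ballI allI)
  show "L2 \<D> u" "L2 \<D> G" using T by (auto simp: L2_tendsto_def)
  fix f i assume f: "f \<in> test_functions \<Omega>"
  have mult_comm: "(\<integral>x. u x * v x \<partial>\<D>) = (\<integral>x. v x * u x \<partial>\<D>)" for u v :: "real^'n \<Rightarrow> complex" by (simp add: mult.commute)
  have "(\<lambda>k. \<integral>x. U k x * of_real (grad f x $ i) \<partial>\<D>) \<longlonglongrightarrow> (\<integral>x. u x * of_real (grad f x $ i) \<partial>\<D>)"
    unfolding mult_comm[of "U _"] mult_comm[of u]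
    by (intro L2_tendsto_pairing[OF bounded_bilinear_mult _ test_function_L2(1)[OF test_function_grad[OF f]] T(1)]) (simp add: norm_mult)
  moreover have "(\<lambda>k. - (\<integral>x. V k x $ i * of_real (f x) \<partial>\<D>)) \<longlonglongrightarrow> - (\<integral>x. G x $ i * of_real (f x) \<partial>\<D>)"
    unfolding mult_comm[of "\<lambda>x. V _ x $ i"] mult_comm[of "\<lambda>x. G x $ i"]
    by (intro tendsto_minus L2_tendsto_pairing[OF bounded_bilinear_mult _ test_function_L2(1)[OF f] L2_tendsto_vec_component[OF T(2)]]) (simp add: norm_mult)
  moreover have "(\<integral>x. U k x * of_real (grad f x $ i) \<partial>\<D>) = - (\<integral>x. V k x $ i * of_real (f x) \<partial>\<D>)" for k
    using g[of k] f unfolding is_weak_gradient_def by blast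
  ultimately show "(\<integral>x. u x * of_real (grad f x $ i) \<partial>\<D>) = - (\<integral>x. G x $ i * of_real (f x) \<partial>\<D>)"
    by (simp add: LIMSEQ_unique)
qed

lemma zero_trace_weak_gradient: "zero_trace w G \<Longrightarrow> is_weak_gradient \<Omega> w G"
  unfolding zero_trace_def by (elim exE conjE) (rule is_weak_gradient_limit[OF weak_gradient_classical], auto)

lemma zero_trace_cnj: assumes "zero_trace w G" shows "zero_trace (\<lambda>x. cnj (w x)) (\<lambda>x. cnjv (G x))"
proof -
  obtain U :: "nat \<Rightarrow> real^'n \<Rightarrow> complex" where U: "\<And>k. Ck 1 (U k)" "L2_tendsto \<D> U w"
      "L2_tendsto \<D> (\<lambda>k. grad (U k)) G" "\<And>k. L2 (surface_measure \<Omega>) (U k)"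
      "(\<lambda>k. l2norm (surface_measure \<Omega>) (U k)) \<longlonglongrightarrow> 0" using assms unfolding zero_trace_def by blast
  have g: "grad (\<lambda>x. cnj (U k x)) x = cnjv (grad (U k) x)" for k x
    by (simp add: vec_eq_iff cnjv_def grad_bounded_linear[OF bounded_linear_cnj U(1)])
  show ?thesis unfolding zero_trace_def
  proof (intro exI[of _ "\<lambda>k x. cnj (U k x)"] conjI allI)
    show "Ck 1 (\<lambda>x. cnj (U k x))" for k by (rule Ck_bounded_linear[OF bounded_linear_cnj U(1)])
    show "L2_tendsto \<D> (\<lambda>k x. cnj (U k x)) (\<lambda>x. cnj (w x))"
      by (rule L2_tendsto_isometry[OF bounded_linear_cnj complex_mod_cnj U(2)])
    have "(\<lambda>k. grad (\<lambda>x. cnj (U k x))) = (\<lambda>k x. cnjv (grad (U k) x))" using g by blast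
    then show "L2_tendsto \<D> (\<lambda>k. grad (\<lambda>x. cnj (U k x))) (\<lambda>x. cnjv (G x))"
      using L2_tendsto_isometry[OF bounded_linear_cnjv norm_cnjv U(3)] by simp
    show "L2 (surface_measure \<Omega>) (\<lambda>x. cnj (U k x))" for k by (rule L2_bounded_linear[OF bounded_linear_cnj U(4)])
    show "(\<lambda>k. l2norm (surface_measure \<Omega>) (\<lambda>x. cnj (U k x))) \<longlonglongrightarrow> 0" using U(5) by (simp add: l2norm_def)
  qed
qed

subsection \<open>The energy estimate\<close>

text \<open>Test the equation with the complex conjugate of \<open>w\<close> and take imaginary parts: the
  principal part and the real potential drop out, and the first order terms cancel by the product rule.\<close>

theorem energy_estimate: assumes zt: "zero_trace w G" and div: "weak_div G q" and a: "Ck 1 a"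
    and c: "c \<in> borel_measurable \<D>" "AE x in \<D>. \<bar>c x\<bar> \<le> B"
    and s: "L2 \<D> s"
    and eq: "AE x in \<D>. q x = - 2 * \<i> * cdot (G x) (cvec (a x)) - \<i> * of_real (divergence a x) * w x
        + (of_real (c x) - \<mu>) * w x + s x"
  shows "\<bar>Im \<mu>\<bar> * l2norm \<D> w \<le> l2norm \<D> s"
proof -
  let ?p = "\<lambda>x. cdot (G x) (cvec (a x)) * cnj (w x)"
  let ?n = "\<lambda>f x. of_real (f x) * w x * cnj (w x)"
  note L = zero_trace_L2[OF zt] and zt' = zero_trace_cnj[OF zt]
  have Lq: "L2 \<D> q" using div by (simp add: weak_div_def)
  have i: "integrable \<D> (\<lambda>x. f x * cnj (w x))" if "L2 \<D> f" for f
    by (rule integrable_times[OF that L2_bounded_linear[OF bounded_linear_cnj L(1)]])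
  have ip: "integrable \<D> ?p"
    by (rule i[OF L2_bounded_bilinear_continuous[OF bounded_bilinear_cdot L(2) continuous_cvec[OF Ck1_continuous[OF a]]]])
  have id: "integrable \<D> (?n (divergence a))" by (rule i[OF L2_real_continuous_mult[OF L(1) divergence_continuous[OF a]]])
  have ic: "integrable \<D> (?n c)" by (rule i[OF L2_mult_bounded[OF L(1), where B = B]]) (use c in auto)
  have i1: "integrable \<D> (\<lambda>x. w x * cnj (w x))" by (rule i[OF L(1)])
  have sq: "w x * cnj (w x) = of_real ((norm (w x))^2)" for x by (simp only: complex_norm_square)
  have re: "Im (\<integral>x. ?n f x \<partial>\<D>) = 0" for f
    unfolding mult.assoc sq of_real_mult[symmetric] integral_complex_of_real by simp
  have N: "(\<integral>x. w x * cnj (w x) \<partial>\<D>) = of_real ((l2norm \<D> w)^2)"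
    unfolding sq l2norm_sq by (rule integral_complex_of_real)
  have "(\<integral>x. q x * cnj (w x) \<partial>\<D>) = (\<integral>x. - 2 * \<i> * ?p x - \<i> * ?n (divergence a) x + ?n c x - \<mu> * (w x * cnj (w x)) + s x * cnj (w x) \<partial>\<D>)"
  proof (rule integral_cong_AE)
    show "AE x in \<D>. q x * cnj (w x) = - 2 * \<i> * ?p x - \<i> * ?n (divergence a) x + ?n c x - \<mu> * (w x * cnj (w x)) + s x * cnj (w x)"
      using eq
    proof eventually_elim
      case (elim x) show ?case unfolding elim by (simp add: algebra_simps)
    qed
  qed (use i[OF Lq] ip id ic i1 i[OF s] in \<open>auto intro!: borel_measurable_integrable\<close>)
  also have "\<dots> = - 2 * \<i> * (\<integral>x. ?p x \<partial>\<D>) - \<i> * (\<integral>x. ?n (divergence a) x \<partial>\<D>) + (\<integral>x. ?n c x \<partial>\<D>)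
      - \<mu> * (l2norm \<D> w)^2 + (\<integral>x. s x * cnj (w x) \<partial>\<D>)" using ip id ic i1 i[OF s] by (simp add: N)
  finally have q: "Im (\<integral>x. q x * cnj (w x) \<partial>\<D>) =
      - 2 * Re (\<integral>x. ?p x \<partial>\<D>) - Re (\<integral>x. ?n (divergence a) x \<partial>\<D>) - Im \<mu> * (l2norm \<D> w)^2 + Im (\<integral>x. s x * cnj (w x) \<partial>\<D>)"
    by (simp add: re flip: of_real_power)
  have "cdot (G x) (cnjv (G x)) = of_real (\<Sum>i\<in>UNIV. (norm (G x $ i))^2)" for x
    by (simp add: cdot_def cnjv_def complex_norm_square del: of_real_power)
  moreover have "(\<integral>x. q x * cnj (w x) \<partial>\<D>) = - (\<integral>x. cdot (G x) (cnjv (G x)) \<partial>\<D>)"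
    by (simp only: green_zero_trace[OF div zt'] minus_minus)
  ultimately have q0: "Im (\<integral>x. q x * cnj (w x) \<partial>\<D>) = 0" by (simp only: integral_complex_of_real) simp
  \<comment> \<open>Green's formula for the field \<open>cnj (w x) *s cvec (a x)\<close> paired with
    \<open>w\<close>: twice the real part of the integral of \<open>?p\<close> is minus that of the
    divergence term, which removes the first order terms from \<open>q\<close>.\<close>
  have "cdot (cnj (w x) *s cvec (a x)) (G x) = ?p x"
    "(of_real (divergence a x) * cnj (w x) + cdot (cnjv (G x)) (cvec (a x))) * w x = ?n (divergence a) x + cnj (?p x)" for x
    by (simp_all add: cdot_def cnjv_def cvec_def algebra_simps sum_distrib_left sum_distrib_right)
  with green_zero_trace[OF weak_div_product[OF zero_trace_weak_gradient[OF zt'] a] zt]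
  have "(\<integral>x. ?p x \<partial>\<D>) = - (\<integral>x. ?n (divergence a) x + cnj (?p x) \<partial>\<D>)" by (simp only:)
  also have "\<dots> = - ((\<integral>x. ?n (divergence a) x \<partial>\<D>) + cnj (\<integral>x. ?p x \<partial>\<D>))"
    using ip id by (simp only: Bochner_Integration.integral_add integrable_cnj Bochner_Integration.integral_cnj)
  finally have "Re (\<integral>x. ?p x \<partial>\<D>) = - Re (\<integral>x. ?n (divergence a) x \<partial>\<D>) - Re (\<integral>x. ?p x \<partial>\<D>)"
    by (rule arg_cong[where f = Re, THEN trans]) simp
  then have "Im \<mu> * (l2norm \<D> w)^2 = Im (\<integral>x. s x * cnj (w x) \<partial>\<D>)" using q q0 by linarith
  then have "\<bar>Im \<mu>\<bar> * (l2norm \<D> w)^2 = \<bar>Im (\<integral>x. s x * cnj (w x) \<partial>\<D>)\<bar>" by (metis abs_mult abs_power2)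
  also have "\<dots> \<le> norm (\<integral>x. s x * cnj (w x) \<partial>\<D>)" by (rule abs_Im_le_cmod)
  also have "\<dots> \<le> l2norm \<D> s * l2norm \<D> w"
    by (rule cauchy_schwarz_integral[OF s L(1) borel_measurable_integrable[OF i[OF s]]]) (simp add: norm_mult)
  finally have "(\<bar>Im \<mu>\<bar> * l2norm \<D> w) * l2norm \<D> w \<le> l2norm \<D> s * l2norm \<D> w" by (simp add: power2_eq_square mult.assoc)
  then show ?thesis by (cases "l2norm \<D> w = 0") (use l2norm_nonneg[of \<D> w] in \<open>simp_all add: mult_le_cancel_right\<close>)
qed

subsection \<open>The normal derivative\<close>

lemma has_trace_diff: assumes "has_trace \<Omega> v g" "has_trace \<Omega> v' g"
  shows "zero_trace (\<lambda>x. v x - v' x) (\<lambda>x. weak_gradient \<Omega> v x - weak_gradient \<Omega> v' x)"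
proof -
  obtain U :: "nat \<Rightarrow> real^'n \<Rightarrow> complex" where U: "\<And>k. Ck 1 (U k)" "L2_tendsto \<D> U v"
    "L2_tendsto \<D> (\<lambda>k. grad (U k)) (weak_gradient \<Omega> v)" "L2_tendsto (surface_measure \<Omega>) U g"
    using assms(1) unfolding has_trace_def by blast
  obtain U' :: "nat \<Rightarrow> real^'n \<Rightarrow> complex" where U': "\<And>k. Ck 1 (U' k)" "L2_tendsto \<D> U' v'"
    "L2_tendsto \<D> (\<lambda>k. grad (U' k)) (weak_gradient \<Omega> v')" "L2_tendsto (surface_measure \<Omega>) U' g"
    using assms(2) unfolding has_trace_def by blast
  have g: "grad (\<lambda>x. U k x - U' k x) = (\<lambda>x. grad (U k) x - grad (U' k) x)" for k
    using grad_diff(2)[OF U(1) U'(1)] by blast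
  have s: "L2_tendsto (surface_measure \<Omega>) (\<lambda>k x. U k x - U' k x) (\<lambda>x. g x - g x)"
    by (rule L2_tendsto_diff[OF U(4) U'(4)])
  show ?thesis unfolding zero_trace_def
  proof (intro exI[of _ "\<lambda>k x. U k x - U' k x"] conjI allI)
    show "Ck 1 (\<lambda>x. U k x - U' k x)" for k by (rule grad_diff(1)[OF U(1) U'(1)])
    show "L2_tendsto \<D> (\<lambda>k x. U k x - U' k x) (\<lambda>x. v x - v' x)" by (rule L2_tendsto_diff[OF U(2) U'(2)])
    show "L2_tendsto \<D> (\<lambda>k. grad (\<lambda>x. U k x - U' k x)) (\<lambda>x. weak_gradient \<Omega> v x - weak_gradient \<Omega> v' x)"
      unfolding g by (rule L2_tendsto_diff[OF U(3) U'(3)])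
    show "L2 (surface_measure \<Omega>) (\<lambda>x. U k x - U' k x)" for k using s by (simp add: L2_tendsto_l2norm)
    show "(\<lambda>k. l2norm (surface_measure \<Omega>) (\<lambda>x. U k x - U' k x)) \<longlonglongrightarrow> 0" using s by (simp add: L2_tendsto_l2norm)
  qed
qed

lemma has_trace_H1: "has_trace \<Omega> v g \<Longrightarrow> v \<in> H1 \<Omega>" by (simp add: has_trace_def)

lemma H1_L2: "v \<in> H1 \<Omega> \<Longrightarrow> L2 \<D> v" "v \<in> H1 \<Omega> \<Longrightarrow> L2 \<D> (weak_gradient \<Omega> v)"
  using weak_gradient_spec by (auto simp: is_weak_gradient_def)

text \<open>The description in \<open>normal_derivative\<close> determines a number because two
  extensions of \<open>g\<close> differ by a function of vanishing trace, for which Green's formula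
  makes the right hand sides agree. The chosen weak Laplacian may be replaced by \<open>q\<close> as
  the two coincide almost everywhere.\<close>

lemma normal_derivative_eq: assumes u: "u \<in> H1 \<Omega>" and q: "weak_div (weak_gradient \<Omega> u) q" and v: "has_trace \<Omega> v g"
  shows "normal_derivative \<Omega> u g =
    (\<integral>x. cdot (weak_gradient \<Omega> u x) (weak_gradient \<Omega> v x) + q x * v x \<partial>\<D>)"
proof -
  let ?G = "weak_gradient \<Omega>" and ?l = "weak_laplacian \<Omega> u"
  have Lq: "L2 \<D> q" using q by (simp add: weak_div_def)
  have "is_weak_laplacian \<Omega> u q" using is_weak_laplacian_iff[OF weak_gradient_spec[OF u] Lq] q by simp
  then have lap: "is_weak_laplacian \<Omega> u ?l" by (rule weak_laplacian_spec)
  then have Ll: "L2 \<D> ?l" by (simp add: is_weak_laplacian_def)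
  have div: "weak_div (?G u) ?l" using is_weak_laplacian_iff[OF weak_gradient_spec[OF u] Ll] lap by simp
  have ae: "AE x in \<D>. ?l x = q x" by (rule weak_div_unique[OF div q])
  have Lu: "L2 \<D> (?G u)" by (rule H1_L2(2)[OF u])
  have int: "integrable \<D> (\<lambda>x. cdot (?G u x) (?G w x))" "integrable \<D> (\<lambda>x. ?l x * w x)" if "has_trace \<Omega> w g" for w
    using H1_L2[OF has_trace_H1[OF that]] by (auto intro: integrable_cdot integrable_times Lu Ll)
  have same: "(\<integral>x. cdot (?G u x) (?G v x) + ?l x * v x \<partial>\<D>) = (\<integral>x. cdot (?G u x) (?G w x) + ?l x * w x \<partial>\<D>)"
    if w: "has_trace \<Omega> w g" for w
  proof -
    have "(\<integral>x. cdot (?G u x) (?G v x - ?G w x) \<partial>\<D>) = - (\<integral>x. ?l x * (v x - w x) \<partial>\<D>)"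
      by (rule green_zero_trace[OF div has_trace_diff[OF v w]])
    then show ?thesis using int[OF v] int[OF w]
      by (simp add: bounded_bilinear.diff_right[OF bounded_bilinear_cdot] right_diff_distrib) (simp add: algebra_simps)
  qed
  have "normal_derivative \<Omega> u g = (\<integral>x. cdot (?G u x) (?G v x) + ?l x * v x \<partial>\<D>)" unfolding normal_derivative_def
  proof (rule the_equality)
    show "\<forall>w. has_trace \<Omega> w g \<longrightarrow> (\<integral>x. cdot (?G u x) (?G v x) + ?l x * v x \<partial>\<D>) = (\<integral>x. cdot (?G u x) (?G w x) + ?l x * w x \<partial>\<D>)"
      using same by blast
  qed (use v in blast)
  also have "\<dots> = (\<integral>x. cdot (?G u x) (?G v x) + q x * v x \<partial>\<D>)"
  proof (rule integral_cong_AE)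
    note Lv = H1_L2[OF has_trace_H1[OF v]]
    show "(\<lambda>x. cdot (?G u x) (?G v x) + ?l x * v x) \<in> borel_measurable \<D>"
      "(\<lambda>x. cdot (?G u x) (?G v x) + q x * v x) \<in> borel_measurable \<D>"
      by (intro borel_measurable_add cdot_measurable borel_measurable_times L2_measurable Lv Lu Ll Lq)+
    show "AE x in \<D>. cdot (?G u x) (?G v x) + ?l x * v x = cdot (?G u x) (?G v x) + q x * v x"
      using ae by eventually_elim simp
  qed
  finally show ?thesis .
qed

lemma surface_L2_continuous:
  fixes f :: "real^'n \<Rightarrow> complex" assumes f: "continuous_on UNIV f" shows "L2 (surface_measure \<Omega>) f"
proof -
  interpret finite_measure "surface_measure \<Omega>" by (rule surface_measure_finite[OF dim open_domain bounded_domain C11])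
  obtain B where B: "\<And>x. x \<in> closure \<Omega> \<Longrightarrow> norm (f x) \<le> B" using continuous_bounded[OF f] by metis
  show ?thesis
  proof (rule L2_bounded)
    have "f \<in> borel_measurable (restrict_space borel (frontier \<Omega>))"
      using f by (intro measurable_restrict_space1 borel_measurable_continuous_onI)
    then show "f \<in> borel_measurable (surface_measure \<Omega>)" by simp
    show "AE x in surface_measure \<Omega>. norm (f x) \<le> B" using B by (intro AE_I2) (auto simp: frontier_def)
  qed
qed

lemma zero_trace_add_has_trace: assumes f: "Ck 1 f" and zt: "zero_trace r G"
  shows "has_trace \<Omega> (\<lambda>x. f x + r x) f" and "AE x in \<D>. weak_gradient \<Omega> (\<lambda>x. f x + r x) x = grad f x + G x"
proof -
  obtain U :: "nat \<Rightarrow> real^'n \<Rightarrow> complex" where U: "\<And>k. Ck 1 (U k)" "L2_tendsto \<D> U r"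
      "L2_tendsto \<D> (\<lambda>k. grad (U k)) G" "\<And>k. L2 (surface_measure \<Omega>) (U k)"
      "(\<lambda>k. l2norm (surface_measure \<Omega>) (U k)) \<longlonglongrightarrow> 0" using zt unfolding zero_trace_def by blast
  \<comment> \<open>The double minus allows sums to be treated by the rule for differences.\<close>
  have U': "Ck 1 (\<lambda>x. f x - - U k x)" and g: "grad (\<lambda>x. f x - - U k x) x = grad f x - - grad (U k) x" for k x
  proof -
    have m: "Ck 1 (\<lambda>x. - U k x)" by (rule Ck_bounded_linear[OF bounded_linear_minus[OF bounded_linear_ident] U(1)])
    show "Ck 1 (\<lambda>x. f x - - U k x)" by (rule grad_diff(1)[OF f m])
    have "grad (\<lambda>x. - U k x) x = - grad (U k) x"
      by (simp add: vec_eq_iff grad_bounded_linear[OF bounded_linear_minus[OF bounded_linear_ident] U(1)])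
    then show "grad (\<lambda>x. f x - - U k x) x = grad f x - - grad (U k) x" using grad_diff(2)[OF f m] by simp
  qed
  note Lf = continuous_L2[OF Ck1_continuous[OF f]] continuous_L2[OF Ck1_continuous_grad[OF f]]
  note LU = continuous_L2[OF Ck1_continuous[OF U(1)]] continuous_L2[OF Ck1_continuous_grad[OF U(1)]]
  have t1: "L2_tendsto \<D> (\<lambda>k x. f x + U k x) (\<lambda>x. f x + r x)"
    using U(2) by (auto simp: L2_tendsto_def intro: L2_add Lf LU)
  have t2: "L2_tendsto \<D> (\<lambda>k. grad (\<lambda>x. f x + U k x)) (\<lambda>x. grad f x + G x)"
  proof -
    have "(\<lambda>k. grad (\<lambda>x. f x + U k x)) = (\<lambda>k x. grad f x + grad (U k) x)" using g by auto
    then show ?thesis using U(3) by (auto simp: L2_tendsto_def intro: L2_add Lf LU)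
  qed
  have C: "Ck 1 (\<lambda>x. f x + U k x)" for k using U'[of k] by simp
  have wg: "is_weak_gradient \<Omega> (\<lambda>x. f x + r x) (\<lambda>x. grad f x + G x)"
    by (rule is_weak_gradient_limit[OF weak_gradient_classical[OF C] t1 t2])
  then show ae: "AE x in \<D>. weak_gradient \<Omega> (\<lambda>x. f x + r x) x = grad f x + G x" by (rule weak_gradient_eq_AE)
  have H: "(\<lambda>x. f x + r x) \<in> H1 \<Omega>" using wg by (auto simp: H1_def)
  note LW = H1_L2(2)[OF H]
  have Lg: "L2 \<D> (grad (\<lambda>x. f x + U k x))" for k by (rule continuous_L2[OF Ck1_continuous_grad[OF C]])
  have LG: "L2 \<D> (\<lambda>x. grad f x + G x)" using t2 by (simp add: L2_tendsto_def)
  show "has_trace \<Omega> (\<lambda>x. f x + r x) f" unfolding has_trace_def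
  proof (intro conjI H exI[of _ "\<lambda>k x. f x + U k x"] allI C t1)
    have "l2norm \<D> (\<lambda>x. grad (\<lambda>x. f x + U k x) x - weak_gradient \<Omega> (\<lambda>x. f x + r x) x) =
        l2norm \<D> (\<lambda>x. grad (\<lambda>x. f x + U k x) x - (grad f x + G x))" for k
      using ae by (intro l2norm_cong_AE borel_measurable_diff L2_measurable Lg LW LG) (auto elim: eventually_mono)
    then show "L2_tendsto \<D> (\<lambda>k. grad (\<lambda>x. f x + U k x)) (weak_gradient \<Omega> (\<lambda>x. f x + r x))"
      using t2 LW by (simp add: L2_tendsto_l2norm)
    show "L2_tendsto (surface_measure \<Omega>) (\<lambda>k x. f x + U k x) f"
      using U(5) surface_L2_continuous[OF Ck1_continuous[OF f]] surface_L2_continuous[OF Ck1_continuous[OF C]]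
      by (simp add: L2_tendsto_l2norm)
  qed
qed

lemma has_trace_classical: assumes f: "Ck 1 f" shows "has_trace \<Omega> f f"
proof -
  have g0: "grad (\<lambda>_ :: real^'n. 0 :: complex) = (\<lambda>_. 0)"  by (rule ext, rule grad_eq_0[of UNIV]) auto
  have "zero_trace (\<lambda>_. 0) (\<lambda>_. 0)" unfolding zero_trace_def
  proof (intro exI[of _ "\<lambda>_ _. 0"] conjI allI)
    have c: "Ck m (\<lambda>_ :: real^'n. 0 :: complex)" for m
      using Ck_bounded_linear[OF bounded_linear_zero, of m "\<lambda>_ :: real^'n. 0 :: complex"] by (induction m) (auto simp: g0)
    show "Ck 1 (\<lambda>_ :: real^'n. 0 :: complex)" by (rule c)
    show "L2 (surface_measure \<Omega>) (\<lambda>_. 0 :: complex)" by (rule surface_L2_continuous) simp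
  qed (simp_all add: g0 L2_tendsto_l2norm continuous_L2 l2norm_def)
  from zero_trace_add_has_trace(1)[OF f this] show ?thesis by simp
qed

subsection \<open>The magnetic equation\<close>

text \<open>What the expanded equation \<open>(- \<i> \<nabla> + a)^2 u + V u - \<mu> u = 0\<close>
  prescribes for the Laplacian of \<open>u\<close>, with \<open>G\<close> in place of its
  gradient.\<close>

definition magnetic_rhs ::
  "(real^'n \<Rightarrow> real^'n) \<Rightarrow> (real^'n \<Rightarrow> real) \<Rightarrow> complex \<Rightarrow> (real^'n \<Rightarrow> complex) \<Rightarrow> (real^'n \<Rightarrow> complex^'n) \<Rightarrow> real^'n \<Rightarrow> complex" where
  "magnetic_rhs a V \<mu> u G x = - 2 * \<i> * cdot (G x) (cvec (a x)) - \<i> * complex_of_real (divergence a x) * u x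
     + (complex_of_real ((norm (a x))^2 + V x) - \<mu>) * u x"

lemma Linf_bound: assumes "Linf \<Omega> V"
  obtains B where "B \<ge> 0" "AE x in \<D>. \<bar>V x\<bar> \<le> B"
proof -
  obtain C where C: "AE x in \<D>. \<bar>V x\<bar> \<le> C" using assms by (auto simp: Linf_def)
  then have "AE x in \<D>. \<bar>V x\<bar> \<le> max C 0" by eventually_elim simp
  then show thesis by (intro that[of "max C 0"]) auto
qed

lemma L2_Linf_mult: assumes V: "Linf \<Omega> V" and u: "L2 \<D> u"
  shows "L2 \<D> (\<lambda>x. complex_of_real (V x) * u x)"
proof -
  obtain B where B: "AE x in \<D>. \<bar>V x\<bar> \<le> B" using Linf_bound[OF V] by metis
  show ?thesis by (rule L2_mult_bounded[OF u, where B = B]) (use B V in \<open>auto simp: Linf_def\<close>)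
qed

lemma magnetic_rhs_L2: assumes u: "L2 \<D> u" and G: "L2 \<D> G" and a: "Ck 1 a" and V: "Linf \<Omega> V"
  shows "L2 \<D> (magnetic_rhs a V \<mu> u G)"
proof -
  have ca: "continuous_on UNIV (\<lambda>x. cvec (a x))" by (rule continuous_cvec[OF Ck1_continuous[OF a]])
  have n: "continuous_on UNIV (\<lambda>x. (norm (a x))^2)" by (intro continuous_on_power continuous_on_norm Ck1_continuous[OF a])
  have eq: "magnetic_rhs a V \<mu> u G = (\<lambda>x. (- 2 * \<i>) * cdot (G x) (cvec (a x)) + (- \<i>) * (of_real (divergence a x) * u x)
      + (of_real ((norm (a x))^2) * u x + of_real (V x) * u x + (- \<mu>) * u x))"
    by (simp add: magnetic_rhs_def fun_eq_iff algebra_simps)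
  show ?thesis unfolding eq
    by (intro L2_add L2_cmult L2_real_continuous_mult[OF u n] L2_Linf_mult[OF V u] L2_real_continuous_mult[OF u divergence_continuous[OF a]]
        L2_bounded_bilinear_continuous[OF bounded_bilinear_cdot G ca] u)
qed

text \<open>In the weak equation one term pairs the potential times \<open>u\<close> with the
  gradient of the test function; \<open>weak_div_product\<close> moves this derivative back, as the
  potential is on \<Omega> the restriction of a C1 field.\<close>

lemma magnetic_eq_iff: assumes u: "u \<in> H1 \<Omega>" and a: "Ck 1 a" and Aa: "\<And>x. x \<in> \<Omega> \<Longrightarrow> A x = a x" and V: "Linf \<Omega> V"
  shows "magnetic_schroedinger_eq \<Omega> A V \<mu> u \<longleftrightarrow> weak_div (weak_gradient \<Omega> u) (magnetic_rhs a V \<mu> u (weak_gradient \<Omega> u))"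
proof -
  let ?G = "weak_gradient \<Omega> u" and ?q = "magnetic_rhs a V \<mu> u (weak_gradient \<Omega> u)"
  note L = H1_L2[OF u] and P = weak_div_product[OF weak_gradient_spec[OF u] a]
  have Lq: "L2 \<D> ?q" by (rule magnetic_rhs_L2[OF L a V])
  have main: "(\<integral>x. cdot ((- \<i>) *s ?G x + u x *s cvec (A x)) (\<i> *s cvec (grad p x) + of_real (p x) *s cvec (A x))
        + (of_real (V x) - \<mu>) * u x * of_real (p x) \<partial>\<D>)
      = (\<integral>x. cdot (?G x) (cvec (grad p x)) \<partial>\<D>) + (\<integral>x. ?q x * of_real (p x) \<partial>\<D>)" (is "?lhs = ?rhs")
    if p: "p \<in> test_functions \<Omega>" for p
  proof -
    note T = test_function_L2[OF p]
    let ?f = "\<lambda>x. cdot (u x *s cvec (a x)) (cvec (grad p x))"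
      and ?g = "\<lambda>x. (of_real (divergence a x) * u x + cdot (?G x) (cvec (a x))) * of_real (p x)"
    \<comment> \<open>The integrand exceeds the desired one by \<open>\<i> * (?f x + ?g x)\<close>,
      whose integral vanishes by the product rule \<open>P\<close>.\<close>
    have "?lhs = (\<integral>x. cdot (?G x) (cvec (grad p x)) + ?q x * of_real (p x) + \<i> * (?f x + ?g x) \<partial>\<D>)"
      by (rule Bochner_Integration.integral_cong)
        (simp_all add: Aa magnetic_rhs_def cdot_linear cdot_commute cdot_cvec_self algebra_simps del: of_real_power)
    also have "\<dots> = ?rhs + \<i> * ((\<integral>x. ?f x \<partial>\<D>) + (\<integral>x. ?g x \<partial>\<D>))"
    proof -
      have "integrable \<D> ?f" "integrable \<D> ?g"
        using P integrable_cdot[OF _ T(2)] integrable_times[OF _ T(1)] by (simp_all add: weak_div_def)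
      with integrable_cdot[OF L(2) T(2)] integrable_times[OF Lq T(1)] show ?thesis
        by (simp only: Bochner_Integration.integral_add Bochner_Integration.integrable_add integral_mult_right_zero
            integrable_mult_right)
    qed
    finally show ?thesis using weak_divD[OF P p] by simp
  qed
  show ?thesis
    unfolding magnetic_schroedinger_eq_def weak_div_def using L(2) Lq main by (simp add: eq_neg_iff_add_eq_0)
qed

end

section \<open>Completeness of the space of square integrable functions\<close>

lemma l2norm_sum_le:
  fixes m :: nat assumes "\<And>k. L2 M (D k)"
  shows "L2 M (\<lambda>x. \<Sum>k<m. D k x) \<and> l2norm M (\<lambda>x. \<Sum>k<m. D k x) \<le> (\<Sum>k<m. l2norm M (D k))"
proof (induction m)
  case 0 show ?case by (simp add: L2_def l2norm_def)
next
  case (Suc m)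
  then show ?case
    using L2_add[of M "\<lambda>x. \<Sum>k<m. D k x" "D m"] l2norm_triangle[of M "\<lambda>x. \<Sum>k<m. D k x" "D m"] assms[of m] by simp
qed

lemma L2_nn_integral: assumes "L2 M f" shows "(\<integral>\<^sup>+x. ennreal ((norm (f x))^2) \<partial>M) = ennreal ((l2norm M f)^2)"
  unfolding l2norm_sq by (rule nn_integral_eq_integral) (use L2_square_integrable[OF assms] in auto)

lemma L2_of_nn_integral:
  assumes m: "f \<in> borel_measurable M" and le: "(\<integral>\<^sup>+x. ennreal ((norm (f x))^2) \<partial>M) \<le> ennreal (c^2)" and c: "0 \<le> c"
  shows "L2 M f \<and> l2norm M f \<le> c"
proof -
  have "(\<integral>\<^sup>+x. ennreal (norm ((norm (f x))^2)) \<partial>M) < \<infinity>" using le by (simp add: le_less_trans)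
  then have L: "L2 M f" unfolding L2_def using m by (intro conjI integrableI_bounded) auto
  then have "ennreal ((l2norm M f)^2) \<le> ennreal (c^2)" using le L2_nn_integral[OF L] by simp
  then have "(l2norm M f)^2 \<le> c^2" by simp
  then show ?thesis using L c by (auto intro: power2_le_imp_le)
qed

text \<open>The argument of Riesz and Fischer: bounded norms of the partial sums \<open>S m\<close>
  and monotone convergence give absolute convergence almost everywhere, and Fatou's lemma turns the
  estimates for \<open>F j - F m\<close> into convergence in norm.\<close>

theorem L2_complete: assumes L: "\<And>k. L2 M (F k)" and fast: "\<And>k. l2norm M (\<lambda>x. F (Suc k) x - F k x) \<le> (1/2)^k"
  obtains f where "L2_tendsto M F f"
proof -
  define D where "D k x = F (Suc k) x - F k x" for k x
  have LD: "L2 M (D k)" "l2norm M (D k) \<le> (1/2)^k" for k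
    using fast[of k] L2_diff[OF L L, of "Suc k" k] by (auto simp: D_def[abs_def])
  have LN: "L2 M (\<lambda>x. norm (D k x))" "l2norm M (\<lambda>x. norm (D k x)) = l2norm M (D k)" for k
    using LD(1)[of k] by (auto simp: L2_def l2norm_def)
  define S where "S m x = (\<Sum>k<m. norm (D k x))" for m x
  have S: "L2 M (S m)" "l2norm M (S m) \<le> 2" for m
  proof -
    have "(\<Sum>k<m. l2norm M (\<lambda>x. norm (D k x))) \<le> (\<Sum>k<m. (1/2)^k)" using LD(2) LN(2) by (intro sum_mono) simp
    also have "\<dots> \<le> 2" by (simp add: sum_gp_strict)
    finally show "L2 M (S m)" "l2norm M (S m) \<le> 2"
      using l2norm_sum_le[of M "\<lambda>k x. norm (D k x)" m, OF LN(1)] unfolding S_def[abs_def] by auto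
  qed
  have "(\<integral>\<^sup>+x. (SUP m. ennreal ((norm (S m x))^2)) \<partial>M) = (SUP m. \<integral>\<^sup>+x. ennreal ((norm (S m x))^2) \<partial>M)"
  proof (rule nn_integral_monotone_convergence_SUP)
    show "incseq (\<lambda>m x. ennreal ((norm (S m x))^2))"
      by (intro incseq_SucI le_funI ennreal_leI power_mono) (auto simp: S_def sum_nonneg)
    show "(\<lambda>x. ennreal ((norm (S m x))^2)) \<in> borel_measurable M" for m
      using L2_measurable[OF S(1)[of m]] by measurable
  qed
  also have "\<dots> \<le> ennreal 4"
  proof (rule SUP_least)
    fix m
    have "(l2norm M (S m))^2 \<le> 2^2" by (intro power_mono S) simp
    then show "(\<integral>\<^sup>+x. ennreal ((norm (S m x))^2) \<partial>M) \<le> ennreal 4"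
      unfolding L2_nn_integral[OF S(1)] by (intro ennreal_leI) simp
  qed
  finally have "(\<integral>\<^sup>+x. (SUP m. ennreal ((norm (S m x))^2)) \<partial>M) \<noteq> \<infinity>" by (auto simp: top_unique)
  moreover have "(\<lambda>x. SUP m. ennreal ((norm (S m x))^2)) \<in> borel_measurable M"
    using L2_measurable[OF S(1)] by measurable
  ultimately have "AE x in M. (SUP m. ennreal ((norm (S m x))^2)) \<noteq> \<infinity>" by (rule nn_integral_PInf_AE[rotated])
  then have conv: "AE x in M. convergent (\<lambda>m. F m x)"
  proof eventually_elim
    case (elim x)
    then obtain c where c: "(SUP m. ennreal ((norm (S m x))^2)) = ennreal c" "0 \<le> c"
      by (metis ennreal_cases infinity_ennreal_def)
    have "S m x \<le> sqrt c" for m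
    proof -
      have "ennreal ((norm (S m x))^2) \<le> ennreal c" unfolding c(1)[symmetric] by (rule SUP_upper) simp
      then have "(S m x)^2 \<le> c" using c(2) by simp
      then show ?thesis by (rule real_le_rsqrt)
    qed
    then have "summable (\<lambda>k. norm (D k x))" unfolding S_def by (intro summableI_nonneg_bounded) auto
    then have "summable (\<lambda>k. D k x)" by (rule summable_norm_cancel)
    then have "convergent (\<lambda>m. F 0 x + (\<Sum>k<m. D k x))"
      by (intro convergent_add convergent_const) (simp add: summable_iff_convergent)
    moreover have "F 0 x + (\<Sum>k<m. D k x) = F m x" for m
      using sum_lessThan_telescope[of "\<lambda>k. F k x" m] by (simp add: D_def)
    ultimately show ?case by simp
  qed
  define f where "f x = lim (\<lambda>m. F m x)" for x
  have fm: "f \<in> borel_measurable M"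
    unfolding f_def[abs_def] by (rule borel_measurable_lim_metric) (rule L2_measurable[OF L])
  have tail: "l2norm M (\<lambda>x. F j x - F m x) \<le> 2 * (1/2)^m" if "m \<le> j" for j m
  proof -
    have "(\<Sum>k<j - m. D (m + k) x) = F j x - F m x" for x
      using sum_lessThan_telescope[of "\<lambda>k. F (m + k) x" "j - m"] that by (simp add: D_def)
    then have "l2norm M (\<lambda>x. F j x - F m x) \<le> (\<Sum>k<j - m. l2norm M (D (m + k)))"
      using l2norm_sum_le[of M "\<lambda>k. D (m + k)" "j - m"] LD(1) by simp
    also have "\<dots> \<le> (\<Sum>k<j - m. (1/2)^m * (1/2)^k)" using LD(2) by (intro sum_mono) (metis power_add)
    also have "\<dots> = (1/2)^m * (\<Sum>k<j - m. (1/2)^k)" by (simp add: sum_distrib_left)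
    also have "\<dots> \<le> (1/2)^m * 2" by (intro mult_left_mono) (auto simp: sum_gp_strict)
    finally show ?thesis by simp
  qed
  have close: "L2 M (\<lambda>x. F m x - f x) \<and> l2norm M (\<lambda>x. F m x - f x) \<le> 2 * (1/2)^m" for m
  proof (rule L2_of_nn_integral)
    show "(\<lambda>x. F m x - f x) \<in> borel_measurable M" by (intro borel_measurable_diff fm L2_measurable L)
    have "(\<integral>\<^sup>+x. ennreal ((norm (F m x - f x))^2) \<partial>M) = (\<integral>\<^sup>+x. liminf (\<lambda>j. ennreal ((norm (F m x - F j x))^2)) \<partial>M)"
    proof (rule nn_integral_cong_AE)
      show "AE x in M. ennreal ((norm (F m x - f x))^2) = liminf (\<lambda>j. ennreal ((norm (F m x - F j x))^2))" using conv
      proof eventually_elim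
        case (elim x)
        then have "(\<lambda>j. F j x) \<longlonglongrightarrow> f x" by (simp add: f_def convergent_LIMSEQ_iff)
        then have "(\<lambda>j. ennreal ((norm (F m x - F j x))^2)) \<longlonglongrightarrow> ennreal ((norm (F m x - f x))^2)"
          by (intro tendsto_ennrealI tendsto_power tendsto_norm tendsto_diff tendsto_const)
        then show ?case by (intro lim_imp_Liminf[symmetric]) auto
      qed
    qed
    also have "\<dots> \<le> liminf (\<lambda>j. \<integral>\<^sup>+x. ennreal ((norm (F m x - F j x))^2) \<partial>M)"
    proof (rule nn_integral_liminf)
      show "(\<lambda>x. ennreal ((norm (F m x - F j x))^2)) \<in> borel_measurable M" for j
        using L2_measurable[OF L[of m]] L2_measurable[OF L[of j]] by measurable
    qed
    also have "\<dots> \<le> ennreal ((2 * (1/2)^m)^2)"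
    proof (rule Liminf_le)
      show "\<forall>\<^sub>F j in sequentially. (\<integral>\<^sup>+x. ennreal ((norm (F m x - F j x))^2) \<partial>M) \<le> ennreal ((2 * (1/2)^m)^2)"
        using eventually_ge_at_top[of m]
      proof eventually_elim
        case (elim j)
        then show ?case unfolding L2_nn_integral[OF L2_diff[OF L L]]
          using tail[OF elim] by (intro ennreal_leI power_mono) (auto simp: l2norm_minus_commute[of M "F m"])
      qed
    qed simp
    finally show "(\<integral>\<^sup>+x. ennreal ((norm (F m x - f x))^2) \<partial>M) \<le> ennreal ((2 * (1/2)^m)^2)" .
  qed simp
  have "L2 M f" using L2_diff[OF L[of 0] conjunct1[OF close[of 0]]] by simp
  moreover have "(\<lambda>m. 2 * (1/2 :: real)^m) \<longlonglongrightarrow> 0"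
    using tendsto_mult_left[OF LIMSEQ_power_zero[of "1/2 :: real"], of 2] by simp
  then have "(\<lambda>m. l2norm M (\<lambda>x. F m x - f x)) \<longlonglongrightarrow> 0" by (rule l2norm_tendsto_0[rotated]) (use close in blast)
  ultimately show thesis using L by (intro that[of f]) (simp add: L2_tendsto_l2norm)
qed

subsection \<open>The Hilbert space of classes of square integrable functions\<close>

text \<open>A partial equivalence: only square integrable functions are related to themselves, so
  the quotient consists of their classes. The measure lives on the whole space since a type cannot
  depend on \<Omega>.\<close>

definition l2_rel :: "('a::euclidean_space \<Rightarrow> 'b::euclidean_space) \<Rightarrow> ('a \<Rightarrow> 'b) \<Rightarrow> bool" where
  "l2_rel f g \<longleftrightarrow> L2 lebesgue f \<and> L2 lebesgue g \<and> (AE x in lebesgue. f x = g x)"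

lemma L2_zero: "L2 M (\<lambda>_. 0)" by (simp add: L2_def)

quotient_type (overloaded) ('a, 'b) l2 = "'a::euclidean_space \<Rightarrow> 'b::euclidean_space" / partial: l2_rel
proof (rule part_equivpI)
  show "\<exists>f :: 'a \<Rightarrow> 'b. l2_rel f f" by (rule exI[of _ "\<lambda>_. 0"]) (simp add: l2_rel_def L2_zero)
  show "symp (l2_rel :: ('a \<Rightarrow> 'b) \<Rightarrow> _)" by (auto intro!: sympI simp: l2_rel_def elim: eventually_mono)
  show "transp (l2_rel :: ('a \<Rightarrow> 'b) \<Rightarrow> _)" by (auto intro!: transpI simp: l2_rel_def)
qed

lemma L2_inner_integrable:
  fixes f g :: "'a \<Rightarrow> 'b::euclidean_space" assumes "L2 M f" "L2 M g" shows "integrable M (\<lambda>x. f x \<bullet> g x)"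
  by (rule integrable_L2_product[OF assms])
     (use L2_measurable[OF assms(1)] L2_measurable[OF assms(2)] in \<open>auto simp: Cauchy_Schwarz_ineq2\<close>)

instantiation l2 :: (euclidean_space, euclidean_space) real_vector
begin

lift_definition zero_l2 :: "('a, 'b) l2" is "\<lambda>_. 0" by (simp add: l2_rel_def L2_zero)
lift_definition plus_l2 :: "('a, 'b) l2 \<Rightarrow> ('a, 'b) l2 \<Rightarrow> ('a, 'b) l2" is "\<lambda>f g x. f x + g x"
  by (auto simp: l2_rel_def L2_add)
lift_definition minus_l2 :: "('a, 'b) l2 \<Rightarrow> ('a, 'b) l2 \<Rightarrow> ('a, 'b) l2" is "\<lambda>f g x. f x - g x"
  by (auto simp: l2_rel_def L2_diff)
lift_definition uminus_l2 :: "('a, 'b) l2 \<Rightarrow> ('a, 'b) l2" is "\<lambda>f x. - f x" by (auto simp: l2_rel_def L2_uminus)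
lift_definition scaleR_l2 :: "real \<Rightarrow> ('a, 'b) l2 \<Rightarrow> ('a, 'b) l2" is "\<lambda>c f x. c *\<^sub>R f x"
  by (auto simp: l2_rel_def L2_scaleR)
instance
proof
  fix x y z :: "('a, 'b) l2" and a b :: real
  show "x + y + z = x + (y + z)" by transfer (auto simp: l2_rel_def L2_add algebra_simps)
  show "x + y = y + x" by transfer (auto simp: l2_rel_def L2_add algebra_simps)
  show "0 + x = x" by transfer (auto simp: l2_rel_def)
  show "- x + x = 0" by transfer (auto simp: l2_rel_def L2_zero)
  show "x - y = x + - y" by transfer (auto simp: l2_rel_def L2_diff)
  show "a *\<^sub>R (x + y) = a *\<^sub>R x + a *\<^sub>R y" by transfer (auto simp: l2_rel_def algebra_simps intro!: L2_add L2_scaleR)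
  show "(a + b) *\<^sub>R x = a *\<^sub>R x + b *\<^sub>R x" by transfer (auto simp: l2_rel_def algebra_simps intro!: L2_add L2_scaleR)
  show "a *\<^sub>R b *\<^sub>R x = (a * b) *\<^sub>R x" by transfer (auto simp: l2_rel_def L2_scaleR)
  show "1 *\<^sub>R x = x" by transfer (auto simp: l2_rel_def)
qed

end

instantiation l2 :: (euclidean_space, euclidean_space) real_inner
begin

lift_definition inner_l2 :: "('a, 'b) l2 \<Rightarrow> ('a, 'b) l2 \<Rightarrow> real" is "\<lambda>f g. \<integral>x. f x \<bullet> g x \<partial>lebesgue"
proof -
  fix f f' g g' :: "'a \<Rightarrow> 'b" assume *: "l2_rel f f'" "l2_rel g g'"
  then have [measurable]: "f \<in> borel_measurable lebesgue" "f' \<in> borel_measurable lebesgue"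
      "g \<in> borel_measurable lebesgue" "g' \<in> borel_measurable lebesgue"
    and ae: "AE x in lebesgue. f x = f' x" "AE x in lebesgue. g x = g' x" by (simp_all add: l2_rel_def L2_measurable)
  from ae have "AE x in lebesgue. f x \<bullet> g x = f' x \<bullet> g' x" by eventually_elim simp
  then show "(\<integral>x. f x \<bullet> g x \<partial>lebesgue) = (\<integral>x. f' x \<bullet> g' x \<partial>lebesgue)" by (intro integral_cong_AE) simp_all
qed

definition norm_l2 :: "('a, 'b) l2 \<Rightarrow> real" where "norm_l2 x = sqrt (inner x x)"
definition sgn_l2 :: "('a, 'b) l2 \<Rightarrow> ('a, 'b) l2" where "sgn_l2 x = x /\<^sub>R norm x"
definition dist_l2 :: "('a, 'b) l2 \<Rightarrow> ('a, 'b) l2 \<Rightarrow> real" where "dist_l2 x y = norm (x - y)"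
definition uniformity_l2 :: "(('a, 'b) l2 \<times> ('a, 'b) l2) filter" where
  "uniformity_l2 = (INF e\<in>{0<..}. principal {(x, y). dist x y < e})"
definition open_l2 :: "('a, 'b) l2 set \<Rightarrow> bool" where
  "open_l2 U = (\<forall>x\<in>U. \<forall>\<^sub>F (x', y) in uniformity. x' = x \<longrightarrow> y \<in> U)"

instance
proof
  fix x y z :: "('a, 'b) l2" and a b :: real
  show "dist x y = norm (x - y)" by (rule dist_l2_def)
  show "sgn x = x /\<^sub>R norm x" by (rule sgn_l2_def)
  show "uniformity = (INF e\<in>{0<..}. principal {(x :: ('a, 'b) l2, y). dist x y < e})" by (rule uniformity_l2_def)
  show "open U = (\<forall>x\<in>U. \<forall>\<^sub>F (x', y) in uniformity. x' = x \<longrightarrow> y \<in> U)" for U :: "('a, 'b) l2 set" by (rule open_l2_def)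
  show "inner x y = inner y x" by transfer (simp add: inner_commute)
  show "inner (x + y) z = inner x z + inner y z"
    by transfer (auto simp: l2_rel_def inner_add_left L2_inner_integrable)
  show "inner (a *\<^sub>R x) y = a * inner x y" by transfer simp
  show "0 \<le> inner x x" by transfer (simp add: Bochner_Integration.integral_nonneg)
  show "inner x x = 0 \<longleftrightarrow> x = 0"
  proof (transfer)
    fix f :: "'a \<Rightarrow> 'b" assume "l2_rel f f"
    then have f: "L2 lebesgue f" by (simp add: l2_rel_def)
    have "(\<integral>x. f x \<bullet> f x \<partial>lebesgue) = 0 \<longleftrightarrow> (AE x in lebesgue. f x \<bullet> f x = 0)"
      using L2_inner_integrable[OF f f] by (intro integral_nonneg_eq_0_iff_AE) auto
    then show "(\<integral>x. f x \<bullet> f x \<partial>lebesgue) = 0 \<longleftrightarrow> l2_rel f (\<lambda>_. 0)" using f by (simp add: l2_rel_def L2_zero)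
  qed
  show "norm x = sqrt (inner x x)" by (rule norm_l2_def)
qed

end

lemma L2_rep_l2: "L2 lebesgue (rep_l2 x)" using Quotient3_rel_rep[OF Quotient3_l2, of x x] by (simp add: l2_rel_def)

lemma abs_l2_rep: "abs_l2 (rep_l2 x) = x" by (rule Quotient3_abs_rep[OF Quotient3_l2])

lemma rep_abs_l2: "L2 lebesgue f \<Longrightarrow> AE x in lebesgue. rep_l2 (abs_l2 f) x = f x"
  using Quotient3_rep_abs[OF Quotient3_l2, of f] by (simp add: l2_rel_def)

lemma minus_abs_l2: "L2 lebesgue f \<Longrightarrow> L2 lebesgue g \<Longrightarrow> abs_l2 f - abs_l2 g = abs_l2 (\<lambda>x. f x - g x)"
  and plus_abs_l2: "L2 lebesgue f \<Longrightarrow> L2 lebesgue g \<Longrightarrow> abs_l2 f + abs_l2 g = abs_l2 (\<lambda>x. f x + g x)"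
  and scaleR_abs_l2: "L2 lebesgue f \<Longrightarrow> c *\<^sub>R abs_l2 f = abs_l2 (\<lambda>x. c *\<^sub>R f x)"
  by (auto simp: minus_l2.abs_eq plus_l2.abs_eq scaleR_l2.abs_eq l2_rel_def)

lemma inner_abs_l2: "L2 lebesgue f \<Longrightarrow> L2 lebesgue g \<Longrightarrow> inner (abs_l2 f) (abs_l2 g) = (\<integral>x. f x \<bullet> g x \<partial>lebesgue)"
  by (simp add: inner_l2.abs_eq l2_rel_def)

lemma norm_abs_l2: "L2 lebesgue f \<Longrightarrow> norm (abs_l2 f) = l2norm lebesgue f"
  by (simp add: norm_l2_def inner_abs_l2 l2norm_def power2_norm_eq_inner)

instance l2 :: (euclidean_space, euclidean_space) complete_space
proof
  fix X :: "nat \<Rightarrow> ('a, 'b) l2" assume X: "Cauchy X"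
  have "\<forall>k. \<exists>N. \<forall>m\<ge>N. \<forall>n\<ge>N. dist (X m) (X n) < (1/2)^k" using X by (simp add: Cauchy_def)
  then obtain N where N: "\<And>k m n. N k \<le> m \<Longrightarrow> N k \<le> n \<Longrightarrow> dist (X m) (X n) < (1/2)^k" by metis
  \<comment> \<open>The sum makes \<open>r\<close> increasing with \<open>N k \<le> r k\<close>, and
    the summand \<open>k\<close> makes it unbounded, so \<open>X (r k)\<close> is a subsequence with
    increments below \<open>(1/2)^k\<close>.\<close>
  define r where "r k = (\<Sum>j\<le>k. N j) + k" for k
  have r: "N k \<le> r k" "r k \<le> r (Suc k)" "k \<le> r k" for k by (auto simp: r_def trans_le_add1 member_le_sum)
  define F where "F k = rep_l2 (X (r k))" for k
  have LF: "L2 lebesgue (F k)" for k by (simp add: F_def L2_rep_l2)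
  have XF: "X (r k) = abs_l2 (F k)" for k by (simp add: F_def abs_l2_rep)
  have "l2norm lebesgue (\<lambda>x. F (Suc k) x - F k x) \<le> (1/2)^k" for k
  proof -
    have "l2norm lebesgue (\<lambda>x. F (Suc k) x - F k x) = dist (X (r (Suc k))) (X (r k))"
      unfolding XF dist_norm minus_abs_l2[OF LF LF] by (rule norm_abs_l2[OF L2_diff[OF LF LF], symmetric])
    then show ?thesis using N[of k "r (Suc k)" "r k"] r[of k] by simp
  qed
  then obtain f where f: "L2_tendsto lebesgue F f" by (rule L2_complete[OF LF])
  then have Lf: "L2 lebesgue f" and lim: "(\<lambda>k. l2norm lebesgue (\<lambda>x. F k x - f x)) \<longlonglongrightarrow> 0" by (auto simp: L2_tendsto_l2norm)
  have d: "dist (X (r k)) (abs_l2 f) = l2norm lebesgue (\<lambda>x. F k x - f x)" for k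
    unfolding XF dist_norm minus_abs_l2[OF LF Lf] by (rule norm_abs_l2[OF L2_diff[OF LF Lf]])
  have "X \<longlonglongrightarrow> abs_l2 f"
  proof (rule LIMSEQ_I, fold dist_norm)
    fix e :: real assume e: "0 < e"
    obtain K where K: "\<And>m n. K \<le> m \<Longrightarrow> K \<le> n \<Longrightarrow> dist (X m) (X n) < e / 2"
      using X e unfolding Cauchy_def by (meson half_gt_zero)
    obtain k0 where k0: "\<And>k. k0 \<le> k \<Longrightarrow> dist (X (r k)) (abs_l2 f) < e / 2"
      using LIMSEQ_D[OF lim, of "e/2"] e unfolding d by auto
    define k where "k = max K k0"
    have "dist (X n) (abs_l2 f) < e" if "K \<le> n" for n
    proof -
      have "dist (X n) (X (r k)) < e / 2" using that r(3)[of k] by (intro K) (auto simp: k_def)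
      moreover have "dist (X (r k)) (abs_l2 f) < e / 2" by (rule k0) (simp add: k_def)
      ultimately show ?thesis using dist_triangle[of "X n" "abs_l2 f" "X (r k)"] by linarith
    qed
    then show "\<exists>no. \<forall>n\<ge>no. dist (X n) (abs_l2 f) < e" by blast
  qed
  then show "convergent X" by (auto simp: convergent_def)
qed

section \<open>The Lax-Milgram theorem\<close>

text \<open>The representing vector minimises \<open>J\<close> on \<open>S\<close>. The
  parallelogram law makes a minimising sequence Cauchy, and the quadratic inequality
  \<open>quad\<close> in the direction \<open>w\<close> shows that the first variation
  vanishes.\<close>

theorem riesz:
  fixes S :: "'h::{real_inner, complete_space} set" assumes S: "subspace S" "closed S"
    and add: "\<And>u v. u \<in> S \<Longrightarrow> v \<in> S \<Longrightarrow> l (u + v) = l u + l v"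
    and scale: "\<And>c v. v \<in> S \<Longrightarrow> l (c *\<^sub>R v) = c * l v"
    and bound: "\<And>v. v \<in> S \<Longrightarrow> \<bar>l v\<bar> \<le> K * norm v"
  obtains r where "r \<in> S" "\<And>v. v \<in> S \<Longrightarrow> inner r v = (l v :: real)"
proof -
  define J where "J v = (norm v)^2 / 2 - l v" for v
  have lb: "- (K^2 / 2) \<le> J v" if "v \<in> S" for v
  proof -
    have "l v \<le> K * norm v" using bound[OF that] by linarith
    moreover have "0 \<le> (norm v - K)^2" by simp
    ultimately show ?thesis unfolding J_def by (simp add: power2_diff field_simps)
  qed
  have ne: "J ` S \<noteq> {}" using subspace_0[OF S(1)] by auto
  have bdd: "bdd_below (J ` S)" using lb by (auto intro!: bdd_belowI2)
  define m where "m = Inf (J ` S)"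
  have m_le: "m \<le> J v" if "v \<in> S" for v unfolding m_def using bdd that by (intro cInf_lower) auto
  have "\<exists>v\<in>S. J v < m + 1 / real (Suc n)" for n
    using cInf_lessD[OF ne, of "m + 1 / real (Suc n)"] by (auto simp: m_def)
  then obtain v where v: "\<And>n. v n \<in> S" "\<And>n. J (v n) < m + 1 / real (Suc n)" by metis
  have par: "(norm (a - b))^2 \<le> 4 * (J a - m) + 4 * (J b - m)" if ab: "a \<in> S" "b \<in> S" for a b
  proof -
    have "m \<le> J ((1/2) *\<^sub>R (a + b))" using ab S(1) by (intro m_le) (auto intro: subspace_add subspace_scale)
    moreover have "J ((1/2) *\<^sub>R (a + b)) = (norm (a + b))^2 / 8 - (l a + l b) / 2"
      using ab S(1) by (simp add: J_def scale[OF subspace_add] add power_divide)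
    moreover have "(norm (a + b))^2 + (norm (a - b))^2 = 2 * (norm a)^2 + 2 * (norm b)^2"
      by (simp add: power2_norm_eq_inner inner_add_left inner_add_right inner_diff_left inner_diff_right)
    ultimately show ?thesis unfolding J_def by (simp add: field_simps)
  qed
  have "Cauchy v"
  proof (rule metric_CauchyI)
    fix e :: real assume e: "0 < e"
    obtain n0 where n0: "1 / real (Suc n0) < e^2 / 8" using e by (metis nat_approx_posE zero_less_divide_iff zero_less_numeral zero_less_power)
    have "dist (v p) (v q) < e" if "n0 \<le> p" "n0 \<le> q" for p q
    proof -
      have "J (v p) - m < e^2 / 8" "J (v q) - m < e^2 / 8"
        using v(2)[of p] v(2)[of q] n0 that frac_le[of 1 1 "real (Suc n0)" "real (Suc p)"] frac_le[of 1 1 "real (Suc n0)" "real (Suc q)"] by auto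
      moreover have "X < E" if "A < E / 8" "B < E / 8" "X \<le> 4 * A + 4 * B" for A B X E :: real using that by (simp add: field_simps)
      ultimately have "(norm (v p - v q))^2 < e^2" using par[OF v(1) v(1), of p q] by blast
      then show ?thesis using e by (simp add: dist_norm power_less_imp_less_base)
    qed
    then show "\<exists>M. \<forall>m\<ge>M. \<forall>n\<ge>M. dist (v m) (v n) < e" by blast
  qed
  then obtain r where lim: "v \<longlonglongrightarrow> r" using Cauchy_convergent convergent_def by blast
  have rS: "r \<in> S" using closed_sequentially[OF S(2)] v(1) lim by blast
  have l0: "l 0 = 0" using scale[of 0 0] subspace_0[OF S(1)] by simp
  have ldiff: "l (a - b) = l a - l b" if "a \<in> S" "b \<in> S" for a b
    using add[of "a - b" b] that S(1) by (simp add: subspace_diff)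
  have "(\<lambda>n. l (v n)) \<longlonglongrightarrow> l r"
  proof -
    have "(\<lambda>n. K * norm (v n - r)) \<longlonglongrightarrow> 0"
      using tendsto_mult_left[OF tendsto_norm_zero[OF LIM_zero[OF lim]], of K] by simp
    then have "(\<lambda>n. l (v n) - l r) \<longlonglongrightarrow> 0"
    proof (rule Lim_null_comparison[rotated])
      show "\<forall>\<^sub>F n in sequentially. norm (l (v n) - l r) \<le> K * norm (v n - r)"
        using bound[OF subspace_diff[OF S(1) v(1) rS]] by (simp add: ldiff[OF v(1) rS])
    qed
    then show ?thesis by (rule LIM_zero_cancel)
  qed
  then have "(\<lambda>n. J (v n)) \<longlonglongrightarrow> J r" unfolding J_def by (intro tendsto_intros lim) auto
  moreover have "(\<lambda>n. m + 1 / real (Suc n)) \<longlonglongrightarrow> m + 0"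
    by (intro tendsto_add tendsto_const lim_1_over_n[THEN LIMSEQ_Suc])
  ultimately have "J r \<le> m + 0" by (rule LIMSEQ_le) (use v(2) in \<open>auto intro: less_imp_le\<close>)
  then have Jr: "J r \<le> J w" if "w \<in> S" for w using m_le[OF that] by simp
  show thesis
  proof (rule that[OF rS])
    fix w assume w: "w \<in> S"
    define d where "d = inner r w - l w"
    have quad: "0 \<le> t * d + t^2 / 2 * (norm w)^2" for t
    proof -
      have "J r \<le> J (r + t *\<^sub>R w)" using rS w S(1) by (intro Jr subspace_add subspace_scale)
      also have "J (r + t *\<^sub>R w) = J r + t * d + t^2 / 2 * (norm w)^2"
      proof -
        have "(norm (r + t *\<^sub>R w))^2 = (norm r)^2 + 2 * t * inner r w + t^2 * (norm w)^2"
          unfolding power2_norm_eq_inner by (simp add: inner_add_left inner_add_right inner_commute[of w r] power2_eq_square algebra_simps)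
        moreover have "l (r + t *\<^sub>R w) = l r + t * l w" using rS w S(1) by (simp add: add subspace_scale scale)
        ultimately show ?thesis unfolding J_def d_def by (simp add: field_simps)
      qed
      finally show ?thesis by simp
    qed
    have "d = 0"
    proof (rule ccontr)
      assume d0: "d \<noteq> 0"
      \<comment> \<open>The inequality \<open>quad\<close> is used at \<open>t = - d / n\<close>,
        close to its minimiser; the summand 1 avoids division by zero when
        \<open>w = 0\<close>.\<close>
      define n where "n = (norm w)^2 + 1"
      have n: "n > 0" "(norm w)^2 \<le> n" by (auto simp: n_def add_nonneg_pos)
      have "0 \<le> (- d / n) * d + (- d / n)^2 / 2 * (norm w)^2" by (rule quad)
      also have "\<dots> \<le> (- d / n) * d + (- d / n)^2 / 2 * n" using n by (intro add_left_mono mult_left_mono) auto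
      also have "\<dots> = - (d^2 / n) / 2" using n by (simp add: power2_eq_square field_simps)
      also have "\<dots> < 0" using d0 n by simp
      finally show False by simp
    qed
    then show "inner r w = l w" by (simp add: d_def)
  qed
qed

theorem lax_milgram:
  fixes S :: "'h::{real_inner, complete_space} set" and b :: "'h \<Rightarrow> 'h \<Rightarrow> real"
  assumes S: "subspace S" "closed S" and bil: "bounded_bilinear b" and l: "bounded_linear l"
    and c: "c > 0" and coercive: "\<And>v. v \<in> S \<Longrightarrow> c * (norm v)^2 \<le> b v v"
  obtains u where "u \<in> S" "\<And>v. v \<in> S \<Longrightarrow> b u v = (l v :: real)"
proof -
  interpret b: bounded_bilinear b by (rule bil)
  interpret l: bounded_linear l by (rule l)
  obtain C where C: "C > 0" "\<And>x y. \<bar>b x y\<bar> \<le> norm x * norm y * C" using b.pos_bounded by auto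
  obtain K where K: "\<And>x. \<bar>l x\<bar> \<le> norm x * K" using l.bounded by auto
  have "\<exists>r. r \<in> S \<and> (\<forall>v\<in>S. inner r v = b u v)" for u
    by (rule riesz[OF S, of "b u" "norm u * C"]) (use C(2)[of u] in \<open>auto simp: b.add_right b.scaleR_right ac_simps\<close>)
  then obtain T where T: "\<And>u. T u \<in> S" "\<And>u v. v \<in> S \<Longrightarrow> inner (T u) v = b u v" by metis
  obtain f where f: "f \<in> S" "\<And>v. v \<in> S \<Longrightarrow> inner f v = l v"
    by (rule riesz[OF S, of l K]) (use K in \<open>auto simp: l.add l.scaleR ac_simps\<close>)
  \<comment> \<open>Enlarging \<open>C\<close> to at least \<open>c\<close> keeps
    \<open>1 - c^2 / C'^2\<close> nonnegative.\<close>
  define C' where "C' = max C c"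
  have C': "C' \<ge> c" "C' \<ge> C" "C' > 0" using C c by (auto simp: C'_def)
  \<comment> \<open>This step size minimises \<open>1 - 2 * t * c + t^2 * C'^2\<close>, the bound
    for the squared contraction factor, with minimum \<open>1 - c^2 / C'^2\<close>.\<close>
  define t where "t = c / C'^2"
  have t: "t > 0" using c C' by (simp add: t_def)
  define \<Phi> where "\<Phi> u = u - t *\<^sub>R (T u - f)" for u
  define k where "k = sqrt (1 - c^2 / C'^2)"
  have ck: "c^2 / C'^2 \<le> 1" "c^2 / C'^2 > 0" using c C' by (auto intro: power_mono)
  have k: "0 \<le> k" "k < 1" using ck by (auto simp: k_def real_sqrt_lt_1_iff)
  have lip: "dist (\<Phi> x) (\<Phi> y) \<le> k * dist x y" if "x \<in> S" "y \<in> S" for x y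
  proof -
    let ?d = "x - y" and ?r = "T x - T y"
    have dS: "?d \<in> S" "?r \<in> S" using that T(1) S(1) by (auto intro: subspace_diff)
    have r: "inner ?r v = b ?d v" if "v \<in> S" for v using that by (simp add: inner_diff_left T(2) b.diff_left)
    have "(norm ?r)^2 = b ?d ?r" using r[OF dS(2)] by (simp add: power2_norm_eq_inner)
    also have "\<dots> \<le> norm ?d * norm ?r * C'" using C(2)[of ?d ?r] C'(2) mult_left_mono[of C C' "norm ?d * norm ?r"] by auto
    finally have "norm ?r \<le> C' * norm ?d" by (cases "norm ?r = 0") (use C' in \<open>auto simp: power2_eq_square mult_le_cancel_right ac_simps\<close>)
    then have nr: "(norm ?r)^2 \<le> C'^2 * (norm ?d)^2" by (metis norm_ge_zero power_mono power_mult_distrib)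
    have "\<Phi> x - \<Phi> y = ?d - t *\<^sub>R ?r" by (simp add: \<Phi>_def algebra_simps)
    then have "(norm (\<Phi> x - \<Phi> y))^2 = (norm ?d)^2 - 2 * t * inner ?r ?d + t^2 * (norm ?r)^2"
      by (simp only: power2_norm_eq_inner inner_diff_left inner_diff_right inner_scaleR_left inner_scaleR_right)
         (simp add: inner_commute power2_eq_square algebra_simps)
    also have "inner ?r ?d = b ?d ?d" by (rule r[OF dS(1)])
    also have "(norm ?d)^2 - 2 * t * b ?d ?d + t^2 * (norm ?r)^2 \<le> (norm ?d)^2 - 2 * t * (c * (norm ?d)^2) + t^2 * (C'^2 * (norm ?d)^2)"
      using coercive[OF dS(1)] nr t by (intro add_mono diff_mono mult_left_mono) auto
    also have "\<dots> = (1 - c^2 / C'^2) * (norm ?d)^2" using C' by (simp add: t_def power2_eq_square field_simps)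
    also have "\<dots> = (k * norm ?d)^2" using ck by (simp add: k_def power_mult_distrib)
    finally show ?thesis using k unfolding dist_norm by (auto intro: power2_le_imp_le)
  qed
  have "\<exists>!x\<in>S. \<Phi> x = x"
  proof (rule Banach_fix[OF _ _ k])
    show "complete S" using S(2) by (simp add: complete_eq_closed)
    show "S \<noteq> {}" using subspace_0[OF S(1)] by auto
    show "\<Phi> ` S \<subseteq> S" using T(1) f(1) S(1) by (auto simp: \<Phi>_def intro!: subspace_diff subspace_scale)
  qed (use lip in auto)
  then obtain u where u: "u \<in> S" "\<Phi> u = u" by auto
  then have "T u = f" using t by (simp add: \<Phi>_def)
  then show thesis using T(2) f(2) u(1) by (intro that[of u]) metis+
qed

section \<open>Solvability of the boundary value problem\<close>

lemma norm_rep_l2: "norm x = l2norm lebesgue (rep_l2 x)"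
  using norm_abs_l2[OF L2_rep_l2[of x]] by (simp add: abs_l2_rep)

lemma subspace_closure:
  fixes D :: "'a::real_normed_vector set" assumes "subspace D" shows "subspace (closure D)"
proof (rule subspaceI)
  show "0 \<in> closure D" using subspace_0[OF assms] closure_subset by blast
  fix x y c assume "x \<in> closure D"
  then obtain u where u: "\<And>n. u n \<in> D" "u \<longlonglongrightarrow> x" unfolding closure_sequential by blast
  show "c *\<^sub>R x \<in> closure D" unfolding closure_sequential
    by (rule exI[of _ "\<lambda>n. c *\<^sub>R u n"]) (use u subspace_scale[OF assms] tendsto_scaleR[OF tendsto_const] in blast)
  assume "y \<in> closure D"
  then obtain v where v: "\<And>n. v n \<in> D" "v \<longlonglongrightarrow> y" unfolding closure_sequential by blast
  show "x + y \<in> closure D" unfolding closure_sequential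
    by (rule exI[of _ "\<lambda>n. u n + v n"]) (use u v subspace_add[OF assms] tendsto_add in blast)
qed

text \<open>The arguments \<open>z, z'\<close> are pairs of the value and the gradient of a function at one point; \<open>y\<close> and \<open>v\<close>
  are the values of the potentials there.\<close>

definition covariant :: "real^'n \<Rightarrow> complex \<times> (complex^'n) \<Rightarrow> complex^'n" where
  "covariant y z = (- \<i>) *s snd z + fst z *s cvec y"

definition magnetic_form :: "real^'n \<Rightarrow> real \<Rightarrow> complex \<Rightarrow> complex \<times> (complex^'n) \<Rightarrow> complex \<times> (complex^'n) \<Rightarrow> complex" where
  "magnetic_form y v \<mu> z z' = cdot (covariant y z) (cnjv (covariant y z')) + (complex_of_real v - \<mu>) * fst z * cnj (fst z')"

lemma linear_covariant: "covariant y (z + z') = covariant y z + covariant y z'" "covariant y (c *\<^sub>R z) = c *\<^sub>R covariant y z"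
  by (simp_all add: covariant_def vec_eq_iff algebra_simps)

lemma norm_fst_snd_le: "norm (fst z) \<le> norm z" "norm (snd z) \<le> norm z"
  using norm_fst_le[of "fst z" "snd z"] norm_snd_le[of "snd z" "fst z"] by simp_all

lemma norm_covariant_le: "norm (covariant y z) \<le> (1 + norm y) * norm z"
proof -
  have "norm (covariant y z) \<le> norm (snd z) + norm (fst z) * norm y"
    unfolding covariant_def by (rule order_trans[OF norm_triangle_ineq]) (simp add: norm_smult_vec)
  also have "\<dots> \<le> norm z + norm z * norm y" using norm_fst_snd_le[of z] by (intro add_mono mult_right_mono) auto
  finally show ?thesis by (simp add: algebra_simps)
qed

lemma cnjv_linear: "cnjv (p + q) = cnjv p + cnjv q" "cnjv (c *\<^sub>R p) = c *\<^sub>R cnjv p"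
  by (simp_all add: cnjv_def vec_eq_iff)

lemma magnetic_form_linear:
  "magnetic_form y v \<mu> (z + w) z' = magnetic_form y v \<mu> z z' + magnetic_form y v \<mu> w z'"
  "magnetic_form y v \<mu> z (z' + w) = magnetic_form y v \<mu> z z' + magnetic_form y v \<mu> z w"
  "magnetic_form y v \<mu> (c *\<^sub>R z) z' = c *\<^sub>R magnetic_form y v \<mu> z z'"
  "magnetic_form y v \<mu> z (c *\<^sub>R z') = c *\<^sub>R magnetic_form y v \<mu> z z'"
  by (simp_all add: cnjv_linear magnetic_form_def linear_covariant cdot_linear algebra_simps
     bounded_bilinear.scaleR_left[OF bounded_bilinear_cdot] bounded_bilinear.scaleR_right[OF bounded_bilinear_cdot])

lemma magnetic_form_bound: assumes "norm y \<le> A" "\<bar>v\<bar> \<le> B"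
  shows "norm (magnetic_form y v \<mu> z z') \<le> ((1 + A)^2 + B + norm \<mu>) * (norm z * norm z')"
proof -
  have A: "0 \<le> A" using assms(1) norm_ge_zero[of y] by linarith
  have c: "norm (covariant y z) \<le> (1 + A) * norm z" for z
    using norm_covariant_le[of y z] mult_right_mono[of "1 + norm y" "1 + A" "norm z"] assms(1) by simp
  have "norm (cdot (covariant y z) (cnjv (covariant y z'))) \<le> norm (covariant y z) * norm (covariant y z')"
    using norm_cdot_le[of "covariant y z" "cnjv (covariant y z')"] by simp
  also have "\<dots> \<le> ((1 + A) * norm z) * ((1 + A) * norm z')" using A by (intro mult_mono c) auto
  finally have 1: "norm (cdot (covariant y z) (cnjv (covariant y z'))) \<le> (1 + A)^2 * (norm z * norm z')"
    by (simp add: power2_eq_square ac_simps)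
  have "norm (of_real v - \<mu>) \<le> B + norm \<mu>" using norm_triangle_ineq4[of "of_real v" \<mu>] assms(2) by simp
  then have "norm (of_real v - \<mu>) * (norm (fst z) * norm (fst z')) \<le> (B + norm \<mu>) * (norm z * norm z')"
    using assms(2) norm_fst_snd_le(1)[of z] norm_fst_snd_le(1)[of z'] by (intro mult_mono) (auto intro: mult_mono)
  then have 2: "norm ((of_real v - \<mu>) * fst z * cnj (fst z')) \<le> (B + norm \<mu>) * (norm z * norm z')"
    by (simp add: norm_mult mult.assoc)
  show ?thesis unfolding magnetic_form_def using norm_triangle_le[OF add_mono[OF 1 2]] by (simp add: algebra_simps)
qed

text \<open>On the diagonal the real part of the form misses only a multiple of
  \<open>(norm (fst z))^2\<close>, and its imaginary part is minus \<open>Im \<mu>\<close> times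
  this square. Multiplication by \<open>Complex 1 K\<close> adds \<open>K * Im \<mu>\<close> times
  it, which makes up for the deficit.\<close>

lemma magnetic_form_coercive: assumes "norm y \<le> A" "\<bar>v\<bar> \<le> B" "K * Im \<mu> \<ge> 1/2 + A^2 + B + \<bar>Re \<mu>\<bar>"
  shows "(norm z)^2 / 2 \<le> Re (Complex 1 K * magnetic_form y v \<mu> z z)"
proof -
  let ?p = "covariant y z" and ?u = "fst z"
  have "cdot ?p (cnjv ?p) = of_real (\<Sum>i\<in>UNIV. (norm (?p $ i))^2)"
    by (simp add: cdot_def cnjv_def complex_norm_square del: of_real_power)
  also have "(\<Sum>i\<in>UNIV. (norm (?p $ i))^2) = (norm ?p)^2" by (simp add: norm_vec_def L2_set_def sum_nonneg)
  finally have p: "cdot ?p (cnjv ?p) = of_real ((norm ?p)^2)" .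
  have u: "?u * cnj ?u = of_real ((norm ?u)^2)" by (simp add: complex_norm_square del: of_real_power)
  have "Re (Complex 1 K * magnetic_form y v \<mu> z z) = (norm ?p)^2 + (v - Re \<mu>) * (norm ?u)^2 + K * Im \<mu> * (norm ?u)^2"
    unfolding magnetic_form_def p mult.assoc u by simp
  moreover have "(norm (snd z))^2 \<le> 2 * (norm ?p)^2 + 2 * A^2 * (norm ?u)^2"
  proof -
    have "snd z = \<i> *s ?p + (- \<i> * ?u) *s cvec y" by (simp add: covariant_def vec_eq_iff algebra_simps)
    then have "norm (snd z) \<le> norm ?p + norm ?u * norm y"
      using norm_triangle_ineq[of "\<i> *s ?p" "(- \<i> * ?u) *s cvec y"] by (simp add: norm_smult_vec norm_mult)
    also have "\<dots> \<le> norm ?p + norm ?u * A" using assms(1) by (intro add_left_mono mult_left_mono) auto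
    finally have "(norm (snd z))^2 \<le> (norm ?p + norm ?u * A)^2" by (simp add: power_mono)
    also have "\<dots> \<le> 2 * (norm ?p)^2 + 2 * (norm ?u * A)^2"
      using sum_squares_bound[of "norm ?p" "norm ?u * A"] by (simp add: power2_sum)
    finally show ?thesis by (simp add: power_mult_distrib ac_simps)
  qed
  moreover have "(1/2 + A^2) * (norm ?u)^2 \<le> (v - Re \<mu> + K * Im \<mu>) * (norm ?u)^2"
    using assms(2,3) by (intro mult_right_mono) auto
  moreover have "(norm z)^2 = (norm ?u)^2 + (norm (snd z))^2" by (simp add: norm_prod_def)
  moreover have "N / 2 \<le> X"
    if "X = P + (v - R) * U + K * m * U" "T \<le> 2 * P + 2 * A^2 * U" "(1/2 + A^2) * U \<le> (v - R + K * m) * U" "N = U + T"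
    for X P U T N R m :: real using that by (simp add: algebra_simps)
  ultimately show ?thesis by blast
qed

lemma pair_measurable:
  fixes f :: "'m \<Rightarrow> complex \<times> (complex^'n)" assumes f: "f \<in> borel_measurable M"
  shows "(\<lambda>t. fst (f t)) \<in> borel_measurable M" "(\<lambda>t. snd (f t)) \<in> borel_measurable M"
proof -
  have c: "continuous_on UNIV (fst :: complex \<times> (complex^'n) \<Rightarrow> _)" "continuous_on UNIV (snd :: complex \<times> (complex^'n) \<Rightarrow> _)"
    by (auto intro: continuous_on_fst continuous_on_snd continuous_on_id)
  show "(\<lambda>t. fst (f t)) \<in> borel_measurable M" "(\<lambda>t. snd (f t)) \<in> borel_measurable M"
    using measurable_compose[OF f borel_measurable_continuous_onI[OF c(1)]] measurable_compose[OF f borel_measurable_continuous_onI[OF c(2)]] .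
qed

lemma covariant_measurable: assumes f: "f \<in> borel_measurable M" and y: "y \<in> borel_measurable M"
  shows "(\<lambda>t. covariant (y t) (f t)) \<in> borel_measurable M"
proof -
  have "(\<lambda>t. cvec (y t)) \<in> borel_measurable M"
    by (rule measurable_compose[OF y borel_measurable_continuous_onI[OF continuous_cvec[OF continuous_on_id]]])
  then show ?thesis
    unfolding covariant_def by (intro borel_measurable_add bounded_bilinear_measurable[OF bounded_bilinear_smult] pair_measurable f borel_measurable_const)
qed

lemma magnetic_form_measurable:
  fixes f g :: "'m \<Rightarrow> complex \<times> (complex^'n)"
  assumes "f \<in> borel_measurable M" "g \<in> borel_measurable M" "y \<in> borel_measurable M" "v \<in> borel_measurable M"
  shows "(\<lambda>t. magnetic_form (y t) (v t) \<mu> (f t) (g t)) \<in> borel_measurable M"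
proof -
  have cm: "(\<lambda>t. cnjv (h t)) \<in> borel_measurable M" if "h \<in> borel_measurable M" for h :: "'m \<Rightarrow> complex^'n"
    by (rule measurable_compose[OF that borel_measurable_continuous_onI[OF linear_continuous_on[OF bounded_linear_cnjv]]])
  have cc: "(\<lambda>t. cnj (h t)) \<in> borel_measurable M" if "h \<in> borel_measurable M" for h
    by (rule measurable_compose[OF that borel_measurable_continuous_onI[OF linear_continuous_on[OF bounded_linear_cnj]]])
  have vm: "(\<lambda>t. complex_of_real (v t)) \<in> borel_measurable M" using assms(4) by simp
  show ?thesis unfolding magnetic_form_def
    by (intro borel_measurable_add cdot_measurable covariant_measurable pair_measurable assms cm cc borel_measurable_times borel_measurable_diff vm borel_measurable_const)
qed

section \<open>The variational form on classes of square integrable pairs\<close>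

locale magnetic_hilbert =
  fixes a :: "real^'n \<Rightarrow> real^'n" and v :: "real^'n \<Rightarrow> real" and \<mu> :: complex and A B :: real
  assumes a_meas: "a \<in> borel_measurable lebesgue" and a_bound: "\<And>x. norm (a x) \<le> A"
    and v_meas: "v \<in> borel_measurable lebesgue" and v_bound: "\<And>x. \<bar>v x\<bar> \<le> B" and Im_\<mu>: "Im \<mu> > 0"
begin

definition form_int :: "(real^'n \<Rightarrow> complex \<times> (complex^'n)) \<Rightarrow> (real^'n \<Rightarrow> complex \<times> (complex^'n)) \<Rightarrow> complex" where
  "form_int f g = (\<integral>t. magnetic_form (a t) (v t) \<mu> (f t) (g t) \<partial>lebesgue)"

text \<open>The real part of the form becomes coercive upon multiplication by \<open>\<kappa>\<close>.\<close>

definition \<kappa> :: complex where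
  "\<kappa> = Complex 1 ((1/2 + A^2 + B + \<bar>Re \<mu>\<bar>) / Im \<mu>)"

definition form_const :: real where
  "form_const = (1 + A)^2 + B + norm \<mu>"

lemma form_measurable:
  "f \<in> borel_measurable lebesgue \<Longrightarrow> g \<in> borel_measurable lebesgue \<Longrightarrow>
   (\<lambda>t. magnetic_form (a t) (v t) \<mu> (f t) (g t)) \<in> borel_measurable lebesgue"
  by (intro magnetic_form_measurable a_meas v_meas)

lemma form_const_pos: "form_const > 0"
proof -
  have "0 \<le> A" "0 \<le> B" using a_bound[of 0] v_bound[of 0] norm_ge_zero[of "a 0"] by linarith+
  then show ?thesis by (simp add: form_const_def add_pos_nonneg)
qed

lemma form_norm_le:
  "norm (magnetic_form (a t) (v t) \<mu> z w) \<le> norm (form_const *\<^sub>R z) * norm w"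
  using magnetic_form_bound[OF a_bound v_bound, of t t \<mu> z w] form_const_pos by (simp add: form_const_def mult.assoc)

lemma form_integrable: assumes "L2 lebesgue f" "L2 lebesgue g"
  shows "integrable lebesgue (\<lambda>t. magnetic_form (a t) (v t) \<mu> (f t) (g t))"
  by (rule integrable_L2_product[OF L2_scaleR[OF assms(1)] assms(2) form_measurable[OF L2_measurable[OF assms(1)] L2_measurable[OF assms(2)]]])
     (rule AE_I2[OF form_norm_le])

lemma form_int_bound: assumes "L2 lebesgue f" "L2 lebesgue g"
  shows "norm (form_int f g) \<le> form_const * l2norm lebesgue f * l2norm lebesgue g"
proof -
  have "norm (form_int f g) \<le> l2norm lebesgue (\<lambda>t. form_const *\<^sub>R f t) * l2norm lebesgue g" unfolding form_int_def
    by (rule cauchy_schwarz_integral[OF L2_scaleR[OF assms(1)] assms(2) form_measurable[OF L2_measurable[OF assms(1)] L2_measurable[OF assms(2)]]])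
       (rule AE_I2[OF form_norm_le])
  also have "\<dots> \<le> form_const * l2norm lebesgue f * l2norm lebesgue g"
    by (intro mult_right_mono l2norm_scaleR_le assms) (use form_const_pos in auto)
  finally show ?thesis .
qed

lemma form_int_cong: assumes "L2 lebesgue f" "L2 lebesgue g" "L2 lebesgue f'" "L2 lebesgue g'"
    "AE t in lebesgue. f t = f' t" "AE t in lebesgue. g t = g' t"
  shows "form_int f g = form_int f' g'" unfolding form_int_def
proof (rule integral_cong_AE)
  show "AE t in lebesgue. magnetic_form (a t) (v t) \<mu> (f t) (g t) = magnetic_form (a t) (v t) \<mu> (f' t) (g' t)"
    using assms(5,6) by eventually_elim simp
qed (intro form_measurable L2_measurable assms)+

lemma form_int_linear: assumes f: "L2 lebesgue f" and f': "L2 lebesgue f'" and g: "L2 lebesgue g"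
  shows "form_int (\<lambda>t. f t + f' t) g = form_int f g + form_int f' g"
    "form_int g (\<lambda>t. f t + f' t) = form_int g f + form_int g f'"
    "form_int (\<lambda>t. c *\<^sub>R f t) g = c *\<^sub>R form_int f g"
    "form_int g (\<lambda>t. c *\<^sub>R f t) = c *\<^sub>R form_int g f" unfolding form_int_def magnetic_form_linear
  using form_integrable[OF f g] form_integrable[OF f' g] form_integrable[OF g f] form_integrable[OF g f'] by simp_all

definition form :: "(real^'n, complex \<times> (complex^'n)) l2 \<Rightarrow> (real^'n, complex \<times> (complex^'n)) l2 \<Rightarrow> real" where
  "form x y = Re (\<kappa> * form_int (rep_l2 x) (rep_l2 y))"

lemma form_abs: assumes "L2 lebesgue f" "L2 lebesgue g"
  shows "form (abs_l2 f) (abs_l2 g) = Re (\<kappa> * form_int f g)" unfolding form_def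
  using form_int_cong[OF L2_rep_l2 L2_rep_l2 assms rep_abs_l2[OF assms(1)] rep_abs_l2[OF assms(2)]] by simp

lemma bounded_bilinear_form: "bounded_bilinear form"
proof
  fix x x' y :: "(real^'n, complex \<times> (complex^'n)) l2" and c :: real
  have cases: "\<exists>f. L2 lebesgue f \<and> x = abs_l2 f" for x :: "(real^'n, complex \<times> (complex^'n)) l2"
    using L2_rep_l2 abs_l2_rep by metis
  obtain f f' g where "x = abs_l2 f" "x' = abs_l2 f'" "y = abs_l2 g" "L2 lebesgue f" "L2 lebesgue f'" "L2 lebesgue g"
    using cases[of x] cases[of x'] cases[of y] by blast
  then show "form (x + x') y = form x y + form x' y" "form y (x + x') = form y x + form y x'"
    "form (c *\<^sub>R x) y = c *\<^sub>R form x y" "form y (c *\<^sub>R x) = c *\<^sub>R form y x"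
    by (simp_all add: plus_abs_l2 scaleR_abs_l2 form_abs L2_add L2_scaleR form_int_linear algebra_simps)
next
  have "norm (form x y) \<le> norm x * norm y * (norm \<kappa> * form_const)" for x y
  proof -
    have "norm (form x y) \<le> norm (\<kappa> * form_int (rep_l2 x) (rep_l2 y))" unfolding form_def real_norm_def by (rule abs_Re_le_cmod)
    also have "\<dots> \<le> norm \<kappa> * (form_const * l2norm lebesgue (rep_l2 x) * l2norm lebesgue (rep_l2 y))"
      unfolding norm_mult by (intro mult_left_mono form_int_bound L2_rep_l2) auto
    finally show ?thesis by (simp add: norm_rep_l2 ac_simps)
  qed
  then show "\<exists>K. \<forall>x y. norm (form x y) \<le> norm x * norm y * K" by blast
qed

lemma form_coercive: "1/2 * (norm x)^2 \<le> form x x"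
proof -
  note i = form_integrable[OF L2_rep_l2 L2_rep_l2, of x x]
  have i': "integrable lebesgue (\<lambda>t. \<kappa> * magnetic_form (a t) (v t) \<mu> (rep_l2 x t) (rep_l2 x t))"
    using i by (rule Bochner_Integration.integrable_mult_right)
  have "(\<integral>t. (norm (rep_l2 x t))^2 / 2 \<partial>lebesgue) \<le> (\<integral>t. Re (\<kappa> * magnetic_form (a t) (v t) \<mu> (rep_l2 x t) (rep_l2 x t)) \<partial>lebesgue)"
  proof (rule integral_mono)
    show "integrable lebesgue (\<lambda>t. (norm (rep_l2 x t))^2 / 2)" using L2_square_integrable[OF L2_rep_l2[of x]] by simp
    show "integrable lebesgue (\<lambda>t. Re (\<kappa> * magnetic_form (a t) (v t) \<mu> (rep_l2 x t) (rep_l2 x t)))"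
      by (rule integrable_bounded_linear[OF bounded_linear_Re i'])
    show "(norm (rep_l2 x t))^2 / 2 \<le> Re (\<kappa> * magnetic_form (a t) (v t) \<mu> (rep_l2 x t) (rep_l2 x t))" for t
      unfolding \<kappa>_def using Im_\<mu> by (intro magnetic_form_coercive[OF a_bound v_bound]) simp
  qed
  also have "\<dots> = Re (\<integral>t. \<kappa> * magnetic_form (a t) (v t) \<mu> (rep_l2 x t) (rep_l2 x t) \<partial>lebesgue)"
    by (rule integral_bounded_linear[OF bounded_linear_Re i'])
  also have "\<dots> = form x x" unfolding form_def form_int_def using i by simp
  finally show ?thesis by (simp add: norm_rep_l2 l2norm_sq)
qed

lemma \<kappa>_nonzero: "\<kappa> \<noteq> 0" by (simp add: \<kappa>_def complex_eq_iff)

text \<open>Lax-Milgram yields an identity for real parts only; testing with \<open>\<i>\<close>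
  times a function recovers the imaginary part.\<close>

lemma form_int_mult_i: assumes "L2 lebesgue f" "L2 lebesgue g"
  shows "form_int f (\<lambda>t. (\<i> * fst (g t), \<i> *s snd (g t))) = - \<i> * form_int f g"
proof -
  have "covariant y (\<i> * fst z, \<i> *s snd z) = \<i> *s covariant y z" for y and z :: "complex \<times> (complex^'n)"
    by (simp add: covariant_def vec_eq_iff algebra_simps)
  then have "magnetic_form (a t) (v t) \<mu> z (\<i> * fst w, \<i> *s snd w) = - \<i> * magnetic_form (a t) (v t) \<mu> z w" for t z w
    by (simp add: magnetic_form_def cnjv_def cdot_def sum_distrib_left algebra_simps sum_negf)
  then show ?thesis unfolding form_int_def using form_integrable[OF assms] by simp
qed

end

lemma grad_add: assumes "Ck 1 f" "Ck 1 g" shows "grad (\<lambda>x. f x + g x) x = grad f x + grad g x"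
proof -
  note D = has_derivative_add[OF Ck1_has_derivative[OF assms(1)] Ck1_has_derivative[OF assms(2)]]
  show ?thesis unfolding vec_eq_iff grad_eqI[OF D] by (simp add: axis_def if_distrib if_distribR cong: if_cong)
qed

lemma L2_lebesgue_bounded_support:
  fixes f :: "real^'n \<Rightarrow> 'b::{banach, second_countable_topology}"
  assumes c: "continuous_on UNIV f" and s: "bounded_support f" shows "L2 lebesgue f" unfolding L2_def
proof
  show "f \<in> borel_measurable lebesgue"
    using borel_measurable_continuous_onI[OF c] by (intro measurable_completion) simp
  have "continuous_on UNIV (\<lambda>x. (norm (f x))^2)" by (intro continuous_on_power continuous_on_norm c)
  moreover have "bounded_support (\<lambda>x. (norm (f x))^2)" using s by (auto simp: bounded_support_def)
  ultimately have i: "integrable lborel (\<lambda>x. (norm (f x))^2)" by (rule integrable_bounded_support)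
  then show "integrable lebesgue (\<lambda>x. (norm (f x))^2)" by (rule integrable_completion[THEN iffD2, rotated]) (rule borel_measurable_integrable[OF i])
qed

text \<open>Pairs of value and gradient embed C1 functions into square integrable pairs in such a
  way that the L2 norm becomes the H1 norm.\<close>

definition jet :: "(real^'n \<Rightarrow> complex) \<Rightarrow> real^'n \<Rightarrow> complex \<times> (complex^'n)" where
  "jet f x = (f x, grad f x)"

lemma continuous_jet: "Ck 1 f \<Longrightarrow> continuous_on UNIV (jet f)"
  unfolding jet_def[abs_def] by (intro continuous_on_Pair Ck1_continuous Ck1_continuous_grad)

lemma bounded_support_jet: "bounded_support f \<Longrightarrow> bounded_support (jet f)"
proof -
  assume s: "bounded_support f"
  obtain R where R: "\<And>x. R < norm x \<Longrightarrow> f x = 0" using s by (auto simp: bounded_support_def)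
  obtain R' where R': "\<And>x. R' < norm x \<Longrightarrow> grad f x = 0" using bounded_support_grad[OF s] by (auto simp: bounded_support_def)
  show ?thesis unfolding bounded_support_def
    by (rule exI[of _ "max R R'"]) (use R R' in \<open>auto simp: jet_def zero_prod_def\<close>)
qed

lemma norm_fst_snd_L2: assumes "L2 M f" shows "L2 M (\<lambda>x. fst (f x) :: complex)" "L2 M (\<lambda>x. snd (f x) :: complex^'n)"
proof -
  show "L2 M (\<lambda>x. fst (f x))" by (rule L2_bound[where g = f and c = 1])
      (use assms pair_measurable(1)[OF L2_measurable[OF assms]] in \<open>simp_all add: norm_fst_snd_le\<close>)
  show "L2 M (\<lambda>x. snd (f x))" by (rule L2_bound[where g = f and c = 1])
      (use assms pair_measurable(2)[OF L2_measurable[OF assms]] in \<open>simp_all add: norm_fst_snd_le\<close>)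
qed

section \<open>Functions vanishing on the boundary, and existence of solutions\<close>

context smooth_domain
begin

lemma L2_lebesgue_restrict: assumes "L2 lebesgue f" shows "L2 \<D> f" "l2norm \<D> f \<le> l2norm lebesgue f"
proof -
  have m: "f \<in> borel_measurable \<D>" using L2_measurable[OF assms] by (rule measurable_restrict_space1)
  have i: "integrable lebesgue (\<lambda>x. indicator \<Omega> x *\<^sub>R (norm (f x))^2)"
    by (rule integrable_mult_indicator) (use L2_square_integrable[OF assms] in auto)
  then show "L2 \<D> f" using m by (simp add: L2_def integrable_restrict_space)
  have "(\<integral>x. (norm (f x))^2 \<partial>\<D>) = (\<integral>x. indicator \<Omega> x *\<^sub>R (norm (f x))^2 \<partial>lebesgue)"
    by (rule integral_restrict_space) simp
  also have "\<dots> \<le> (\<integral>x. (norm (f x))^2 \<partial>lebesgue)"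
    by (rule integral_mono[OF i L2_square_integrable[OF assms]]) (simp add: indicator_def)
  finally show "l2norm \<D> f \<le> l2norm lebesgue f" by (simp add: l2norm_def)
qed

definition C1_test :: "(real^'n \<Rightarrow> complex) set" where
  "C1_test = {f. Ck 1 f \<and> compact_support_in \<Omega> f}"

lemma C1_testD: assumes "f \<in> C1_test"
  shows "Ck 1 f" "compact_support_in \<Omega> f" "L2 lebesgue (jet f)" "x \<notin> \<Omega> \<Longrightarrow> jet f x = 0"
proof -
  show C: "Ck 1 f" "compact_support_in \<Omega> f" using assms by (auto simp: C1_test_def)
  show "L2 lebesgue (jet f)"
    by (intro L2_lebesgue_bounded_support continuous_jet C bounded_support_jet compact_support_in_bounded_support[OF C(2)])
  show "jet f x = 0" if x: "x \<notin> \<Omega>"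
  proof -
    have K: "closure {x. f x \<noteq> 0} \<subseteq> \<Omega>" using C(2) by (simp add: compact_support_in_def)
    have z: "f y = 0" if "y \<in> - closure {x. f x \<noteq> 0}" for y using that closure_subset[of "{x. f x \<noteq> 0}"] by blast
    have nx: "x \<in> - closure {x. f x \<noteq> 0}" using K x by blast
    have "grad f x = 0" by (rule grad_eq_0[OF _ nx z]) (auto simp only: open_Compl closed_closure)
    then show ?thesis using z[OF nx] by (simp add: jet_def zero_prod_def)
  qed
qed

lemma C1_test_add: "f \<in> C1_test \<Longrightarrow> g \<in> C1_test \<Longrightarrow> (\<lambda>x. f x + g x) \<in> C1_test"
  and C1_test_linear: "bounded_linear l \<Longrightarrow> f \<in> C1_test \<Longrightarrow> (\<lambda>x. l (f x)) \<in> C1_test"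
proof -
  have z: "f x = 0" if "x \<notin> closure {x. f x \<noteq> 0}" for f :: "real^'n \<Rightarrow> complex" and x
    using that closure_subset[of "{x. f x \<noteq> 0}"] by blast
  {
    assume "f \<in> C1_test" "g \<in> C1_test"
    note f = C1_testD(1,2)[OF this(1)] and g = C1_testD(1,2)[OF this(2)]
    have "compact_support_in \<Omega> (\<lambda>x. f x + g x)"
    proof (rule compact_support_inI[of "closure {x. f x \<noteq> 0} \<union> closure {x. g x \<noteq> 0}"])
      fix x assume "x \<notin> closure {x. f x \<noteq> 0} \<union> closure {x. g x \<noteq> 0}"
      then show "f x + g x = 0" using z[of x f] z[of x g] by auto
    qed (use f(2) g(2) in \<open>auto simp only: compact_support_in_def compact_Un Un_subset_iff\<close>)
    then show "(\<lambda>x. f x + g x) \<in> C1_test" using Ck_add[OF f(1) g(1)] by (simp add: C1_test_def)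
  }
  assume l: "bounded_linear l" and "f \<in> C1_test"
  note f = C1_testD(1,2)[OF this(2)]
  have "compact_support_in \<Omega> (\<lambda>x. l (f x))"
  proof (rule compact_support_inI[of "closure {x. f x \<noteq> 0}"])
    show "l (f x) = 0" if "x \<notin> closure {x. f x \<noteq> 0}" for x
      using z[OF that] bounded_linear.linear[OF l] by (simp only: linear_0)
  qed (use f(2) in \<open>auto simp only: compact_support_in_def\<close>)
  then show "(\<lambda>x. l (f x)) \<in> C1_test" using Ck_bounded_linear[OF l f(1)] by (simp add: C1_test_def)
qed

text \<open>Functions vanishing on the boundary, represented as pairs of function and gradient.\<close>

definition H10 :: "(real^'n, complex \<times> (complex^'n)) l2 set" where
  "H10 = closure ((\<lambda>f. abs_l2 (jet f)) ` C1_test)"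

lemma subspace_H10: "subspace H10" unfolding H10_def
proof (rule subspace_closure, rule subspaceI)
  have l0: "bounded_linear (\<lambda>x :: complex. c *\<^sub>R x)" for c by (rule bounded_linear_scaleR_right)
  have sc: "c *\<^sub>R abs_l2 (jet f) = abs_l2 (jet (\<lambda>x. c *\<^sub>R f x))" if "f \<in> C1_test" for c f
  proof -
    have "jet (\<lambda>x. c *\<^sub>R f x) = (\<lambda>x. c *\<^sub>R jet f x)"
      using grad_bounded_linear[OF l0 C1_testD(1)[OF that], of c] by (auto simp: jet_def fun_eq_iff vec_eq_iff)
    then show ?thesis by (simp add: scaleR_abs_l2[OF C1_testD(3)[OF that]])
  qed
  have cs: "compact_support_in \<Omega> (\<lambda>_. 0 :: complex)" by (rule compact_support_inI[of "{}"]) auto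
  have "Ck 1 (\<lambda>_ :: real^'n. 0 :: complex)"
  proof -
    have "grad (\<lambda>_ :: real^'n. 0 :: complex) x = 0" for x by (rule grad_eq_0[of UNIV]) auto
    then show ?thesis by simp
  qed
  then have z: "(\<lambda>_. 0) \<in> C1_test" using cs by (simp add: C1_test_def)
  show "0 \<in> (\<lambda>f. abs_l2 (jet f)) ` C1_test" using sc[OF z, of 0] z by (auto intro!: image_eqI[of _ _ "\<lambda>_. 0"])
  fix x y c assume "x \<in> (\<lambda>f. abs_l2 (jet f)) ` C1_test"
  then obtain f where f: "f \<in> C1_test" "x = abs_l2 (jet f)" by blast
  show "c *\<^sub>R x \<in> (\<lambda>f. abs_l2 (jet f)) ` C1_test"
    using sc[OF f(1), of c] C1_test_linear[OF l0 f(1), of c] f(2) by (intro image_eqI[of _ _ "\<lambda>x. c *\<^sub>R f x"]) auto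
  assume "y \<in> (\<lambda>f. abs_l2 (jet f)) ` C1_test"
  then obtain g where g: "g \<in> C1_test" "y = abs_l2 (jet g)" by blast
  have "jet (\<lambda>x. f x + g x) = (\<lambda>x. jet f x + jet g x)"
    using grad_add[OF C1_testD(1)[OF f(1)] C1_testD(1)[OF g(1)]] by (simp add: jet_def fun_eq_iff)
  then have "x + y = abs_l2 (jet (\<lambda>x. f x + g x))"
    unfolding f(2) g(2) by (simp add: plus_abs_l2[OF C1_testD(3)[OF f(1)] C1_testD(3)[OF g(1)]])
  then show "x + y \<in> (\<lambda>f. abs_l2 (jet f)) ` C1_test"
    using C1_test_add[OF f(1) g(1)] by (intro image_eqI[of _ _ "\<lambda>x. f x + g x"]) auto
qed

text \<open>The defining approximants have compact support in \<Omega>, hence vanish on the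
  boundary, and themselves are the witness for \<open>zero_trace\<close>.\<close>

lemma H10_zero_trace: assumes z: "z \<in> H10"
  shows "zero_trace (\<lambda>x. fst (rep_l2 z x)) (\<lambda>x. snd (rep_l2 z x))"
proof -
  obtain u where u: "\<And>k. u k \<in> (\<lambda>f. abs_l2 (jet f)) ` C1_test" "u \<longlonglongrightarrow> z"
    using z unfolding H10_def closure_sequential by blast
  then have "\<forall>k. \<exists>f. f \<in> C1_test \<and> u k = abs_l2 (jet f)" by blast
  then obtain f where f: "\<And>k. f k \<in> C1_test" "\<And>k. u k = abs_l2 (jet (f k))" by metis
  note C = C1_testD[OF f(1)]
  note R = L2_rep_l2[of z]
  let ?d = "\<lambda>k x. jet (f k) x - rep_l2 z x"
  have d: "L2 lebesgue (?d k)" for k by (rule L2_diff[OF C(3) R])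
  have "dist (u k) z = l2norm lebesgue (?d k)" for k
    using norm_abs_l2[OF d[of k]] minus_abs_l2[OF C(3)[of k] R] by (simp add: dist_norm f(2) abs_l2_rep)
  then have lim: "(\<lambda>k. l2norm lebesgue (?d k)) \<longlonglongrightarrow> 0" using u(2)[unfolded tendsto_dist_iff[of u]] by simp
  have comp: "l2norm \<D> (\<lambda>x. fst (?d k x)) \<le> l2norm lebesgue (?d k)"
    "l2norm \<D> (\<lambda>x. snd (?d k x)) \<le> l2norm lebesgue (?d k)" for k
  proof -
    have "l2norm \<D> (\<lambda>x. fst (?d k x)) \<le> 1 * l2norm \<D> (?d k)"
      "l2norm \<D> (\<lambda>x. snd (?d k x)) \<le> 1 * l2norm \<D> (?d k)"
      using norm_fst_snd_le[of "?d k _"] pair_measurable[OF L2_measurable[OF L2_lebesgue_restrict(1)[OF d]]]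
      by (intro l2norm_le L2_lebesgue_restrict(1)[OF d] AE_I2; simp)+
    then show "l2norm \<D> (\<lambda>x. fst (?d k x)) \<le> l2norm lebesgue (?d k)"
      "l2norm \<D> (\<lambda>x. snd (?d k x)) \<le> l2norm lebesgue (?d k)" using L2_lebesgue_restrict(2)[OF d[of k]] by linarith+
  qed
  show ?thesis unfolding zero_trace_def
  proof (intro exI[of _ f] conjI allI C(1))
    have "L2 \<D> (\<lambda>x. fst (rep_l2 z x))" "L2 \<D> (\<lambda>x. snd (rep_l2 z x))"
      using norm_fst_snd_L2[OF L2_lebesgue_restrict(1)[OF R]] .
    moreover have "L2 \<D> (f k)" "L2 \<D> (grad (f k))" for k
      by (rule continuous_L2[OF Ck1_continuous[OF C(1)]], rule continuous_L2[OF Ck1_continuous_grad[OF C(1)]])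
    moreover have "(\<lambda>k. l2norm \<D> (\<lambda>x. f k x - fst (rep_l2 z x))) \<longlonglongrightarrow> 0"
      "(\<lambda>k. l2norm \<D> (\<lambda>x. grad (f k) x - snd (rep_l2 z x))) \<longlonglongrightarrow> 0"
      using comp lim by (intro l2norm_tendsto_0[OF _ lim]; simp add: jet_def)+
    ultimately show "L2_tendsto \<D> f (\<lambda>x. fst (rep_l2 z x))"
      "L2_tendsto \<D> (\<lambda>k. grad (f k)) (\<lambda>x. snd (rep_l2 z x))" by (simp_all add: L2_tendsto_l2norm)
    show "L2 (surface_measure \<Omega>) (f k)" for k by (rule surface_L2_continuous[OF Ck1_continuous[OF C(1)]])
    have "f k x = 0" if "x \<in> frontier \<Omega>" for k x
      using C(4)[of x k] that open_domain by (simp add: jet_def zero_prod_def frontier_def interior_open)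
    then have "l2norm (surface_measure \<Omega>) (f k) = l2norm (surface_measure \<Omega>) (\<lambda>_. 0 :: complex)" for k
      unfolding l2norm_def by (intro arg_cong[of _ _ sqrt] Bochner_Integration.integral_cong) auto
    then show "(\<lambda>k. l2norm (surface_measure \<Omega>) (f k)) \<longlonglongrightarrow> 0" by (simp add: l2norm_def)
  qed
qed

text \<open>The ansatz \<open>u = \<Phi> + r\<close> with \<open>r\<close> in \<open>H10\<close>
  turns the boundary condition into a right hand side: on \<open>H10\<close> the form of
  \<open>r\<close> must be minus that of \<open>\<Phi>\<close>.\<close>

theorem bvp_solvable: assumes a: "Ck 1 a" "bounded_support a" and Aa: "\<And>x. x \<in> \<Omega> \<Longrightarrow> A x = a x" and V: "Linf \<Omega> V"
    and \<mu>: "Im \<mu> > 0" and \<Phi>: "Ck 1 \<Phi>"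
  shows "is_bvp_solution \<Omega> A V \<mu> \<Phi> (bvp_solution \<Omega> A V \<mu> \<Phi>)"
proof -
  obtain A0 where A0: "\<And>x. norm (a x) \<le> A0" using bounded_bounded_support[OF Ck1_continuous[OF a(1)] a(2)] by metis
  obtain B where B: "B \<ge> 0" "AE x in \<D>. \<bar>V x\<bar> \<le> B" using Linf_bound[OF V] by metis
  \<comment> \<open>\<open>V\<close> is bounded only almost everywhere; truncation yields a bound at
    every point and changes \<open>V\<close> only on a null set of \<Omega>.\<close>
  define v where "v x = (if x \<in> \<Omega> then max (- B) (min B (V x)) else 0)" for x
  have Vm[measurable]: "V \<in> borel_measurable \<D>" using V by (simp add: Linf_def)
  interpret H: magnetic_hilbert a v \<mu> A0 B
  proof
    show "a \<in> borel_measurable lebesgue"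
      using borel_measurable_continuous_onI[OF Ck1_continuous[OF a(1)]] by (intro measurable_completion) simp
    show "v \<in> borel_measurable lebesgue" unfolding v_def[abs_def] by (rule borel_measurable_if_I) (measurable, simp)
    show "\<bar>v x\<bar> \<le> B" for x using B(1) by (auto simp: v_def)
  qed (use A0 \<mu> in auto)
  have vV: "AE x in \<D>. v x = V x" using B(2) AE_space by eventually_elim (auto simp: v_def)
  \<comment> \<open>Cut off outside \<Omega>, because \<open>\<Phi>\<close> may fail to be square
    integrable on the whole space; the jets of test functions vanish there.\<close>
  let ?F = "\<lambda>x. indicator \<Omega> x *\<^sub>R jet \<Phi> x"
  have LF: "L2 lebesgue ?F"
  proof -
    have L: "L2 \<D> (jet \<Phi>)" by (rule continuous_L2[OF continuous_jet[OF \<Phi>]])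
    have m: "jet \<Phi> \<in> borel_measurable lebesgue"
      using borel_measurable_continuous_onI[OF continuous_jet[OF \<Phi>]] by (intro measurable_completion) simp
    have "integrable lebesgue (\<lambda>x. indicator \<Omega> x *\<^sub>R (norm (jet \<Phi> x))^2)"
      using L2_square_integrable[OF L] by (simp add: integrable_restrict_space)
    moreover have "indicator \<Omega> x *\<^sub>R (norm (jet \<Phi> x))^2 = (norm (?F x))^2" for x by (simp add: indicator_def)
    ultimately show ?thesis unfolding L2_def using m by (auto intro!: borel_measurable_scaleR borel_measurable_indicator)
  qed
  have bl: "bounded_linear (\<lambda>y. - H.form (abs_l2 ?F) y)"
    by (intro bounded_linear_minus bounded_bilinear.bounded_linear_right[OF H.bounded_bilinear_form])
  obtain z where z: "z \<in> H10" "\<And>y. y \<in> H10 \<Longrightarrow> H.form z y = - H.form (abs_l2 ?F) y"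
    using lax_milgram[OF subspace_H10 _ H.bounded_bilinear_form bl _ H.form_coercive] by (auto simp: H10_def)
  note R = L2_rep_l2[of z]
  let ?r = "\<lambda>x. fst (rep_l2 z x)" and ?G = "\<lambda>x. snd (rep_l2 z x)"
  have zt: "zero_trace ?r ?G" by (rule H10_zero_trace[OF z(1)])
  define u where "u x = \<Phi> x + ?r x" for x
  let ?Z = "\<lambda>x. rep_l2 z x + ?F x"
  have LZ: "L2 lebesgue ?Z" by (rule L2_add[OF R LF])
  have form0: "H.form_int ?Z (jet f) = 0" if f: "f \<in> C1_test" for f
  proof -
    note Lf = C1_testD(3)[OF f]
    have re: "Re (H.\<kappa> * H.form_int ?Z (jet p)) = 0" if p: "p \<in> C1_test" for p
    proof -
      note Lp = C1_testD(3)[OF p]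
      have "abs_l2 (jet p) \<in> H10" unfolding H10_def by (rule subsetD[OF closure_subset imageI[OF p]])
      from z(2)[OF this] have "H.form (z + abs_l2 ?F) (abs_l2 (jet p)) = 0"
        by (simp add: bounded_bilinear.add_left[OF H.bounded_bilinear_form])
      moreover have "z + abs_l2 ?F = abs_l2 ?Z" using plus_abs_l2[OF R LF] by (simp add: abs_l2_rep)
      ultimately show ?thesis by (simp add: H.form_abs[OF LZ Lp])
    qed
    have bi: "bounded_linear (\<lambda>c :: complex. \<i> * c)" by (rule bounded_linear_mult_right)
    have "jet (\<lambda>x. \<i> * f x) = (\<lambda>x. (\<i> * fst (jet f x), \<i> *s snd (jet f x)))"
      using grad_bounded_linear[OF bi C1_testD(1)[OF f]] by (simp add: jet_def fun_eq_iff vec_eq_iff)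
    then have "H.form_int ?Z (jet (\<lambda>x. \<i> * f x)) = - \<i> * H.form_int ?Z (jet f)"
      using H.form_int_mult_i[OF LZ Lf] by simp
    then have "Re (H.\<kappa> * (- \<i> * H.form_int ?Z (jet f))) = 0" using re[OF C1_test_linear[OF bi f]] by simp
    then have "Im (H.\<kappa> * H.form_int ?Z (jet f)) = 0" by simp
    then have "H.\<kappa> * H.form_int ?Z (jet f) = 0" using re[OF f] by (simp add: complex_eq_iff)
    then show ?thesis using H.\<kappa>_nonzero by simp
  qed
  have tr: "has_trace \<Omega> u \<Phi>" and wg: "AE x in \<D>. weak_gradient \<Omega> u x = grad \<Phi> x + ?G x"
    unfolding u_def[abs_def] using zero_trace_add_has_trace[OF \<Phi> zt] .
  have H1: "u \<in> H1 \<Omega>" by (rule has_trace_H1[OF tr])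
  note LW = H1_L2[OF H1]
  have "magnetic_schroedinger_eq \<Omega> A V \<mu> u" unfolding magnetic_schroedinger_eq_def
  proof
    fix f assume f: "f \<in> test_functions \<Omega>"
    let ?f = "\<lambda>x. complex_of_real (f x)"
    have C: "Ck 1 ?f" by (rule Ck_bounded_linear[OF bounded_linear_of_real test_functionD(1)[OF f]])
    have "compact_support_in \<Omega> ?f" using test_functionD(2)[OF f] by (simp add: compact_support_in_def)
    then have T: "?f \<in> C1_test" using C by (simp add: C1_test_def)
    have g: "grad ?f x = cvec (grad f x)" for x
      using grad_bounded_linear[OF bounded_linear_of_real[where 'a=complex] test_functionD(1)[OF f]] by (simp add: vec_eq_iff cvec_def)
    let ?h = "\<lambda>x. magnetic_form (a x) (v x) \<mu> (?Z x) (jet ?f x)"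
    have hz: "?h x = 0" if "x \<notin> \<Omega>" for x
      using C1_testD(4)[OF T that] by (simp add: magnetic_form_def covariant_def cnjv_def cdot_def zero_prod_def)
    let ?e = "\<lambda>A x. cdot ((- \<i>) *s weak_gradient \<Omega> u x + u x *s cvec (A x))
             (\<i> *s cvec (grad f x) + complex_of_real (f x) *s cvec (A x))
        + (complex_of_real (V x) - \<mu>) * u x * complex_of_real (f x)"
    have "(\<integral>x. ?e A x \<partial>\<D>) = (\<integral>x. ?h x \<partial>\<D>)"
    proof (rule integral_cong_AE)
      have Am: "(\<lambda>x. cvec (a x)) \<in> borel_measurable \<D>" by (rule continuous_measurable[OF continuous_cvec[OF Ck1_continuous[OF a(1)]]])
      have Vm': "(\<lambda>x. complex_of_real (V x)) \<in> borel_measurable \<D>" by measurable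
      note T2 = test_function_L2[OF f]
      have "(\<lambda>x. ?e a x) \<in> borel_measurable \<D>"
        by (intro borel_measurable_add borel_measurable_times borel_measurable_diff cdot_measurable
              bounded_bilinear_measurable[OF bounded_bilinear_smult] L2_measurable[OF LW(1)] L2_measurable[OF LW(2)] Am Vm'
              L2_measurable[OF T2(1)] L2_measurable[OF T2(2)] borel_measurable_const)
      then show "(\<lambda>x. ?e A x) \<in> borel_measurable \<D>" by (rule measurable_cong[THEN iffD1, rotated]) (simp add: Aa)
      show "?h \<in> borel_measurable \<D>"
        by (rule measurable_restrict_space1[OF H.form_measurable[OF L2_measurable[OF LZ] L2_measurable[OF C1_testD(3)[OF T]]]])
      show "AE x in \<D>. ?e A x = ?h x" using wg vV AE_space
      proof eventually_elim
        case (elim x)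
        then have x: "x \<in> \<Omega>" by simp
        have cj: "cnjv (complex_of_real c *s cvec y' - \<i> *s cvec y) = \<i> *s cvec y + complex_of_real c *s cvec y'" for y y' :: "real^'n" and c
          by (simp add: cnjv_def cvec_def vec_eq_iff)
        show ?case
          using x unfolding magnetic_form_def covariant_def jet_def fst_add snd_add by (simp add: elim Aa cj g u_def jet_def algebra_simps)
      qed
    qed
    also have "\<dots> = (\<integral>x. indicator \<Omega> x *\<^sub>R ?h x \<partial>lebesgue)" by (rule integral_restrict_space) simp
    also have "(\<lambda>x. indicator \<Omega> x *\<^sub>R ?h x) = ?h" using hz by (auto simp: fun_eq_iff indicator_def)
    also have "(\<integral>x. ?h x \<partial>lebesgue) = 0" using form0[OF T] by (simp add: H.form_int_def)
    finally show "(\<integral>x. ?e A x \<partial>\<D>) = 0" .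
  qed
  then have "is_bvp_solution \<Omega> A V \<mu> \<Phi> u" using H1 tr by (simp add: is_bvp_solution_def)
  then show ?thesis unfolding bvp_solution_def by (rule someI[of "is_bvp_solution \<Omega> A V \<mu> \<Phi>"])
qed

end

text \<open>Meant for the phases: near each point they coincide with a smooth ray integral whose
  length depends on the point.\<close>

lemma Ck_local: assumes "\<And>x. \<exists>S g. open S \<and> x \<in> S \<and> Ck k g \<and> (\<forall>y\<in>S. f y = g y)"
  shows "Ck k f" using assms
proof (induction k arbitrary: f)
  case 0
  have "isCont f x" for x
  proof -
    obtain S g where S: "open S" "x \<in> S" "Ck 0 g" "\<And>y. y \<in> S \<Longrightarrow> f y = g y" using 0[of x] by blast
    have "isCont g x" using S(3) by (simp add: continuous_on_eq_continuous_at)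
    moreover have "eventually (\<lambda>y. g y = f y) (nhds x)" using S(1,2,4) by (auto simp: eventually_nhds)
    ultimately show ?thesis by (simp add: isCont_cong)
  qed
  then show ?case by (simp add: continuous_at_imp_continuous_on)
next
  case (Suc k)
  have loc: "f differentiable (at x)" "\<exists>S g. open S \<and> x \<in> S \<and> Ck k g \<and> (\<forall>y\<in>S. grad f y $ i = g y)" for x i
  proof -
    obtain S g where S: "open S" "x \<in> S" "Ck (Suc k) g" "\<And>y. y \<in> S \<Longrightarrow> f y = g y" using Suc.prems[of x] by blast
    have d: "(f has_derivative (\<lambda>v. \<Sum>i\<in>UNIV. (v $ i) *\<^sub>R grad g y $ i)) (at y)" if "y \<in> S" for y
      by (rule has_derivative_transform_within_open[OF Ck1_has_derivative[OF Ck_Suc_imp_Ck1[OF S(3)]] S(1) that]) (simp add: S(4))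
    have "grad f y $ i = grad g y $ i" if "y \<in> S" for y
      by (simp add: grad_eqI[OF d[OF that]] axis_def if_distrib if_distribR cong: if_cong)
    then show "\<exists>S g. open S \<and> x \<in> S \<and> Ck k g \<and> (\<forall>y\<in>S. grad f y $ i = g y)"
      using S by (intro exI[of _ S] exI[of _ "\<lambda>y. grad g y $ i"]) simp
    show "f differentiable (at x)" using d[OF S(2)] by (auto simp: differentiable_def)
  qed
  have "Ck k (\<lambda>x. grad f x $ i)" for i by (rule Suc.IH[OF loc(2)])
  then show ?case using loc(1) by (simp add: differentiable_on_def)
qed

lemma grad_cong_open: assumes "open S" "x \<in> S" "\<And>y. y \<in> S \<Longrightarrow> f y = g y" "Ck 1 g"
  shows "grad f x = grad g x"
proof -
  have "(f has_derivative (\<lambda>v. \<Sum>i\<in>UNIV. (v $ i) *\<^sub>R grad g x $ i)) (at x)"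
    by (rule has_derivative_transform_within_open[OF Ck1_has_derivative[OF assms(4)] assms(1,2)]) (simp add: assms(3))
  then show ?thesis by (simp add: vec_eq_iff grad_eqI axis_def if_distrib if_distribR cong: if_cong)
qed

lemma C1_lipschitz:
  fixes f :: "real^'n \<Rightarrow> 'b::real_normed_vector" assumes "Ck 1 f" "\<And>x. norm (grad f x) \<le> B"
  shows "norm (f x - f y) \<le> B * norm (x - y)"
proof (rule differentiable_bound[of UNIV f "\<lambda>x v. \<Sum>i\<in>UNIV. (v $ i) *\<^sub>R grad f x $ i"])
  show "(f has_derivative (\<lambda>v. \<Sum>i\<in>UNIV. (v $ i) *\<^sub>R grad f z $ i)) (at z within UNIV)" for z
    by (simp add: Ck1_has_derivative[OF assms(1)])
  show "onorm (\<lambda>v. \<Sum>i\<in>UNIV. (v $ i) *\<^sub>R grad f z $ i) \<le> B" for z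
    by (rule onorm_le) (use norm_sum_scaleR_le[of _ "grad f z"] mult_left_mono[OF assms(2)[of z] norm_ge_zero] in \<open>smt (verit) mult.commute\<close>)
qed auto

section \<open>The phases\<close>

text \<open>The truncation at length \<open>L\<close> replaces the half-line of \<open>phase\<close>
  by an interval with integrable indicator, the weight in the averages of translates. For large
  \<open>L\<close> nothing is lost, see \<open>phase_eq_ray\<close>.\<close>

definition ray :: "real \<Rightarrow> real^'n \<Rightarrow> (real^'n \<Rightarrow> real) \<Rightarrow> real^'n \<Rightarrow> real" where
  "ray L h f x = (\<integral>s. indicator {- L..0} s *\<^sub>R f (x + s *\<^sub>R h) \<partial>lborel)"

lemma indicator_integrable: "integrable lborel (indicator {- L..0} :: real \<Rightarrow> real)"
  by (rule integrable_real_indicator) (simp_all add: emeasure_lborel_Icc_eq)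

lemma indicator_integral: "0 \<le> L \<Longrightarrow> (\<integral>s. indicator {- L..0} s * B \<partial>lborel) = L * (B :: real)" by simp

lemma ray_direction_measurable: "(\<lambda>s. s *\<^sub>R h :: real^'n) \<in> borel_measurable lborel"
  by (auto intro!: borel_measurable_continuous_onI continuous_intros)

lemmas ray_integrable = integrable_weighted_translate[OF bounded_bilinear_scaleR indicator_integrable ray_direction_measurable]

lemma Ck_ray: "Ck m f \<Longrightarrow> bounded_support f \<Longrightarrow> Ck m (ray L h f)" unfolding ray_def[abs_def]
  by (rule Ck_weighted_translate[OF bounded_bilinear_scaleR indicator_integrable ray_direction_measurable])

lemma grad_ray: "Ck 1 f \<Longrightarrow> bounded_support f \<Longrightarrow> grad (ray L h f) x $ i = ray L h (\<lambda>y. grad f y $ i) x"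
  unfolding ray_def[abs_def]
  by (rule grad_weighted_translate[OF bounded_bilinear_scaleR indicator_integrable ray_direction_measurable])

lemma ray_diff_le:
  assumes f: "continuous_on UNIV f" "bounded_support f" and g: "continuous_on UNIV g" "bounded_support g" and "L \<ge> 0"
    and B: "\<And>s. s \<in> {- L..0} \<Longrightarrow> \<bar>f (x + s *\<^sub>R h) - g (x + s *\<^sub>R h')\<bar> \<le> B"
  shows "\<bar>ray L h f x - ray L h' g x\<bar> \<le> L * B"
proof -
  have "ray L h f x - ray L h' g x
    = (\<integral>s. indicator {- L..0} s *\<^sub>R f (x + s *\<^sub>R h) - indicator {- L..0} s *\<^sub>R g (x + s *\<^sub>R h') \<partial>lborel)"
    unfolding ray_def
    by (rule Bochner_Integration.integral_diff[symmetric, OF ray_integrable[OF f] ray_integrable[OF g]])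
  also have "norm \<dots> \<le> (\<integral>s. indicator {- L..0} s * B \<partial>lborel)"
  proof (rule norm_integral_le[OF Bochner_Integration.integrable_diff[OF ray_integrable[OF f] ray_integrable[OF g]]])
    show "integrable lborel (\<lambda>s. indicator {- L..0} s * B)" by (rule integrable_mult_left) (use indicator_integrable in auto)
  qed (use B in \<open>auto simp: indicator_def\<close>)
  also have "\<dots> = L * B" using assms(5) by (rule indicator_integral)
  finally show ?thesis by simp
qed

lemma abs_ray_le: assumes "continuous_on UNIV f" "bounded_support f" "L \<ge> 0" and B: "\<And>y. \<bar>f y\<bar> \<le> B"
  shows "\<bar>ray L h f x\<bar> \<le> L * B"
  using ray_diff_le[OF assms(1,2) continuous_on_const[of UNIV 0] _ assms(3), where h = h and h' = h and x = x and B = B] B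
  by (simp add: ray_def bounded_support_def)

text \<open>The derivative of a ray integral in the direction of the ray is the integral of a
  derivative along it, and the contribution of the far end vanishes.\<close>

lemma ray_transport: assumes f: "Ck 1 f" "bounded_support f" and "L \<ge> 0" and z: "f (x - L *\<^sub>R q) = 0"
  shows "(\<Sum>i\<in>UNIV. q $ i * ray L q (\<lambda>y. grad f y $ i) x) = f x"
proof -
  have i: "integrable lborel (\<lambda>s. indicator {- L..0} s *\<^sub>R grad f (x + s *\<^sub>R q) $ i)" for i
    by (rule ray_integrable[OF _ bounded_support_grad_component[OF f(2)]])
       (rule continuous_on_component[OF Ck1_continuous_grad[OF f(1)]])
  let ?d = "\<lambda>s. \<Sum>i\<in>UNIV. q $ i * grad f (x + s *\<^sub>R q) $ i"
  have D: "((\<lambda>s. f (x + s *\<^sub>R q)) has_vector_derivative ?d s) (at s within S)" for s S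
  proof -
    have "((\<lambda>s. x + s *\<^sub>R q) has_derivative (\<lambda>h. h *\<^sub>R q)) (at s within S)" by (auto intro!: derivative_eq_intros)
    from has_derivative_compose[OF this Ck1_has_derivative[OF f(1)]]
    have "((\<lambda>s. f (x + s *\<^sub>R q)) has_derivative (\<lambda>h. \<Sum>i\<in>UNIV. (h *\<^sub>R q) $ i *\<^sub>R grad f (x + s *\<^sub>R q) $ i)) (at s within S)" .
    moreover have "(\<lambda>h. \<Sum>i\<in>UNIV. (h *\<^sub>R q) $ i *\<^sub>R grad f (x + s *\<^sub>R q) $ i) = (\<lambda>h. h *\<^sub>R ?d s)"
      by (simp add: fun_eq_iff sum_distrib_left mult.assoc)
    ultimately show ?thesis by (simp only: has_vector_derivative_def)
  qed
  have c: "continuous_on {- L..0} ?d"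
  proof (intro continuous_on_sum continuous_on_mult continuous_on_const)
    fix i
    have "continuous_on {- L..0} (\<lambda>s. x + s *\<^sub>R q)" by (intro continuous_intros)
    from continuous_on_compose2[OF continuous_on_component[OF Ck1_continuous_grad[OF f(1)]] this]
    show "continuous_on {- L..0} (\<lambda>s. grad f (x + s *\<^sub>R q) $ i)" by simp
  qed
  have "(\<Sum>i\<in>UNIV. q $ i * ray L q (\<lambda>y. grad f y $ i) x) = (\<integral>s. indicator {- L..0} s *\<^sub>R ?d s \<partial>lborel)"
  proof -
    have "(\<integral>s. indicator {- L..0} s *\<^sub>R ?d s \<partial>lborel)
      = (\<integral>s. (\<Sum>i\<in>UNIV. q $ i * (indicator {- L..0} s *\<^sub>R grad f (x + s *\<^sub>R q) $ i)) \<partial>lborel)"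
      by (rule Bochner_Integration.integral_cong) (simp_all add: sum_distrib_left mult.left_commute)
    also have "\<dots> = (\<Sum>i\<in>UNIV. \<integral>s. q $ i * (indicator {- L..0} s *\<^sub>R grad f (x + s *\<^sub>R q) $ i) \<partial>lborel)"
      by (rule Bochner_Integration.integral_sum) (rule integrable_mult_right[OF i])
    also have "\<dots> = (\<Sum>i\<in>UNIV. q $ i * ray L q (\<lambda>y. grad f y $ i) x)"
      unfolding ray_def by (simp only: integral_mult_right_zero)
    finally show ?thesis by (rule sym)
  qed
  also have "\<dots> = f (x + 0 *\<^sub>R q) - f (x + (- L) *\<^sub>R q)" by (rule integral_FTC_Icc[OF _ D c]) (use assms(3) in auto)
  finally show ?thesis using z by simp
qed

text \<open>In the end \<open>a\<close> is the common extension of both potentials: equality on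
  \<Omega> makes the two extensions equal.\<close>

locale magnetic_domain = smooth_domain \<rho> \<Omega> for \<rho> :: "real^'n \<Rightarrow> real" and \<Omega> +
  fixes a :: "real^'n \<Rightarrow> real^'n" assumes a_C1: "Ck 1 a" and a_support: "bounded_support a"
begin

lemma a_continuous: "continuous_on UNIV a" by (rule Ck1_continuous[OF a_C1])

lemma a_grad_continuous: "continuous_on UNIV (\<lambda>x. grad a x $ i)"
  by (rule continuous_on_component[OF Ck1_continuous_grad[OF a_C1]])

lemma a_measurable: "a \<in> borel_measurable borel" "(\<lambda>x. grad a x $ i) \<in> borel_measurable borel"
  by (rule borel_measurable_continuous_onI[OF a_continuous], rule borel_measurable_continuous_onI[OF a_grad_continuous])

lemma a_integrable: "integrable lborel a" "integrable lborel (\<lambda>x. grad a x $ i)"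
  using integrable_bounded_support[OF a_continuous a_support]
    integrable_bounded_support[OF a_grad_continuous bounded_support_grad_component[OF a_support]] .

lemma width: assumes "1 \<le> (t :: real)" shows "0 < t powr (- 1 / 3)" "t powr (- 1 / 3) \<le> 1"
  using assms powr_le1[of "- 1 / 3" t] powr_mono[of "- 1 / 3" 0 t] by auto

text \<open>The integrand of \<open>phase\<close>; its ray integral is minus the phase.\<close>

definition speed :: "real \<Rightarrow> real^'n \<Rightarrow> real^'n \<Rightarrow> real" where
  "speed t h y = h \<bullet> mollified \<rho> a t y"

lemma speed_Ck: "1 \<le> t \<Longrightarrow> Ck m (speed t h)" unfolding speed_def[abs_def] mollified_eq_conv
  by (rule Ck_bounded_linear[OF bounded_linear_inner_right Ck_conv[OF width(1) a_integrable(1)]])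

lemma mollified_zero: assumes "1 \<le> t" and R: "\<forall>x. R < norm x \<longrightarrow> a x = 0" and x: "R + 1 < norm x"
  shows "mollified \<rho> a t x = 0"
proof -
  obtain B where B: "\<And>x. norm (a x) \<le> B" using bounded_bounded_support[OF a_continuous a_support] by metis
  show ?thesis unfolding mollified_eq_conv
  proof (rule conv_const[OF a_measurable(1) B width(1)[OF assms(1)]])
    fix y assume "dist x y \<le> t powr (- 1 / 3)"
    then have "R < norm y" using x width(2)[OF assms(1)] norm_triangle_ineq[of y "x - y"] by (simp add: dist_norm)
    then show "a y = 0" using R by blast
  qed
qed

lemma speed_support: "1 \<le> t \<Longrightarrow> bounded_support (speed t h)"
proof -
  assume t: "1 \<le> t"
  obtain R where R: "\<forall>x. R < norm x \<longrightarrow> a x = 0" using a_support by (auto simp: bounded_support_def)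
  show ?thesis unfolding bounded_support_def speed_def using mollified_zero[OF t R] by (intro exI[of _ "R + 1"]) simp
qed

lemma grad_speed: assumes "1 \<le> t"
  shows "grad (speed t h) y $ i = h \<bullet> conv \<rho> (t powr (- 1 / 3)) (\<lambda>x. grad a x $ i) y"
  unfolding speed_def[abs_def] mollified_eq_conv
  using grad_bounded_linear[OF bounded_linear_inner_right[of h] Ck_conv[OF width(1)[OF assms] a_integrable(1), of 1], of y i]
    grad_conv[OF width(1)[OF assms] a_C1 a_support, of y i] by simp

lemma grad_speed_Ck: "1 \<le> t \<Longrightarrow> Ck m (\<lambda>y. grad (speed t h) y $ i)" using speed_Ck[of t "Suc m" h] by simp

text \<open>A mollification width of at most 1 enlarges the support radius to \<open>R + 1\<close>;
  beyond length \<open>R + 1 + norm x\<close> the ray has left this ball.\<close>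

lemma phase_eq_ray:
  assumes t: "1 \<le> t" and h: "norm h = 1" and R: "\<forall>x. R < norm x \<longrightarrow> a x = 0" and L: "R + 1 + norm x \<le> L"
  shows "phase \<rho> a t h x = - ray L h (speed t h) x"
proof -
  have "indicator {..0} s *\<^sub>R (h \<bullet> mollified \<rho> a t (x + s *\<^sub>R h)) = indicator {- L..0} s *\<^sub>R speed t h (x + s *\<^sub>R h)" for s
  proof (cases "s < - L")
    case True
    then have "R + 1 < norm (x + s *\<^sub>R h)" using L h norm_triangle_ineq[of "x + s *\<^sub>R h" "- x"] by simp
    then show ?thesis using mollified_zero[OF t R] by (simp add: speed_def)
  qed (simp add: speed_def indicator_def)
  then show ?thesis by (simp add: phase_def set_lebesgue_integral_def ray_def)
qed

lemma phase_Ck: assumes t: "1 \<le> t" and h: "norm h = 1" shows "Ck m (phase \<rho> a t h)"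
proof (rule Ck_local)
  fix x :: "real^'n"
  obtain R where R: "\<forall>x. R < norm x \<longrightarrow> a x = 0" using a_support by (auto simp: bounded_support_def)
  \<comment> \<open>One more than \<open>phase_eq_ray\<close> asks for at \<open>x\<close>, so that
    the same length works in the unit ball around \<open>x\<close>.\<close>
  let ?L = "R + 2 + norm x"
  have "phase \<rho> a t h y = - ray ?L h (speed t h) y" if "y \<in> ball x 1" for y
    using that norm_triangle_ineq[of x "y - x"] by (intro phase_eq_ray[OF t h R]) (auto simp: dist_norm norm_minus_commute)
  moreover have "Ck m (\<lambda>y. - ray ?L h (speed t h) y)"
    by (rule Ck_bounded_linear[OF bounded_linear_minus[OF bounded_linear_ident] Ck_ray[OF speed_Ck[OF t] speed_support[OF t]]])
  ultimately show "\<exists>S g. open S \<and> x \<in> S \<and> Ck m g \<and> (\<forall>y\<in>S. phase \<rho> a t h y = g y)"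
    by (intro exI[of _ "ball x 1"] exI[of _ "\<lambda>y. - ray ?L h (speed t h) y"]) auto
qed

text \<open>The strict inequality for \<open>L\<close> persists in a whole ball, so the ray formula
  can be differentiated there, twice, with \<open>L\<close> fixed.\<close>

lemma grad_phase: assumes t: "1 \<le> t" and h: "norm h = 1" and R: "\<forall>x. R < norm x \<longrightarrow> a x = 0" and L: "R + 1 + norm x < L"
  shows "grad (phase \<rho> a t h) x $ i = - ray L h (\<lambda>y. grad (speed t h) y $ i) x"
    and "grad (\<lambda>y. grad (phase \<rho> a t h) y $ i) x $ j = - ray L h (\<lambda>y. grad (\<lambda>z. grad (speed t h) z $ i) y $ j) x"
proof -
  let ?S = "ball 0 (L - R - 1)"
  note m = bounded_linear_minus[OF bounded_linear_ident]
  note S = speed_Ck[OF t, of _ h] speed_support[OF t, of h]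
  note S' = grad_speed_Ck[OF t, of _ h i] bounded_support_grad_component[OF S(2), of i]
  have 1: "grad (phase \<rho> a t h) y $ i = - ray L h (\<lambda>y. grad (speed t h) y $ i) y" if "y \<in> ?S" for y
  proof -
    have "grad (phase \<rho> a t h) y = grad (\<lambda>y. - ray L h (speed t h) y) y" by (rule grad_cong_open[OF _ that])
        (use phase_eq_ray[OF t h R] Ck_bounded_linear[OF m Ck_ray[OF S]] in auto)
    then show ?thesis using grad_bounded_linear[OF m Ck_ray[OF S]] grad_ray[OF S] by simp
  qed
  have x: "x \<in> ?S" using L by simp
  show "grad (phase \<rho> a t h) x $ i = - ray L h (\<lambda>y. grad (speed t h) y $ i) x" by (rule 1[OF x])
  have "grad (\<lambda>y. grad (phase \<rho> a t h) y $ i) x = grad (\<lambda>y. - ray L h (\<lambda>y. grad (speed t h) y $ i) y) x"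
    by (rule grad_cong_open[OF _ x 1 Ck_bounded_linear[OF m Ck_ray[OF S']]]) auto
  then show "grad (\<lambda>y. grad (phase \<rho> a t h) y $ i) x $ j = - ray L h (\<lambda>y. grad (\<lambda>z. grad (speed t h) z $ i) y $ j) x"
    using grad_bounded_linear[OF m Ck_ray[OF S']] grad_ray[OF S'] by simp
qed

text \<open>The potential has bounded derivatives of first order only. Hence the phase and its
  gradient are bounded, while second derivatives cost the inverse of the mollification width;
  replacing the mollified potential by \<open>a\<close> costs the width itself. The last estimate is
  for the two directions of the ansatz, whose difference tends to 0.\<close>

lemma phase_estimates: obtains C where "C \<ge> 0"
    "\<And>t q x. 1 \<le> t \<Longrightarrow> norm q = 1 \<Longrightarrow> x \<in> \<Omega> \<Longrightarrow> \<bar>phase \<rho> a t q x\<bar> \<le> C"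
    "\<And>t q x. 1 \<le> t \<Longrightarrow> norm q = 1 \<Longrightarrow> x \<in> \<Omega> \<Longrightarrow> norm (grad (phase \<rho> a t q) x) \<le> C"
    "\<And>t q x. 1 \<le> t \<Longrightarrow> norm q = 1 \<Longrightarrow> x \<in> \<Omega> \<Longrightarrow> \<bar>laplacian (phase \<rho> a t q) x\<bar> \<le> C * t powr (1/3)"
    "\<And>t q x. 1 \<le> t \<Longrightarrow> norm q = 1 \<Longrightarrow> x \<in> \<Omega> \<Longrightarrow> \<bar>q \<bullet> (grad (phase \<rho> a t q) x + a x)\<bar> \<le> C * t powr (- 1/3)"
    "\<And>t q q' x. 1 \<le> t \<Longrightarrow> norm q = 1 \<Longrightarrow> norm q' = 1 \<Longrightarrow> x \<in> \<Omega> \<Longrightarrow>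
      \<bar>phase \<rho> a t q x - phase \<rho> a t q' x\<bar> \<le> C * (norm (q - q') + t powr (- 1/3))"
proof -
  obtain R where R: "R > 0" "\<forall>x. R < norm x \<longrightarrow> a x = 0"
  proof -
    obtain R where "\<forall>x. R < norm x \<longrightarrow> a x = 0" using a_support by (auto simp: bounded_support_def)
    then show thesis by (intro that[of "max R 1"]) auto
  qed
  obtain M where M: "M > 0" "\<And>x. x \<in> \<Omega> \<Longrightarrow> norm x \<le> M" using bounded_domain bounded_pos by blast
  define L where "L = R + M + 2"
  have L: "L > 0" using R(1) M(1) by (simp add: L_def)
  have Lx: "R + 1 + norm x < L" if "x \<in> \<Omega>" for x using M(2)[OF that] by (simp add: L_def)
  obtain A where A: "A \<ge> 0" "\<And>x. norm (a x) \<le> A" by (rule bounded_bounded_support[OF a_continuous a_support]) (rule that)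
  obtain D where D: "D \<ge> 0" "\<And>x. norm (grad a x) \<le> D"
    by (rule bounded_bounded_support[OF Ck1_continuous_grad[OF a_C1] bounded_support_grad[OF a_support]]) (rule that)
  have Di: "norm (grad a x $ i) \<le> D" for x i using Finite_Cartesian_Product.norm_nth_le[of "grad a x" i] D(2)[of x] by linarith
  obtain K where K: "K \<ge> 0" "\<And>h. 0 < h \<Longrightarrow> integrable lborel (\<lambda>y. norm (grad (mollifier \<rho> h) y))"
    "\<And>h. 0 < h \<Longrightarrow> (\<integral>y. norm (grad (mollifier \<rho> h) y) \<partial>lborel) \<le> K / h" by (rule grad_kernel_integral_bound) (rule that)
  let ?n = "real CARD('n)"
  have close: "norm (mollified \<rho> a t x - a x) \<le> D * t powr (- 1/3)" if "1 \<le> t" for t x unfolding mollified_eq_conv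
  proof (rule conv_close[OF a_measurable(1) A(2) width(1)[OF that]])
    fix y :: "real^'n" assume y: "norm y \<le> t powr (- 1 / 3)"
    show "norm (a (x - y) - a x) \<le> D * t powr (- 1/3)"
      using C1_lipschitz[OF a_C1 D(2), of "x - y" x] mult_left_mono[OF y D(1)] by simp
  qed
  have cs: "continuous_on UNIV (speed t q)" "bounded_support (speed t q)"
    "continuous_on UNIV (\<lambda>y. grad (speed t q) y $ i)" "bounded_support (\<lambda>y. grad (speed t q) y $ i)"
    "continuous_on UNIV (\<lambda>y. grad (\<lambda>z. grad (speed t q) z $ i) y $ j)"
    "bounded_support (\<lambda>y. grad (\<lambda>z. grad (speed t q) z $ i) y $ j)" if t: "1 \<le> t" for t q i j
    using Ck_imp_continuous[OF speed_Ck[OF t, of 0]] speed_support[OF t] Ck_imp_continuous[OF grad_speed_Ck[OF t, of 0]]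
      continuous_on_component[OF Ck1_continuous_grad[OF grad_speed_Ck[OF t]]]
    by (auto intro!: bounded_support_grad_component)
  have unit: "\<bar>q \<bullet> y\<bar> \<le> b" if "norm q = 1" "norm y \<le> b" for q y :: "real^'n" and b
    using Cauchy_Schwarz_ineq2[of q y] that by simp
  have b0: "\<bar>speed t q y\<bar> \<le> A" if "1 \<le> t" "norm q = 1" for t q y
    unfolding speed_def mollified_eq_conv by (rule unit[OF that(2) norm_conv_le[OF a_measurable(1) A(2) width(1)[OF that(1)]]])
  have b1: "\<bar>grad (speed t q) y $ i\<bar> \<le> D" if "1 \<le> t" "norm q = 1" for t q y i
    unfolding grad_speed[OF that(1)] by (rule unit[OF that(2) norm_conv_le[OF a_measurable(2) Di width(1)[OF that(1)]]])
  \<comment> \<open>One derivative falls on \<open>a\<close>, the other on the kernel.\<close>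
  have b2: "\<bar>grad (\<lambda>z. grad (speed t q) z $ i) y $ j\<bar> \<le> K * D * t powr (1/3)" if t: "1 \<le> t" and q: "norm q = 1" for t q y i j
  proof -
    note w = width(1)[OF t]
    have "norm (grad (conv \<rho> (t powr (- 1 / 3)) (\<lambda>x. grad a x $ i)) y $ j) \<le> K * D / t powr (- 1 / 3)"
      by (rule norm_grad_conv_le[OF w a_integrable(2) Di K(2)[OF w] K(3)[OF w]])
    moreover have "grad (\<lambda>z. grad (speed t q) z $ i) y $ j = q \<bullet> (grad (conv \<rho> (t powr (- 1 / 3)) (\<lambda>x. grad a x $ i)) y $ j)"
      unfolding grad_speed[OF t] by (rule grad_bounded_linear[OF bounded_linear_inner_right Ck_conv[OF w a_integrable(2)]])
    ultimately show ?thesis using unit[OF q] by (simp add: powr_minus_divide)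
  qed
  define C where "C = L * A + ?n * (L * D) + ?n * (L * (K * D)) + D + L * (A + D * L + 2 * D)"
  have C: "L * A \<le> C" "?n * (L * D) \<le> C" "?n * (L * (K * D)) \<le> C" "D \<le> C" "L * (A + D * L + 2 * D) \<le> C" "0 \<le> C"
    using L A(1) D(1) K(1) by (simp_all add: C_def)
  show thesis
  proof (rule that[OF C(6)])
    fix t :: real and q x :: "real^'n" assume t: "1 \<le> t" and q: "norm q = 1" and x: "x \<in> \<Omega>"
    note Lx = Lx[OF x] note g = grad_phase[OF t q R(2) Lx]
    have "\<bar>ray L q (speed t q) x\<bar> \<le> L * A" by (rule abs_ray_le[OF cs(1,2)[OF t] _ b0[OF t q]]) (use L in simp)
    then show "\<bar>phase \<rho> a t q x\<bar> \<le> C" using phase_eq_ray[OF t q R(2) less_imp_le[OF Lx]] C(1) by simp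
    have "\<bar>grad (phase \<rho> a t q) x $ i\<bar> \<le> L * D" for i
      unfolding g(1) abs_minus_cancel by (rule abs_ray_le[OF cs(3,4)[OF t] _ b1[OF t q]]) (use L in simp)
    then have "(\<Sum>i\<in>UNIV. \<bar>grad (phase \<rho> a t q) x $ i\<bar>) \<le> ?n * (L * D)" by (rule sum_bounded_above)
    then show "norm (grad (phase \<rho> a t q) x) \<le> C" using norm_le_l1_cart[of "grad (phase \<rho> a t q) x"] C(2) by linarith
    have "\<bar>grad (\<lambda>y. grad (phase \<rho> a t q) y $ i) x $ i\<bar> \<le> L * (K * D * t powr (1/3))" for i
      unfolding g(2) abs_minus_cancel by (rule abs_ray_le[OF cs(5,6)[OF t] _ b2[OF t q]]) (use L in simp)
    then have "(\<Sum>i\<in>UNIV. \<bar>grad (\<lambda>y. grad (phase \<rho> a t q) y $ i) x $ i\<bar>) \<le> ?n * (L * (K * D * t powr (1/3)))" by (rule sum_bounded_above)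
    then have "\<bar>laplacian (phase \<rho> a t q) x\<bar> \<le> ?n * (L * (K * D)) * t powr (1/3)"
      unfolding laplacian_def using order_trans[OF sum_abs] by (simp add: mult.assoc)
    also have "\<dots> \<le> C * t powr (1/3)" by (rule mult_right_mono[OF C(3)]) simp
    finally show "\<bar>laplacian (phase \<rho> a t q) x\<bar> \<le> C * t powr (1/3)" .
    \<comment> \<open>The length \<open>L\<close> takes the ray out of the support, so the far end
      contributes nothing in \<open>ray_transport\<close>.\<close>
    have z: "speed t q (x - L *\<^sub>R q) = 0"
      unfolding speed_def using mollified_zero[OF t R(2), of "x - L *\<^sub>R q"] Lx q L norm_triangle_ineq3[of x "L *\<^sub>R q"] by simp
    have "(\<Sum>i\<in>UNIV. q $ i * ray L q (\<lambda>y. grad (speed t q) y $ i) x) = speed t q x"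
      by (rule ray_transport[OF speed_Ck[OF t] speed_support[OF t] _ z]) (use L in simp)
    then have "q \<bullet> grad (phase \<rho> a t q) x = - speed t q x" by (simp add: inner_vec_def g(1) sum_negf)
    then have "q \<bullet> (grad (phase \<rho> a t q) x + a x) = - (q \<bullet> (mollified \<rho> a t x - a x))" by (simp add: speed_def inner_simps)
    then have "\<bar>q \<bullet> (grad (phase \<rho> a t q) x + a x)\<bar> \<le> D * t powr (- 1/3)" using unit[OF q close[OF t, of x]] by simp
    also have "\<dots> \<le> C * t powr (- 1/3)" by (rule mult_right_mono[OF C(4)]) simp
    finally show "\<bar>q \<bullet> (grad (phase \<rho> a t q) x + a x)\<bar> \<le> C * t powr (- 1/3)" .
    fix q' :: "real^'n" assume q': "norm q' = 1"
    let ?e = "norm (q - q')" and ?d = "t powr (- 1/3)"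
    \<comment> \<open>The three summands: the change of direction in the inner product, the
      displacement of the evaluation point by at most \<open>L * ?e\<close>, and the replacement of
      the mollified field by \<open>a\<close> at both points.\<close>
    have "\<bar>ray L q (speed t q) x - ray L q' (speed t q') x\<bar> \<le> L * (?e * A + D * (L * ?e) + 2 * (D * ?d))"
    proof (rule ray_diff_le[OF cs(1,2)[OF t] cs(1,2)[OF t]])
      fix s assume s: "s \<in> {- L..0}"
      let ?y = "x + s *\<^sub>R q" and ?y' = "x + s *\<^sub>R q'" and ?m = "mollified \<rho> a t"
      have "?y - ?y' = s *\<^sub>R (q - q')" by (simp add: algebra_simps)
      then have "norm (?y - ?y') \<le> L * ?e" using s mult_right_mono[of "- s" L ?e] by simp
      then have "norm (a ?y - a ?y') \<le> D * (L * ?e)"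
        using C1_lipschitz[OF a_C1 D(2), of ?y ?y'] mult_left_mono[OF _ D(1)] order_trans by blast
      moreover have "norm (?m ?y - ?m ?y') \<le> norm (?m ?y - a ?y) + norm (a ?y - a ?y') + norm (?m ?y' - a ?y')"
        using norm_triangle_ineq4[of "?m ?y - a ?y + (a ?y - a ?y')" "?m ?y' - a ?y'"] norm_triangle_ineq[of "?m ?y - a ?y" "a ?y - a ?y'"]
        by (simp add: algebra_simps)
      ultimately have "norm (?m ?y - ?m ?y') \<le> D * (L * ?e) + 2 * (D * ?d)" using close[OF t, of ?y] close[OF t, of ?y'] by linarith
      then have "\<bar>q' \<bullet> (?m ?y - ?m ?y')\<bar> \<le> D * (L * ?e) + 2 * (D * ?d)" by (rule unit[OF q'])
      moreover have "\<bar>(q - q') \<bullet> ?m ?y\<bar> \<le> ?e * A"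
        using Cauchy_Schwarz_ineq2[of "q - q'" "?m ?y"] mult_left_mono[of "norm (?m ?y)" A ?e]
          norm_conv_le[OF a_measurable(1) A(2) width(1)[OF t]] by (fastforce simp: mollified_eq_conv)
      moreover have "speed t q ?y - speed t q' ?y' = (q - q') \<bullet> ?m ?y + q' \<bullet> (?m ?y - ?m ?y')"
        by (simp add: speed_def inner_simps)
      ultimately show "\<bar>speed t q ?y - speed t q' ?y'\<bar> \<le> ?e * A + D * (L * ?e) + 2 * (D * ?d)" by linarith
    qed (use L in simp)
    moreover have "phase \<rho> a t q x - phase \<rho> a t q' x = - (ray L q (speed t q) x - ray L q' (speed t q') x)"
      using phase_eq_ray[OF t q R(2) less_imp_le[OF Lx]] phase_eq_ray[OF t q' R(2) less_imp_le[OF Lx]] by simp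
    moreover have "?e * A + D * (L * ?e) + 2 * (D * ?d) \<le> (A + D * L + 2 * D) * (?e + ?d)"
    proof -
      have "(A + D * L + 2 * D) * (?e + ?d) - (?e * A + D * (L * ?e) + 2 * (D * ?d)) = (A + D * L) * ?d + 2 * D * ?e" by (simp add: algebra_simps)
      moreover have "0 \<le> (A + D * L) * ?d + 2 * D * ?e" using A(1) D(1) L by simp
      ultimately show ?thesis by linarith
    qed
    ultimately have "\<bar>phase \<rho> a t q x - phase \<rho> a t q' x\<bar> \<le> L * ((A + D * L + 2 * D) * (?e + ?d))"
      using mult_left_mono[of _ _ L] L by (smt (verit))
    also have "\<dots> \<le> C * (?e + ?d)" unfolding mult.assoc[symmetric] by (rule mult_right_mono[OF C(5)]) simp
    finally show "\<bar>phase \<rho> a t q x - phase \<rho> a t q' x\<bar> \<le> C * (?e + ?d)" .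
  qed
qed

end

section \<open>Complex exponential solutions up to a small error\<close>

lemma Ck_mult:
  fixes f g :: "real^'n \<Rightarrow> 'b::real_normed_algebra" shows "Ck k f \<Longrightarrow> Ck k g \<Longrightarrow> Ck k (\<lambda>x. f x * g x)"
proof (induction k arbitrary: f g)
  case 0 then show ?case by (simp add: continuous_on_mult)
next
  case (Suc k)
  note C1 = Suc.prems[THEN Ck_Suc_imp_Ck1]
  have "Ck k (\<lambda>x. f x * grad g x $ i + grad f x $ i * g x)" for i
    using Suc.IH Suc.prems Ck_Suc_imp_Ck[OF Suc.prems(1)] Ck_Suc_imp_Ck[OF Suc.prems(2)] by (intro Ck_add) simp_all
  then show ?case using Ck1_mult[OF C1] by (simp add: grad_mult[OF C1])
qed

lemma Ck_vec:
  fixes F :: "real^'n \<Rightarrow> complex^'n" assumes "\<And>i. Ck k (\<lambda>x. F x $ i)" shows "Ck k F"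
proof -
  have l: "bounded_linear (axis i :: complex \<Rightarrow> complex^'n)" for i
    unfolding linear_conv_bounded_linear[symmetric] by (rule linearI) (simp_all add: vec_eq_iff axis_def)
  have c0: "Ck k (\<lambda>x :: real^'n. 0 :: complex^'n)" using Ck_bounded_linear[OF bounded_linear_zero assms] by simp
  have "Ck k (\<lambda>x. \<Sum>i\<in>I. axis i (F x $ i))" if "finite I" for I using that
  proof (induction I)
    case (insert i I)
    have "Ck k (\<lambda>x. axis i (F x $ i) + (\<Sum>i\<in>I. axis i (F x $ i)))"
      by (rule Ck_add[OF Ck_bounded_linear[OF l assms] insert.IH])
    then show ?case using insert by simp
  qed (simp add: c0)
  moreover have "(\<lambda>x. \<Sum>i\<in>UNIV. axis i (F x $ i)) = F"
    by (simp add: fun_eq_iff vec_eq_iff axis_def if_distrib if_distribR cong: if_cong)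
  ultimately show ?thesis using finite_class.finite_UNIV by metis
qed

lemma grad_exp:
  fixes S :: "real^'n \<Rightarrow> complex" assumes S: "Ck 1 S"
  shows "grad (\<lambda>x. exp (c * S x)) x $ i = c * grad S x $ i * exp (c * S x)"
    and "((\<lambda>x. exp (c * S x)) has_derivative (\<lambda>v. \<Sum>i\<in>UNIV. v $ i *\<^sub>R (c * grad S x $ i * exp (c * S x)))) (at x)"
proof -
  have "((\<lambda>x. exp (c * S x)) has_derivative (\<lambda>v. exp (c * S x) * (c * (\<Sum>i\<in>UNIV. v $ i *\<^sub>R grad S x $ i)))) (at x)"
    using has_derivative_compose[OF has_derivative_mult_right[OF Ck1_has_derivative[OF S]] DERIV_exp[unfolded has_field_derivative_def]] .
  moreover have "(\<lambda>v. exp (c * S x) * (c * (\<Sum>i\<in>UNIV. v $ i *\<^sub>R grad S x $ i))) = (\<lambda>v. \<Sum>i\<in>UNIV. v $ i *\<^sub>R (c * grad S x $ i * exp (c * S x)))"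
    by (simp add: sum_distrib_left fun_eq_iff algebra_simps)
  ultimately show d: "((\<lambda>x. exp (c * S x)) has_derivative (\<lambda>v. \<Sum>i\<in>UNIV. v $ i *\<^sub>R (c * grad S x $ i * exp (c * S x)))) (at x)"
    by simp
  show "grad (\<lambda>x. exp (c * S x)) x $ i = c * grad S x $ i * exp (c * S x)"
    by (simp add: grad_eqI[OF d] axis_def if_distrib if_distribR cong: if_cong)
qed

lemma Ck_exp:
  fixes S :: "real^'n \<Rightarrow> complex" shows "Ck (Suc k) S \<Longrightarrow> Ck k (\<lambda>x. exp (c * S x))"
proof (induction k)
  case 0
  then have "continuous_on UNIV S" using Ck_imp_continuous by blast
  then show ?case by (simp add: continuous_on_exp continuous_on_mult_left)
next
  case (Suc k)
  have S: "Ck 1 S" by (rule Ck_Suc_imp_Ck1[OF Suc.prems])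
  have p: "Ck (Suc k) S" by (rule Ck_Suc_imp_Ck[OF Suc.prems])
  have "Ck k (\<lambda>x. grad S x $ i)" for i using p by simp
  from Ck_mult[OF Ck_bounded_linear[OF bounded_linear_mult_right this] Suc.IH[OF p]]
  have "Ck k (\<lambda>x. c * grad S x $ i * exp (c * S x))" for i .
  then show ?case using grad_exp(2)[OF S] by (auto simp: grad_exp(1)[OF S] differentiable_on_def differentiable_def)
qed

text \<open>The sign \<open>\<sigma> = 1\<close> gives \<open>Phi1\<close> and
  \<open>\<sigma> = - 1\<close> gives \<open>Phi2\<close>, so both are estimated at once.\<close>

definition wave :: "(real^'n \<Rightarrow> real) \<Rightarrow> (real^'n \<Rightarrow> real^'n) \<Rightarrow> real \<Rightarrow> real \<Rightarrow> real^'n \<Rightarrow> real^'n \<Rightarrow> complex" where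
  "wave \<rho> a \<sigma> t h x = exp (\<i> * of_real \<sigma> * (sqrt_lam t * of_real (h \<bullet> x) + of_real (phase \<rho> a t h x)))"

lemma Phi1_eq_wave: "Phi1 \<rho> a \<xi> \<eta> t = wave \<rho> a 1 t (eta1 \<xi> \<eta> t)"
  and Phi2_eq_wave: "Phi2 \<rho> a (\<lambda>_. 1) \<xi> \<eta> t = wave \<rho> a (- 1) t (eta2 \<xi> \<eta> t)"
  by (simp_all add: fun_eq_iff Phi1_def Phi2_def wave_def exp_add[symmetric] algebra_simps)

context magnetic_domain
begin

text \<open>The transpose of \<open>(-i\<nabla> + a)^2\<close> is \<open>(-i\<nabla> - a)^2\<close>; the sign \<open>\<sigma>\<close> distinguishes the two.\<close>

definition wave_error :: "real \<Rightarrow> real \<Rightarrow> real^'n \<Rightarrow> real^'n \<Rightarrow> complex" where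
  "wave_error \<sigma> t h x = (let w = wave \<rho> a \<sigma> t h in
     - laplacian w x - 2 * \<i> * of_real \<sigma> * cdot (grad w x) (cvec (a x)) - \<i> * of_real \<sigma> * of_real (divergence a x) * w x
     + (of_real ((norm (a x))^2) - lam t) * w x)"

context
  fixes t \<sigma> :: real and h :: "real^'n" assumes t: "1 \<le> t" and h: "norm h = 1" and \<sigma>: "\<sigma>^2 = 1"
begin

private abbreviation "w \<equiv> wave \<rho> a \<sigma> t h"

private abbreviation "f \<equiv> phase \<rho> a t h"

private definition exponent :: "real^'n \<Rightarrow> complex" where
  "exponent x = sqrt_lam t * of_real (h \<bullet> x) + of_real (f x)"

lemma wave_exponent: "w = (\<lambda>x. exp ((\<i> * of_real \<sigma>) * exponent x))" by (simp add: fun_eq_iff wave_def exponent_def)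

text \<open>The linear part of the exponent has a constant gradient, so only the phase enters the
  second derivatives.\<close>

lemma exponent_Ck: "Ck m exponent"
  and grad_exponent: "grad exponent x $ i = sqrt_lam t * of_real (h $ i) + of_real (grad f x $ i)"
  and grad2_exponent: "grad (\<lambda>y. grad exponent y $ i) x $ j = of_real (grad (\<lambda>y. grad f y $ i) x $ j)"
proof -
  have bl: "bounded_linear (\<lambda>x. sqrt_lam t * of_real (h \<bullet> x))"
    by (intro bounded_linear_const_mult bounded_linear_compose[OF bounded_linear_of_real bounded_linear_inner_right])
  have dl: "((\<lambda>x. sqrt_lam t * of_real (h \<bullet> x)) has_derivative (\<lambda>x. sqrt_lam t * of_real (h \<bullet> x))) (at y)" for y
    by (rule bounded_linear_imp_has_derivative[OF bl])
  have Cp: "Ck m f" for m by (rule phase_Ck[OF t h])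
  have Cr: "Ck m (\<lambda>x. of_real (f x))" for m by (rule Ck_bounded_linear[OF bounded_linear_of_real Cp])
  have D: "(exponent has_derivative (\<lambda>v. sqrt_lam t * of_real (h \<bullet> v) + (\<Sum>i\<in>UNIV. v $ i *\<^sub>R grad (\<lambda>x. of_real (f x)) y $ i))) (at y)" for y
    unfolding exponent_def[abs_def] by (rule has_derivative_add[OF dl Ck1_has_derivative[OF Cr]])
  have th: "h \<bullet> axis i 1 = h $ i" for i by (simp add: inner_axis)
  have gr: "grad (\<lambda>x. of_real (f x)) y $ i = of_real (grad f y $ i)" for y i
    by (rule grad_bounded_linear[OF bounded_linear_of_real Cp])
  show g: "grad exponent x $ i = sqrt_lam t * of_real (h $ i) + of_real (grad f x $ i)" for x i
    unfolding grad_eqI[OF D] th by (simp add: gr axis_def if_distrib if_distribR cong: if_cong)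
  have Cg: "Ck m (\<lambda>x. grad f x $ i)" for m i using Cp[of "Suc m"] by simp
  have Dg: "((\<lambda>y. grad exponent y $ i) has_derivative (\<lambda>v. of_real (\<Sum>j\<in>UNIV. v $ j *\<^sub>R grad (\<lambda>y. grad f y $ i) y $ j))) (at y)" for y i
    unfolding g using has_derivative_add[OF has_derivative_const
        bounded_linear.has_derivative[OF bounded_linear_of_real Ck1_has_derivative[OF Cg]]] by simp
  show gg: "grad (\<lambda>y. grad exponent y $ i) x $ j = of_real (grad (\<lambda>y. grad f y $ i) x $ j)" for x i j
    unfolding grad_eqI[OF Dg] by (simp add: axis_def if_distrib if_distribR cong: if_cong)
  have Cg2: "Ck m (\<lambda>x. of_real (grad (\<lambda>y. grad f y $ i) x $ j) :: complex)" for m i j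
    by (rule Ck_bounded_linear[OF bounded_linear_of_real]) (use Cg[of "Suc m" i] in simp)
  have 2: "Ck (Suc (Suc m)) exponent" for m
  proof (rule Ck_SucI[OF D])
    fix i
    have "Ck (Suc m) (\<lambda>y. grad exponent y $ i)"
      using Dg Cg2 by (auto simp: gg differentiable_on_def differentiable_def)
    then show "Ck (Suc m) (\<lambda>x. sqrt_lam t * of_real (h \<bullet> axis i 1) + (\<Sum>j\<in>UNIV. axis i 1 $ j *\<^sub>R grad (\<lambda>x. of_real (f x)) x $ j))"
      unfolding g gr th by (simp add: axis_def if_distrib if_distribR cong: if_cong)
  qed
  show "Ck m exponent" by (rule Ck_Suc_imp_Ck[OF Ck_Suc_imp_Ck[OF 2]])
qed

lemma wave_Ck: "Ck m w" unfolding wave_exponent by (rule Ck_exp[OF exponent_Ck])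

lemma grad_wave: "grad w x $ i = \<i> * of_real \<sigma> * grad exponent x $ i * w x"
  unfolding wave_exponent by (rule grad_exp(1)[OF exponent_Ck])

lemma grad_wave_Ck: "Ck m (grad w)" by (rule Ck_vec) (use wave_Ck[of "Suc m"] in simp)

lemma laplacian_wave:
  "laplacian w x = (\<i> * of_real \<sigma> * of_real (laplacian f x) - (\<Sum>i\<in>UNIV. (grad exponent x $ i)^2)) * w x"
proof -
  let ?c = "\<i> * of_real \<sigma>"
  have c2: "?c^2 = - 1" using \<sigma> by (simp add: power_mult_distrib flip: of_real_power)
  have C: "Ck 1 (\<lambda>x. ?c * grad exponent x $ i)" for i
    by (rule Ck_bounded_linear[OF bounded_linear_mult_right]) (use exponent_Ck[of "Suc 1"] in simp)
  have G: "grad (\<lambda>x. ?c * grad exponent x $ i) x $ i = ?c * grad (\<lambda>y. grad exponent y $ i) x $ i" for i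
    by (rule grad_bounded_linear[OF bounded_linear_mult_right]) (use exponent_Ck[of "Suc 1"] in simp)
  have "grad (\<lambda>y. grad w y $ i) x $ i = (?c * of_real (grad (\<lambda>y. grad f y $ i) x $ i) + ?c^2 * (grad exponent x $ i)^2) * w x" for i
    unfolding grad_wave grad_mult[OF C wave_Ck] G grad2_exponent by (simp only: grad_wave power2_eq_square) (simp add: algebra_simps)
  then show ?thesis
    unfolding laplacian_def c2 by (simp add: sum_distrib_right sum_distrib_left sum_subtractf ring_distribs)
qed

text \<open>For a unit direction the leading term is the square of \<open>sqrt_lam t\<close>, that
  is \<open>lam t\<close>; it will cancel against the spectral parameter.\<close>

lemma exponent_square:
  "(\<Sum>i\<in>UNIV. (grad exponent x $ i)^2) = lam t + 2 * sqrt_lam t * of_real (h \<bullet> grad f x) + of_real ((norm (grad f x))^2)"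
proof -
  have "(\<Sum>i\<in>UNIV. (grad exponent x $ i)^2) = (\<Sum>i\<in>UNIV. lam t * of_real (h $ i * h $ i)
      + 2 * sqrt_lam t * of_real (h $ i * grad f x $ i) + of_real (grad f x $ i * grad f x $ i))"
    by (rule sum.cong) (simp_all add: grad_exponent lam_def power2_eq_square algebra_simps)
  also have "\<dots> = lam t * of_real (h \<bullet> h) + 2 * sqrt_lam t * of_real (h \<bullet> grad f x) + of_real (grad f x \<bullet> grad f x)"
    by (simp add: sum.distrib sum_distrib_left inner_vec_def)
  finally show ?thesis using h by (simp add: power2_norm_eq_inner[symmetric])
qed

text \<open>The terms of order \<open>lam t\<close> cancel, and \<open>sqrt_lam t\<close> multiplies
  only \<open>h \<bullet> (grad f x + a x)\<close>, which the transport equation makes small. As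
  \<open>\<sigma>^2 = 1\<close>, the terms quadratic in the fields are the same for both
  signs.\<close>

lemma wave_error_eq:
  "wave_error \<sigma> t h x = (- \<i> * of_real \<sigma> * of_real (laplacian f x + divergence a x) + of_real ((norm (grad f x))^2)
     + 2 * sqrt_lam t * of_real (h \<bullet> (grad f x + a x)) + of_real (2 * (grad f x \<bullet> a x)) + of_real ((norm (a x))^2)) * w x"
proof -
  have "cdot (grad w x) (cvec (a x)) = (\<i> * of_real \<sigma> * w x) * (\<Sum>i\<in>UNIV. grad exponent x $ i * of_real (a x $ i))"
    unfolding cdot_def cvec_def grad_wave by (simp add: sum_distrib_left mult_ac)
  also have "(\<Sum>i\<in>UNIV. grad exponent x $ i * of_real (a x $ i)) = sqrt_lam t * of_real (h \<bullet> a x) + of_real (grad f x \<bullet> a x)"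
    by (simp add: grad_exponent inner_vec_def sum.distrib sum_distrib_left ring_distribs mult_ac)
  finally have c: "cdot (grad w x) (cvec (a x)) = (\<i> * of_real \<sigma> * w x) * (sqrt_lam t * of_real (h \<bullet> a x) + of_real (grad f x \<bullet> a x))" .
  have s: "of_real \<sigma> * (of_real \<sigma> * z) = z" for z
    using \<sigma> by (simp add: power2_eq_square flip: mult.assoc of_real_mult)
  have ii: "\<i> * (\<i> * z) = - z" for z by (simp flip: mult.assoc)
  have "2 * \<i> * of_real \<sigma> * cdot (grad w x) (cvec (a x)) = - 2 * (sqrt_lam t * of_real (h \<bullet> a x) + of_real (grad f x \<bullet> a x)) * w x"
    unfolding c by (simp add: algebra_simps s ii)
  then show ?thesis
    unfolding wave_error_def Let_def laplacian_wave exponent_square by (simp add: inner_add_right algebra_simps)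
qed

end

text \<open>The largest term is the modulus of \<open>sqrt_lam l\<close>, of order \<open>l\<close>,
  times the transport error of order \<open>l powr (- 1/3)\<close>; the others are of lower
  order.\<close>

lemma wave_estimates: obtains C where "C \<ge> 0"
    "\<And>\<sigma> l d x. 1 \<le> l \<Longrightarrow> norm d = 1 \<Longrightarrow> \<sigma>^2 = 1 \<Longrightarrow> x \<in> \<Omega> \<Longrightarrow> norm (wave \<rho> a \<sigma> l d x) \<le> C"
    "\<And>\<sigma> l d x. 1 \<le> l \<Longrightarrow> norm d = 1 \<Longrightarrow> \<sigma>^2 = 1 \<Longrightarrow> x \<in> \<Omega> \<Longrightarrow> norm (wave_error \<sigma> l d x) \<le> C * l powr (2/3)"
proof -
  obtain M where M: "\<And>x. x \<in> \<Omega> \<Longrightarrow> norm x \<le> M" using bounded_domain by (auto simp: bounded_iff)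
  obtain A where A: "A \<ge> 0" "\<And>x. norm (a x) \<le> A" by (rule bounded_bounded_support[OF a_continuous a_support]) (rule that)
  obtain D where D: "\<And>x. x \<in> \<Omega> \<Longrightarrow> \<bar>divergence a x\<bar> \<le> D"
  proof -
    obtain B where "\<And>x. x \<in> closure \<Omega> \<Longrightarrow> norm (divergence a x) \<le> B"
      by (rule continuous_bounded[OF divergence_continuous[OF a_C1]]) (rule that)
    then show thesis using closure_subset[of \<Omega>] by (intro that[of B]) auto
  qed
  obtain C where C: "C \<ge> 0"
    "\<And>l d x. 1 \<le> l \<Longrightarrow> norm d = 1 \<Longrightarrow> x \<in> \<Omega> \<Longrightarrow> norm (grad (phase \<rho> a l d) x) \<le> C"
    "\<And>l d x. 1 \<le> l \<Longrightarrow> norm d = 1 \<Longrightarrow> x \<in> \<Omega> \<Longrightarrow> \<bar>laplacian (phase \<rho> a l d) x\<bar> \<le> C * l powr (1/3)"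
    "\<And>l d x. 1 \<le> l \<Longrightarrow> norm d = 1 \<Longrightarrow> x \<in> \<Omega> \<Longrightarrow> \<bar>d \<bullet> (grad (phase \<rho> a l d) x + a x)\<bar> \<le> C * l powr (- 1/3)"
    by (rule phase_estimates) (rule that)
  define E where "E = C + \<bar>D\<bar> + C^2 + 4 * C + 2 * (C * A) + A^2"
  have E0: "0 \<le> E" using C(1) A(1) by (simp add: E_def)
  \<comment> \<open>The imaginary part of \<open>sqrt_lam\<close> is 1, so the modulus of the wave
    is \<open>exp (- \<sigma> * (d \<bullet> x))\<close>, bounded on the bounded domain.\<close>
  have wb: "norm (wave \<rho> a \<sigma> l d x) \<le> exp M" if h: "norm d = 1" "\<sigma>^2 = 1" "x \<in> \<Omega>" for \<sigma> l d x
  proof -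
    have "\<bar>\<sigma>\<bar> = 1" using h(2) by (auto simp: power2_eq_1_iff)
    then have "\<bar>\<sigma> * (d \<bullet> x)\<bar> \<le> M" using Cauchy_Schwarz_ineq2[of d x] M[OF h(3)] h(1) by (simp add: abs_mult)
    then show ?thesis by (simp add: wave_def sqrt_lam_def algebra_simps)
  qed
  show thesis
  proof (rule that[of "(1 + E) * exp M"])
    show "0 \<le> (1 + E) * exp M" using E0 by simp
    fix \<sigma> l :: real and d x :: "real^'n"
    assume l: "1 \<le> l" and d: "norm d = 1" and \<sigma>: "\<sigma>^2 = 1" and x: "x \<in> \<Omega>"
    note W = wb[OF d \<sigma> x, of l]
    show "norm (wave \<rho> a \<sigma> l d x) \<le> (1 + E) * exp M" by (rule order_trans[OF W]) (use E0 mult_right_mono[of 1 "1 + E" "exp M"] in simp)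
    let ?p = "phase \<rho> a l d" and ?t = "l powr (2/3)"
    have t: "l powr (1/3) \<le> ?t" "1 \<le> ?t" "(l + 1) * l powr (- 1/3) \<le> 2 * ?t"
    proof -
      show "l powr (1/3) \<le> ?t" by (rule powr_mono) (use l in auto)
      show "1 \<le> ?t" by (rule ge_one_powr_ge_zero) (use l in auto)
      have "(l + 1) * l powr (- 1/3) \<le> (2 * l powr 1) * l powr (- 1/3)" by (rule mult_right_mono) (use l in auto)
      also have "\<dots> = 2 * ?t" using powr_add[of l 1 "- 1/3"] by simp
      finally show "(l + 1) * l powr (- 1/3) \<le> 2 * ?t" .
    qed
    have \<sigma>1: "\<bar>\<sigma>\<bar> = 1" using \<sigma> by (auto simp: power2_eq_1_iff)
    have up: "c \<le> c * ?t" if "0 \<le> c" for c using mult_left_mono[OF t(2) that] by simp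
    have "\<bar>laplacian ?p x + divergence a x\<bar> \<le> C * l powr (1/3) + \<bar>D\<bar>" using C(3)[OF l d x] D[OF x] by linarith
    also have "\<dots> \<le> C * ?t + \<bar>D\<bar> * ?t" by (intro add_mono mult_left_mono t(1) C(1) up) simp
    finally have n1: "norm (- \<i> * of_real \<sigma> * complex_of_real (laplacian ?p x + divergence a x)) \<le> (C + \<bar>D\<bar>) * ?t"
      unfolding norm_mult norm_minus_cancel norm_ii norm_of_real \<sigma>1 by (simp add: ring_distribs)
    have sq: "norm (complex_of_real ((norm y)^2)) \<le> c^2 * ?t" if "norm y \<le> c" for y :: "real^'n" and c
      unfolding norm_of_real abs_power2 by (rule order_trans[OF power_mono[OF that] up]) auto
    note n2 = sq[OF C(2)[OF l d x]] and n5 = sq[OF A(2)[of x]]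
    have n3: "norm (2 * sqrt_lam l * complex_of_real (d \<bullet> (grad ?p x + a x))) \<le> 4 * C * ?t"
    proof -
      have "norm (sqrt_lam l) \<le> l + 1" using norm_triangle_ineq[of "complex_of_real l" \<i>] l by (simp add: sqrt_lam_def)
      then have "norm (sqrt_lam l) * \<bar>d \<bullet> (grad ?p x + a x)\<bar> \<le> (l + 1) * (C * l powr (- 1/3))"
        by (rule mult_mono[OF _ C(4)[OF l d x]]) (use l in auto)
      also have "\<dots> \<le> C * (2 * ?t)" using mult_left_mono[OF t(3) C(1)] by (simp add: mult.left_commute)
      finally show ?thesis by (simp add: norm_mult)
    qed
    have "\<bar>grad ?p x \<bullet> a x\<bar> \<le> C * A"
      by (rule order_trans[OF Cauchy_Schwarz_ineq2 mult_mono[OF C(2)[OF l d x] A(2) C(1)]]) simp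
    then have n4: "norm (complex_of_real (2 * (grad ?p x \<bullet> a x))) \<le> 2 * (C * A) * ?t"
      using up[of "2 * (C * A)"] C(1) A(1) by (simp add: norm_mult)
    have "norm (wave_error \<sigma> l d x) \<le> ((C + \<bar>D\<bar>) * ?t + C^2 * ?t + 4 * C * ?t + 2 * (C * A) * ?t + A^2 * ?t) * exp M"
      unfolding wave_error_eq[OF l d \<sigma>] norm_mult[of _ "wave \<rho> a \<sigma> l d x"]
      by (rule mult_mono[OF norm_triangle_mono[OF norm_triangle_mono[OF norm_triangle_mono[OF norm_triangle_mono[OF n1 n2] n3] n4] n5] W])
        (use C(1) A(1) in simp_all)
    also have "\<dots> = E * exp M * ?t" by (simp add: E_def algebra_simps)
    also have "\<dots> \<le> (1 + E) * exp M * ?t" by (rule mult_right_mono) auto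
    finally show "norm (wave_error \<sigma> l d x) \<le> (1 + E) * exp M * ?t" .
  qed
qed

end

section \<open>The limit of the boundary forms\<close>

lemma (in finite_measure) integral_norm_le_l2norm:
  fixes f g :: "'a \<Rightarrow> complex"
  assumes f: "L2 M f" and g: "g \<in> borel_measurable M" "AE x in M. norm (g x) \<le> K" and K: "0 \<le> K"
  shows "norm (\<integral>x. f x * g x \<partial>M) \<le> l2norm M f * (K * sqrt (measure M (space M)))"
proof -
  have "norm (\<integral>x. f x * g x \<partial>M) \<le> l2norm M f * l2norm M g" by (rule cauchy_schwarz_integral[OF f L2_bounded[OF g]])
       (use L2_measurable[OF f] g(1) in \<open>auto simp: norm_mult\<close>)
  also have "\<dots> \<le> l2norm M f * (K * sqrt (measure M (space M)))"
    by (rule mult_left_mono[OF l2norm_bounded_le[OF g K]]) simp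
  finally show ?thesis .
qed

context magnetic_domain
begin

lemma weak_div_wave: assumes "1 \<le> l" "norm h = 1" "\<sigma>^2 = 1"
  defines "w \<equiv> wave \<rho> a \<sigma> l h"
  shows "weak_div (grad w) (laplacian w)" "weak_div (weak_gradient \<Omega> w) (laplacian w)"
    "AE x in \<D>. weak_gradient \<Omega> w x = grad w x" "has_trace \<Omega> w w"
    "L2 \<D> (wave_error \<sigma> l h)"
proof -
  have W: "Ck m w" "Ck m (grad w)" for m unfolding w_def using wave_Ck[OF assms(1-3)] grad_wave_Ck[OF assms(1-3)] .
  have Cl: "continuous_on UNIV (laplacian w)" unfolding laplacian_def
  proof (intro continuous_on_sum)
    fix i
    have "Ck 1 (\<lambda>x. grad w x $ i)" using W(1)[of "Suc 1"] by simp
    from continuous_on_component[OF Ck1_continuous_grad[OF this]] show "continuous_on UNIV (\<lambda>x. grad (\<lambda>y. grad w y $ i) x $ i)" .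
  qed
  have "laplacian w x = (\<Sum>i\<in>UNIV. grad (grad w) x $ i $ i)" for x
    unfolding laplacian_def by (simp add: grad_bounded_linear[OF bounded_linear_vec_nth W(2)])
  then show d: "weak_div (grad w) (laplacian w)" using weak_div_classical[OF W(2)] by presburger
  show wg: "AE x in \<D>. weak_gradient \<Omega> w x = grad w x" by (rule weak_gradient_eq_AE[OF weak_gradient_classical[OF W(1)]])
  show t: "has_trace \<Omega> w w" by (rule has_trace_classical[OF W(1)])
  show "weak_div (weak_gradient \<Omega> w) (laplacian w)"
  proof (rule weak_div_cong_AE[OF d])
    show "L2 \<D> (weak_gradient \<Omega> w)" by (rule H1_L2(2)[OF has_trace_H1[OF t]])
    show "L2 \<D> (laplacian w)" by (rule continuous_L2[OF Cl])
    show "AE x in \<D>. grad w x = weak_gradient \<Omega> w x" using wg by eventually_elim simp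
  qed simp
  have g: "continuous_on UNIV (grad w)" by (rule Ck1_continuous_grad[OF W(1)])
  have "continuous_on UNIV (\<lambda>x. cdot (grad w x) (cvec (a x)))"
    by (rule bounded_bilinear.continuous_on[OF bounded_bilinear_cdot g continuous_cvec[OF a_continuous]])
  note cont = this Cl Ck1_continuous[OF W(1)] divergence_continuous[OF a_C1] a_continuous
  show "L2 \<D> (wave_error \<sigma> l h)" unfolding wave_error_def[abs_def] Let_def w_def[symmetric]
    by (rule continuous_L2) (intro continuous_on_add continuous_on_diff continuous_on_minus continuous_on_mult
      continuous_on_const continuous_on_of_real continuous_on_power continuous_on_norm cont)
qed

lemma zeroth_order_bound: assumes "Linf \<Omega> V"
  obtains B where "(\<lambda>x. (norm (a x))^2 + V x) \<in> borel_measurable \<D>"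
    "AE x in \<D>. \<bar>(norm (a x))^2 + V x\<bar> \<le> B"
proof -
  obtain A where A: "\<And>x. norm (a x) \<le> A" using bounded_bounded_support[OF a_continuous a_support] by metis
  obtain B where B: "AE x in \<D>. \<bar>V x\<bar> \<le> B" using assms by (auto simp: Linf_def)
  show thesis
  proof (rule that)
    have "(\<lambda>x. (norm (a x))^2) \<in> borel_measurable \<D>"
      by (rule continuous_measurable) (intro continuous_on_power continuous_on_norm a_continuous)
    then show "(\<lambda>x. (norm (a x))^2 + V x) \<in> borel_measurable \<D>"
      by (rule borel_measurable_add) (use assms in \<open>simp add: Linf_def\<close>)
    show "AE x in \<D>. \<bar>(norm (a x))^2 + V x\<bar> \<le> A^2 + B" using B
    proof eventually_elim
      case (elim x)
      have "(norm (a x))^2 \<le> A^2" by (rule power_mono[OF A]) simp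
      then show ?case using elim by (simp add: abs_le_iff) (smt (verit) zero_le_power2)
    qed
  qed
qed

lemma bvp_solution_weak_div: assumes "is_bvp_solution \<Omega> A V \<mu> \<Phi> u" "\<forall>x\<in>\<Omega>. A x = a x" "Linf \<Omega> V"
  shows "weak_div (weak_gradient \<Omega> u) (magnetic_rhs a V \<mu> u (weak_gradient \<Omega> u))"
    "has_trace \<Omega> u \<Phi>" "u \<in> H1 \<Omega>"
proof -
  show u: "has_trace \<Omega> u \<Phi>" "u \<in> H1 \<Omega>" using assms(1) by (auto simp: is_bvp_solution_def)
  have "magnetic_schroedinger_eq \<Omega> A V \<mu> u \<longleftrightarrow> weak_div (weak_gradient \<Omega> u) (magnetic_rhs a V \<mu> u (weak_gradient \<Omega> u))"
    by (rule magnetic_eq_iff[OF u(2) a_C1 _ assms(3)]) (use assms(2) in auto)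
  then show "weak_div (weak_gradient \<Omega> u) (magnetic_rhs a V \<mu> u (weak_gradient \<Omega> u))"
    using assms(1) by (simp add: is_bvp_solution_def)
qed

lemma weak_div_diff: assumes "weak_div F q" "weak_div F' q'"
  shows "weak_div (\<lambda>x. F x - F' x) (\<lambda>x. q x - q' x)" using weak_div_lincomb[OF assms, of "- 1"] by simp

text \<open>The difference of solution and wave has vanishing trace and solves the magnetic equation
  whose source is \<open>V\<close> times the wave plus the wave error. The imaginary part of
  \<open>lam t\<close> is \<open>2 * t\<close>.\<close>

lemma corrector_estimate: assumes h: "1 \<le> t" "norm d = 1" and u: "is_bvp_solution \<Omega> A V (lam t) (wave \<rho> a 1 t d) u"
    and Aa: "\<forall>x\<in>\<Omega>. A x = a x" and V: "Linf \<Omega> V"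
  shows "2 * t * l2norm \<D> (\<lambda>x. u x - wave \<rho> a 1 t d x)
    \<le> l2norm \<D> (\<lambda>x. of_real (V x) * wave \<rho> a 1 t d x + wave_error 1 t d x)"
proof -
  let ?w = "wave \<rho> a 1 t d"
  note U = bvp_solution_weak_div[OF u Aa V]
  note W = weak_div_wave[OF h, of 1, simplified]
  obtain B where B: "(\<lambda>x. (norm (a x))^2 + V x) \<in> borel_measurable \<D>"
    "AE x in \<D>. \<bar>(norm (a x))^2 + V x\<bar> \<le> B" by (rule zeroth_order_bound[OF V]) (rule that)
  have "\<bar>Im (lam t)\<bar> * l2norm \<D> (\<lambda>x. u x - ?w x)
    \<le> l2norm \<D> (\<lambda>x. of_real (V x) * ?w x + wave_error 1 t d x)"
  proof (rule energy_estimate[OF has_trace_diff[OF U(2) W(4)] weak_div_diff[OF U(1) W(2)] a_C1 B])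
    show "L2 \<D> (\<lambda>x. of_real (V x) * ?w x + wave_error 1 t d x)"
      by (rule L2_add[OF L2_Linf_mult[OF V H1_L2(1)[OF has_trace_H1[OF W(4)]]] W(5)])
    show "AE x in \<D>. magnetic_rhs a V (lam t) u (weak_gradient \<Omega> u) x - laplacian ?w x
      = - 2 * \<i> * cdot (weak_gradient \<Omega> u x - weak_gradient \<Omega> ?w x) (cvec (a x)) - \<i> * of_real (divergence a x) * (u x - ?w x)
        + (of_real ((norm (a x))^2 + V x) - lam t) * (u x - ?w x) + (of_real (V x) * ?w x + wave_error 1 t d x)"
      using W(3) by eventually_elim (simp add: magnetic_rhs_def wave_error_def Let_def cdot_linear cdot_commute algebra_simps)
  qed
  then show ?thesis using h(1) by (simp add: lam_def sqrt_lam_def power2_eq_square)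
qed

text \<open>Both magnetic potentials are \<open>a\<close> on \<Omega>, so the difference solves the
  equation with potential \<open>V2\<close> and source \<open>(V1 - V2) u1\<close>, with vanishing
  trace.\<close>

lemma solution_difference_estimate:
  assumes \<mu>: "Im \<mu> > 0" and u1: "is_bvp_solution \<Omega> A1 V1 \<mu> \<Phi> u1" and u2: "is_bvp_solution \<Omega> A2 V2 \<mu> \<Phi> u2"
    and A1: "\<forall>x\<in>\<Omega>. A1 x = a x" and A2: "\<forall>x\<in>\<Omega>. A2 x = a x" and V: "Linf \<Omega> V1" "Linf \<Omega> V2"
  shows "Im \<mu> * l2norm \<D> (\<lambda>x. u1 x - u2 x) \<le> l2norm \<D> (\<lambda>x. of_real (V1 x) * u1 x - of_real (V2 x) * u1 x)"
proof -
  note U1 = bvp_solution_weak_div[OF u1 A1 V(1)] and U2 = bvp_solution_weak_div[OF u2 A2 V(2)]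
  obtain B where B: "(\<lambda>x. (norm (a x))^2 + V2 x) \<in> borel_measurable \<D>"
    "AE x in \<D>. \<bar>(norm (a x))^2 + V2 x\<bar> \<le> B" by (rule zeroth_order_bound[OF V(2)]) (rule that)
  note L = H1_L2(1)[OF U1(3)]
  have "\<bar>Im \<mu>\<bar> * l2norm \<D> (\<lambda>x. u1 x - u2 x) \<le> l2norm \<D> (\<lambda>x. of_real (V1 x) * u1 x - of_real (V2 x) * u1 x)"
    by (rule energy_estimate[OF has_trace_diff[OF U1(2) U2(2)] weak_div_diff[OF U1(1) U2(1)] a_C1 B
        L2_diff[OF L2_Linf_mult[OF V(1) L] L2_Linf_mult[OF V(2) L]]], rule AE_I2)
      (simp add: magnetic_rhs_def cdot_linear algebra_simps)
  then show ?thesis using \<mu> by simp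
qed

text \<open>Green's formula is applied to \<open>u1 - u2\<close> and the flux \<open>?F\<close>
  belonging to the transposed equation for \<open>v\<close>. Derivatives thereby fall on
  \<open>v\<close>, where they combine to its wave error, next to the terms with \<open>V1\<close>
  and \<open>V2\<close>.\<close>

lemma normal_derivative_difference: assumes h: "1 \<le> t" "norm d = 1"
    and u1: "is_bvp_solution \<Omega> A1 V1 (lam t) \<Phi> u1" and u2: "is_bvp_solution \<Omega> A2 V2 (lam t) \<Phi> u2"
    and A1: "\<forall>x\<in>\<Omega>. A1 x = a x" and A2: "\<forall>x\<in>\<Omega>. A2 x = a x" and V: "Linf \<Omega> V1" "Linf \<Omega> V2"
  defines "v \<equiv> wave \<rho> a (- 1) t d"
  shows "normal_derivative \<Omega> u1 v - normal_derivative \<Omega> u2 v =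
    (\<integral>x. (u1 x - u2 x) * (wave_error (- 1) t d x + of_real (V2 x) * v x) \<partial>\<D>)
    + (\<integral>x. (of_real (V1 x) * u1 x - of_real (V2 x) * u1 x) * v x \<partial>\<D>)"
proof -
  note U1 = bvp_solution_weak_div[OF u1 A1 V(1)] and U2 = bvp_solution_weak_div[OF u2 A2 V(2)]
  note W = weak_div_wave[OF h, of "- 1", simplified, folded v_def]
  note L1 = H1_L2[OF U1(3)] and L2 = H1_L2[OF U2(3)] and Lv = H1_L2[OF has_trace_H1[OF W(4)]]
  let ?G = "\<lambda>x. weak_gradient \<Omega> u1 x - weak_gradient \<Omega> u2 x" and ?w = "\<lambda>x. u1 x - u2 x"
  let ?q1 = "magnetic_rhs a V1 (lam t) u1 (weak_gradient \<Omega> u1)" and ?q2 = "magnetic_rhs a V2 (lam t) u2 (weak_gradient \<Omega> u2)"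
  let ?W = "weak_gradient \<Omega> v"
  let ?F = "\<lambda>x. ?W x + (- 2 * \<i>) *s (v x *s cvec (a x))"
  let ?q = "\<lambda>x. laplacian v x + (- 2 * \<i>) * (of_real (divergence a x) * v x + cdot (?W x) (cvec (a x)))"
  let ?R = "\<lambda>x. of_real (V1 x) * u1 x - of_real (V2 x) * u1 x"
  have F: "weak_div ?F ?q"
    by (rule weak_div_lincomb[OF W(2) weak_div_product[OF weak_gradient_spec[OF has_trace_H1[OF W(4)]] a_C1]])
  have green: "(\<integral>x. cdot (?F x) (?G x) \<partial>\<D>) = - (\<integral>x. ?q x * ?w x \<partial>\<D>)"
    by (rule green_zero_trace[OF F has_trace_diff[OF U1(2) U2(2)]])
  have Lq: "L2 \<D> ?q1" "L2 \<D> ?q2" "L2 \<D> ?F" "L2 \<D> ?q" using U1(1) U2(1) F by (auto simp: weak_div_def)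
  have Lw: "L2 \<D> ?w" "L2 \<D> ?G" using L2_diff[OF L1(1) L2(1)] L2_diff[OF L1(2) L2(2)] .
  have LR: "L2 \<D> ?R" by (rule L2_diff[OF L2_Linf_mult[OF V(1) L1(1)] L2_Linf_mult[OF V(2) L1(1)]])
  have LE: "L2 \<D> (\<lambda>x. wave_error (- 1) t d x + of_real (V2 x) * v x)" by (rule L2_add[OF W(5) L2_Linf_mult[OF V(2) Lv(1)]])
  let ?P = "\<lambda>x. ?w x * (wave_error (- 1) t d x + of_real (V2 x) * v x)"
  have iP: "integrable \<D> ?P" by (rule integrable_times[OF Lw(1) LE])
  have iR: "integrable \<D> (\<lambda>x. ?R x * v x)" by (rule integrable_times[OF LR Lv(1)])
  have iF: "integrable \<D> (\<lambda>x. cdot (?F x) (?G x))" by (rule integrable_cdot[OF Lq(3) Lw(2)])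
  have iq: "integrable \<D> (\<lambda>x. ?q x * ?w x)" by (rule integrable_times[OF Lq(4) Lw(1)])
  have i1: "integrable \<D> (\<lambda>x. cdot (weak_gradient \<Omega> u1 x) (?W x) + ?q1 x * v x)"
    "integrable \<D> (\<lambda>x. cdot (weak_gradient \<Omega> u2 x) (?W x) + ?q2 x * v x)"
    by (rule Bochner_Integration.integrable_add[OF integrable_cdot[OF L1(2) Lv(2)] integrable_times[OF Lq(1) Lv(1)]],
        rule Bochner_Integration.integrable_add[OF integrable_cdot[OF L2(2) Lv(2)] integrable_times[OF Lq(2) Lv(1)]])
  have iS: "integrable \<D> (\<lambda>x. cdot (?F x) (?G x) + ?q x * ?w x + ?P x + ?R x * v x)"
    by (intro Bochner_Integration.integrable_add iF iq iP iR)
  have "normal_derivative \<Omega> u1 v - normal_derivative \<Omega> u2 v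
    = (\<integral>x. (cdot (weak_gradient \<Omega> u1 x) (?W x) + ?q1 x * v x) - (cdot (weak_gradient \<Omega> u2 x) (?W x) + ?q2 x * v x) \<partial>\<D>)"
    unfolding normal_derivative_eq[OF U1(3) U1(1) W(4)] normal_derivative_eq[OF U2(3) U2(1) W(4)]
    by (rule Bochner_Integration.integral_diff[OF i1, symmetric])
  also have "\<dots> = (\<integral>x. cdot (?F x) (?G x) + ?q x * ?w x + ?P x + ?R x * v x \<partial>\<D>)"
  proof (rule integral_cong_AE)
    show "AE x in \<D>. (cdot (weak_gradient \<Omega> u1 x) (?W x) + ?q1 x * v x) - (cdot (weak_gradient \<Omega> u2 x) (?W x) + ?q2 x * v x)
      = cdot (?F x) (?G x) + ?q x * ?w x + ?P x + ?R x * v x" using W(3)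
    proof eventually_elim
      case (elim x)
      show ?case unfolding elim
        by (simp add: magnetic_rhs_def wave_error_def Let_def v_def[symmetric] cdot_linear cdot_commute algebra_simps)
    qed
  qed (use Bochner_Integration.integrable_diff[OF i1] iS in \<open>auto dest!: borel_measurable_integrable\<close>)
  also have "\<dots> = ((\<integral>x. cdot (?F x) (?G x) \<partial>\<D>) + (\<integral>x. ?q x * ?w x \<partial>\<D>) + (\<integral>x. ?P x \<partial>\<D>)) + (\<integral>x. ?R x * v x \<partial>\<D>)"
    using iF iq iP iR by (simp only: Bochner_Integration.integral_add Bochner_Integration.integrable_add)
  finally show ?thesis unfolding green by simp
qed

end

text \<open>Pythagoras, for which \<open>B_fac\<close> is made; \<open>norm \<xi> \<le> t\<close>
  keeps the argument of its square root nonnegative.\<close>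

lemma norm_eta: assumes \<xi>: "norm \<eta> = 1" "\<eta> \<bullet> \<xi> = 0" and t: "1 \<le> t" "norm \<xi> \<le> t"
  shows "norm (eta1 \<xi> \<eta> t) = 1" "norm (eta2 \<xi> \<eta> t) = 1"
proof -
  let ?q = "(norm \<xi>)^2 / (4 * t^2)"
  have "(norm \<xi>)^2 \<le> t^2" by (rule power_mono[OF t(2)]) simp
  moreover have "0 < t^2" using t(1) by simp
  ultimately have "(norm \<xi>)^2 \<le> 4 * t^2" by linarith
  then have B: "(B_fac \<xi> t)^2 = 1 - ?q" using t(1) by (simp add: B_fac_def divide_le_eq)
  have *: "norm (b *\<^sub>R \<eta> + c *\<^sub>R \<xi>) = 1" if "b^2 + c^2 * (norm \<xi>)^2 = 1" for b c
  proof -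
    have "(norm (b *\<^sub>R \<eta> + c *\<^sub>R \<xi>))^2 = b^2 * (norm \<eta>)^2 + c^2 * (norm \<xi>)^2"
      unfolding power2_norm_eq_inner using \<xi>(2) by (simp add: inner_add_left inner_add_right inner_commute[of \<xi> \<eta>] power2_eq_square)
    then show ?thesis using that \<xi>(1) by (simp add: abs_square_eq_1)
  qed
  have q: "(1 / (2 * t))^2 * (norm \<xi>)^2 = ?q" "(- (1 / (2 * t)))^2 * (norm \<xi>)^2 = ?q"
    by (simp_all add: power_divide power_mult_distrib)
  show "norm (eta1 \<xi> \<eta> t) = 1" using *[of "B_fac \<xi> t" "- (1 / (2 * t))"] B q by (simp add: eta1_def)
  show "norm (eta2 \<xi> \<eta> t) = 1" using *[of "B_fac \<xi> t" "1 / (2 * t)"] B q by (simp add: eta2_def)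
qed

lemma eta_diff: "t \<noteq> 0 \<Longrightarrow> eta1 \<xi> \<eta> t - eta2 \<xi> \<eta> t = - ((1 / t) *\<^sub>R \<xi>)"
  by (simp add: eta1_def eta2_def algebra_simps flip: scaleR_add_left)

context magnetic_domain
begin

text \<open>The directions differ by \<open>- \<xi> / t\<close>, and
  \<open>sqrt_lam t / t = 1 + \<i> / t\<close>, so the linear parts of the exponent tend to
  \<open>- \<i> * (\<xi> \<bullet> x)\<close>. The phases use the same potential along directions
  that approach each other, so their difference tends to 0.\<close>

lemma wave_product_limit: assumes \<xi>: "norm \<eta> = 1" "\<eta> \<bullet> \<xi> = 0" and x: "x \<in> \<Omega>"
  shows "((\<lambda>t. wave \<rho> a 1 t (eta1 \<xi> \<eta> t) x * wave \<rho> a (- 1) t (eta2 \<xi> \<eta> t) x) \<longlongrightarrow> exp (- \<i> * of_real (\<xi> \<bullet> x))) at_top"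
proof -
  obtain C where C: "\<And>t h h' x. 1 \<le> t \<Longrightarrow> norm h = 1 \<Longrightarrow> norm h' = 1 \<Longrightarrow> x \<in> \<Omega> \<Longrightarrow>
      \<bar>phase \<rho> a t h x - phase \<rho> a t h' x\<bar> \<le> C * (norm (h - h') + t powr (- 1/3))"
    by (rule phase_estimates) (rule that)
  let ?f = "\<lambda>t. phase \<rho> a t (eta1 \<xi> \<eta> t) x - phase \<rho> a t (eta2 \<xi> \<eta> t) x"
  have ev: "\<forall>\<^sub>F t in at_top. max 1 (norm \<xi>) \<le> t" by (rule eventually_ge_at_top)
  have f: "(?f \<longlongrightarrow> 0) at_top"
  proof (rule Lim_null_comparison)
    show "\<forall>\<^sub>F t in at_top. norm (?f t) \<le> C * (norm \<xi> * inverse t + t powr (- 1/3))" using ev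
    proof eventually_elim
      case (elim t)
      then have t: "1 \<le> t" "norm \<xi> \<le> t" by auto
      then have "norm (eta1 \<xi> \<eta> t - eta2 \<xi> \<eta> t) = norm \<xi> * inverse t" by (simp add: eta_diff divide_inverse)
      then show ?case using C[OF t(1) norm_eta[OF \<xi> t] x] by simp
    qed
    have "((\<lambda>t :: real. t powr (- 1/3)) \<longlongrightarrow> 0) at_top" by (rule tendsto_neg_powr[OF _ filterlim_ident]) simp
    from tendsto_mult_left[OF tendsto_add[OF tendsto_mult_left[OF tendsto_inverse_0_at_top[OF filterlim_ident]] this]]
    show "((\<lambda>t. C * (norm \<xi> * inverse t + t powr (- 1/3))) \<longlongrightarrow> 0) at_top" by simp
  qed
  let ?e = "\<lambda>t. exp (- \<i> * of_real (\<xi> \<bullet> x) + of_real ((\<xi> \<bullet> x) * inverse t) + \<i> * of_real (?f t))"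
  have "(?e \<longlongrightarrow> exp (- \<i> * of_real (\<xi> \<bullet> x) + of_real ((\<xi> \<bullet> x) * 0) + \<i> * of_real 0)) at_top"
    by (intro tendsto_exp tendsto_add tendsto_const tendsto_of_real tendsto_mult f tendsto_inverse_0_at_top filterlim_ident)
  then have "(?e \<longlongrightarrow> exp (- \<i> * of_real (\<xi> \<bullet> x))) at_top" by simp
  moreover have "\<forall>\<^sub>F t in at_top. ?e t = wave \<rho> a 1 t (eta1 \<xi> \<eta> t) x * wave \<rho> a (- 1) t (eta2 \<xi> \<eta> t) x" using ev
  proof eventually_elim
    case (elim t)
    let ?d = "of_real (eta1 \<xi> \<eta> t \<bullet> x) - of_real (eta2 \<xi> \<eta> t \<bullet> x)"
    have "?d = of_real ((eta1 \<xi> \<eta> t - eta2 \<xi> \<eta> t) \<bullet> x)" by (simp add: inner_diff_left)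
    also have "\<dots> = - of_real ((\<xi> \<bullet> x) / t)" using elim by (simp add: eta_diff)
    finally have d: "?d = - of_real ((\<xi> \<bullet> x) / t)" .
    have "wave \<rho> a 1 t (eta1 \<xi> \<eta> t) x * wave \<rho> a (- 1) t (eta2 \<xi> \<eta> t) x = exp (\<i> * sqrt_lam t * ?d + \<i> * of_real (?f t))"
      by (simp add: wave_def exp_add[symmetric] algebra_simps)
    also have "\<i> * sqrt_lam t * ?d = - \<i> * of_real (\<xi> \<bullet> x) + of_real ((\<xi> \<bullet> x) * inverse t)"
      unfolding d sqrt_lam_def using elim by (simp add: field_simps)
    finally show ?case by simp
  qed
  ultimately show ?thesis by (rule tendsto_cong[THEN iffD1, rotated])
qed

lemma main_term_limit: assumes \<xi>: "norm \<eta> = 1" "\<eta> \<bullet> \<xi> = 0" and V: "Linf \<Omega> V1" "Linf \<Omega> V2"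
  shows "((\<lambda>t. \<integral>x. of_real (V1 x - V2 x) * (wave \<rho> a 1 t (eta1 \<xi> \<eta> t) x * wave \<rho> a (- 1) t (eta2 \<xi> \<eta> t) x) \<partial>\<D>)
    \<longlongrightarrow> (\<integral>x. of_real (V1 x - V2 x) * exp (- \<i> * of_real (\<xi> \<bullet> x)) \<partial>\<D>)) at_top"
proof -
  let ?P = "\<lambda>t x. wave \<rho> a 1 t (eta1 \<xi> \<eta> t) x * wave \<rho> a (- 1) t (eta2 \<xi> \<eta> t) x"
  define T where "T = max 1 (norm \<xi>)"
  \<comment> \<open>The estimates hold for parameters from \<open>T\<close> on; replacing
    \<open>t\<close> by \<open>m t\<close> makes them available for all \<open>t\<close> without
    affecting the limit.\<close>
  define m where "m t = max T t" for t
  have m: "1 \<le> m t" "norm \<xi> \<le> m t" for t by (auto simp: m_def T_def)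
  have mt: "m t = t" if "T \<le> t" for t using that by (simp add: m_def)
  note e = norm_eta[OF \<xi> m]
  obtain K where K: "K \<ge> 0"
    "\<And>\<sigma> t h x. 1 \<le> t \<Longrightarrow> norm h = 1 \<Longrightarrow> \<sigma>^2 = 1 \<Longrightarrow> x \<in> \<Omega> \<Longrightarrow> norm (wave \<rho> a \<sigma> t h x) \<le> K"
    by (rule wave_estimates) (rule that)
  obtain B1 where B1: "AE x in \<D>. \<bar>V1 x\<bar> \<le> B1" by (rule Linf_bound[OF V(1)]) (rule that)
  obtain B2 where B2: "AE x in \<D>. \<bar>V2 x\<bar> \<le> B2" by (rule Linf_bound[OF V(2)]) (rule that)
  have Vm: "(\<lambda>x. complex_of_real (V1 x - V2 x)) \<in> borel_measurable \<D>"
  proof -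
    have [measurable]: "V1 \<in> borel_measurable \<D>" "V2 \<in> borel_measurable \<D>" using V by (auto simp: Linf_def)
    show ?thesis by measurable
  qed
  have "((\<lambda>t. \<integral>x. of_real (V1 x - V2 x) * ?P (m t) x \<partial>\<D>)
    \<longlongrightarrow> (\<integral>x. of_real (V1 x - V2 x) * exp (- \<i> * of_real (\<xi> \<bullet> x)) \<partial>\<D>)) at_top"
  proof (rule integral_dominated_convergence_at_top)
    have "continuous_on UNIV (\<lambda>x. exp (- \<i> * complex_of_real (\<xi> \<bullet> x)))" by (intro continuous_intros)
    then show "(\<lambda>x. of_real (V1 x - V2 x) * exp (- \<i> * of_real (\<xi> \<bullet> x))) \<in> borel_measurable \<D>"
      by (intro borel_measurable_times Vm continuous_measurable)
    show "(\<lambda>x. of_real (V1 x - V2 x) * ?P (m t) x) \<in> borel_measurable \<D>" for t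
      by (intro borel_measurable_times Vm continuous_measurable[OF Ck_imp_continuous[OF wave_Ck]] m e) auto
    show "integrable \<D> (\<lambda>_. (B1 + B2) * (K * K))" by (rule dom.integrable_const)
    show "AE x in \<D>. ((\<lambda>t. of_real (V1 x - V2 x) * ?P (m t) x) \<longlongrightarrow> of_real (V1 x - V2 x) * exp (- \<i> * of_real (\<xi> \<bullet> x))) at_top"
    proof (rule AE_domainI)
      fix x assume "x \<in> \<Omega>"
      from tendsto_mult_left[OF wave_product_limit[OF \<xi> this], of "of_real (V1 x - V2 x)"]
      show "((\<lambda>t. of_real (V1 x - V2 x) * ?P (m t) x) \<longlongrightarrow> of_real (V1 x - V2 x) * exp (- \<i> * of_real (\<xi> \<bullet> x))) at_top"
        by (rule tendsto_cong[THEN iffD1, rotated]) (use eventually_ge_at_top[of T] in eventually_elim, simp add: mt)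
    qed
    have "AE x in \<D>. norm (of_real (V1 x - V2 x) * ?P (m t) x) \<le> (B1 + B2) * (K * K)" for t using B1 B2 AE_space
    proof eventually_elim
      case (elim x)
      then have x: "x \<in> \<Omega>" by simp
      have "norm (?P (m t) x) \<le> K * K"
        unfolding norm_mult by (rule mult_mono[OF K(2)[OF m(1) e(1) _ x] K(2)[OF m(1) e(2) _ x] K(1)]) auto
      moreover have "norm (complex_of_real (V1 x - V2 x)) \<le> B1 + B2" using elim(1,2) unfolding norm_of_real by linarith
      ultimately show ?case unfolding norm_mult[of "of_real (V1 x - V2 x)"] by (intro mult_mono') auto
    qed
    then show "\<forall>\<^sub>F t in at_top. AE x in \<D>. norm (of_real (V1 x - V2 x) * ?P (m t) x) \<le> (B1 + B2) * (K * K)" by simp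
  qed
  then show ?thesis
    by (rule tendsto_cong[THEN iffD1, rotated]) (use eventually_ge_at_top[of T] in eventually_elim, simp add: mt)
qed

text \<open>Besides the main integral there is one term with \<open>r = u1 - \<Phi>\<close> and one
  with \<open>w = u1 - u2\<close>. The first decays because \<open>r\<close> is of order
  \<open>l powr (- 1/3)\<close>. In the second, \<open>w\<close> gains the full factor
  \<open>1 / l\<close>, enough to absorb the error of \<open>v\<close> of order
  \<open>l powr (2/3)\<close>.\<close>

theorem boundary_form_limit: assumes \<xi>: "norm \<eta> = 1" "\<eta> \<bullet> \<xi> = 0" and V: "Linf \<Omega> V1" "Linf \<Omega> V2"
    and A1: "\<forall>x\<in>\<Omega>. A1 x = a x" and A2: "\<forall>x\<in>\<Omega>. A2 x = a x" and fr: "\<forall>x\<in>frontier \<Omega>. A1 x = A2 x"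
  shows "((\<lambda>l. S_ansatz \<Omega> A1 V1 \<rho> a a \<xi> \<eta> l - S_ansatz \<Omega> A2 V2 \<rho> a a \<xi> \<eta> l) \<longlongrightarrow>
    (\<integral>x. of_real (V1 x - V2 x) * exp (- \<i> * of_real (\<xi> \<bullet> x)) \<partial>\<D>)) at_top"
proof -
  obtain K where K: "K \<ge> 0"
    "\<And>\<sigma> l h x. 1 \<le> l \<Longrightarrow> norm h = 1 \<Longrightarrow> \<sigma>^2 = 1 \<Longrightarrow> x \<in> \<Omega> \<Longrightarrow> norm (wave \<rho> a \<sigma> l h x) \<le> K"
    "\<And>\<sigma> l h x. 1 \<le> l \<Longrightarrow> norm h = 1 \<Longrightarrow> \<sigma>^2 = 1 \<Longrightarrow> x \<in> \<Omega> \<Longrightarrow> norm (wave_error \<sigma> l h x) \<le> K * l powr (2/3)"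
    by (rule wave_estimates) (rule that)
  obtain B where B: "B \<ge> 0" "AE x in \<D>. \<bar>V1 x\<bar> \<le> B" "AE x in \<D>. \<bar>V2 x\<bar> \<le> B"
  proof -
    obtain B1 where B1: "B1 \<ge> 0" "AE x in \<D>. \<bar>V1 x\<bar> \<le> B1" by (rule Linf_bound[OF V(1)]) (rule that)
    obtain B2 where B2: "B2 \<ge> 0" "AE x in \<D>. \<bar>V2 x\<bar> \<le> B2" by (rule Linf_bound[OF V(2)]) (rule that)
    show thesis
    proof (rule that[of "B1 + B2"])
      show "AE x in \<D>. \<bar>V1 x\<bar> \<le> B1 + B2" using B1(2) by eventually_elim (use B2(1) in simp)
      show "AE x in \<D>. \<bar>V2 x\<bar> \<le> B1 + B2" using B2(2) by eventually_elim (use B1(1) in simp)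
    qed (use B1(1) B2(1) in simp)
  qed
  let ?s = "sqrt (measure \<D> (space \<D>))"
  \<comment> \<open>\<open>R\<close> bounds \<open>l * l2norm \<D> r\<close> relative to
    \<open>l powr (2/3)\<close>, \<open>N\<close> bounds the norm of \<open>u1\<close>, and
    \<open>E\<close> collects the constants of both error terms.\<close>
  define R where "R = (1 + B) * K * ?s"
  define N where "N = R + K * ?s"
  define E where "E = B * N * ((1 + B) * K * ?s) + R * (2 * B * K * ?s)"
  have nn: "0 \<le> R" "0 \<le> N" using K(1) B(1) by (auto simp: R_def N_def)
  have Vm: "V1 \<in> borel_measurable \<D>" "V2 \<in> borel_measurable \<D>" using V by (auto simp: Linf_def)
  let ?S = "\<lambda>l. S_ansatz \<Omega> A1 V1 \<rho> a a \<xi> \<eta> l - S_ansatz \<Omega> A2 V2 \<rho> a a \<xi> \<eta> l"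
  let ?I = "\<lambda>l. \<integral>x. of_real (V1 x - V2 x) * (wave \<rho> a 1 l (eta1 \<xi> \<eta> l) x * wave \<rho> a (- 1) l (eta2 \<xi> \<eta> l) x) \<partial>\<D>"
  have main: "norm (?S l - ?I l) \<le> E * l powr (- 1/3)" if l: "max 1 (norm \<xi>) \<le> l" for l
  proof -
    have l1: "1 \<le> l" and l2: "norm \<xi> \<le> l" using l by auto
    note e = norm_eta[OF \<xi> l1 l2]
    let ?t = "l powr (2/3)"
    have t1: "1 \<le> ?t" by (rule ge_one_powr_ge_zero) (use l1 in auto)
    have tt: "?t / l = l powr (- 1/3)" using powr_diff[of l "2/3" 1] l1 by simp
    have tle: "l powr (- 1/3) \<le> 1" by (rule width(2)[OF l1])
    define \<Phi> where "\<Phi> = wave \<rho> a 1 l (eta1 \<xi> \<eta> l)"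
    define v where "v = wave \<rho> a (- 1) l (eta2 \<xi> \<eta> l)"
    define E2 where "E2 = wave_error (- 1) l (eta2 \<xi> \<eta> l)"
    have C: "Ck m \<Phi>" "Ck m v" for m unfolding \<Phi>_def v_def using wave_Ck[OF l1 e(1)] wave_Ck[OF l1 e(2)] by auto
    have b\<Phi>: "norm (\<Phi> x) \<le> K" and bv: "norm (v x) \<le> K" and bE: "norm (wave_error 1 l (eta1 \<xi> \<eta> l) x) \<le> K * ?t"
      and bE2: "norm (E2 x) \<le> K * ?t" if "x \<in> \<Omega>" for x
      unfolding \<Phi>_def v_def E2_def using K(2,3)[OF l1 e(1) _ that] K(2,3)[OF l1 e(2) _ that] by auto
    have \<mu>: "Im (lam l) = 2 * l" by (simp add: lam_def sqrt_lam_def power2_eq_square)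
    have \<mu>0: "Im (lam l) > 0" using \<mu> l1 by simp
    define u1 where "u1 = bvp_solution \<Omega> A1 V1 (lam l) \<Phi>"
    define u2 where "u2 = bvp_solution \<Omega> A2 V2 (lam l) \<Phi>"
    have u1: "is_bvp_solution \<Omega> A1 V1 (lam l) \<Phi> u1"
      unfolding u1_def by (rule bvp_solvable[OF a_C1 a_support _ V(1) \<mu>0 C(1)]) (use A1 in auto)
    have u2: "is_bvp_solution \<Omega> A2 V2 (lam l) \<Phi> u2"
      unfolding u2_def by (rule bvp_solvable[OF a_C1 a_support _ V(2) \<mu>0 C(1)]) (use A2 in auto)
    have L1: "L2 \<D> u1" and L2: "L2 \<D> u2" using u1 u2 H1_L2(1) by (auto simp: is_bvp_solution_def)
    have L\<Phi>: "L2 \<D> \<Phi>" and Lv: "L2 \<D> v" using continuous_L2[OF Ck_imp_continuous] C by blast+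
    note LE = weak_div_wave(5)[OF l1 e(1), of 1, simplified] and LE2 = weak_div_wave(5)[OF l1 e(2), of "- 1", simplified, folded E2_def]
    define r where "r x = u1 x - \<Phi> x" for x
    have Lr: "L2 \<D> r" unfolding r_def[abs_def] by (rule L2_diff[OF L1 L\<Phi>])
    have nr: "l * l2norm \<D> r \<le> R * ?t"
    proof -
      have "2 * l * l2norm \<D> r \<le> l2norm \<D> (\<lambda>x. of_real (V1 x) * \<Phi> x + wave_error 1 l (eta1 \<xi> \<eta> l) x)"
        unfolding r_def[abs_def] \<Phi>_def by (rule corrector_estimate[OF l1 e(1) u1[unfolded \<Phi>_def] A1 V(1)])
      also have "\<dots> \<le> ((1 + B) * K * ?t) * ?s"
      proof (rule dom.l2norm_bounded_le)
        show "(\<lambda>x. of_real (V1 x) * \<Phi> x + wave_error 1 l (eta1 \<xi> \<eta> l) x) \<in> borel_measurable \<D>"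
          by (rule L2_measurable[OF L2_add[OF L2_Linf_mult[OF V(1) L\<Phi>] LE]])
        show "AE x in \<D>. norm (of_real (V1 x) * \<Phi> x + wave_error 1 l (eta1 \<xi> \<eta> l) x) \<le> (1 + B) * K * ?t"
          using B(2) AE_space
        proof eventually_elim
          case (elim x)
          then have x: "x \<in> \<Omega>" by simp
          have "norm (of_real (V1 x) * \<Phi> x) \<le> B * K" unfolding norm_mult norm_of_real
            by (rule mult_mono[OF elim(1) b\<Phi>[OF x] B(1)]) simp
          also have "\<dots> \<le> B * K * ?t" using mult_left_mono[OF t1, of "B * K"] B(1) K(1) by simp
          finally show ?case using norm_triangle_ineq[of "of_real (V1 x) * \<Phi> x" "wave_error 1 l (eta1 \<xi> \<eta> l) x"] bE[OF x] by (simp add: ring_distribs)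
        qed
      qed (use B(1) K(1) in simp)
      finally have "2 * (l * l2norm \<D> r) \<le> R * ?t" by (simp add: R_def mult_ac)
      moreover have "0 \<le> l * l2norm \<D> r" using l1 by simp
      ultimately show ?thesis by linarith
    qed
    have nr': "l2norm \<D> r \<le> R * l powr (- 1/3)" using nr l1 unfolding tt[symmetric] by (simp add: field_simps)
    have nu: "l2norm \<D> u1 \<le> N"
    proof -
      have "l2norm \<D> u1 \<le> l2norm \<D> r + l2norm \<D> \<Phi>" using l2norm_triangle[OF Lr L\<Phi>] by (simp add: r_def)
      moreover have "l2norm \<D> \<Phi> \<le> K * ?s"
        by (rule dom.l2norm_bounded_le[OF L2_measurable[OF L\<Phi>] AE_domainI[OF b\<Phi>] K(1)])
      moreover have "R * l powr (- 1/3) \<le> R" using mult_left_mono[OF tle nn(1)] by simp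
      ultimately show ?thesis using nr' by (simp add: N_def)
    qed
    define w where "w x = u1 x - u2 x" for x
    have Lw: "L2 \<D> w" unfolding w_def[abs_def] by (rule L2_diff[OF L1 L2])
    have nw: "l * l2norm \<D> w \<le> B * N"
    proof -
      have "2 * l * l2norm \<D> w \<le> l2norm \<D> (\<lambda>x. of_real (V1 x) * u1 x - of_real (V2 x) * u1 x)"
        unfolding w_def[abs_def] using solution_difference_estimate[OF \<mu>0 u1 u2 A1 A2 V] \<mu> by simp
      also have "\<dots> \<le> (2 * B) * l2norm \<D> u1"
      proof (rule l2norm_le[OF L2_measurable[OF L2_diff[OF L2_Linf_mult[OF V(1) L1] L2_Linf_mult[OF V(2) L1]]] L1])
        show "AE x in \<D>. norm (of_real (V1 x) * u1 x - of_real (V2 x) * u1 x) \<le> 2 * B * norm (u1 x)" using B(2,3)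
        proof eventually_elim
          case (elim x)
          have "norm (of_real (V1 x) * u1 x - of_real (V2 x) * u1 x) = \<bar>V1 x - V2 x\<bar> * norm (u1 x)"
            by (simp only: left_diff_distrib[symmetric] of_real_diff[symmetric] norm_mult norm_of_real)
          also have "\<dots> \<le> 2 * B * norm (u1 x)" by (rule mult_right_mono) (use elim in auto)
          finally show ?case .
        qed
      qed (use B(1) in simp)
      also have "\<dots> \<le> 2 * B * N" by (rule mult_left_mono[OF nu]) (use B(1) in simp)
      finally show ?thesis by simp
    qed
    \<comment> \<open>The boundary integrals of the magnetic terms cancel, because the potentials
      agree on the boundary as well.\<close>
    have "?S l = normal_derivative \<Omega> u1 v - normal_derivative \<Omega> u2 v"
    proof -
      have "(\<integral>x. \<i> * of_real (A1 x \<bullet> outward_normal \<Omega> x) * f x * g x \<partial>surface_measure \<Omega>)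
        = (\<integral>x. \<i> * of_real (A2 x \<bullet> outward_normal \<Omega> x) * f x * g x \<partial>surface_measure \<Omega>)" for f g
        by (rule Bochner_Integration.integral_cong) (use fr in \<open>simp_all add: space_surface_measure\<close>)
      then show ?thesis by (simp add: S_ansatz_def DN_map_def Phi1_eq_wave Phi2_eq_wave u1_def u2_def \<Phi>_def v_def)
    qed
    also have "\<dots> = (\<integral>x. w x * (E2 x + of_real (V2 x) * v x) \<partial>\<D>) + (\<integral>x. (of_real (V1 x) * u1 x - of_real (V2 x) * u1 x) * v x \<partial>\<D>)"
      unfolding v_def E2_def w_def by (rule normal_derivative_difference[OF l1 e(2) u1 u2 A1 A2 V])
    also have "(\<integral>x. (of_real (V1 x) * u1 x - of_real (V2 x) * u1 x) * v x \<partial>\<D>)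
      = (\<integral>x. r x * (of_real (V1 x - V2 x) * v x) \<partial>\<D>) + ?I l"
    proof -
      have LVv: "L2 \<D> (\<lambda>x. of_real (V1 x - V2 x) * v x)"
        using L2_diff[OF L2_Linf_mult[OF V(1) Lv] L2_Linf_mult[OF V(2) Lv]] by (simp add: algebra_simps)
      have "(\<integral>x. (of_real (V1 x) * u1 x - of_real (V2 x) * u1 x) * v x \<partial>\<D>)
        = (\<integral>x. r x * (of_real (V1 x - V2 x) * v x) + \<Phi> x * (of_real (V1 x - V2 x) * v x) \<partial>\<D>)"
        by (rule Bochner_Integration.integral_cong) (simp_all add: r_def algebra_simps)
      also have "\<dots> = (\<integral>x. r x * (of_real (V1 x - V2 x) * v x) \<partial>\<D>) + (\<integral>x. \<Phi> x * (of_real (V1 x - V2 x) * v x) \<partial>\<D>)"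
        by (rule Bochner_Integration.integral_add[OF integrable_times[OF Lr LVv] integrable_times[OF L\<Phi> LVv]])
      finally show ?thesis by (simp add: \<Phi>_def v_def mult_ac)
    qed
    finally have "?S l - ?I l = (\<integral>x. w x * (E2 x + of_real (V2 x) * v x) \<partial>\<D>) + (\<integral>x. r x * (of_real (V1 x - V2 x) * v x) \<partial>\<D>)" by simp
    also have "norm \<dots> \<le> l2norm \<D> w * (((1 + B) * K * ?t) * ?s) + l2norm \<D> r * ((2 * B * K) * ?s)"
    proof (rule norm_triangle_mono)
      show "norm (\<integral>x. w x * (E2 x + of_real (V2 x) * v x) \<partial>\<D>) \<le> l2norm \<D> w * (((1 + B) * K * ?t) * ?s)"
      proof (rule dom.integral_norm_le_l2norm[OF Lw L2_measurable[OF L2_add[OF LE2 L2_Linf_mult[OF V(2) Lv]]]])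
        show "AE x in \<D>. norm (E2 x + of_real (V2 x) * v x) \<le> (1 + B) * K * ?t" using B(3) AE_space
        proof eventually_elim
          case (elim x)
          then have x: "x \<in> \<Omega>" by simp
          have "norm (of_real (V2 x) * v x) \<le> B * K" unfolding norm_mult norm_of_real
            by (rule mult_mono[OF elim(1) bv[OF x] B(1)]) simp
          also have "\<dots> \<le> B * K * ?t" using mult_left_mono[OF t1, of "B * K"] B(1) K(1) by simp
          finally show ?case using norm_triangle_ineq[of "E2 x" "of_real (V2 x) * v x"] bE2[OF x] by (simp add: ring_distribs)
        qed
      qed (use B(1) K(1) in simp)
      show "norm (\<integral>x. r x * (of_real (V1 x - V2 x) * v x) \<partial>\<D>) \<le> l2norm \<D> r * ((2 * B * K) * ?s)"
      proof (rule dom.integral_norm_le_l2norm[OF Lr])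
        show "(\<lambda>x. of_real (V1 x - V2 x) * v x) \<in> borel_measurable \<D>" using Vm L2_measurable[OF Lv] by measurable
        show "AE x in \<D>. norm (of_real (V1 x - V2 x) * v x) \<le> 2 * B * K" using B(2,3) AE_space
        proof eventually_elim
          case (elim x)
          then have x: "x \<in> \<Omega>" by simp
          show ?case unfolding norm_mult norm_of_real by (rule mult_mono[OF _ bv[OF x]]) (use elim(1,2) B(1) in auto)
        qed
      qed (use B(1) K(1) in simp)
    qed
    also have "l2norm \<D> w * (((1 + B) * K * ?t) * ?s) \<le> B * N * ((1 + B) * K * ?s) * l powr (- 1/3)"
    proof -
      have "l2norm \<D> w * (((1 + B) * K * ?t) * ?s) = (l * l2norm \<D> w) * ((1 + B) * K * ?s) * (?t / l)" using l1 by simp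
      also have "\<dots> \<le> B * N * ((1 + B) * K * ?s) * (?t / l)"
        by (intro mult_right_mono nw) (use B(1) K(1) l1 in simp_all)
      finally show ?thesis unfolding tt .
    qed
    also have "l2norm \<D> r * ((2 * B * K) * ?s) \<le> R * l powr (- 1/3) * ((2 * B * K) * ?s)"
      by (rule mult_right_mono[OF nr']) (use B(1) K(1) in simp)
    finally show ?thesis by (simp add: E_def algebra_simps)
  qed
  have "((\<lambda>l :: real. l powr (- 1/3)) \<longlongrightarrow> 0) at_top" by (rule tendsto_neg_powr[OF _ filterlim_ident]) simp
  then have "((\<lambda>l. E * l powr (- 1/3)) \<longlongrightarrow> 0) at_top" by (rule tendsto_mult_right_zero)
  moreover have "\<forall>\<^sub>F l in at_top. norm (?S l - ?I l) \<le> E * l powr (- 1/3)"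
    using eventually_ge_at_top[of "max 1 (norm \<xi>)"] by eventually_elim (rule main)
  ultimately have "((\<lambda>l. ?S l - ?I l) \<longlongrightarrow> 0) at_top" by (rule Lim_null_comparison[rotated])
  from tendsto_add[OF this main_term_limit[OF \<xi> V]] show ?thesis by simp
qed

end

theorem proposition3p5:
  fixes \<Omega> \<Omega>t :: "(real^'n) set"
    and A1 A2 At1 At2 :: "real^'n \<Rightarrow> real^'n"
    and V1 V2 :: "real^'n \<Rightarrow> real"
    and \<rho> :: "real^'n \<Rightarrow> real"
    and \<xi> \<eta> :: "real^'n"
  assumes dim: "CARD('n) \<ge> 2"
    and domain: "open \<Omega>" "\<Omega> \<noteq> {}" "bounded \<Omega>" "connected \<Omega>" "C11_boundary \<Omega>" "connected (- \<Omega>)"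
    and potentials: "Linf \<Omega> V1" "Linf \<Omega> V2" "C1_closure \<Omega> A1" "C1_closure \<Omega> A2"
    and larger_set: "open \<Omega>t" "bounded \<Omega>t" "closure \<Omega> \<subseteq> \<Omega>t"
    and extension1: "Ck 1 At1" "compact_support_in \<Omega>t At1" "\<And>x. x \<in> \<Omega> \<Longrightarrow> At1 x = A1 x"
    and extension2: "\<And>x. x \<in> \<Omega> \<Longrightarrow> At2 x = A2 x" "\<And>x. x \<notin> \<Omega> \<Longrightarrow> At2 x = At1 x"
    and mollifier: "Cinf \<rho>" "\<And>x. \<rho> x \<ge> 0" "closure {x. \<rho> x \<noteq> 0} \<subseteq> cball 0 1"
      "(LINT x|lborel. \<rho> x) = 1"
    and same_magnetic: "\<And>x. x \<in> \<Omega> \<Longrightarrow> A1 x = A2 x"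
    and directions: "\<xi> \<noteq> 0" "norm \<eta> = 1" "\<eta> \<bullet> \<xi> = 0"
  shows "((\<lambda>\<tau>. S_ansatz \<Omega> A1 V1 \<rho> At1 At2 \<xi> \<eta> \<tau> - S_ansatz \<Omega> A2 V2 \<rho> At1 At2 \<xi> \<eta> \<tau>) \<longlongrightarrow>
           (LINT x|lebesgue_on \<Omega>.
              complex_of_real (V1 x - V2 x) * exp (- \<i> * complex_of_real (\<xi> \<bullet> x)))) at_top"
proof -
  \<comment> \<open>Inside \<Omega> both are the common potential, outside they agree by
    construction.\<close>
  have At: "At2 = At1"
  proof
    fix x show "At2 x = At1 x"
      by (cases "x \<in> \<Omega>") (simp_all add: extension1(3) extension2 same_magnetic)
  qed
  interpret magnetic_domain \<rho> \<Omega> At1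
    by unfold_locales
      (use dim domain mollifier extension1(1) compact_support_in_bounded_support[OF extension1(2)] in auto)
  \<comment> \<open>Equality passes to the closure by continuity; the surface integral in
    \<open>DN_map\<close> evaluates the potentials on the boundary.\<close>
  have "A1 x - A2 x = 0" if "x \<in> closure \<Omega>" for x
    by (rule continuous_constant_on_closure[OF _ _ that])
      (use potentials(3,4) same_magnetic in \<open>auto simp: C1_closure_def intro: continuous_on_diff\<close>)
  then have "\<forall>x\<in>frontier \<Omega>. A1 x = A2 x" by (simp add: frontier_def)
  then show ?thesis
    unfolding At by (intro boundary_form_limit directions potentials) (simp_all add: extension1(3) same_magnetic)
qed

end
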